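(* Let $\mathcal V$ be a (graded-polarized) variation of mixed Hodge structure over a complex manifold with only two non-trivial weight graded quotients $\operatorname{gr}^W_a$ and $\operatorname{gr}^W_b$, which are adjacent, i.e. $|a-b|=1$. Then the pullback of the mixed Hodge metric along the period map of $\mathcal V$ is a Kähler pseudo-metric.
   Context: Classifying space: fix a finite-dimensional real vector space $V_{\mathbb R}$, an increasing (weight) filtration $W$, non-degenerate $(-1)^k$-symmetric real bilinear forms $Q_k$ on $\operatorname{gr}^W_k$, and numbers $h^{p,q}$. $D$ is the set of decreasing filtrations $F$ of $V_{\mathbb C}$ such that $(F,W)$ is a mixed Hodge structure, graded-polarized by $\{Q_k\}$, with Hodge numbers $h^{p,q}$. For $F\in D$ the Deligne bigrading is the unique functorial $V_{\mathbb C}=\bigoplus I^{p,q}$ with $F^p=\bigoplus_{a\ge p}I^{a,b}$, $W_k=\bigoplus_{a+b\le k}I^{a,b}$, $\overline{I^{p,q}}\equiv I^{q,p}$ mod $\bigoplus_{a<q,b<p}I^{a,b}$. The mixed Hodge metric $h_F$ on $V_{\mathbb C}$ makes the bigrading orthogonal with $h_F(u,v)=\mathrm i^{p-q}Q_{p+q}([u],[\bar v])$ for $u,v\in I^{p,q}$; on $\operatorname{End}(V_{\mathbb C})$, $h_F(\alpha,\beta)=\operatorname{Tr}(\alpha\beta^* )$. $G_{\mathbb C}$ is the group of complex automorphisms of $V_{\mathbb C}$ preserving $W$ and inducing automorphisms of the $Q_k$; $G_{\mathbb R}=G_{\mathbb C}\cap GL(V_{\mathbb R})$; $\mathfrak g_{\mathbb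 C}$ is the Lie algebra of $G_{\mathbb C}$; $\mathfrak g^{r,s}$ is the set of elements of $\mathfrak g_{\mathbb C}$ mapping each $I^{p,q}$ to $I^{p+r,q+s}$; $\mathfrak q_F=\bigoplus_{r<0}\mathfrak g^{r,s}$. $D$ is a complex manifold, open in $G_{\mathbb C}\cdot F$; $u\mapsto\frac{d}{dt}|_0e^{tu}\cdot F$ identifies $\mathfrak q_F$ with $T_F^{1,0}D$, and the mixed Hodge metric on $T(D)$ is $h_F$ restricted to $\mathfrak q_F$; $G_{\mathbb R}$ acts by holomorphic isometries. A tangent vector $u\in\mathfrak q_F$ is horizontal if $u\in\bigoplus_s\mathfrak g^{-1,s}$. The period map of a variation over $S$ is the associated holomorphic, horizontal, locally liftable map $\varphi:S\to\Gamma\backslash D$, $\Gamma\subset G_{\mathbb R}$ the monodromy group. The pulled back metric is a pseudo-metric (semi-positive hermitian form on each holomorphic tangent space); it is Kähler if its associated $(1,1)$-form is closed. *)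

theory Defs
  imports "HOL-Analysis.Analysis"
begin

section \<open>Complex manifolds and hermitian pseudo-metrics\<close>

definition holomorphic_map :: "(complex^'m \<Rightarrow> complex^'k) \<Rightarrow> (complex^'m) set \<Rightarrow> bool" where
  "holomorphic_map f N \<longleftrightarrow>
     (\<forall>z\<in>N. \<exists>f'. (f has_derivative f') (at z) \<and> (\<forall>c v. f' (c *s v) = c *s f' v))"

text \<open>A chart is a domain together with a coordinate map; it is only meaningful on the domain.\<close>

type_synonym ('s, 'm) chart = "'s set \<times> ('s \<Rightarrow> complex^'m)"

definition chart_inv :: "('s, 'm::finite) chart \<Rightarrow> complex^'m \<Rightarrow> 's" where
  "chart_inv c = inv_into (fst c) (snd c)"

definition transition :: "('s, 'm::finite) chart \<Rightarrow> ('s, 'm) chart \<Rightarrow> complex^'m \<Rightarrow> complex^'m" where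
  "transition c d = snd d \<circ> chart_inv c"

definition complex_manifold ::
  "('s::{t2_space, second_countable_topology}, 'm::finite) chart set \<Rightarrow> bool" where
  "complex_manifold M \<longleftrightarrow>
     (\<Union>c\<in>M. fst c) = UNIV \<and>
     (\<forall>c\<in>M. open (fst c) \<and> open (snd c ` fst c) \<and>
        homeomorphism (fst c) (snd c ` fst c) (snd c) (chart_inv c)) \<and>
     (\<forall>c\<in>M. \<forall>d\<in>M. holomorphic_map (transition c d) (snd c ` (fst c \<inter> fst d)))"

fun Ck_on :: "nat \<Rightarrow> ('a::real_normed_vector \<Rightarrow> 'b::real_normed_vector) \<Rightarrow> 'a set \<Rightarrow> bool" where
  "Ck_on 0 f N \<longleftrightarrow> continuous_on N f"
| "Ck_on (Suc k) f N \<longleftrightarrow> (\<forall>x\<in>N. f differentiable at x) \<and>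
     (\<forall>v. Ck_on k (\<lambda>x. frechet_derivative f (at x) v) N)"

definition smooth_on :: "('a::real_normed_vector \<Rightarrow> 'b::real_normed_vector) \<Rightarrow> 'a set \<Rightarrow> bool" where
  "smooth_on f N \<longleftrightarrow> (\<forall>k. Ck_on k f N)"

text \<open>A tensor \<open>g\<close> is given by its expression in every chart: \<open>g c z \<xi> \<eta>\<close> is its value on
  \<open>\<Sum>j. \<xi>\<^sub>j \<partial>/\<partial>z\<^sub>j\<close> and \<open>\<Sum>j. \<eta>\<^sub>j \<partial>/\<partial>z\<^sub>j\<close> at the point with coordinates \<open>z\<close>.
  The expressions have to match under changes of charts.\<close>

definition hermitian_pseudo_metric ::
  "('s::{t2_space, second_countable_topology}, 'm::finite) chart set \<Rightarrow>
   (('s, 'm) chart \<Rightarrow> complex^'m \<Rightarrow> complex^'m \<Rightarrow> complex^'m \<Rightarrow> complex) \<Rightarrow> bool" where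
  "hermitian_pseudo_metric M g \<longleftrightarrow>
     (\<forall>c\<in>M. \<forall>z\<in>snd c ` fst c.
        (\<forall>s \<xi> \<xi>' \<eta>. g c z (s *s \<xi> + \<xi>') \<eta> = s * g c z \<xi> \<eta> + g c z \<xi>' \<eta>) \<and>
        (\<forall>\<xi> \<eta>. g c z \<eta> \<xi> = cnj (g c z \<xi> \<eta>)) \<and>
        (\<forall>\<xi>. 0 \<le> Re (g c z \<xi> \<xi>))) \<and>
     (\<forall>c\<in>M. \<forall>\<xi> \<eta>. smooth_on (\<lambda>z. g c z \<xi> \<eta>) (snd c ` fst c)) \<and>
     (\<forall>c\<in>M. \<forall>d\<in>M. \<forall>z\<in>snd c ` (fst c \<inter> fst d). \<forall>\<xi> \<eta>.
        g c z \<xi> \<eta> = g d (transition c d z)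
          (frechet_derivative (transition c d) (at z) \<xi>)
          (frechet_derivative (transition c d) (at z) \<eta>))"

text \<open>The associated form \<open>(\<i>/2) \<Sum>j k. g\<^sub>j\<^sub>k dz\<^sub>j \<and> cnj (dz\<^sub>k)\<close>, viewed as a real 2-form on the
  underlying real tangent space \<open>complex^'m\<close> of a chart.\<close>

definition fundamental_form ::
  "(complex^'m \<Rightarrow> complex^'m \<Rightarrow> complex^'m \<Rightarrow> complex) \<Rightarrow>
   complex^'m \<Rightarrow> complex^'m \<Rightarrow> complex^'m \<Rightarrow> real" where
  "fundamental_form g z X Y = Re (\<i> / 2 * (g z X Y - g z Y X))"

text \<open>\<open>d\<omega>(X,Y,Z)\<close>; the bracket terms vanish because \<open>X\<close>, \<open>Y\<close>, \<open>Z\<close> are constant vector fields.\<close>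

definition ext_deriv2 ::
  "('v::real_normed_vector \<Rightarrow> 'v \<Rightarrow> 'v \<Rightarrow> real) \<Rightarrow> 'v \<Rightarrow> 'v \<Rightarrow> 'v \<Rightarrow> 'v \<Rightarrow> real" where
  "ext_deriv2 \<omega> z X Y Z =
     frechet_derivative (\<lambda>w. \<omega> w Y Z) (at z) X
   - frechet_derivative (\<lambda>w. \<omega> w X Z) (at z) Y
   + frechet_derivative (\<lambda>w. \<omega> w X Y) (at z) Z"

definition kaehler_pseudo_metric ::
  "('s::{t2_space, second_countable_topology}, 'm::finite) chart set \<Rightarrow>
   (('s, 'm) chart \<Rightarrow> complex^'m \<Rightarrow> complex^'m \<Rightarrow> complex^'m \<Rightarrow> complex) \<Rightarrow> bool" where
  "kaehler_pseudo_metric M g \<longleftrightarrow> hermitian_pseudo_metric M g \<and>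
     (\<forall>c\<in>M. \<forall>z\<in>snd c ` fst c. \<forall>X Y Z. ext_deriv2 (fundamental_form (g c)) z X Y Z = 0)"

section \<open>Graded-polarized mixed Hodge structures\<close>

text \<open>\<open>V\<^sub>\<real>\<close> is \<open>real^'n\<close> and \<open>V\<^sub>\<complex>\<close> is \<open>complex^'n\<close>.\<close>

definition re_vec :: "complex^'n \<Rightarrow> real^'n" where "re_vec v = (\<chi> i. Re (v $ i))"
definition im_vec :: "complex^'n \<Rightarrow> real^'n" where "im_vec v = (\<chi> i. Im (v $ i))"
definition cnj_vec :: "complex^'n \<Rightarrow> complex^'n" where "cnj_vec v = (\<chi> i. cnj (v $ i))"
definition complex_mat :: "real^'n^'n \<Rightarrow> complex^'n^'n" where
  "complex_mat A = (\<chi> i j. complex_of_real (A $ i $ j))"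

definition complexify :: "(real^'n) set \<Rightarrow> (complex^'n) set" where
  "complexify U = {v. re_vec v \<in> U \<and> im_vec v \<in> U}"

definition complex_form ::
  "(real^'n \<Rightarrow> real^'n \<Rightarrow> real) \<Rightarrow> complex^'n \<Rightarrow> complex^'n \<Rightarrow> complex" where
  "complex_form B u v =
     Complex (B (re_vec u) (re_vec v) - B (im_vec u) (im_vec v))
             (B (re_vec u) (im_vec v) + B (im_vec u) (re_vec v))"

definition subspace_sum :: "(complex^'n) set \<Rightarrow> (complex^'n) set \<Rightarrow> (complex^'n) set" where
  "subspace_sum A B = {u + v | u v. u \<in> A \<and> v \<in> B}"

type_synonym 'n weight = "int \<Rightarrow> (real^'n) set"
type_synonym 'n forms = "int \<Rightarrow> real^'n \<Rightarrow> real^'n \<Rightarrow> real"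
type_synonym 'n filtration = "int \<Rightarrow> (complex^'n) set"

definition weight_filtration :: "'n::finite weight \<Rightarrow> bool" where
  "weight_filtration W \<longleftrightarrow> (\<forall>k. subspace (W k)) \<and> mono W \<and>
     (\<exists>k. W k = {0}) \<and> (\<exists>k. W k = UNIV)"

definition gr_nontrivial :: "'n::finite weight \<Rightarrow> int \<Rightarrow> bool" where
  "gr_nontrivial W k \<longleftrightarrow> W (k - 1) \<noteq> W k"

text \<open>A form on \<open>gr\<^sup>W\<^sub>k = W\<^sub>k / W\<^sub>k\<^sub>-\<^sub>1\<close> is given by its pullback to \<open>W\<^sub>k\<close>; its values outside
  \<open>W\<^sub>k\<close> are irrelevant.\<close>

definition graded_forms :: "'n::finite weight \<Rightarrow> 'n forms \<Rightarrow> bool" where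
  "graded_forms W Q \<longleftrightarrow> (\<forall>k.
     (\<forall>u\<in>W k. \<forall>u'\<in>W k. \<forall>v\<in>W k. \<forall>c. Q k (c *\<^sub>R u + u') v = c * Q k u v + Q k u' v) \<and>
     (\<forall>u\<in>W k. \<forall>v\<in>W k. Q k v u = (if even k then Q k u v else - Q k u v)) \<and>
     (\<forall>u\<in>W k. u \<in> W (k - 1) \<longleftrightarrow> (\<forall>v\<in>W k. Q k u v = 0)))"

definition hodge_filtration :: "'n::finite filtration \<Rightarrow> bool" where
  "hodge_filtration F \<longleftrightarrow> (\<forall>p. vec.subspace (F p)) \<and> antimono F \<and>
     (\<exists>p. F p = UNIV) \<and> (\<exists>p. F p = {0})"

text \<open>Subspaces of \<open>gr\<^sup>W\<^sub>k\<close> (complexified) are represented by their preimages in \<open>W\<^sub>k\<close>, which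
  contain \<open>W\<^sub>k\<^sub>-\<^sub>1\<close>: first \<open>F\<^sup>p gr\<^sup>W\<^sub>k\<close>, then the Hodge component \<open>H\<^sup>p\<^sup>,\<^sup>q\<close> of \<open>gr\<^sup>W\<^sub>p\<^sub>+\<^sub>q\<close>.\<close>

definition gr_hodge :: "'n::finite weight \<Rightarrow> 'n filtration \<Rightarrow> int \<Rightarrow> int \<Rightarrow> (complex^'n) set" where
  "gr_hodge W F k p = subspace_sum (F p \<inter> complexify (W k)) (complexify (W (k - 1)))"

definition hodge_component ::
  "'n::finite weight \<Rightarrow> 'n filtration \<Rightarrow> int \<Rightarrow> int \<Rightarrow> (complex^'n) set" where
  "hodge_component W F p q = gr_hodge W F (p + q) p \<inter> cnj_vec ` gr_hodge W F (p + q) q"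

text \<open>Purity of \<open>gr\<^sup>W\<^sub>k\<close>: it is the direct sum of \<open>F\<^sup>p gr\<^sup>W\<^sub>k\<close> and the conjugate of
  \<open>F\<^sup>k\<^sup>+\<^sup>1\<^sup>-\<^sup>p gr\<^sup>W\<^sub>k\<close>, for every \<open>p\<close>.\<close>

definition mixed_hodge_structure :: "'n::finite weight \<Rightarrow> 'n filtration \<Rightarrow> bool" where
  "mixed_hodge_structure W F \<longleftrightarrow> weight_filtration W \<and> hodge_filtration F \<and>
     (\<forall>k p.
        subspace_sum (gr_hodge W F k p) (cnj_vec ` gr_hodge W F k (k + 1 - p)) = complexify (W k) \<and>
        gr_hodge W F k p \<inter> cnj_vec ` gr_hodge W F k (k + 1 - p) = complexify (W (k - 1)))"

text \<open>The number whose real part is taken below is automatically real, by the symmetry of \<open>Q\<close>.\<close>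

definition graded_polarized :: "'n::finite weight \<Rightarrow> 'n forms \<Rightarrow> 'n filtration \<Rightarrow> bool" where
  "graded_polarized W Q F \<longleftrightarrow> graded_forms W Q \<and>
     (\<forall>k p. \<forall>u\<in>gr_hodge W F k p. \<forall>v\<in>gr_hodge W F k (k + 1 - p). complex_form (Q k) u v = 0) \<and>
     (\<forall>p q. \<forall>u\<in>hodge_component W F p q - complexify (W (p + q - 1)).
        0 < Re (\<i> powi (p - q) * complex_form (Q (p + q)) u (cnj_vec u)))"

definition hodge_number :: "'n::finite weight \<Rightarrow> 'n filtration \<Rightarrow> int \<Rightarrow> int \<Rightarrow> nat" where
  "hodge_number W F p q =
     vec.dim (hodge_component W F p q) - vec.dim (complexify (W (p + q - 1)))"

definition classifying_space ::
  "'n::finite weight \<Rightarrow> 'n forms \<Rightarrow> (int \<Rightarrow> int \<Rightarrow> nat) \<Rightarrow> 'n filtration set" where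
  "classifying_space W Q h =
     {F. mixed_hodge_structure W F \<and> graded_polarized W Q F \<and> hodge_number W F = h}"

section \<open>Deligne bigrading and mixed Hodge metric\<close>

type_synonym 'n bigrading = "int \<Rightarrow> int \<Rightarrow> (complex^'n) set"

definition bigraded_part :: "'n::finite bigrading \<Rightarrow> (int \<times> int) set \<Rightarrow> (complex^'n) set" where
  "bigraded_part I J = vec.span (\<Union>(p, q)\<in>J. I p q)"

definition is_deligne_bigrading ::
  "'n::finite weight \<Rightarrow> 'n filtration \<Rightarrow> 'n bigrading \<Rightarrow> bool" where
  "is_deligne_bigrading W F I \<longleftrightarrow>
     (\<forall>p q. vec.subspace (I p q)) \<and>
     bigraded_part I UNIV = UNIV \<and>
     (\<forall>p q. I p q \<inter> bigraded_part I (- {(p, q)}) = {0}) \<and>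
     (\<forall>p. F p = bigraded_part I {(a, b). p \<le> a}) \<and>
     (\<forall>k. complexify (W k) = bigraded_part I {(a, b). a + b \<le> k}) \<and>
     (\<forall>p q. let R = bigraded_part I {(a, b). a < q \<and> b < p} in
        subspace_sum (cnj_vec ` I p q) R = subspace_sum (I q p) R)"

definition deligne_bigrading :: "'n::finite weight \<Rightarrow> 'n filtration \<Rightarrow> 'n bigrading" where
  "deligne_bigrading W F = (THE I. is_deligne_bigrading W F I)"

definition deligne_proj ::
  "'n::finite weight \<Rightarrow> 'n filtration \<Rightarrow> int \<Rightarrow> int \<Rightarrow> complex^'n \<Rightarrow> complex^'n" where
  "deligne_proj W F p q v =
     (THE w. w \<in> deligne_bigrading W F p q \<and>
        v - w \<in> bigraded_part (deligne_bigrading W F) (- {(p, q)}))"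

definition mixed_hodge_metric ::
  "'n::finite weight \<Rightarrow> 'n forms \<Rightarrow> 'n filtration \<Rightarrow> complex^'n \<Rightarrow> complex^'n \<Rightarrow> complex" where
  "mixed_hodge_metric W Q F u v =
     (\<Sum>(p, q)\<in>{(p, q). deligne_bigrading W F p q \<noteq> {0}}.
        \<i> powi (p - q) *
        complex_form (Q (p + q)) (deligne_proj W F p q u) (cnj_vec (deligne_proj W F p q v)))"

definition metric_adjoint ::
  "'n::finite weight \<Rightarrow> 'n forms \<Rightarrow> 'n filtration \<Rightarrow> complex^'n^'n \<Rightarrow> complex^'n^'n" where
  "metric_adjoint W Q F \<beta> =
     (THE \<beta>'. \<forall>u v. mixed_hodge_metric W Q F (\<beta> *v u) v = mixed_hodge_metric W Q F u (\<beta>' *v v))"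

definition mixed_hodge_metric_End ::
  "'n::finite weight \<Rightarrow> 'n forms \<Rightarrow> 'n filtration \<Rightarrow> complex^'n^'n \<Rightarrow> complex^'n^'n \<Rightarrow> complex" where
  "mixed_hodge_metric_End W Q F \<alpha> \<beta> = trace (\<alpha> ** metric_adjoint W Q F \<beta>)"

section \<open>The tangent spaces of the classifying space\<close>

definition G_C :: "'n::finite weight \<Rightarrow> 'n forms \<Rightarrow> (complex^'n^'n) set" where
  "G_C W Q = {g. invertible g \<and>
     (\<forall>k. (*v) g ` complexify (W k) = complexify (W k)) \<and>
     (\<forall>k. \<forall>u\<in>complexify (W k). \<forall>v\<in>complexify (W k).
        complex_form (Q k) (g *v u) (g *v v) = complex_form (Q k) u v)}"

text \<open>The Lie algebra as the tangent space of the group at the identity.\<close>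

definition lie_algebra :: "(complex^'n^'n) set \<Rightarrow> (complex^'n^'n) set" where
  "lie_algebra G = {X. \<exists>g :: real \<Rightarrow> complex^'n^'n.
     (\<forall>t. g t \<in> G) \<and> g 0 = mat 1 \<and> (g has_vector_derivative X) (at 0)}"

definition g_component ::
  "'n::finite weight \<Rightarrow> 'n forms \<Rightarrow> 'n filtration \<Rightarrow> int \<Rightarrow> int \<Rightarrow> (complex^'n^'n) set" where
  "g_component W Q F r s = {X \<in> lie_algebra (G_C W Q).
     \<forall>p q. (*v) X ` deligne_bigrading W F p q \<subseteq> deligne_bigrading W F (p + r) (q + s)}"

text \<open>The components are complex subspaces, so their real span is also their complex span.\<close>

definition q_space ::
  "'n::finite weight \<Rightarrow> 'n forms \<Rightarrow> 'n filtration \<Rightarrow> (complex^'n^'n) set" where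
  "q_space W Q F = span (\<Union>(r, s)\<in>{(r, s). r < 0}. g_component W Q F r s)"

text \<open>Tangent vectors at \<open>F\<close> to the flag variety, which contains \<open>D\<close> as a complex submanifold, are
  compatible families of maps \<open>F\<^sup>p \<rightarrow> V\<^sub>\<complex> / F\<^sup>p\<close>. The derivative of a holomorphic family \<open>\<Phi>\<close> in
  direction \<open>\<xi>\<close> sends \<open>f z\<close> to the class of \<open>D f(z) \<xi>\<close>, for local holomorphic sections \<open>f\<close> of
  \<open>\<Phi>\<^sup>p\<close>; the derivative of \<open>exp (t u) \<cdot> F\<close> at \<open>t = 0\<close> sends \<open>v\<close> to the class of \<open>u v\<close>. The
  predicate states that these tangent vectors agree, i.e. that \<open>u\<close> represents \<open>d\<Phi>\<^sub>z(\<xi>)\<close>.\<close>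

definition represents_derivative ::
  "(complex^'m \<Rightarrow> 'n::finite filtration) \<Rightarrow> complex^'m \<Rightarrow> complex^'m \<Rightarrow> complex^'n^'n \<Rightarrow> bool" where
  "represents_derivative \<Phi> z \<xi> u \<longleftrightarrow>
     (\<forall>p N f. open N \<and> z \<in> N \<and> holomorphic_map f N \<and> (\<forall>w\<in>N. f w \<in> \<Phi> w p) \<longrightarrow>
        frechet_derivative f (at z) \<xi> - u *v f z \<in> \<Phi> z p)"

definition tangent_vector ::
  "'n::finite weight \<Rightarrow> 'n forms \<Rightarrow> (complex^'m \<Rightarrow> 'n filtration) \<Rightarrow>
   complex^'m \<Rightarrow> complex^'m \<Rightarrow> complex^'n^'n" where
  "tangent_vector W Q \<Phi> z \<xi> = (THE u. u \<in> q_space W Q (\<Phi> z) \<and> represents_derivative \<Phi> z \<xi> u)"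

section \<open>Variations of mixed Hodge structure\<close>

definition locally_constant_on :: "('a::topological_space \<Rightarrow> 'b) \<Rightarrow> 'a set \<Rightarrow> bool" where
  "locally_constant_on f T \<longleftrightarrow>
     (\<forall>x\<in>T. \<exists>N. open N \<and> x \<in> N \<and> (\<forall>y\<in>N \<inter> T. f y = f x))"

text \<open>The fibre over \<open>x\<close> of the local system is a copy of \<open>real^'n\<close>, with no relation assumed
  between different fibres; the flat structure is carried by the local frames \<open>(U, A)\<close>, where the
  columns of \<open>A x\<close> are the values in the fibre over \<open>x\<close> of a basis of flat sections on \<open>U\<close>.\<close>

record ('s, 'n) variation =
  frames :: "('s set \<times> ('s \<Rightarrow> real^'n^'n)) set"
  weight :: "'s \<Rightarrow> int \<Rightarrow> (real^'n) set"
  forms :: "'s \<Rightarrow> int \<Rightarrow> real^'n \<Rightarrow> real^'n \<Rightarrow> real"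
  hodge :: "'s \<Rightarrow> int \<Rightarrow> (complex^'n) set"

definition flat_frame ::
  "('s::topological_space, 'n::finite) variation \<Rightarrow> 's set \<Rightarrow> ('s \<Rightarrow> real^'n^'n) \<Rightarrow> bool" where
  "flat_frame V U A \<longleftrightarrow> open U \<and> (\<forall>x\<in>U. invertible (A x)) \<and>
     (\<forall>(U', A')\<in>frames V. locally_constant_on (\<lambda>x. matrix_inv (A' x) ** A x) (U \<inter> U'))"

definition local_system :: "('s::topological_space, 'n::finite) variation \<Rightarrow> bool" where
  "local_system V \<longleftrightarrow> (\<Union>(U, A)\<in>frames V. U) = UNIV \<and> (\<forall>(U, A)\<in>frames V. flat_frame V U A)"

definition flat_weight :: "('s::topological_space, 'n::finite) variation \<Rightarrow> bool" where
  "flat_weight V \<longleftrightarrow> (\<forall>(U, A)\<in>frames V. \<forall>k.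
     locally_constant_on (\<lambda>x. (*v) (matrix_inv (A x)) ` weight V x k) U)"

definition flat_forms :: "('s::topological_space, 'n::finite) variation \<Rightarrow> bool" where
  "flat_forms V \<longleftrightarrow> (\<forall>(U, A)\<in>frames V. \<forall>k. \<forall>x\<in>U. \<exists>N. open N \<and> x \<in> N \<and>
     (\<forall>y\<in>N \<inter> U. \<forall>u\<in>weight V x k. \<forall>v\<in>weight V x k.
        let T = A y ** matrix_inv (A x)
        in forms V y k (T *v u) (T *v v) = forms V x k u v))"

definition act :: "real^'n^'n \<Rightarrow> 'n::finite filtration \<Rightarrow> 'n filtration" where
  "act g F = (\<lambda>p. (*v) (complex_mat g) ` F p)"

text \<open>The Hodge filtration in the flat frame \<open>A\<close> and the chart \<open>c\<close>.\<close>

definition local_hodge ::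
  "('s, 'n::finite) variation \<Rightarrow> ('s, 'm::finite) chart \<Rightarrow> ('s \<Rightarrow> real^'n^'n) \<Rightarrow>
   complex^'m \<Rightarrow> 'n filtration" where
  "local_hodge V c A z =
     act (matrix_inv (A (chart_inv c z))) (hodge V (chart_inv c z))"

definition holomorphic_subbundle ::
  "(complex^'m \<Rightarrow> (complex^'n::finite) set) \<Rightarrow> (complex^'m) set \<Rightarrow> bool" where
  "holomorphic_subbundle E N \<longleftrightarrow> (\<forall>z\<in>N. \<exists>N' r f. open N' \<and> z \<in> N' \<and> N' \<subseteq> N \<and>
     (\<forall>i<r. holomorphic_map (f i) N') \<and>
     (\<forall>w\<in>N'. E w = vec.span ((\<lambda>i. f i w) ` {..<r::nat}) \<and> vec.dim (E w) = r))"

definition holomorphic_hodge ::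
  "('s::topological_space, 'm::finite) chart set \<Rightarrow> ('s, 'n::finite) variation \<Rightarrow> bool" where
  "holomorphic_hodge M V \<longleftrightarrow> (\<forall>c\<in>M. \<forall>(U, A)\<in>frames V. \<forall>p.
     holomorphic_subbundle (\<lambda>z. local_hodge V c A z p) (snd c ` (fst c \<inter> U)))"

definition griffiths_transversal ::
  "('s::topological_space, 'm::finite) chart set \<Rightarrow> ('s, 'n::finite) variation \<Rightarrow> bool" where
  "griffiths_transversal M V \<longleftrightarrow> (\<forall>c\<in>M. \<forall>(U, A)\<in>frames V. \<forall>p N f.
     open N \<and> N \<subseteq> snd c ` (fst c \<inter> U) \<and> holomorphic_map f N \<and>
     (\<forall>z\<in>N. f z \<in> local_hodge V c A z p) \<longrightarrow>
     (\<forall>z\<in>N. \<forall>\<xi>. frechet_derivative f (at z) \<xi> \<in> local_hodge V c A z (p - 1)))"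

definition graded_polarized_VMHS ::
  "('s::topological_space, 'm::finite) chart set \<Rightarrow> ('s, 'n::finite) variation \<Rightarrow> bool" where
  "graded_polarized_VMHS M V \<longleftrightarrow>
     local_system V \<and> flat_weight V \<and> flat_forms V \<and>
     holomorphic_hodge M V \<and> griffiths_transversal M V \<and>
     (\<exists>h. \<forall>x. hodge V x \<in> classifying_space (weight V x) (forms V x) h)"

section \<open>The period map and the pulled back metric\<close>

text \<open>\<open>B t\<close> is parallel transport from \<open>x\<close> to \<open>\<gamma> t\<close> along \<open>\<gamma>\<close>.\<close>

definition parallel_transports ::
  "('s::topological_space, 'n::finite) variation \<Rightarrow> 's \<Rightarrow> 's \<Rightarrow> (real^'n^'n) set" where
  "parallel_transports V x y = {P. \<exists>\<gamma> B. path \<gamma> \<and> pathstart \<gamma> = x \<and> pathfinish \<gamma> = y \<and>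
     B (0::real) = mat 1 \<and> B 1 = P \<and>
     (\<forall>(U, A)\<in>frames V.
        locally_constant_on (\<lambda>t. matrix_inv (A (\<gamma> t)) ** B t) {t \<in> {0..1}. \<gamma> t \<in> U})}"

definition monodromy_group ::
  "('s::topological_space, 'n::finite) variation \<Rightarrow> 's \<Rightarrow> (real^'n^'n) set" where
  "monodromy_group V s0 = parallel_transports V s0 s0"

text \<open>\<open>D\<close> is the classifying space of the fibre over the base point \<open>s0\<close>, and points of \<open>\<Gamma>\D\<close> are
  \<open>\<Gamma>\<close>-orbits. The result does not depend on the choice of the path from \<open>s0\<close> to \<open>x\<close> used to
  transport the Hodge filtration back to the base point.\<close>

definition period_map ::
  "('s::topological_space, 'n::finite) variation \<Rightarrow> 's \<Rightarrow> 's \<Rightarrow> 'n filtration set" where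
  "period_map V s0 x = {act g (act (matrix_inv P) (hodge V x)) | g P.
     g \<in> monodromy_group V s0 \<and> P \<in> parallel_transports V s0 x}"

text \<open>Local lifts of the period map come from flat frames on \<open>U\<close> that are obtained by transporting
  a basis of the fibre over \<open>s0\<close>, here the standard one.\<close>

definition period_lift ::
  "('s::topological_space, 'n::finite) variation \<Rightarrow> 's \<Rightarrow> 's set \<Rightarrow> ('s \<Rightarrow> 'n filtration) \<Rightarrow> bool" where
  "period_lift V s0 U \<phi> \<longleftrightarrow> (\<forall>x\<in>U. \<phi> x \<in> period_map V s0 x) \<and>
     (\<exists>A. flat_frame V U A \<and>
        (\<forall>x\<in>U. A x \<in> parallel_transports V s0 x \<and> \<phi> x = act (matrix_inv (A x)) (hodge V x)))"

text \<open>Any local lift around the point may be used, since \<open>\<Gamma>\<close> acts on \<open>D\<close> by isometries.\<close>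

definition period_pullback_metric ::
  "('s::topological_space, 'n::finite) variation \<Rightarrow> 's \<Rightarrow>
   ('s, 'm::finite) chart \<Rightarrow> complex^'m \<Rightarrow> complex^'m \<Rightarrow> complex^'m \<Rightarrow> complex" where
  "period_pullback_metric V s0 c z \<xi> \<eta> = (THE t. \<exists>U \<phi>.
     period_lift V s0 U \<phi> \<and> chart_inv c z \<in> U \<and>
     (let W = weight V s0; Q = forms V s0; \<Phi> = (\<lambda>w. \<phi> (chart_inv c w))
      in t = mixed_hodge_metric_End W Q (\<Phi> z)
               (tangent_vector W Q \<Phi> z \<xi>) (tangent_vector W Q \<Phi> z \<eta>)))"

end

theory Submission
  imports Defs "HOL-Complex_Analysis.Cauchy_Integral_Formula"
begin

text \<open>For the adjacent weights \<open>m\<close> and \<open>m + 1\<close> the Deligne bigrading is split over \<open>\<real>\<close>, i.e.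
  \<open>I\<^sup>q\<^sup>,\<^sup>p\<close> is the conjugate of \<open>I\<^sup>p\<^sup>,\<^sup>q\<close>. It is encoded by two matrices: \<open>P\<close>, which is multiplication
  by \<open>p\<close> on \<open>I\<^sup>p\<^sup>,\<^sup>q\<close>, and the real projection \<open>S\<close> with kernel \<open>W\<^sub>m\<close> onto the part of weight \<open>m + 1\<close>.
  Along a holomorphic horizontal family the tangent vector in direction \<open>X\<close> is the Wirtinger
  derivative \<open>\<theta>\<^sub>X = \<partial>\<^sub>X P\<close>; it has components of type \<open>(-1, 1)\<close> and \<open>(-1, 0)\<close> only, and the latter
  is \<open>B\<^sub>X = \<partial>\<^sub>X S\<close>. The metric becomes \<open>Tr (\<theta>\<^sub>X cnj \<theta>\<^sub>Y) + \<i> \<beta> (B\<^sub>X, cnj B\<^sub>Y)\<close>, where \<open>\<beta>\<close> is the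
  form induced by the two polarizations on the maps \<open>gr\<^sub>m\<^sub>+\<^sub>1 \<rightarrow> gr\<^sub>m\<close>. As the weights are adjacent, one
  polarization is symmetric and the other one alternating, so \<open>\<beta>\<close> is antisymmetric; it is constant
  in a flat frame. The metric is Kaehler if \<open>\<partial>\<^sub>Z\<close> of its value at \<open>X, Y\<close> is symmetric in \<open>X\<close> and
  \<open>Z\<close>. This follows by differentiating \<open>[P, \<theta>\<^sub>X] = -\<theta>\<^sub>X\<close> and \<open>[P, B\<^sub>X] = -B\<^sub>X\<close> from the commutation of
  the \<open>\<theta>\<^sub>X\<close>, the antisymmetry of \<open>\<beta>\<close> and its invariance under infinitesimal isometries. Two local
  lifts of the period map differ by a constant real isometry, which preserves these formulas.\<close>

text \<open>Only the filtration \<open>F\<close> varies holomorphically; the bigrading mixes it with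
  its conjugate and is merely smooth. Hence the detour through projections built from holomorphic
  frames by rational operations on Gram matrices, and through the smoothness of holomorphic maps. A
  (1,0) derivative moves F^r into F^(r-1) by horizontality and keeps the conjugate of F^s, which
  cuts the derivative of a Hodge projection down to a few types. The derivative of \<open>P\<close>
  represents the tangent vector because P - r maps F^r into F^(r+1). The factor i in the metric
  comes from the Weil operator i^(p-q): a map of type (-1,0) changes p - q by one and picks up -i, a
  map of type (-1,1) changes it by two and picks up only a sign. Antisymmetry of beta serves twice:
  combined with the factor i it makes the metric hermitian, and in the proof of closedness it
  restores the sign lost when a commutator moves from one argument of beta to the other. The Hodge
  indices must be bounded by one \<open>hi\<close> on a whole neighbourhood, so that the index set
  of the bigrading is constant there; local constancy of ranks provides this.\<close>

section \<open>Smooth functions\<close>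

text \<open>Openness of \<open>N\<close> matters: \<open>Ck_on\<close> uses derivatives
  \<open>at x\<close>, which see a full neighbourhood and not only the points of
  \<open>N\<close>.\<close>

lemma Ck_on_cong:
  assumes "open N" "\<And>x. x \<in> N \<Longrightarrow> f x = g x" "Ck_on k f N"
  shows "Ck_on k g N"
  using assms(2,3)
proof (induction k arbitrary: f g)
  case 0
  then show ?case by (simp cong: continuous_on_cong)
next
  case (Suc k)
  have hd: "(g has_derivative frechet_derivative f (at x)) (at x)" if "x \<in> N" for x
  proof -
    have "(f has_derivative frechet_derivative f (at x)) (at x)"
      using Suc.prems that by (simp add: frechet_derivative_works)
    then show ?thesis
      by (rule has_derivative_transform_within_open[OF _ assms(1) that]) (use Suc.prems in auto)
  qed
  then have eq: "frechet_derivative g (at x) = frechet_derivative f (at x)" if "x \<in> N" for x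
    using frechet_derivative_at that by metis
  show ?case
  proof (simp, intro conjI ballI allI)
    fix x assume "x \<in> N" then show "g differentiable at x"
      using hd differentiable_def by blast
  next
    fix v
    have "Ck_on k (\<lambda>x. frechet_derivative f (at x) v) N" using Suc.prems by simp
    then show "Ck_on k (\<lambda>x. frechet_derivative g (at x) v) N"
      by (rule Suc.IH[rotated]) (simp add: eq)
  qed
qed

text \<open>Lets any explicit derivative stand in for \<open>frechet_derivative\<close>, so that the
  product and chain rules can be quoted directly.\<close>

lemma Ck_on_SucI:
  assumes "open N" "\<And>x. x \<in> N \<Longrightarrow> (f has_derivative f' x) (at x)"
    "\<And>v. Ck_on k (\<lambda>x. f' x v) N"
  shows "Ck_on (Suc k) f N"
proof (simp, intro conjI ballI allI)
  fix x assume "x \<in> N" then show "f differentiable at x" using assms(2) differentiable_def by blast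
next
  fix v show "Ck_on k (\<lambda>x. frechet_derivative f (at x) v) N"
    by (rule Ck_on_cong[OF assms(1) _ assms(3)[of v]]) (metis assms(2) frechet_derivative_at)
qed

lemma Ck_on_Suc_imp: "Ck_on (Suc k) f N \<Longrightarrow> Ck_on k f N"
proof (induction k arbitrary: f)
  case 0
  then show ?case
    by (auto intro!: continuous_at_imp_continuous_on simp: differentiable_imp_continuous_within)
next
  case (Suc k)
  then show ?case by auto
qed

lemma Ck_on_subset: "Ck_on k f N \<Longrightarrow> N' \<subseteq> N \<Longrightarrow> Ck_on k f N'"
  by (induction k arbitrary: f) (auto intro: continuous_on_subset)

lemma Ck_on_local:
  assumes "\<And>x. x \<in> N \<Longrightarrow> \<exists>N'. open N' \<and> x \<in> N' \<and> Ck_on k f N'"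
  shows "Ck_on k f N"
  using assms
proof (induction k arbitrary: f)
  case 0
  show ?case unfolding Ck_on.simps
  proof (rule continuous_at_imp_continuous_on, rule ballI)
    fix x assume "x \<in> N"
    then obtain N' where "open N'" "x \<in> N'" "continuous_on N' f" using 0 by auto
    then show "isCont f x" by (simp add: continuous_on_eq_continuous_at)
  qed
next
  case (Suc k)
  show ?case
  proof (simp, intro conjI ballI allI)
    fix x assume "x \<in> N" then show "f differentiable at x" using Suc.prems[of x] by auto
  next
    fix v show "Ck_on k (\<lambda>x. frechet_derivative f (at x) v) N"
      by (rule Suc.IH) (metis Suc.prems Ck_on.simps(2))
  qed
qed

lemma Ck_on_deriv:
  assumes "Ck_on (Suc k) f N" "x \<in> N"
  shows "(f has_derivative frechet_derivative f (at x)) (at x)"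
  using assms by (simp add: frechet_derivative_works)

lemma Ck_on_const: "open N \<Longrightarrow> Ck_on k (\<lambda>x. c) N"
proof (induction k arbitrary: c)
  case (Suc k)
  show ?case by (rule Ck_on_SucI[OF Suc.prems has_derivative_const]) (rule Suc.IH[OF Suc.prems])
qed simp

lemma Ck_on_linear:
  assumes L: "bounded_linear L" and N: "open N" and "Ck_on k f N"
  shows "Ck_on k (\<lambda>x. L (f x)) N"
  using assms(3)
proof (induction k arbitrary: f)
  case 0
  then show ?case by (simp add: bounded_linear.continuous_on[OF L])
next
  case (Suc k)
  show ?case
    by (rule Ck_on_SucI[OF N bounded_linear.has_derivative[OF L Ck_on_deriv[OF Suc.prems]]])
      (use Suc in auto)
qed

lemma Ck_on_add:
  assumes N: "open N" and "Ck_on k f N" "Ck_on k g N"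
  shows "Ck_on k (\<lambda>x. f x + g x) N"
  using assms(2,3)
proof (induction k arbitrary: f g)
  case 0
  then show ?case by (simp add: continuous_on_add)
next
  case (Suc k)
  show ?case
    by (rule Ck_on_SucI[OF N has_derivative_add[OF Ck_on_deriv[OF Suc.prems(1)] Ck_on_deriv[OF Suc.prems(2)]]])
      (use Suc in auto)
qed

lemma Ck_on_bilinear:
  assumes B: "bounded_bilinear B" and N: "open N" and "Ck_on k f N" "Ck_on k g N"
  shows "Ck_on k (\<lambda>x. B (f x) (g x)) N"
  using assms(3,4)
proof (induction k arbitrary: f g)
  case 0
  then show ?case by (simp add: bounded_bilinear.continuous_on[OF B])
next
  case (Suc k)
  note IH = Suc.IH and f = Suc.prems(1) and g = Suc.prems(2)
  show ?case
    by (rule Ck_on_SucI[OF N bounded_bilinear.FDERIV[OF B Ck_on_deriv[OF f] Ck_on_deriv[OF g]]];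
        (intro Ck_on_add N IH Ck_on_Suc_imp[OF f] Ck_on_Suc_imp[OF g])?)
      (use f g in auto)
qed

text \<open>The derivative of 1/f is, up to sign, f' times two factors 1/f. So regularity of order
  k, the induction hypothesis for the same \<open>f\<close>, yields order k + 1.\<close>

lemma Ck_on_inverse:
  fixes f :: "'a::real_normed_vector \<Rightarrow> complex"
  assumes N: "open N" and "\<And>x. x \<in> N \<Longrightarrow> f x \<noteq> 0" and "Ck_on k f N"
  shows "Ck_on k (\<lambda>x. inverse (f x)) N"
  using assms(3)
proof (induction k)
  case 0
  then show ?case using assms by (simp add: continuous_on_inverse)
next
  case (Suc k)
  have mult: "Ck_on k (\<lambda>x. u x * v x) N" if "Ck_on k u N" "Ck_on k v N" for u v :: "'a \<Rightarrow> complex"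
    by (rule Ck_on_bilinear[OF bounded_bilinear_mult N that])
  have neg: "Ck_on k (\<lambda>x. - u x) N" if "Ck_on k u N" for u :: "'a \<Rightarrow> complex"
    by (rule Ck_on_linear[OF bounded_linear_minus[OF bounded_linear_ident] N that])
  have IH: "Ck_on k (\<lambda>x. inverse (f x)) N" using Suc Ck_on_Suc_imp by blast
  show ?case
    by (rule Ck_on_SucI[OF N Deriv.has_derivative_inverse[OF _ Ck_on_deriv[OF Suc.prems]]])
      (use Suc IH assms in \<open>auto intro!: mult neg\<close>)
qed

lemma smooth_on_cong:
  "open N \<Longrightarrow> (\<And>x. x \<in> N \<Longrightarrow> f x = g x) \<Longrightarrow> smooth_on f N \<Longrightarrow> smooth_on g N"
  unfolding smooth_on_def using Ck_on_cong by blast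

lemma smooth_on_subset: "smooth_on f N \<Longrightarrow> N' \<subseteq> N \<Longrightarrow> smooth_on f N'"
  unfolding smooth_on_def using Ck_on_subset by blast

lemma smooth_on_local:
  "(\<And>x. x \<in> N \<Longrightarrow> \<exists>N'. open N' \<and> x \<in> N' \<and> smooth_on f N') \<Longrightarrow> smooth_on f N"
  unfolding smooth_on_def by (metis Ck_on_local)

lemma smooth_on_const: "open N \<Longrightarrow> smooth_on (\<lambda>x. c) N"
  by (simp add: smooth_on_def Ck_on_const)

lemma smooth_on_linear:
  "bounded_linear L \<Longrightarrow> open N \<Longrightarrow> smooth_on f N \<Longrightarrow> smooth_on (\<lambda>x. L (f x)) N"
  by (simp add: smooth_on_def Ck_on_linear)

lemma smooth_on_bilinear:
  "bounded_bilinear B \<Longrightarrow> open N \<Longrightarrow> smooth_on f N \<Longrightarrow> smooth_on g N \<Longrightarrow> smooth_on (\<lambda>x. B (f x) (g x)) N"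
  by (simp add: smooth_on_def Ck_on_bilinear)

lemma smooth_on_add:
  "open N \<Longrightarrow> smooth_on f N \<Longrightarrow> smooth_on g N \<Longrightarrow> smooth_on (\<lambda>x. f x + g x) N"
  by (simp add: smooth_on_def Ck_on_add)

lemma smooth_on_minus: "open N \<Longrightarrow> smooth_on f N \<Longrightarrow> smooth_on (\<lambda>x. - f x) N"
  by (rule smooth_on_linear[OF bounded_linear_minus[OF bounded_linear_ident]])

lemma smooth_on_diff:
  "open N \<Longrightarrow> smooth_on f N \<Longrightarrow> smooth_on g N \<Longrightarrow> smooth_on (\<lambda>x. f x - g x) N"
  using smooth_on_add[OF _ _ smooth_on_minus, of N f g] by simp

lemma smooth_on_sum:
  "open N \<Longrightarrow> (\<And>i. i \<in> I \<Longrightarrow> smooth_on (f i) N) \<Longrightarrow> smooth_on (\<lambda>x. \<Sum>i\<in>I. f i x) N"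
  by (induction I rule: infinite_finite_induct) (auto intro: smooth_on_const smooth_on_add)

lemma smooth_on_mult:
  fixes f g :: "'a::real_normed_vector \<Rightarrow> complex"
  shows "open N \<Longrightarrow> smooth_on f N \<Longrightarrow> smooth_on g N \<Longrightarrow> smooth_on (\<lambda>x. f x * g x) N"
  by (rule smooth_on_bilinear[OF bounded_bilinear_mult])

lemma smooth_on_prod:
  fixes f :: "'i \<Rightarrow> 'a::real_normed_vector \<Rightarrow> complex"
  shows "open N \<Longrightarrow> (\<And>i. i \<in> I \<Longrightarrow> smooth_on (f i) N) \<Longrightarrow> smooth_on (\<lambda>x. \<Prod>i\<in>I. f i x) N"
  by (induction I rule: infinite_finite_induct) (auto intro: smooth_on_const smooth_on_mult)

lemma smooth_on_inverse:
  fixes f :: "'a::real_normed_vector \<Rightarrow> complex"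
  shows "open N \<Longrightarrow> smooth_on f N \<Longrightarrow> (\<And>x. x \<in> N \<Longrightarrow> f x \<noteq> 0) \<Longrightarrow> smooth_on (\<lambda>x. inverse (f x)) N"
  by (simp add: smooth_on_def Ck_on_inverse)

lemma smooth_on_deriv:
  "smooth_on f N \<Longrightarrow> smooth_on (\<lambda>x. frechet_derivative f (at x) v) N"
  unfolding smooth_on_def by (metis Ck_on.simps(2))

lemma smooth_on_has_derivative:
  "smooth_on f N \<Longrightarrow> x \<in> N \<Longrightarrow> (f has_derivative frechet_derivative f (at x)) (at x)"
  unfolding smooth_on_def using Ck_on_deriv by blast

lemma smooth_on_continuous: "smooth_on f N \<Longrightarrow> continuous_on N f"
  unfolding smooth_on_def using Ck_on.simps(1) by blast

lemma bounded_linear_vec_lambda: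
  fixes h :: "'i::finite \<Rightarrow> 'a::euclidean_space \<Rightarrow> 'b::euclidean_space"
  assumes "\<And>i. linear (h i)"
  shows "bounded_linear (\<lambda>x. \<chi> i. h i x)"
  unfolding linear_conv_bounded_linear[symmetric]
  by (rule linearI) (auto simp: vec_eq_iff linear_add[OF assms] linear_cmul[OF assms])

lemma smooth_on_vec:
  fixes f :: "'a::real_normed_vector \<Rightarrow> 'b::euclidean_space ^ 'i::finite"
  assumes "open N" "\<And>i. smooth_on (\<lambda>x. f x $ i) N"
  shows "smooth_on f N"
proof -
  have "smooth_on (\<lambda>x. \<Sum>i\<in>UNIV. (\<lambda>y. \<chi> j. if j = i then y else 0) (f x $ i)) N"
    by (intro smooth_on_sum assms(1) smooth_on_linear[OF bounded_linear_vec_lambda _ assms(2)])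
      (auto intro!: linearI)
  moreover have "(\<Sum>i\<in>UNIV. (\<lambda>y. \<chi> j. if j = i then y else 0) (f x $ i)) = f x" for x
    by (simp add: vec_eq_iff)
  ultimately show ?thesis by simp
qed

lemma smooth_on_nth:
  fixes f :: "'a::real_normed_vector \<Rightarrow> 'b::euclidean_space ^ 'i::finite"
  shows "open N \<Longrightarrow> smooth_on f N \<Longrightarrow> smooth_on (\<lambda>x. f x $ i) N"
  by (rule smooth_on_linear[OF bounded_linear_vec_nth])

section \<open>Symmetry of second derivatives\<close>

lemma second_difference_real:
  fixes f :: "'a::real_normed_vector \<Rightarrow> real"
  assumes f: "smooth_on f (ball z r)" and s: "0 < s" "s * norm u + s * norm v < r"
  shows "\<exists>y. dist z y \<le> s * norm u + s * norm v \<and>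
    f (z + s *\<^sub>R u + s *\<^sub>R v) - f (z + s *\<^sub>R u) - f (z + s *\<^sub>R v) + f z =
    s * s * frechet_derivative (\<lambda>x. frechet_derivative f (at x) u) (at y) v"
proof -
  define Du where "Du = (\<lambda>x. frechet_derivative f (at x) u)"
  have Du: "smooth_on Du (ball z r)" unfolding Du_def by (rule smooth_on_deriv[OF f])
  have inb: "z + a *\<^sub>R u + b *\<^sub>R v \<in> ball z r" and
    dist: "dist z (z + a *\<^sub>R u + b *\<^sub>R v) \<le> s * norm u + s * norm v"
    if "0 \<le> a" "a \<le> s" "0 \<le> b" "b \<le> s" for a b
  proof -
    have "norm (a *\<^sub>R u + b *\<^sub>R v) \<le> s * norm u + s * norm v"
      using that by (intro norm_triangle_le add_mono) (auto intro: mult_right_mono)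
    then show "dist z (z + a *\<^sub>R u + b *\<^sub>R v) \<le> s * norm u + s * norm v"
      by (metis add.assoc add_diff_cancel_left' dist_commute dist_norm)
    then show "z + a *\<^sub>R u + b *\<^sub>R v \<in> ball z r" using s by auto
  qed
  have line: "((\<lambda>t. h (p + t *\<^sub>R w)) has_real_derivative frechet_derivative h (at (p + t *\<^sub>R w)) w) (at t)"
    if "smooth_on h (ball z r)" "p + t *\<^sub>R w \<in> ball z r" for h :: "'a \<Rightarrow> real" and p w t
  proof -
    have h: "(h has_derivative frechet_derivative h (at (p + t *\<^sub>R w))) (at (p + t *\<^sub>R w))"
      using smooth_on_has_derivative that by blast
    have "((\<lambda>t. h (p + t *\<^sub>R w)) has_derivative (\<lambda>x. frechet_derivative h (at (p + t *\<^sub>R w)) (x *\<^sub>R w))) (at t)"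
      by (rule has_derivative_compose[where f = "\<lambda>t. p + t *\<^sub>R w", OF _ h]) (auto intro!: derivative_eq_intros)
    then show ?thesis
      unfolding has_field_derivative_def
      using linear_cmul[OF has_derivative_linear[OF h]] by (simp add: mult.commute[of _ "frechet_derivative h (at (p + t *\<^sub>R w)) w"])
  qed
  \<comment> \<open>The difference in direction \<open>v\<close> as a function of the step in
    direction \<open>u\<close>: \<open>g s - g 0\<close> is the second difference. One mean value
    theorem in \<open>u\<close> and one in \<open>v\<close> turn it into s^2 times a mixed
    derivative at a nearby point.\<close>
  define g where "g = (\<lambda>a. f (z + s *\<^sub>R v + a *\<^sub>R u) - f (z + a *\<^sub>R u))"
  have "\<exists>a>0. a < s \<and> g s - g 0 = (s - 0) * (Du (z + s *\<^sub>R v + a *\<^sub>R u) - Du (z + a *\<^sub>R u))"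
    unfolding g_def Du_def
    by (rule MVT2[OF s(1)], rule DERIV_diff; rule line[OF f])
      (use inb[of _ s] inb[of _ 0] s in \<open>auto simp: algebra_simps\<close>)
  then obtain a where a: "0 < a" "a < s" "g s - g 0 = s * (Du (z + s *\<^sub>R v + a *\<^sub>R u) - Du (z + a *\<^sub>R u))"
    by auto
  have "\<exists>b>0. b < s \<and> Du (z + a *\<^sub>R u + s *\<^sub>R v) - Du (z + a *\<^sub>R u + 0 *\<^sub>R v)
      = (s - 0) * frechet_derivative Du (at (z + a *\<^sub>R u + b *\<^sub>R v)) v"
    by (rule MVT2[OF s(1)], rule line[OF Du]) (use inb a in auto)
  then obtain b where b: "0 < b" "b < s" "Du (z + a *\<^sub>R u + s *\<^sub>R v) - Du (z + a *\<^sub>R u)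
      = s * frechet_derivative Du (at (z + a *\<^sub>R u + b *\<^sub>R v)) v" by auto
  have "g s - g 0 = s * s * frechet_derivative Du (at (z + a *\<^sub>R u + b *\<^sub>R v)) v"
    using a b by (simp add: algebra_simps)
  then show ?thesis using dist[of a b] a b unfolding g_def Du_def
    by (intro exI[of _ "z + a *\<^sub>R u + b *\<^sub>R v"]) (auto simp: algebra_simps)
qed

text \<open>The second difference is symmetric in \<open>u\<close> and \<open>v\<close>, so the two
  mixed derivatives take a common value at points \<open>y\<close> and \<open>y'\<close> arbitrarily
  close to \<open>z\<close>; both are continuous at \<open>z\<close>.\<close>

lemma second_derivative_symmetric_real:
  fixes f :: "'a::real_normed_vector \<Rightarrow> real"
  assumes f: "smooth_on f N" and N: "open N" "z \<in> N"
  shows "frechet_derivative (\<lambda>x. frechet_derivative f (at x) u) (at z) v =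
    frechet_derivative (\<lambda>x. frechet_derivative f (at x) v) (at z) u"
proof -
  define A where "A = (\<lambda>y. frechet_derivative (\<lambda>x. frechet_derivative f (at x) u) (at y) v)"
  define B where "B = (\<lambda>y. frechet_derivative (\<lambda>x. frechet_derivative f (at x) v) (at y) u)"
  have cA: "isCont A z" and cB: "isCont B z" unfolding A_def B_def
    using smooth_on_continuous[OF smooth_on_deriv[OF smooth_on_deriv[OF f]]] N
    by (auto simp: continuous_on_eq_continuous_at)
  obtain r where r: "r > 0" "ball z r \<subseteq> N" using N open_contains_ball by blast
  have fr: "smooth_on f (ball z r)" using f r smooth_on_subset by blast
  have "\<bar>A z - B z\<bar> \<le> e" if e: "e > 0" for e
  proof -
    from cA obtain d1 where d1: "d1 > 0" "\<And>y. dist y z < d1 \<Longrightarrow> dist (A y) (A z) < e/2"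
      unfolding continuous_at_eps_delta using half_gt_zero[OF e] by blast
    from cB obtain d2 where d2: "d2 > 0" "\<And>y. dist y z < d2 \<Longrightarrow> dist (B y) (B z) < e/2"
      unfolding continuous_at_eps_delta using half_gt_zero[OF e] by blast
    define d where "d = min r (min d1 d2)"
    \<comment> \<open>This step keeps the second difference within distance d/2 of \<open>z\<close>;
      the summand 1 avoids a division by zero for \<open>u = v = 0\<close>.\<close>
    define s where "s = d / (2 * (norm u + norm v + 1))"
    have "d > 0" using r d1 d2 by (simp add: d_def)
    have n: "norm u + norm v + 1 > 0" by (simp add: add_nonneg_pos)
    have s: "s > 0" unfolding s_def using \<open>d > 0\<close> n by simp
    have "s * norm u + s * norm v = s * (norm u + norm v)" by (simp add: algebra_simps)
    also have "\<dots> \<le> s * (norm u + norm v + 1)" using s by simp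
    also have "\<dots> = d / 2" unfolding s_def using less_imp_neq[OF n] by (simp add: field_simps)
    also have "\<dots> < d" using \<open>d > 0\<close> by simp
    finally have sd: "s * norm u + s * norm v < d" .
    from second_difference_real[OF fr s, of u v] sd obtain y where
      y: "dist z y \<le> s * norm u + s * norm v"
      "f (z + s *\<^sub>R u + s *\<^sub>R v) - f (z + s *\<^sub>R u) - f (z + s *\<^sub>R v) + f z = s * s * A y"
      unfolding A_def d_def by auto
    from second_difference_real[OF fr s, of v u] sd obtain y' where
      y': "dist z y' \<le> s * norm v + s * norm u"
      "f (z + s *\<^sub>R v + s *\<^sub>R u) - f (z + s *\<^sub>R v) - f (z + s *\<^sub>R u) + f z = s * s * B y'"
      unfolding B_def d_def by auto
    have "s * s * A y = s * s * B y'" using y y' by (simp add: algebra_simps)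
    then have "A y = B y'" using s by simp
    moreover have "dist (A y) (A z) < e/2" "dist (B y') (B z) < e/2"
      using y y' sd d1 d2 by (auto simp: d_def dist_commute)
    ultimately show ?thesis unfolding dist_real_def by linarith
  qed
  then have "\<bar>A z - B z\<bar> \<le> 0" by (rule field_le_epsilon) simp
  then show ?thesis unfolding A_def B_def by simp
qed

lemma frechet_derivative_linear:
  assumes "bounded_linear L" "f differentiable at x"
  shows "frechet_derivative (\<lambda>x. L (f x)) (at x) v = L (frechet_derivative f (at x) v)"
  by (metis assms bounded_linear.has_derivative frechet_derivative_at frechet_derivative_works)

lemma smooth_on_differentiable: "smooth_on f N \<Longrightarrow> x \<in> N \<Longrightarrow> f differentiable at x"
  using smooth_on_has_derivative differentiable_def by blast

lemma frechet_derivative_cong_open: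
  assumes "open N" "x \<in> N" "\<And>y. y \<in> N \<Longrightarrow> f y = g y" "f differentiable at x"
  shows "frechet_derivative g (at x) = frechet_derivative f (at x)"
proof -
  have "(g has_derivative frechet_derivative f (at x)) (at x)"
    by (rule has_derivative_transform_within_open[OF assms(4)[unfolded frechet_derivative_works] assms(1,2)])
      (rule assms(3))
  then show ?thesis using frechet_derivative_at by metis
qed

lemma second_derivative_symmetric:
  fixes f :: "'a::real_normed_vector \<Rightarrow> 'b::euclidean_space"
  assumes f: "smooth_on f N" and N: "open N" "z \<in> N"
  shows "frechet_derivative (\<lambda>x. frechet_derivative f (at x) u) (at z) v =
    frechet_derivative (\<lambda>x. frechet_derivative f (at x) v) (at z) u"
proof (rule euclidean_eqI)
  fix b :: 'b
  note L = bounded_linear_inner_left[of b]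
  have fd: "frechet_derivative (\<lambda>x. f x \<bullet> b) (at y) w = frechet_derivative f (at y) w \<bullet> b"
    if "y \<in> N" for y w
    by (rule frechet_derivative_linear[OF L]) (rule smooth_on_differentiable[OF f that])
  have "frechet_derivative (\<lambda>x. frechet_derivative f (at x) u) (at z) v \<bullet> b =
    frechet_derivative (\<lambda>x. frechet_derivative (\<lambda>x. f x \<bullet> b) (at x) u) (at z) v" for u v
  proof -
    have "frechet_derivative (\<lambda>x. frechet_derivative f (at x) u) (at z) v \<bullet> b =
        frechet_derivative (\<lambda>x. frechet_derivative f (at x) u \<bullet> b) (at z) v"
      by (rule frechet_derivative_linear[OF L, symmetric])
        (rule smooth_on_differentiable[OF smooth_on_deriv[OF f] N(2)])
    also have "\<dots> = frechet_derivative (\<lambda>x. frechet_derivative (\<lambda>x. f x \<bullet> b) (at x) u) (at z) v"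
      by (rule fun_cong[OF frechet_derivative_cong_open[OF N]])
        (use fd smooth_on_differentiable[OF smooth_on_deriv[OF smooth_on_linear[OF L N(1) f]] N(2)] in auto)
    finally show ?thesis .
  qed
  moreover have "smooth_on (\<lambda>x. f x \<bullet> b) N" by (rule smooth_on_linear[OF L N(1) f])
  ultimately show "frechet_derivative (\<lambda>x. frechet_derivative f (at x) u) (at z) v \<bullet> b =
    frechet_derivative (\<lambda>x. frechet_derivative f (at x) v) (at z) u \<bullet> b"
    using second_derivative_symmetric_real[OF _ N] by metis
qed

section \<open>Holomorphic maps are smooth\<close>

text \<open>Scalar counterpart of \<open>holomorphic_map\<close>. Neither notion assumes a
  continuous derivative, so smoothness has to be earned from Cauchy estimates.\<close>

definition holomorphic_fun :: "(complex^'m \<Rightarrow> complex) \<Rightarrow> (complex^'m) set \<Rightarrow> bool" where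
  "holomorphic_fun f N \<longleftrightarrow>
     (\<forall>z\<in>N. \<exists>f'. (f has_derivative f') (at z) \<and> (\<forall>c v. f' (c *s v) = c * f' v))"

lemma norm_vector_smult: "norm (c *s v) = norm c * norm v" for c :: complex and v :: "complex^'m"
  by (simp add: norm_vec_def L2_set_right_distrib norm_mult)

lemma scaleR_eq_smult: "a *\<^sub>R v = complex_of_real a *s v" for v :: "complex^'m"
  by (simp add: vec_eq_iff) (simp add: scaleR_conv_of_real)

lemma holomorphic_funD:
  assumes "holomorphic_fun f N" "z \<in> N"
  shows "(f has_derivative frechet_derivative f (at z)) (at z)"
    "frechet_derivative f (at z) (c *s v) = c * frechet_derivative f (at z) v"
  using assms unfolding holomorphic_fun_def by (metis frechet_derivative_at)+

lemma holomorphic_fun_subset: "holomorphic_fun f N \<Longrightarrow> N' \<subseteq> N \<Longrightarrow> holomorphic_fun f N'"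
  unfolding holomorphic_fun_def by blast

lemma holomorphic_fun_line:
  assumes "holomorphic_fun f N" "z + t *s v \<in> N"
  shows "((\<lambda>t. f (z + t *s v)) has_field_derivative frechet_derivative f (at (z + t *s v)) v) (at t)"
proof -
  have "bounded_linear (\<lambda>t. t *s v)"
    unfolding linear_conv_bounded_linear[symmetric]
    by (rule linearI) (auto simp: vec_eq_iff algebra_simps)
  then have "((\<lambda>t. z + t *s v) has_derivative (\<lambda>t. t *s v)) (at t)"
    by (auto intro!: derivative_eq_intros bounded_linear_imp_has_derivative)
  from has_derivative_compose[OF this holomorphic_funD(1)[OF assms]]
  show ?thesis unfolding has_field_derivative_def
    using holomorphic_funD(2)[OF assms] by (simp add: mult.commute[of _ "frechet_derivative f (at (z + t *s v)) v"])
qed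

text \<open>Cauchy's inequality in one variable, on the complex line through \<open>z\<close> in
  direction \<open>v\<close>; the disc of radius r / norm v is mapped into the ball.\<close>

lemma holomorphic_fun_Cauchy:
  assumes f: "holomorphic_fun f N" and r: "r > 0" "cball z r \<subseteq> N" and M: "\<And>w. w \<in> cball z r \<Longrightarrow> norm (f w) \<le> M"
  shows "norm (frechet_derivative f (at z) v) \<le> M * norm v / r"
proof (cases "v = 0")
  case True
  have "z \<in> N" using r by auto
  then have "frechet_derivative f (at z) 0 = 0"
    using has_derivative_linear[OF holomorphic_funD(1)[OF f]] linear_0 by blast
  then show ?thesis using True by simp
next
  case False
  define \<rho> where "\<rho> = r / norm v"
  have \<rho>: "\<rho> > 0" using False r by (simp add: \<rho>_def)
  have inb: "z + t *s v \<in> cball z r" if "norm t \<le> \<rho>" for t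
  proof -
    have "norm t * norm v \<le> \<rho> * norm v" using that by (simp add: mult_right_mono)
    also have "\<dots> = r" using False by (simp add: \<rho>_def)
    finally show ?thesis by (simp add: dist_norm norm_vector_smult)
  qed
  define \<phi> where "\<phi> = (\<lambda>t. f (z + t *s v))"
  have D: "(\<phi> has_field_derivative frechet_derivative f (at (z + t *s v)) v) (at t)" if "norm t \<le> \<rho>" for t
    unfolding \<phi>_def by (rule holomorphic_fun_line[OF f]) (use inb[OF that] r in auto)
  have "norm ((deriv ^^ 1) \<phi> 0) \<le> fact 1 * M / \<rho> ^ 1"
  proof (rule Cauchy_inequality[OF _ _ \<rho>])
    show "\<phi> holomorphic_on ball 0 \<rho>"
      by (rule holomorphic_onI, rule field_differentiable_at_within)
        (use D in \<open>force simp: field_differentiable_def\<close>)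
    show "continuous_on (cball 0 \<rho>) \<phi>"
      by (intro continuous_at_imp_continuous_on ballI DERIV_isCont[OF D]) simp
    show "norm (\<phi> x) \<le> M" if "norm (0 - x) = \<rho>" for x
      unfolding \<phi>_def by (rule M, rule inb) (use that in simp)
  qed
  moreover have "deriv \<phi> 0 = frechet_derivative f (at z) v"
    using DERIV_imp_deriv[OF D[of 0]] \<rho> by simp
  ultimately show ?thesis using False r by (simp add: \<rho>_def)
qed

lemma holomorphic_fun_diff:
  assumes "holomorphic_fun f N" "holomorphic_fun g N"
  shows "holomorphic_fun (\<lambda>z. f z - g z) N"
  unfolding holomorphic_fun_def
proof
  fix z assume z: "z \<in> N"
  note f = holomorphic_funD[OF assms(1) z] and g = holomorphic_funD[OF assms(2) z]
  show "\<exists>f'. ((\<lambda>z. f z - g z) has_derivative f') (at z) \<and> (\<forall>c v. f' (c *s v) = c * f' v)"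
    by (rule exI, rule conjI[OF has_derivative_diff[OF f(1) g(1)]]) (simp add: f(2) g(2) algebra_simps)
qed

lemma has_derivative_shift:
  assumes "(f has_derivative f') (at (z + w))"
  shows "((\<lambda>z. f (z + w)) has_derivative f') (at z)"
proof -
  have "((\<lambda>z. z + w) has_derivative (\<lambda>h. h)) (at z)" by (auto intro!: derivative_eq_intros)
  from has_derivative_compose[OF this assms] show ?thesis by simp
qed

lemma holomorphic_fun_shift:
  assumes "holomorphic_fun f N" "\<And>z. z \<in> N' \<Longrightarrow> z + w \<in> N"
  shows "holomorphic_fun (\<lambda>z. f (z + w)) N'"
  using assms has_derivative_shift unfolding holomorphic_fun_def by metis

lemma frechet_derivative_eqI: "(f has_derivative f') (at z) \<Longrightarrow> frechet_derivative f (at z) = f'"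
  by (metis frechet_derivative_at)

text \<open>The difference quotients of \<open>f\<close> in direction \<open>v\<close> converge uniformly to the derivative of
  \<open>f\<close>, at rate \<open>1/n\<close>; by the Cauchy estimate their derivatives then converge uniformly, too.\<close>

lemma holomorphic_fun_deriv_near:
  assumes f: "holomorphic_fun f N" and N: "open N" "z0 \<in> N"
  shows "\<exists>r>0. holomorphic_fun (\<lambda>z. frechet_derivative f (at z) v) (ball z0 r)"
proof -
  let ?D = "\<lambda>z. frechet_derivative f (at z)"
  have "isCont f z0" using has_derivative_continuous[OF holomorphic_funD(1)[OF f N(2)]] by simp
  then obtain R1 where R1: "R1 > 0" "\<And>w. dist w z0 < R1 \<Longrightarrow> dist (f w) (f z0) < 1"
    unfolding continuous_at_eps_delta using zero_less_one by blast
  obtain R2 where R2: "R2 > 0" "ball z0 R2 \<subseteq> N" using N open_contains_ball by blast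
  \<comment> \<open>The factor 6 leaves room for nested balls of radii \<open>r\<close> to
    \<open>6*r\<close>: Cauchy estimates and translations by vectors of length at most
    \<open>r\<close> each give up part of the margin.\<close>
  define r where "r = min R1 R2 / 6"
  define M where "M = norm (f z0) + 1"
  have r: "r > 0" and M0: "M \<ge> 0" using R1 R2 by (auto simp: r_def M_def)
  have B: "ball z0 (6*r) \<subseteq> N" using R2 by (auto simp: r_def)
  have fB: "holomorphic_fun f (ball z0 (6*r))" using holomorphic_fun_subset[OF f B] .
  have M: "norm (f w) \<le> M" if "w \<in> ball z0 (6*r)" for w
  proof -
    have "dist (f w) (f z0) < 1" using that by (intro R1(2)) (auto simp: r_def dist_commute)
    then show ?thesis unfolding M_def dist_norm using norm_triangle_ineq2[of "f w" "f z0"] by simp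
  qed
  have D1: "norm (?D z h) \<le> M * norm h / r" if "z \<in> ball z0 (4*r)" for z h
  proof (rule holomorphic_fun_Cauchy[OF fB r])
    show "cball z r \<subseteq> ball z0 (6*r)"
    proof
      fix y assume "y \<in> cball z r" then show "y \<in> ball z0 (6*r)"
        using that r dist_triangle[of z0 y z] by auto
    qed
    then show "norm (f w) \<le> M" if "w \<in> cball z r" for w using M that by blast
  qed
  have L1: "norm (f (z + w) - f z) \<le> M / r * norm w" if z: "z \<in> ball z0 (3*r)" and w: "norm w \<le> r" for z w
  proof -
    have "norm (f (z + w) - f z) \<le> M / r * norm (z + w - z)"
    proof (rule differentiable_bound[OF convex_ball[of z0 "4*r"]])
      fix x assume x: "x \<in> ball z0 (4*r)"
      then have "x \<in> ball z0 (6*r)" using r by auto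
      from has_derivative_at_withinI[OF holomorphic_funD(1)[OF fB this]]
      show "(f has_derivative ?D x) (at x within ball z0 (4*r))" .
      show "onorm (?D x) \<le> M / r"
        by (rule onorm_bound) (use M0 r D1[OF x] in \<open>auto simp: mult.commute\<close>)
    next
      show "z + w \<in> ball z0 (4*r)" using z w dist_triangle[of z0 "z+w" z] by (simp add: dist_norm)
      show "z \<in> ball z0 (4*r)" using z r by auto
    qed
    then show ?thesis by simp
  qed
  have sub: "cball z (r/2) \<subseteq> ball z0 ((a+1)*r)" if "z \<in> ball z0 (a*r)" for z a
  proof
    fix y assume "y \<in> cball z (r/2)" then show "y \<in> ball z0 ((a+1)*r)"
      using that r dist_triangle[of z0 y z] by (auto simp: algebra_simps)
  qed
  \<comment> \<open>The Cauchy estimate for \<open>f (z + w) - f z\<close>, which is small by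
    \<open>L1\<close>, makes the derivative itself Lipschitz.\<close>
  have D2: "norm (?D (z + w) h - ?D z h) \<le> M / r * norm w * norm h / (r/2)"
    if z: "z \<in> ball z0 (2*r)" and w: "norm w \<le> r" for z w h
  proof -
    have in6: "y + w \<in> ball z0 (6*r)" if "y \<in> ball z0 (3*r)" for y
      using that w r dist_triangle[of z0 "y+w" y] by (simp add: dist_norm)
    have hol: "holomorphic_fun (\<lambda>z. f (z + w) - f z) (ball z0 (3*r))"
      by (rule holomorphic_fun_diff, rule holomorphic_fun_shift[OF fB in6], simp)
        (rule holomorphic_fun_subset[OF fB], use r in auto)
    have "norm (frechet_derivative (\<lambda>z. f (z + w) - f z) (at z) h) \<le> M / r * norm w * norm h / (r/2)"
      by (rule holomorphic_fun_Cauchy[OF hol]) (use r sub[of z 2] z L1 w in auto)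
    moreover have "frechet_derivative (\<lambda>z. f (z + w) - f z) (at z) = (\<lambda>h. ?D (z + w) h - ?D z h)"
      by (intro frechet_derivative_eqI has_derivative_diff has_derivative_shift holomorphic_funD(1)[OF fB] in6)
        (use z r in auto)
    ultimately show ?thesis by simp
  qed
  \<comment> \<open>Starting the sequence of steps at \<open>n0\<close> guarantees that
    \<open>s n *\<^sub>R v\<close> has length at most \<open>r\<close> for every
    \<open>n\<close>.\<close>
  obtain n0 :: nat where n0: "norm v / r < n0" "n0 > 0"
    by (metis gr0I less_numeral_extra(3) of_nat_0 order_less_trans reals_Archimedean2 linorder_not_less of_nat_0_less_iff r norm_ge_zero divide_nonneg_pos)
  define s where "s = (\<lambda>n::nat. 1 / real (n + n0))"
  have s: "s n > 0" for n using n0 by (simp add: s_def)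
  have sv: "t * norm v \<le> r" if "t \<le> s n" for t n
  proof -
    have "norm v \<le> r * real (n + n0)" using n0 r by (simp add: field_simps) (smt (verit) mult_nonneg_nonneg of_nat_0_le_iff)
    then have "s n * norm v \<le> r" using n0 by (simp add: s_def field_simps)
    moreover have "t * norm v \<le> s n * norm v" using that by (simp add: mult_right_mono)
    ultimately show ?thesis by linarith
  qed
  have slim: "s \<longlonglongrightarrow> 0"
    unfolding s_def using LIMSEQ_ignore_initial_segment[OF lim_1_over_n, of n0] by simp
  define q where "q = (\<lambda>n z. (f (z + s n *\<^sub>R v) - f z) /\<^sub>R s n)"
  define C where "C = M / r * norm v * norm v / (r/2)"
  have C0: "C \<ge> 0" using M0 r by (simp add: C_def)
  have qlim: "norm (q n z - ?D z v) \<le> C * s n" if z: "z \<in> ball z0 (2*r)" for n z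
  proof -
    \<comment> \<open>\<open>k (s n) - k 0\<close> is \<open>s n\<close> times the error of the
      difference quotient, and the derivative of \<open>k\<close> at \<open>t\<close> is bounded by
      \<open>C * t\<close> because of \<open>D2\<close>.\<close>
    define k where "k = (\<lambda>t. f (z + t *\<^sub>R v) - t *\<^sub>R ?D z v)"
    have "norm (k (s n) - k 0) \<le> (C * s n) * norm (s n - 0)"
    proof (rule differentiable_bound[OF convex_real_interval(5)[of 0 "s n"]])
      fix t assume t: "t \<in> {0..s n}"
      have tv: "norm (t *\<^sub>R v) \<le> r" using sv[of t n] t by simp
      have "z + t *\<^sub>R v \<in> ball z0 (6*r)"
        using z tv r dist_triangle[of z0 "z + t *\<^sub>R v" z] by (simp add: dist_norm)
      note h = holomorphic_funD(1)[OF fB this]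
      have "((\<lambda>t. z + t *\<^sub>R v) has_derivative (\<lambda>x. x *\<^sub>R v)) (at t within {0..s n})"
        by (auto intro!: derivative_eq_intros)
      from has_derivative_compose[OF this h]
      have "((\<lambda>t. f (z + t *\<^sub>R v)) has_derivative (\<lambda>x. x *\<^sub>R ?D (z + t *\<^sub>R v) v)) (at t within {0..s n})"
        using linear_cmul[OF has_derivative_linear[OF h]] by simp
      then show "(k has_derivative (\<lambda>x. x *\<^sub>R ?D (z + t *\<^sub>R v) v - x *\<^sub>R ?D z v)) (at t within {0..s n})"
        unfolding k_def by (auto intro!: derivative_eq_intros)
      show "onorm (\<lambda>x. x *\<^sub>R ?D (z + t *\<^sub>R v) v - x *\<^sub>R ?D z v) \<le> C * s n"
      proof (rule onorm_bound)
        fix x :: real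
        have "norm (?D (z + t *\<^sub>R v) v - ?D z v) \<le> M / r * norm (t *\<^sub>R v) * norm v / (r/2)"
          by (rule D2[OF z tv])
        also have "\<dots> = C * t" using t by (simp add: C_def)
        also have "\<dots> \<le> C * s n" using t C0 by (simp add: mult_left_mono)
        finally have "\<bar>x\<bar> * norm (?D (z + t *\<^sub>R v) v - ?D z v) \<le> \<bar>x\<bar> * (C * s n)" by (simp add: mult_left_mono)
        then show "norm (x *\<^sub>R ?D (z + t *\<^sub>R v) v - x *\<^sub>R ?D z v) \<le> C * s n * norm x"
          by (simp flip: scaleR_diff_right add: mult.commute mult.left_commute)
      qed (use C0 s[of n] in auto)
    qed (use s[of n] in auto)
    then have "norm (f (z + s n *\<^sub>R v) - s n *\<^sub>R ?D z v - f z) \<le> C * s n * s n"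
      using s[of n] by (simp add: k_def)
    moreover have "f (z + s n *\<^sub>R v) - s n *\<^sub>R ?D z v - f z = s n *\<^sub>R (q n z - ?D z v)"
      using s[of n] by (simp add: q_def algebra_simps)
    ultimately have "s n * norm (q n z - ?D z v) \<le> s n * (C * s n)" using s[of n] by (simp add: mult.commute mult.left_commute)
    then show ?thesis using s[of n] by simp
  qed
  have in6: "y + s n *\<^sub>R v \<in> ball z0 (6*r)" if "y \<in> ball z0 (2*r)" for y n
    using that sv[of "s n" n] s[of n] r dist_triangle[of z0 "y + s n *\<^sub>R v" y] by (simp add: dist_norm)
  have in6': "y \<in> ball z0 (6*r)" if "y \<in> ball z0 (2*r)" for y using that r by auto
  define q' where "q' = (\<lambda>n z h. (?D (z + s n *\<^sub>R v) h - ?D z h) /\<^sub>R s n)"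
  have qd: "(q n has_derivative q' n z) (at z)" if "z \<in> ball z0 (2*r)" for n z
    unfolding q_def q'_def
    by (intro has_derivative_scaleR_right has_derivative_diff has_derivative_shift
        holomorphic_funD(1)[OF fB] in6 in6' that)
  have q'c: "q' n z (c *s h) = c * q' n z h" if "z \<in> ball z0 (2*r)" for n z c h
    unfolding q'_def holomorphic_funD(2)[OF fB in6[OF that]] holomorphic_funD(2)[OF fB in6'[OF that]]
    by (simp add: algebra_simps)
  have qh: "holomorphic_fun (q n) (ball z0 (2*r))" for n
    unfolding holomorphic_fun_def using qd q'c by blast
  \<comment> \<open>\<open>q n - q k\<close> is holomorphic and of size at most
    \<open>C * (s n + s k)\<close> by \<open>qlim\<close>, so the Cauchy estimate bounds the
    difference of the derivatives as well.\<close>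
  have cauchy: "norm (q' n z h - q' k z h) \<le> C * (s n + s k) * norm h / (r/2)"
    if z: "z \<in> ball z0 r" for n k z h
  proof -
    have z2: "z \<in> ball z0 (2*r)" using z r by auto
    have "frechet_derivative (\<lambda>z. q n z - q k z) (at z) = (\<lambda>h. q' n z h - q' k z h)"
      by (intro frechet_derivative_eqI has_derivative_diff qd z2)
    moreover have "norm (frechet_derivative (\<lambda>z. q n z - q k z) (at z) h) \<le> C * (s n + s k) * norm h / (r/2)"
    proof (rule holomorphic_fun_Cauchy[OF holomorphic_fun_diff[OF qh qh]])
      show sub2: "cball z (r/2) \<subseteq> ball z0 (2*r)" using sub[of z 1] z by simp
      fix w assume "w \<in> cball z (r/2)"
      then have w: "w \<in> ball z0 (2*r)" using sub2 by blast
      have "norm (q n w - q k w) \<le> norm (q n w - ?D w v) + norm (q k w - ?D w v)"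
        by (metis norm_minus_commute norm_diff_triangle_ineq diff_add_cancel add.commute dist_norm dist_triangle2)
      then show "norm (q n w - q k w) \<le> C * (s n + s k)"
        using qlim[OF w, of n] qlim[OF w, of k] by (simp add: algebra_simps)
    qed (use r in auto)
    ultimately show ?thesis by simp
  qed
  define g' where "g' = (\<lambda>z h. lim (\<lambda>n. q' n z h))"
  have conv: "(\<lambda>n. q' n z h) \<longlonglongrightarrow> g' z h" if z: "z \<in> ball z0 r" for z h
    unfolding g'_def convergent_LIMSEQ_iff[symmetric]
  proof (rule Cauchy_convergent, rule metric_CauchyI)
    fix e :: real assume e: "e > 0"
    define K where "K = C * norm h / (r/2)"
    have K0: "K \<ge> 0" using C0 r by (simp add: K_def)
    have "(\<lambda>n. K * s n) \<longlonglongrightarrow> K * 0" by (intro tendsto_intros slim)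
    then have "\<forall>\<^sub>F n in sequentially. K * s n < e/2" using e by (intro order_tendstoD(2)) auto
    then obtain n1 where n1: "\<And>n. n \<ge> n1 \<Longrightarrow> K * s n < e/2" unfolding eventually_sequentially by blast
    have "dist (q' n z h) (q' k z h) < e" if "n \<ge> n1" "k \<ge> n1" for n k
    proof -
      have "C * (s n + s k) * norm h / (r/2) = K * s n + K * s k"
        using r by (simp add: K_def field_simps)
      then have "dist (q' n z h) (q' k z h) \<le> K * s n + K * s k"
        using cauchy[OF z, of n h k] by (simp add: dist_norm)
      then show ?thesis using n1[OF that(1)] n1[OF that(2)] by linarith
    qed
    then show "\<exists>M. \<forall>m\<ge>M. \<forall>n\<ge>M. dist (q' m z h) (q' n z h) < e" by blast
  qed
  have rate: "norm (q' n z h - g' z h) \<le> C * s n * norm h / (r/2)" if z: "z \<in> ball z0 r" for n z h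
  proof (rule LIMSEQ_le)
    show "(\<lambda>k. norm (q' n z h - q' k z h)) \<longlonglongrightarrow> norm (q' n z h - g' z h)"
      by (intro tendsto_intros conv z)
    have "(\<lambda>k. C * (s n + s k) * norm h / (r/2)) \<longlonglongrightarrow> C * (s n + 0) * norm h / (r/2)"
      using r by (intro tendsto_intros slim) auto
    then show "(\<lambda>k. C * (s n + s k) * norm h / (r/2)) \<longlonglongrightarrow> C * s n * norm h / (r/2)" by simp
  qed (use cauchy[OF z] in auto)
  have "\<exists>g. \<forall>x\<in>ball z0 r. (\<lambda>n. q n x) \<longlonglongrightarrow> g x \<and> (g has_derivative g' x) (at x within ball z0 r)"
  proof (rule has_derivative_sequence[where f' = q' and ?x0.0 = z0 and l = "?D z0 v", OF convex_ball])
    show "(q n has_derivative q' n x) (at x within ball z0 r)" if "x \<in> ball z0 r" for n x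
      by (rule has_derivative_at_withinI[OF qd]) (use that r in auto)
    show "\<forall>\<^sub>F n in sequentially. \<forall>x\<in>ball z0 r. \<forall>h. norm (q' n x h - g' x h) \<le> e * norm h" if "e > 0" for e
    proof -
      have "(\<lambda>n. C * s n / (r/2)) \<longlonglongrightarrow> C * 0 / (r/2)" using r by (intro tendsto_intros slim) auto
      then have "\<forall>\<^sub>F n in sequentially. C * s n / (r/2) < e" using that by (intro order_tendstoD(2)) auto
      then show ?thesis
      proof eventually_elim
        case (elim n)
        show ?case
        proof (intro ballI allI)
          fix x h assume "x \<in> ball z0 r"
          then have "norm (q' n x h - g' x h) \<le> C * s n / (r/2) * norm h" using rate[of x n h] by (simp only: times_divide_eq_left)
          also have "\<dots> \<le> e * norm h" using elim by (intro mult_right_mono) auto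
          finally show "norm (q' n x h - g' x h) \<le> e * norm h" .
        qed
      qed
    qed
    show "z0 \<in> ball z0 r" using r by simp
    have z0: "z0 \<in> ball z0 (2*r)" using r by simp
    show "(\<lambda>n. q n z0) \<longlonglongrightarrow> ?D z0 v"
    proof (rule LIM_zero_cancel, rule Lim_null_comparison)
      show "(\<lambda>n. C * s n) \<longlonglongrightarrow> 0" using tendsto_mult[OF tendsto_const slim, of C] by simp
    qed (use qlim[OF z0] in auto)
  qed
  then obtain g where g: "\<And>x. x \<in> ball z0 r \<Longrightarrow> (\<lambda>n. q n x) \<longlonglongrightarrow> g x"
    "\<And>x. x \<in> ball z0 r \<Longrightarrow> (g has_derivative g' x) (at x within ball z0 r)" by blast
  have geq: "g x = ?D x v" if x: "x \<in> ball z0 r" for x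
  proof (rule LIMSEQ_unique[OF g(1)[OF x]])
    have x2: "x \<in> ball z0 (2*r)" using x r by auto
    show "(\<lambda>n. q n x) \<longlonglongrightarrow> ?D x v"
    proof (rule LIM_zero_cancel, rule Lim_null_comparison)
      show "(\<lambda>n. C * s n) \<longlonglongrightarrow> 0" using tendsto_mult[OF tendsto_const slim, of C] by simp
    qed (use qlim[OF x2] in auto)
  qed
  have "holomorphic_fun (\<lambda>z. ?D z v) (ball z0 r)"
    unfolding holomorphic_fun_def
  proof (intro ballI exI conjI allI)
    fix x assume x: "x \<in> ball z0 r"
    have "(g has_derivative g' x) (at x)" using g(2)[OF x] unfolding at_within_open[OF x open_ball] .
    then show "((\<lambda>z. ?D z v) has_derivative g' x) (at x)"
      by (rule has_derivative_transform_within_open[OF _ open_ball x]) (rule geq)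
    fix c h
    have x2: "x \<in> ball z0 (2*r)" using x r by auto
    have "(\<lambda>n. c * q' n x h) \<longlonglongrightarrow> c * g' x h" by (intro tendsto_intros conv x)
    then show "g' x (c *s h) = c * g' x h"
      using conv[OF x, of "c *s h"] unfolding q'c[OF x2] using LIMSEQ_unique by blast
  qed
  then show ?thesis using r by blast
qed

lemma holomorphic_fun_deriv:
  assumes "holomorphic_fun f N" "open N"
  shows "holomorphic_fun (\<lambda>z. frechet_derivative f (at z) v) N"
  unfolding holomorphic_fun_def
proof
  fix z assume "z \<in> N"
  from holomorphic_fun_deriv_near[OF assms this, of v] obtain r where
    "r > 0" "holomorphic_fun (\<lambda>z. frechet_derivative f (at z) v) (ball z r)" by blast
  then show "\<exists>f'. ((\<lambda>z. frechet_derivative f (at z) v) has_derivative f') (at z) \<and> (\<forall>c v. f' (c *s v) = c * f' v)"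
    unfolding holomorphic_fun_def by (metis centre_in_ball)
qed

lemma holomorphic_fun_smooth:
  assumes "holomorphic_fun f N" "open N"
  shows "smooth_on f N"
proof -
  have "Ck_on k f N" for k
    using assms(1)
  proof (induction k arbitrary: f)
    case 0
    have "continuous_on N f"
      by (rule continuous_at_imp_continuous_on)
        (use has_derivative_continuous[OF holomorphic_funD(1)[OF 0]] in auto)
    then show ?case by simp
  next
    case (Suc k)
    show ?case
      by (rule Ck_on_SucI[OF assms(2) holomorphic_funD(1)[OF Suc.prems]])
        (auto intro: Suc.IH holomorphic_fun_deriv[OF Suc.prems assms(2)])
  qed
  then show ?thesis by (simp add: smooth_on_def)
qed

lemma holomorphic_mapD:
  assumes "holomorphic_map f N" "z \<in> N"
  shows "(f has_derivative frechet_derivative f (at z)) (at z)"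
    "frechet_derivative f (at z) (c *s v) = c *s frechet_derivative f (at z) v"
  using assms unfolding holomorphic_map_def by (metis frechet_derivative_at)+

lemma holomorphic_map_nth:
  assumes "holomorphic_map f N"
  shows "holomorphic_fun (\<lambda>z. f z $ i) N"
  unfolding holomorphic_fun_def
proof (intro ballI exI conjI allI)
  fix z assume z: "z \<in> N"
  show "((\<lambda>z. f z $ i) has_derivative (\<lambda>v. frechet_derivative f (at z) v $ i)) (at z)"
    by (rule bounded_linear.has_derivative[OF bounded_linear_vec_nth holomorphic_mapD(1)[OF assms z]])
qed (simp add: holomorphic_mapD(2)[OF assms])

lemma holomorphic_map_smooth:
  "holomorphic_map f N \<Longrightarrow> open N \<Longrightarrow> smooth_on f N"
  by (intro smooth_on_vec holomorphic_fun_smooth holomorphic_map_nth)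

section \<open>Wirtinger calculus for matrix-valued functions\<close>

lemma bounded_bilinear_matrix_mult:
  "bounded_bilinear ((**) :: complex^'n^'m \<Rightarrow> complex^'k^'n \<Rightarrow> complex^'k^'m)"
  unfolding bilinear_conv_bounded_bilinear[symmetric] bilinear_def linear_iff
  by (auto simp: matrix_matrix_mult_def vec_eq_iff sum.distrib algebra_simps scaleR_right.sum)

lemmas mm_add_left = bounded_bilinear.add_left[OF bounded_bilinear_matrix_mult]
  and mm_add_right = bounded_bilinear.add_right[OF bounded_bilinear_matrix_mult]
  and mm_diff_left = bounded_bilinear.diff_left[OF bounded_bilinear_matrix_mult]
  and mm_diff_right = bounded_bilinear.diff_right[OF bounded_bilinear_matrix_mult]
  and mm_minus_left = bounded_bilinear.minus_left[OF bounded_bilinear_matrix_mult]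
  and mm_minus_right = bounded_bilinear.minus_right[OF bounded_bilinear_matrix_mult]
  and mm_scaleR_left = bounded_bilinear.scaleR_left[OF bounded_bilinear_matrix_mult]
  and mm_scaleR_right = bounded_bilinear.scaleR_right[OF bounded_bilinear_matrix_mult]
  and mm_sum_left = bounded_bilinear.sum_left[OF bounded_bilinear_matrix_mult]
  and mm_sum_right = bounded_bilinear.sum_right[OF bounded_bilinear_matrix_mult]
  and mm_zero_left = bounded_bilinear.zero_left[OF bounded_bilinear_matrix_mult]
  and mm_zero_right = bounded_bilinear.zero_right[OF bounded_bilinear_matrix_mult]

lemmas mm_simps = mm_add_left mm_add_right mm_diff_left mm_diff_right mm_minus_left mm_minus_right
  mm_scaleR_left mm_scaleR_right mm_zero_left mm_zero_right matrix_mul_lid matrix_mul_rid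
  matrix_mul_assoc

lemma matrix_mul_assoc': "(A ** B) ** C = A ** (B ** C)" for A B C :: "complex^'n^'n"
  by (simp add: matrix_mul_assoc)

text \<open>Complex scalars act on matrices through the central matrices \<open>mat c\<close>, so
  that every identity below stays inside the matrix algebra.\<close>

lemma mat_mult_entry: "(mat c ** A) $ i $ j = c * A $ i $ j" for A :: "complex^'n^'n"
  by (simp add: matrix_matrix_mult_def mat_def if_distrib[of "\<lambda>x. x * _"] cong: if_cong)

lemma mult_mat_entry: "(A ** mat c) $ i $ j = A $ i $ j * c" for A :: "complex^'n^'n"
  by (simp add: matrix_matrix_mult_def mat_def if_distrib[of "\<lambda>x. _ * x"] cong: if_cong)

lemma mat_central: "A ** mat c = mat c ** A" for A :: "complex^'n^'n"
  by (simp add: vec_eq_iff mat_mult_entry mult_mat_entry)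

lemma mat_left_commute: "A ** (mat c ** B) = mat c ** (A ** B)" for A :: "complex^'n^'n"
  by (metis mat_central matrix_mul_assoc)

lemma mat_mult_mat: "mat c ** (mat d ** A) = mat (c * d) ** A" for A :: "complex^'n^'n"
  by (simp add: vec_eq_iff mat_mult_entry)

lemma mat_mult_vec: "mat c *v x = c *s x" for x :: "complex^'n"
  by (simp add: vec_eq_iff matrix_vector_mult_def mat_def if_distrib[of "\<lambda>x. x * _"] cong: if_cong)

lemma scaleR_matrix: "a *\<^sub>R A = mat (complex_of_real a) ** A" for A :: "complex^'n^'n"
  by (simp add: vec_eq_iff mat_mult_entry) (simp add: scaleR_conv_of_real)

definition cnj_mat :: "complex^'n^'m \<Rightarrow> complex^'n^'m" where
  "cnj_mat A = (\<chi> i j. cnj (A $ i $ j))"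

lemma bounded_linear_cnj_mat: "bounded_linear (cnj_mat :: complex^'n^'m \<Rightarrow> _)"
  unfolding linear_conv_bounded_linear[symmetric]
  by (rule linearI) (auto simp: cnj_mat_def vec_eq_iff)

lemma cnj_mat_mult: "cnj_mat (A ** B) = cnj_mat A ** cnj_mat B"
  by (simp add: cnj_mat_def matrix_matrix_mult_def)

lemma cnj_mat_mat [simp]: "cnj_mat (mat c) = mat (cnj c)"
  by (auto simp: cnj_mat_def mat_def vec_eq_iff)

lemma cnj_mat_cnj_mat [simp]: "cnj_mat (cnj_mat A) = A"
  by (simp add: cnj_mat_def)

lemma cnj_mat_linear [simp]:
  "cnj_mat (A + B) = cnj_mat A + cnj_mat B" "cnj_mat (A - B) = cnj_mat A - cnj_mat B"
  "cnj_mat (- A) = - cnj_mat A" "cnj_mat (r *\<^sub>R A) = r *\<^sub>R cnj_mat A" "cnj_mat 0 = 0"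
  by (simp_all add: cnj_mat_def vec_eq_iff)

lemma cnj_mat_transpose: "cnj_mat (transpose A) = transpose (cnj_mat A)"
  by (simp add: cnj_mat_def transpose_def)

lemma trace_cnj_mat: "trace (cnj_mat A) = cnj (trace A)"
  by (simp add: trace_def cnj_mat_def)

lemma bounded_linear_trace: "bounded_linear (trace :: complex^'n^'n \<Rightarrow> complex)"
  unfolding linear_conv_bounded_linear[symmetric]
  by (rule linearI) (auto simp: trace_def sum.distrib scaleR_right.sum)

lemma trace_linear [simp]:
  fixes A B :: "complex^'n^'n"
  shows "trace (A + B) = trace A + trace B" "trace (A - B) = trace A - trace B"
    "trace (- A) = - trace A" "trace (0 :: complex^'n^'n) = 0"
  by (simp_all add: trace_def sum.distrib sum_subtractf sum_negf)

lemma trace_scaleR: "trace (r *\<^sub>R A) = r *\<^sub>R trace A" for A :: "complex^'n^'n"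
  by (simp add: trace_def scaleR_right.sum)

lemma trace_mat_mult: "trace (mat c ** A) = c * trace A" for A :: "complex^'n^'n"
  by (simp add: trace_def mat_mult_entry sum_distrib_left)

lemma trace_mult_commute: "trace (A ** B) = trace (B ** A)" for A B :: "complex^'n^'n"
  by (rule trace_mul_sym)

lemma trace_transpose': "trace (transpose A) = trace A" for A :: "complex^'n^'n"
  by (simp add: trace_def transpose_def)

lemma transpose_linear [simp]:
  fixes A B :: "complex^'n^'m"
  shows "transpose (A + B) = transpose A + transpose B" "transpose (A - B) = transpose A - transpose B"
    "transpose (- A) = - transpose A" "transpose (0 :: complex^'n^'m) = 0"
    "transpose (r *\<^sub>R A) = r *\<^sub>R transpose A"
  by (simp_all add: transpose_def vec_eq_iff)

lemma transpose_mult: "transpose (A ** B) = transpose B ** transpose A"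
  for A :: "complex^'n^'m" and B :: "complex^'k^'n"
  by (rule matrix_transpose_mul)

lemma bounded_linear_transpose: "bounded_linear (transpose :: complex^'n^'m \<Rightarrow> _)"
  unfolding linear_conv_bounded_linear[symmetric] by (rule linearI) auto

section \<open>Wirtinger derivatives\<close>

type_synonym ('m, 'n) mfun = "complex^'m \<Rightarrow> complex^'n^'n"

text \<open>The tangent vector \<open>X\<close> is a real one: \<open>dz\<close> is the derivative
  along its (1,0) part and is complex linear in \<open>X\<close>, \<open>dzb\<close> the one along
  its (0,1) part.\<close>

definition dz :: "('m::finite, 'n::finite) mfun \<Rightarrow> complex^'m \<Rightarrow> complex^'m \<Rightarrow> complex^'n^'n" where
  "dz F z X = (1/2) *\<^sub>R (frechet_derivative F (at z) X - mat \<i> ** frechet_derivative F (at z) (\<i> *s X))"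

definition dzb :: "('m::finite, 'n::finite) mfun \<Rightarrow> complex^'m \<Rightarrow> complex^'m \<Rightarrow> complex^'n^'n" where
  "dzb F z X = (1/2) *\<^sub>R (frechet_derivative F (at z) X + mat \<i> ** frechet_derivative F (at z) (\<i> *s X))"

definition dzs :: "(complex^'m::finite \<Rightarrow> complex) \<Rightarrow> complex^'m \<Rightarrow> complex^'m \<Rightarrow> complex" where
  "dzs f z X = (frechet_derivative f (at z) X - \<i> * frechet_derivative f (at z) (\<i> *s X)) / 2"

lemma frechet_derivative_works': "F differentiable at z \<Longrightarrow> (F has_derivative frechet_derivative F (at z)) (at z)"
  by (simp add: frechet_derivative_works)

lemma frechet_derivative_props:
  assumes "F differentiable at z"
  shows "frechet_derivative F (at z) (X + Y) = frechet_derivative F (at z) X + frechet_derivative F (at z) Y"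
    "frechet_derivative F (at z) (X - Y) = frechet_derivative F (at z) X - frechet_derivative F (at z) Y"
    "frechet_derivative F (at z) (- X) = - frechet_derivative F (at z) X"
    "frechet_derivative F (at z) (r *\<^sub>R X) = r *\<^sub>R frechet_derivative F (at z) X"
    "frechet_derivative F (at z) 0 = 0"
  using linear_frechet_derivative[OF assms]
  by (auto simp: linear_add linear_diff linear_neg linear_cmul linear_0)

lemma frechet_derivative_mm:
  fixes F G :: "('m::finite, 'n::finite) mfun"
  assumes "F differentiable at z" "G differentiable at z"
  shows "frechet_derivative (\<lambda>z. F z ** G z) (at z) X =
      F z ** frechet_derivative G (at z) X + frechet_derivative F (at z) X ** G z"
    "(\<lambda>z. F z ** G z) differentiable at z"
proof -
  note * = bounded_bilinear.FDERIV[OF bounded_bilinear_matrix_mult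
      frechet_derivative_works'[OF assms(1)] frechet_derivative_works'[OF assms(2)]]
  show "frechet_derivative (\<lambda>z. F z ** G z) (at z) X =
      F z ** frechet_derivative G (at z) X + frechet_derivative F (at z) X ** G z"
    using frechet_derivative_eqI[OF *] by simp
  show "(\<lambda>z. F z ** G z) differentiable at z" using * differentiable_def by blast
qed

lemma frechet_derivative_add':
  assumes "F differentiable at z" "G differentiable at z"
  shows "frechet_derivative (\<lambda>z. F z + G z) (at z) X = frechet_derivative F (at z) X + frechet_derivative G (at z) X"
  using frechet_derivative_eqI[OF has_derivative_add[OF assms[THEN frechet_derivative_works']]] by simp

lemma frechet_derivative_diff':
  assumes "F differentiable at z" "G differentiable at z"
  shows "frechet_derivative (\<lambda>z. F z - G z) (at z) X = frechet_derivative F (at z) X - frechet_derivative G (at z) X"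
  using frechet_derivative_eqI[OF has_derivative_diff[OF assms[THEN frechet_derivative_works']]] by simp

lemma differentiable_linear: "bounded_linear L \<Longrightarrow> F differentiable at z \<Longrightarrow> (\<lambda>z. L (F z)) differentiable at z"
  using bounded_linear.has_derivative differentiable_def by metis

lemma dz_mult:
  assumes "F differentiable at z" "G differentiable at z"
  shows "dz (\<lambda>z. F z ** G z) z X = dz F z X ** G z + F z ** dz G z X"
  unfolding dz_def frechet_derivative_mm[OF assms] by (simp add: mm_simps algebra_simps mat_central)

lemma dzb_mult:
  assumes "F differentiable at z" "G differentiable at z"
  shows "dzb (\<lambda>z. F z ** G z) z X = dzb F z X ** G z + F z ** dzb G z X"
  unfolding dzb_def frechet_derivative_mm[OF assms] by (simp add: mm_simps algebra_simps mat_central)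

lemma dz_add:
  assumes "F differentiable at z" "G differentiable at z"
  shows "dz (\<lambda>z. F z + G z) z X = dz F z X + dz G z X" "dzb (\<lambda>z. F z + G z) z X = dzb F z X + dzb G z X"
  unfolding dz_def dzb_def frechet_derivative_add'[OF assms] by (simp_all add: mm_simps algebra_simps)

lemma dz_diff:
  assumes "F differentiable at z" "G differentiable at z"
  shows "dz (\<lambda>z. F z - G z) z X = dz F z X - dz G z X" "dzb (\<lambda>z. F z - G z) z X = dzb F z X - dzb G z X"
  unfolding dz_def dzb_def frechet_derivative_diff'[OF assms] by (simp_all add: mm_simps algebra_simps)

lemma dz_const: "dz (\<lambda>z. A) z X = 0" "dzb (\<lambda>z. A) z X = 0"
  unfolding dz_def dzb_def by (simp_all add: mm_simps)

lemma differentiable_sum':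
  "(\<And>i. i \<in> I \<Longrightarrow> F i differentiable at z) \<Longrightarrow> (\<lambda>z. \<Sum>i\<in>I. F i z) differentiable at z"
  by (induction I rule: infinite_finite_induct) (auto intro: differentiable_add)

lemma dz_sum:
  "(\<And>i. i \<in> I \<Longrightarrow> F i differentiable at z) \<Longrightarrow> dz (\<lambda>z. \<Sum>i\<in>I. F i z) z X = (\<Sum>i\<in>I. dz (F i) z X)"
  "(\<And>i. i \<in> I \<Longrightarrow> F i differentiable at z) \<Longrightarrow> dzb (\<lambda>z. \<Sum>i\<in>I. F i z) z X = (\<Sum>i\<in>I. dzb (F i) z X)"
  by (induction I rule: infinite_finite_induct) (auto simp: dz_const dz_add differentiable_sum')

text \<open>Meant for real scalars, transposition and two-sided multiplication by constants.
  Conjugation of matrices does not commute with \<open>mat \<i>\<close>; it exchanges the two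
  operators.\<close>

lemma dz_linear:
  fixes F :: "('m::finite, 'n::finite) mfun" and L :: "complex^'n^'n \<Rightarrow> complex^'n^'n"
  assumes L: "bounded_linear L" "\<And>A. L (mat \<i> ** A) = mat \<i> ** L A" and F: "F differentiable at z"
  shows "dz (\<lambda>z. L (F z)) z X = L (dz F z X)" "dzb (\<lambda>z. L (F z)) z X = L (dzb F z X)"
  unfolding dz_def dzb_def frechet_derivative_linear[OF L(1) F]
  by (simp_all add: L linear_simps[OF L(1)])

lemma dz_cnj:
  assumes F: "F differentiable at z"
  shows "dz (\<lambda>z. cnj_mat (F z)) z X = cnj_mat (dzb F z X)" "dzb (\<lambda>z. cnj_mat (F z)) z X = cnj_mat (dz F z X)"
proof -
  have *: "mat (- \<i>) ** A = - (mat \<i> ** A)" for A :: "complex^'n^'n"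
    by (simp add: vec_eq_iff mat_mult_entry)
  show "dz (\<lambda>z. cnj_mat (F z)) z X = cnj_mat (dzb F z X)" "dzb (\<lambda>z. cnj_mat (F z)) z X = cnj_mat (dz F z X)"
    unfolding dz_def dzb_def frechet_derivative_linear[OF bounded_linear_cnj_mat F]
    by (simp_all add: cnj_mat_mult *)
qed

lemma dzs_trace:
  fixes F :: "('m::finite, 'n::finite) mfun"
  assumes F: "F differentiable at z"
  shows "dzs (\<lambda>z. trace (F z)) z X = trace (dz F z X)"
  unfolding dzs_def dz_def frechet_derivative_linear[OF bounded_linear_trace F]
  unfolding trace_scaleR by (simp add: trace_mat_mult scaleR_conv_of_real)

lemma dz_cong:
  assumes "open N" "z \<in> N" "\<And>y. y \<in> N \<Longrightarrow> F y = G y" "F differentiable at z"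
  shows "dz G z X = dz F z X" "dzb G z X = dzb F z X"
proof -
  have "frechet_derivative G (at z) = frechet_derivative F (at z)"
    using frechet_derivative_cong_open[OF assms(1,2) _ assms(4), of G] assms(3) by blast
  then show "dz G z X = dz F z X" "dzb G z X = dzb F z X" unfolding dz_def dzb_def by simp_all
qed

lemma smooth_on_mm:
  fixes F G :: "('m::finite, 'n::finite) mfun"
  shows "open N \<Longrightarrow> smooth_on F N \<Longrightarrow> smooth_on G N \<Longrightarrow> smooth_on (\<lambda>z. F z ** G z) N"
  by (rule smooth_on_bilinear[OF bounded_bilinear_matrix_mult])

lemma smooth_on_dz:
  assumes "open N" "smooth_on F N"
  shows "smooth_on (\<lambda>z. dz F z X) N" "smooth_on (\<lambda>z. dzb F z X) N"
  unfolding dz_def dzb_def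
  by (intro smooth_on_linear[OF bounded_linear_scaleR_right] smooth_on_diff smooth_on_add assms
      smooth_on_mm smooth_on_const smooth_on_deriv)+

lemma frechet_derivative_dz:
  fixes F :: "('m::finite, 'n::finite) mfun"
  assumes N: "open N" "z \<in> N" and F: "smooth_on F N"
  shows "frechet_derivative (\<lambda>w. dz F w X) (at z) Y =
    (1/2) *\<^sub>R (frechet_derivative (\<lambda>w. frechet_derivative F (at w) X) (at z) Y
      - mat \<i> ** frechet_derivative (\<lambda>w. frechet_derivative F (at w) (\<i> *s X)) (at z) Y)"
   "frechet_derivative (\<lambda>w. dzb F w X) (at z) Y =
    (1/2) *\<^sub>R (frechet_derivative (\<lambda>w. frechet_derivative F (at w) X) (at z) Y
      + mat \<i> ** frechet_derivative (\<lambda>w. frechet_derivative F (at w) (\<i> *s X)) (at z) Y)"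
proof -
  have d: "(\<lambda>w. frechet_derivative F (at w) X) differentiable at z" for X
    by (rule smooth_on_differentiable[OF smooth_on_deriv[OF F] N(2)])
  have c: "(\<lambda>w::complex^'m. mat \<i> :: complex^'n^'n) differentiable at z" by simp
  note m = frechet_derivative_mm[OF c d]
  show "frechet_derivative (\<lambda>w. dz F w X) (at z) Y =
    (1/2) *\<^sub>R (frechet_derivative (\<lambda>w. frechet_derivative F (at w) X) (at z) Y
      - mat \<i> ** frechet_derivative (\<lambda>w. frechet_derivative F (at w) (\<i> *s X)) (at z) Y)"
   "frechet_derivative (\<lambda>w. dzb F w X) (at z) Y =
    (1/2) *\<^sub>R (frechet_derivative (\<lambda>w. frechet_derivative F (at w) X) (at z) Y
      + mat \<i> ** frechet_derivative (\<lambda>w. frechet_derivative F (at w) (\<i> *s X)) (at z) Y)"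
    unfolding dz_def dzb_def
    by (subst frechet_derivative_linear[OF bounded_linear_scaleR_right],
        intro differentiable_diff differentiable_add d m(2),
        simp add: frechet_derivative_diff' frechet_derivative_add' d m mm_simps)+
qed

lemma dz_commute:
  fixes F :: "('m::finite, 'n::finite) mfun"
  assumes N: "open N" "z \<in> N" and F: "smooth_on F N"
  shows "dz (\<lambda>w. dz F w X) z Y = dz (\<lambda>w. dz F w Y) z X"
    "dz (\<lambda>w. dzb F w X) z Y = dzb (\<lambda>w. dz F w Y) z X"
  unfolding dz_def[of "\<lambda>w. dz F w _"] dz_def[of "\<lambda>w. dzb F w _"] dzb_def[of "\<lambda>w. dz F w _"]
    frechet_derivative_dz[OF assms]
    second_derivative_symmetric[OF F N, of Y X] second_derivative_symmetric[OF F N, of "\<i> *s Y" X]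
    second_derivative_symmetric[OF F N, of "\<i> *s Y" "\<i> *s X"] second_derivative_symmetric[OF F N, of Y "\<i> *s X"]
  by (simp_all add: mm_simps algebra_simps mat_mult_mat)

lemma dz_smult:
  fixes F :: "('m::finite, 'n::finite) mfun"
  assumes F: "F differentiable at z"
  shows "dz F z (c *s X) = mat c ** dz F z X"
proof -
  let ?D = "frechet_derivative F (at z)"
  have c: "c *s Y = Re c *\<^sub>R Y + Im c *\<^sub>R (\<i> *s Y)" for Y :: "complex^'m"
    by (simp add: vec_eq_iff) (simp add: complex_eq_iff)
  have c': "mat c ** A = Re c *\<^sub>R A + Im c *\<^sub>R (mat \<i> ** A)" for A :: "complex^'n^'n"
    by (simp add: vec_eq_iff mat_mult_entry) (simp add: complex_eq_iff)
  have ii: "\<i> *s (\<i> *s Y) = - Y" for Y :: "complex^'m" by (simp add: vec_eq_iff)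
  have ii': "mat \<i> ** (mat \<i> ** A) = - A" for A :: "complex^'n^'n" by (simp add: vec_eq_iff mat_mult_entry)
  have smul: "\<i> *s (r *\<^sub>R Y) = r *\<^sub>R (\<i> *s Y)" for Y :: "complex^'m" and r by (simp add: vec_eq_iff)
  have "dz F z (\<i> *s X) = mat \<i> ** dz F z X"
    unfolding dz_def ii frechet_derivative_props[OF F] mm_scaleR_right mm_diff_right ii' mm_minus_right
    by simp
  moreover have "dz F z (r *\<^sub>R Y) = r *\<^sub>R dz F z Y" for r Y
    unfolding dz_def smul frechet_derivative_props[OF F] mm_scaleR_right by (simp add: algebra_simps)
  moreover have "dz F z (Y + Y') = dz F z Y + dz F z Y'" for Y Y'
    unfolding dz_def vector_add_ldistrib frechet_derivative_props[OF F] mm_add_right by (simp add: algebra_simps)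
  ultimately show ?thesis by (subst c) (simp add: c')
qed

lemma dz_add_right:
  fixes F :: "('m::finite, 'n::finite) mfun"
  assumes F: "F differentiable at z"
  shows "dz F z (X + Y) = dz F z X + dz F z Y"
  unfolding dz_def vector_add_ldistrib frechet_derivative_props[OF F] mm_add_right by (simp add: algebra_simps)

lemma dz_holomorphic:
  assumes "\<And>c v. frechet_derivative F (at z) (c *s v) = mat c ** frechet_derivative F (at z) v"
  shows "dzb F z X = 0" "dz F z X = frechet_derivative F (at z) X"
  unfolding dz_def dzb_def assms
  by (simp_all add: mat_mult_mat) (simp_all add: vec_eq_iff mat_mult_entry)

text \<open>The derivative of \<open>t\<close> is complex linear and respects the splitting into
  (1,0) and (0,1) parts, so no \<open>dzb\<close> term appears.\<close>

lemma dz_compose: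
  fixes F :: "('m::finite, 'n::finite) mfun" and t :: "complex^'k::finite \<Rightarrow> complex^'m"
  assumes F: "F differentiable at (t z)" and t: "t differentiable at z"
    and tc: "\<And>c v. frechet_derivative t (at z) (c *s v) = c *s frechet_derivative t (at z) v"
  shows "dz (\<lambda>w. F (t w)) z X = dz F (t z) (frechet_derivative t (at z) X)"
proof -
  have "frechet_derivative (\<lambda>w. F (t w)) (at z) = (\<lambda>v. frechet_derivative F (at (t z)) (frechet_derivative t (at z) v))"
    by (rule frechet_derivative_eqI)
      (rule has_derivative_compose[OF frechet_derivative_works'[OF t] frechet_derivative_works'[OF F]])
  then show ?thesis unfolding dz_def by (simp add: tc)
qed

section \<open>Closedness of the fundamental form\<close>

lemma transpose_mat_mult: "transpose (mat c ** A) = mat c ** transpose A" for A :: "complex^'n^'n"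
  by (simp add: vec_eq_iff mat_mult_entry transpose_def)

text \<open>\<open>p\<close> is a projector onto \<open>W\<^sub>m\<close>, \<open>q0\<close> and \<open>q1\<close> are Gram matrices of the polarizations of the
  two graded quotients, and \<open>K\<close> is a partial inverse of \<open>q1\<close>.\<close>

locale graded_forms_matrix =
  fixes p q0 q1 K :: "complex^'n::finite^'n" and \<epsilon> :: real
  assumes eps: "\<epsilon> * \<epsilon> = 1"
    and q0_sym: "transpose q0 = \<epsilon> *\<^sub>R q0" and q1_sym: "transpose q1 = - (\<epsilon> *\<^sub>R q1)"
    and Kq1: "K ** q1 = mat 1 - p" and q1p: "q1 ** p = 0"
begin

text \<open>The form on maps from \<open>gr\<^sub>m\<^sub>+\<^sub>1\<close> to
  \<open>gr\<^sub>m\<close>, as a contraction with the inverse of \<open>q1\<close> on the source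
  and with \<open>q0\<close> on the target.\<close>

definition beta :: "complex^'n^'n \<Rightarrow> complex^'n^'n \<Rightarrow> complex" where
  "beta B C = trace (B ** K ** transpose C ** q0)"

text \<open>Such a \<open>B\<close> kills W_m and has values in W_m, so it amounts to a map between
  the two graded quotients.\<close>

definition off_diagonal :: "complex^'n^'n \<Rightarrow> bool" where
  "off_diagonal B \<longleftrightarrow> B ** p = 0 \<and> p ** B = B"

lemma beta_linear:
  "beta (B + B') C = beta B C + beta B' C" "beta (B - B') C = beta B C - beta B' C" "beta (- B) C = - beta B C"
  "beta B (C + C') = beta B C + beta B C'" "beta B (C - C') = beta B C - beta B C'" "beta B (- C) = - beta B C"
  by (simp_all add: beta_def mm_simps)

lemma q1Kq1: "q1 ** (K ** q1) = q1"
  by (simp add: Kq1 mm_diff_right q1p)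

lemma q1KTq1: "q1 ** (transpose K ** q1) = - (\<epsilon> *\<^sub>R q1)"
proof -
  have "transpose (q1 ** (K ** q1)) = q1 ** (transpose K ** q1)"
    by (simp add: transpose_mult q1_sym mm_simps eps)
  then show ?thesis by (simp add: q1Kq1 q1_sym)
qed

lemma off_diagonal_factor: "off_diagonal B \<Longrightarrow> B ** (K ** q1) = B"
  by (simp add: Kq1 mm_diff_right off_diagonal_def)

lemma off_diagonal_factor': "off_diagonal B \<Longrightarrow> transpose B = - (\<epsilon> *\<^sub>R (q1 ** (transpose K ** transpose B)))"
  using arg_cong[OF off_diagonal_factor, of B transpose]
  by (simp add: transpose_mult q1_sym mm_simps)

text \<open>\<open>K\<close> inverts \<open>q1\<close> only from the left and only modulo
  \<open>p\<close>. Between off-diagonal factors both sides can be routed through \<open>q1\<close>,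
  after which \<open>X\<close> matters only through \<open>q1 ** X ** q1\<close>.\<close>

lemma sandwich:
  assumes "off_diagonal B" "off_diagonal C"
  shows "B ** X ** transpose C = - (\<epsilon> *\<^sub>R (B ** K ** (q1 ** X ** q1) ** (transpose K ** transpose C)))"
proof -
  have "B ** X ** transpose C = B ** (K ** q1) ** X ** (- (\<epsilon> *\<^sub>R (q1 ** (transpose K ** transpose C))))"
    unfolding off_diagonal_factor[OF assms(1)] off_diagonal_factor'[OF assms(2), symmetric] ..
  then show ?thesis by (simp only: mm_simps)
qed

text \<open>\<open>K\<close> itself carries no symmetry; between off-diagonal factors it inherits
  that of \<open>q1\<close>.\<close>

lemma sandwich_K:
  assumes "off_diagonal B" "off_diagonal C"
  shows "B ** K ** transpose C = - (\<epsilon> *\<^sub>R (B ** K ** q1 ** (transpose K ** transpose C)))"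
    "B ** transpose K ** transpose C = B ** K ** q1 ** (transpose K ** transpose C)"
  unfolding sandwich[OF assms] using q1Kq1 q1KTq1
  by (simp_all add: matrix_mul_assoc) (simp add: mm_simps eps)

text \<open>Transposing under the trace costs the sign \<epsilon> for \<open>q0\<close> and
  -\<epsilon> for \<open>K\<close>. Adjacency of the weights is what makes these signs
  opposite.\<close>

lemma beta_antisym:
  assumes "off_diagonal B" "off_diagonal C"
  shows "beta C B = - beta B C"
proof -
  have "beta C B = trace (transpose (C ** K ** transpose B ** q0))"
    by (simp add: beta_def trace_transpose')
  also have "\<dots> = \<epsilon> *\<^sub>R trace (q0 ** (B ** transpose K ** transpose C))"
    by (simp only: transpose_mult q0_sym transpose_transpose mm_scaleR_left trace_scaleR matrix_mul_assoc)
  also have "\<dots> = \<epsilon> *\<^sub>R trace ((B ** transpose K ** transpose C) ** q0)"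
    by (simp only: trace_mult_commute)
  also have "B ** transpose K ** transpose C = - (\<epsilon> *\<^sub>R (B ** K ** transpose C))"
    unfolding sandwich_K[OF assms] by (simp add: eps)
  finally show ?thesis by (simp add: beta_def mm_simps trace_scaleR eps)
qed

text \<open>\<open>C\<close> rescales the two forms infinitesimally by \<open>c0\<close> and
  \<open>c1\<close>. In the commutators, left multiplication by \<open>C\<close> meets
  \<open>q0\<close> and right multiplication meets the inverse of \<open>q1\<close>, whence the
  difference. It serves for \<open>P\<close>, with factors m and m + 1, and for a derivative of
  \<open>P\<close>, with factors 0.\<close>

lemma beta_invariant:
  assumes B: "off_diagonal B" and B': "off_diagonal B'"
    and c0: "transpose p ** (transpose C ** q0 + q0 ** C) ** p = c0 *\<^sub>R q0"
    and c1: "transpose C ** q1 + q1 ** C = c1 *\<^sub>R q1"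
  shows "beta (C ** B - B ** C) B' + beta B (C ** B' - B' ** C) = (c0 - c1) *\<^sub>R beta B B'"
proof -
  have pB: "p ** B = B" and pB': "transpose B' ** transpose p = transpose B'"
    using B B' by (auto simp: off_diagonal_def simp flip: transpose_mult)
  have "beta (C ** B) B' + beta B (C ** B') = trace (B ** K ** transpose B' ** (transpose C ** q0 + q0 ** C))"
    unfolding beta_def transpose_mult
    using trace_mult_commute[of "C" "B ** K ** transpose B' ** q0"] by (simp add: mm_simps)
  also have "\<dots> = trace (p ** (B ** K ** transpose B' ** transpose p ** (transpose C ** q0 + q0 ** C)))"
    using pB pB' by (simp only: matrix_mul_assoc) (simp add: matrix_mul_assoc')
  also have "\<dots> = trace (B ** K ** transpose B' ** (transpose p ** (transpose C ** q0 + q0 ** C) ** p))"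
    by (subst trace_mult_commute) (simp only: matrix_mul_assoc)
  also have "\<dots> = c0 *\<^sub>R beta B B'" unfolding c0 beta_def by (simp add: mm_simps trace_scaleR)
  finally have 1: "beta (C ** B) B' + beta B (C ** B') = c0 *\<^sub>R beta B B'" .
  \<comment> \<open>For multiplication on the right, \<open>sandwich\<close> reduces
    \<open>C ** K\<close> and \<open>K ** transpose C\<close> to their compressions by
    \<open>q1\<close>, where \<open>K\<close> disappears.\<close>
  have "q1 ** C = c1 *\<^sub>R q1 - transpose C ** q1" using c1 by (metis add_diff_cancel_left')
  then have "q1 ** (C ** K) ** q1 = c1 *\<^sub>R (q1 ** (K ** q1)) - transpose C ** (q1 ** (K ** q1))"
    by (simp only: matrix_mul_assoc mm_diff_left mm_scaleR_left)
  then have "q1 ** (C ** K) ** q1 = c1 *\<^sub>R q1 - transpose C ** q1" by (simp only: q1Kq1)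
  also have "\<dots> = q1 ** C" using c1 by (metis add_diff_cancel_left')
  finally have a: "q1 ** (C ** K) ** q1 = q1 ** C" .
  have tc: "transpose C ** q1 = c1 *\<^sub>R q1 - q1 ** C" using c1 by (metis add_diff_cancel_right')
  have "q1 ** (K ** transpose C) ** q1 = q1 ** K ** (transpose C ** q1)" by (simp add: matrix_mul_assoc)
  also have "\<dots> = c1 *\<^sub>R (q1 ** (K ** q1)) - q1 ** (K ** q1) ** C" unfolding tc by (simp add: mm_simps)
  finally have b: "q1 ** (K ** transpose C) ** q1 = c1 *\<^sub>R q1 - q1 ** C" by (simp only: q1Kq1)
  have "B ** (C ** K + K ** transpose C) ** transpose B' = c1 *\<^sub>R (B ** K ** transpose B')"
    unfolding sandwich[OF B B'] mm_add_right mm_add_left a b sandwich_K(1)[OF B B']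
    using q1Kq1 by (simp add: mm_simps algebra_simps)
  then have "trace (B ** (C ** K + K ** transpose C) ** transpose B' ** q0) = c1 *\<^sub>R beta B B'"
    by (simp add: beta_def mm_simps trace_scaleR)
  then have 2: "beta (B ** C) B' + beta B (B' ** C) = c1 *\<^sub>R beta B B'"
    unfolding beta_def transpose_mult by (simp add: mm_simps)
  show ?thesis by (simp add: beta_linear scaleR_diff_left 1[symmetric] 2[symmetric])
qed

end

text \<open>\<open>P\<close> acts on the component of type \<open>(r, s)\<close> of the Deligne bigrading as multiplication by \<open>r\<close>,
  and \<open>S\<close> is the projection with kernel \<open>W\<^sub>m\<close> onto the part of weight \<open>m + 1\<close>. The derivatives of
  \<open>P\<close> and \<open>S\<close> then represent the differential of the period map and its component of type
  \<open>(-1, 0)\<close>.\<close>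

locale hodge_operator = graded_forms_matrix p q0 q1 K \<epsilon>
  for p q0 q1 K :: "complex^'n::finite^'n" and \<epsilon> :: real +
  fixes N :: "(complex^'m::finite) set" and P S :: "('m, 'n) mfun" and m :: real
  assumes N: "open N" and sP: "smooth_on P N" and sS: "smooth_on S N"
    and real: "cnj_mat p = p" "cnj_mat q0 = q0" "cnj_mat q1 = q1" "cnj_mat K = K"
    and S_real: "z \<in> N \<Longrightarrow> cnj_mat (S z) = S z"
    and P_cnj: "z \<in> N \<Longrightarrow> cnj_mat (P z) = S z + m *\<^sub>R mat 1 - P z"
    and P_bracket: "z \<in> N \<Longrightarrow> P z ** dz P z X - dz P z X ** P z = - dz P z X"
    and S_bracket: "z \<in> N \<Longrightarrow> P z ** dz S z X - dz S z X ** P z = - dz S z X"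
    and Sp: "z \<in> N \<Longrightarrow> S z ** p = 0" and pS: "z \<in> N \<Longrightarrow> p ** (mat 1 - S z) = mat 1 - S z"
    and pPp: "z \<in> N \<Longrightarrow> p ** (P z ** p) = P z ** p"
    and P_q0: "z \<in> N \<Longrightarrow> transpose p ** (transpose (P z) ** q0 + q0 ** P z) ** p = m *\<^sub>R q0"
    and P_q1: "z \<in> N \<Longrightarrow> transpose (P z) ** q1 + q1 ** P z = (m + 1) *\<^sub>R q1"
begin

abbreviation "\<theta> X z \<equiv> dz P z X"
abbreviation "B X z \<equiv> dz S z X"

definition metric :: "complex^'m \<Rightarrow> complex^'m \<Rightarrow> complex^'m \<Rightarrow> complex" where
  "metric z X Y = trace (\<theta> X z ** cnj_mat (\<theta> Y z)) + \<i> * beta (B X z) (cnj_mat (B Y z))"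

lemma smooth_diff: "smooth_on F N \<Longrightarrow> z \<in> N \<Longrightarrow> F differentiable at z"
  by (rule smooth_on_differentiable)

lemmas sm = smooth_on_mm[OF N] smooth_on_dz[OF N] smooth_on_add[OF N] smooth_on_diff[OF N] sP sS
  smooth_on_const[OF N] smooth_on_linear[OF bounded_linear_cnj_mat N]
  smooth_on_linear[OF bounded_linear_transpose N]

lemma dz_eq_const:
  assumes "z \<in> N" "\<And>w. w \<in> N \<Longrightarrow> F w = A" "smooth_on F N"
  shows "dz F z X = 0" "dzb F z X = 0"
  using dz_cong[OF N assms(1) assms(2) smooth_diff[OF assms(3,1)], of X] by (simp_all add: dz_const)

text \<open>W_m does not move in a flat frame: \<open>p\<close> is constant, so \<open>Sp\<close>
  and \<open>pS\<close> can be differentiated, and then once more in the direction \<open>Y\<close>.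
  Reality of \<open>p\<close> handles the conjugate.\<close>

lemma commute_S:
  assumes z: "z \<in> N"
  shows "off_diagonal (B X z)" "off_diagonal (cnj_mat (B X z))" "off_diagonal (dzb (B X) z Y)"
proof -
  have bp: "B X w ** p = 0" and pB: "p ** B X w = B X w" if w: "w \<in> N" for w
  proof -
    have "dz (\<lambda>z. S z ** p) w X = 0" by (rule dz_eq_const(1)[OF w Sp]) (auto intro: sm)
    then show "B X w ** p = 0" by (subst (asm) dz_mult) (auto simp: dz_const mm_simps smooth_diff[OF sS w])
    have "dz (\<lambda>z. p ** (mat 1 - S z) - (mat 1 - S z)) w X = 0"
      by (rule dz_eq_const(1)[OF w, where A = 0], simp add: pS, intro sm)
    moreover have "dz (\<lambda>z. p ** (mat 1 - S z) - (mat 1 - S z)) w X = - (p ** B X w) + B X w"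
    proof -
      have dS: "S differentiable at w" and dc: "(\<lambda>z. A) differentiable at w" for A :: "complex^'n^'n"
        using smooth_diff[OF sS w] by auto
      have d1: "(\<lambda>z. mat 1 - S z) differentiable at w" using dS by simp
      show ?thesis
        by (simp only: dz_diff(1)[OF frechet_derivative_mm(2)[OF dc d1] d1] dz_mult[OF dc d1]
            dz_diff(1)[OF dc dS] dz_const) (simp add: mm_simps)
    qed
    ultimately show "p ** B X w = B X w" by simp
  qed
  then show 1: "off_diagonal (B X z)" using z by (simp add: off_diagonal_def)
  then show "off_diagonal (cnj_mat (B X z))"
    unfolding off_diagonal_def by (metis cnj_mat_mult real(1) cnj_mat_linear(5))
  have d: "(\<lambda>w. B X w) differentiable at z" by (rule smooth_diff[OF _ z]) (intro sm)
  have "dzb (\<lambda>w. B X w ** p) z Y = 0" by (rule dz_eq_const(2)[OF z bp], assumption, intro sm)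
  moreover have "dzb (\<lambda>w. p ** B X w) z Y = dzb (B X) z Y"
    by (rule dz_cong(2)[OF N z _ d]) (simp add: pB)
  ultimately show "off_diagonal (dzb (B X) z Y)"
    unfolding off_diagonal_def using d by (simp add: dzb_mult dz_const mm_simps)
qed

lemma theta_p:
  assumes z: "z \<in> N"
  shows "p ** (\<theta> X z ** p) = \<theta> X z ** p"
proof -
  have d: "P differentiable at z" by (rule smooth_diff[OF sP z])
  have "dz (\<lambda>z. p ** (P z ** p) - P z ** p) z X = 0"
    by (rule dz_eq_const(1)[OF z, where A = 0], simp add: pPp, intro sm)
  moreover have "dz (\<lambda>z. p ** (P z ** p) - P z ** p) z X = p ** (\<theta> X z ** p) - \<theta> X z ** p"
    using d by (subst dz_diff(1); (intro frechet_derivative_mm(2))?; simp)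
      (simp add: dz_mult frechet_derivative_mm(2) dz_const mm_simps)
  ultimately show ?thesis by simp
qed

lemma bracket_derivative:
  fixes F :: "('m, 'n) mfun"
  assumes z: "z \<in> N" and F: "smooth_on F N" "\<And>w. w \<in> N \<Longrightarrow> P w ** F w - F w ** P w = - F w"
  shows "dz P z X ** F z + P z ** dz F z X - (dz F z X ** P z + F z ** dz P z X) = - dz F z X"
    "dzb P z X ** F z + P z ** dzb F z X - (dzb F z X ** P z + F z ** dzb P z X) = - dzb F z X"
proof -
  have d: "P differentiable at z" "F differentiable at z" using smooth_diff z sP F by auto
  have F0: "P w ** F w - F w ** P w + F w = 0" if "w \<in> N" for w using F(2)[OF that] by simp
  note dd = frechet_derivative_mm(2)[OF d] frechet_derivative_mm(2)[OF d(2,1)]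
  have "dz (\<lambda>w. P w ** F w - F w ** P w + F w) z X = 0" "dzb (\<lambda>w. P w ** F w - F w ** P w + F w) z X = 0"
    by (rule dz_eq_const[OF z F0]; auto intro!: sm F)+
  then show "dz P z X ** F z + P z ** dz F z X - (dz F z X ** P z + F z ** dz P z X) = - dz F z X"
    "dzb P z X ** F z + P z ** dzb F z X - (dzb F z X ** P z + F z ** dzb P z X) = - dzb F z X"
    by (simp_all add: dz_add dz_diff dz_mult dzb_mult d dd differentiable_diff add_eq_0_iff2)
qed

text \<open>Differentiate the bracket identity along \<open>Z\<close> and exchange \<open>X\<close>
  and \<open>Z\<close>. Second derivatives commute, so the difference of the two identities is twice
  the commutator.\<close>

lemma theta_commute:
  assumes z: "z \<in> N"
  shows "\<theta> Z z ** \<theta> X z = \<theta> X z ** \<theta> Z z"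
proof -
  have 1: "\<theta> Z z ** \<theta> X z + P z ** dz (\<theta> X) z Z - (dz (\<theta> X) z Z ** P z + \<theta> X z ** \<theta> Z z) = - dz (\<theta> X) z Z" for X Z
    by (rule bracket_derivative(1)[OF z]) (auto intro: sm simp: P_bracket)
  have s: "dz (\<theta> Z) z X = dz (\<theta> X) z Z" by (rule dz_commute(1)[OF N z sP])
  have cancel: "u = v" if "u + c - (d + v) = v + c - (d + u)" for u v c d :: "complex^'n^'n"
  proof -
    have "2 *\<^sub>R u = (u + c - (d + v)) + u + d + v - c" by (simp add: scaleR_2)
    also have "\<dots> = 2 *\<^sub>R v" unfolding that by (simp add: scaleR_2)
    finally show ?thesis by simp
  qed
  show ?thesis by (rule cancel[OF trans[OF 1[of Z X] 1[of X Z, unfolded s, symmetric]]])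
qed

text \<open>Multiply the \<open>dzb\<close> derivative of the bracket identity by
  \<open>\<theta> X z\<close> and take traces. The terms with \<open>?C\<close> cancel by
  \<open>theta_commute\<close>; the terms with \<open>P\<close> give the trace itself, the
  right-hand side its negative.\<close>

lemma trace_theta_dzb:
  assumes z: "z \<in> N"
  shows "trace (\<theta> X z ** dzb (\<theta> Z) z Y) = 0"
proof -
  let ?C = "dzb P z Y" and ?k = "dzb (\<theta> Z) z Y"
  have b: "?C ** \<theta> Z z + P z ** ?k - (?k ** P z + \<theta> Z z ** ?C) = - ?k"
    by (rule bracket_derivative(2)[OF z]) (auto intro: sm simp: P_bracket)
  have "trace (\<theta> X z ** (?C ** \<theta> Z z)) + trace (\<theta> X z ** (P z ** ?k)) - trace (\<theta> X z ** (?k ** P z))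
      - trace (\<theta> X z ** (\<theta> Z z ** ?C)) = - trace (\<theta> X z ** ?k)"
    using arg_cong[OF b, of "\<lambda>A. trace (\<theta> X z ** A)"] by (simp add: mm_add_right mm_diff_right mm_minus_right algebra_simps)
  moreover have "trace (\<theta> X z ** (?C ** \<theta> Z z)) = trace (\<theta> X z ** (\<theta> Z z ** ?C))"
    using trace_mult_commute[of "\<theta> X z ** ?C" "\<theta> Z z"] theta_commute[OF z, of Z X]
    by (simp add: matrix_mul_assoc)
  moreover have "trace (\<theta> X z ** (?k ** P z)) = trace (P z ** \<theta> X z ** ?k)"
    using trace_mult_commute[of "\<theta> X z ** ?k" "P z"] by (simp add: matrix_mul_assoc)
  moreover have "P z ** \<theta> X z = \<theta> X z ** P z - \<theta> X z" using P_bracket[OF z, of X] by (simp add: algebra_simps)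
  ultimately have "trace (\<theta> X z ** ?k) = - trace (\<theta> X z ** ?k)" by (simp add: mm_simps)
  then show ?thesis by simp
qed

text \<open>The conjugate of \<open>P\<close> is S + m - P, so the conjugate of
  \<open>\<theta> Y\<close> is a \<open>dzb\<close> derivative of S - P; it remains to exchange it
  with \<open>dz\<close>.\<close>

lemma dz_cnj_theta:
  assumes z: "z \<in> N"
  shows "dz (\<lambda>w. cnj_mat (\<theta> Y w)) z Z = dzb (B Z) z Y - dzb (\<theta> Z) z Y"
proof -
  have eq: "cnj_mat (\<theta> Y w) = dzb S w Y - dzb P w Y" if w: "w \<in> N" for w
  proof -
    have d: "P differentiable at w" "S differentiable at w" using smooth_diff w sP sS by auto
    have d1: "(\<lambda>z. S z + m *\<^sub>R mat 1) differentiable at w" using d by simp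
    have "dzb (\<lambda>w. cnj_mat (P w)) w Y = dzb (\<lambda>w. S w + m *\<^sub>R mat 1 - P w) w Y"
      by (rule dz_cong(2)[OF N w]) (auto simp: P_cnj d d1)
    then show ?thesis unfolding dz_cnj(2)[OF d(1)] by (simp add: dz_diff dz_add d d1 dz_const)
  qed
  have d: "(\<lambda>w. dzb S w Y) differentiable at z" "(\<lambda>w. dzb P w Y) differentiable at z"
    by (rule smooth_diff[OF _ z], intro sm)+
  have "dz (\<lambda>w. cnj_mat (\<theta> Y w)) z Z = dz (\<lambda>w. dzb S w Y - dzb P w Y) z Z"
    by (rule dz_cong(1)[OF N z]) (auto simp: eq d)
  also have "\<dots> = dzb (B Z) z Y - dzb (\<theta> Z) z Y"
    by (simp add: dz_diff d dz_commute(2)[OF N z sP] dz_commute(2)[OF N z sS])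
  finally show ?thesis .
qed

lemma dz_cnj_B:
  assumes z: "z \<in> N"
  shows "dz (\<lambda>w. cnj_mat (B Y w)) z Z = dzb (B Z) z Y"
proof -
  have eq: "cnj_mat (B Y w) = dzb S w Y" if w: "w \<in> N" for w
  proof -
    have d: "S differentiable at w" using smooth_diff w sS by auto
    have "dzb (\<lambda>w. cnj_mat (S w)) w Y = dzb S w Y"
      by (rule dz_cong(2)[OF N w]) (auto simp: S_real d)
    then show ?thesis unfolding dz_cnj(2)[OF d] .
  qed
  have d: "(\<lambda>w. dzb S w Y) differentiable at z" by (rule smooth_diff[OF _ z], intro sm)
  have "dz (\<lambda>w. cnj_mat (B Y w)) z Z = dz (\<lambda>w. dzb S w Y) z Z"
    by (rule dz_cong(1)[OF N z]) (auto simp: eq d)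
  then show ?thesis by (simp add: dz_commute(2)[OF N z sS])
qed

text \<open>\<open>\<theta> X z\<close> preserves W_m, while \<open>C\<close> maps everything into
  W_m and kills W_m; their product is block-triangular with zero diagonal blocks.\<close>

lemma trace_theta_off_diagonal:
  assumes z: "z \<in> N" and C: "off_diagonal C"
  shows "trace (\<theta> X z ** C) = 0"
proof -
  have "trace (\<theta> X z ** C) = trace ((\<theta> X z ** p) ** C)" using C by (simp add: off_diagonal_def matrix_mul_assoc')
  also have "\<dots> = trace (p ** (\<theta> X z ** (p ** C)))" using theta_p[OF z, of X] by (metis matrix_mul_assoc)
  also have "\<dots> = trace (\<theta> X z ** (p ** C) ** p)" by (rule trace_mult_commute)
  also have "\<dots> = 0" using C by (simp add: off_diagonal_def matrix_mul_assoc')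
  finally show ?thesis .
qed

text \<open>Let k be the \<open>dzb\<close> derivative of \<open>B Z\<close> and C that of
  \<open>P\<close>. Invariance under \<open>P\<close> has total factor m - (m + 1) = -1, which
  cancels the contribution of [P, B X] = - B X and leaves beta(B X, k) = - beta(B X, [C, B Z]).
  Moving the bracket over to \<open>B X\<close> costs one sign for antisymmetry and one for
  invariance under C.\<close>

lemma beta_symmetric:
  assumes z: "z \<in> N"
  shows "beta (B X z) (dzb (B Z) z Y) = beta (B Z z) (dzb (B X) z Y)"
proof -
  let ?C = "dzb P z Y"
  have d: "P differentiable at z" by (rule smooth_diff[OF sP z])
  have dt: "(\<lambda>z. transpose (P z)) differentiable at z" by (rule smooth_diff[OF _ z]) (intro sm)
  note lt = dz_linear[OF bounded_linear_transpose transpose_mat_mult d]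
  have lt2: "dzb (\<lambda>z. transpose (P z)) z Y = transpose ?C" using lt by blast
  have d2: "(\<lambda>z. transpose (P z) ** q0) differentiable at z" "(\<lambda>z. q0 ** P z) differentiable at z"
    "(\<lambda>z. transpose (P z) ** q1) differentiable at z" "(\<lambda>z. q1 ** P z) differentiable at z"
    "(\<lambda>z. transpose p ** (transpose (P z) ** q0 + q0 ** P z)) differentiable at z"
    by (rule smooth_diff[OF _ z], intro sm)+
  have "dzb (\<lambda>z. transpose p ** (transpose (P z) ** q0 + q0 ** P z) ** p) z Y = 0"
    by (rule dz_eq_const(2)[OF z P_q0]) (auto intro!: sm)
  then have c0: "transpose p ** (transpose ?C ** q0 + q0 ** ?C) ** p = 0 *\<^sub>R q0"
    by (simp add: dzb_mult d2 d dt dz_const differentiable_add mm_zero_left mm_zero_right dz_add lt2)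
  have "dzb (\<lambda>z. transpose (P z) ** q1 + q1 ** P z) z Y = 0"
    by (rule dz_eq_const(2)[OF z P_q1]) (auto intro!: sm)
  then have c1: "transpose ?C ** q1 + q1 ** ?C = 0 *\<^sub>R q1"
    by (simp add: dzb_mult d2 d dt dz_const mm_zero_left mm_zero_right dz_add lt2)
  have inv: "beta (?C ** B X z - B X z ** ?C) (B Z z) = - beta (B X z) (?C ** B Z z - B Z z ** ?C)" for X Z
    using beta_invariant[OF commute_S(1)[OF z] commute_S(1)[OF z] c0 c1, of X Z] by (simp add: add_eq_0_iff2)
  have key: "beta (B X z) (dzb (B Z) z Y) = - beta (B X z) (?C ** B Z z - B Z z ** ?C)"
    and od: "off_diagonal (?C ** B Z z - B Z z ** ?C)" for X Z
  proof -
    let ?k = "dzb (B Z) z Y"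
    have b: "?C ** B Z z + P z ** ?k - (?k ** P z + B Z z ** ?C) = - ?k"
      by (rule bracket_derivative(2)[OF z]) (auto intro: sm simp: S_bracket)
    then have b': "P z ** ?k - ?k ** P z = - ?k - (?C ** B Z z - B Z z ** ?C)" by (simp add: algebra_simps)
    have "beta (P z ** B X z - B X z ** P z) ?k + beta (B X z) (P z ** ?k - ?k ** P z) = (m - (m + 1)) *\<^sub>R beta (B X z) ?k"
      by (rule beta_invariant[OF commute_S(1)[OF z] commute_S(3)[OF z] P_q0[OF z] P_q1[OF z]])
    then have "- beta (B X z) ?k + beta (B X z) (- ?k - (?C ** B Z z - B Z z ** ?C)) = - beta (B X z) ?k"
      unfolding b' S_bracket[OF z] by (simp add: beta_linear)
    then show "beta (B X z) ?k = - beta (B X z) (?C ** B Z z - B Z z ** ?C)" by (simp add: beta_linear)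
    have k: "?k ** p = 0" "p ** ?k = ?k" using commute_S(3)[OF z] by (auto simp: off_diagonal_def)
    have kPp: "?k ** (P z ** p) = 0"
      by (subst pPp[OF z, symmetric]) (simp add: matrix_mul_assoc k mm_zero_left)
    have pPk: "p ** (P z ** ?k) = P z ** ?k"
      using arg_cong[OF pPp[OF z], of "\<lambda>A. A ** ?k"] by (simp add: matrix_mul_assoc' k)
    \<comment> \<open>The bracket is expressed through \<open>?k\<close> and \<open>P\<close>, for
      which the block conditions are known.\<close>
    have "?C ** B Z z - B Z z ** ?C = - ?k - (P z ** ?k - ?k ** P z)" using b' by (simp add: algebra_simps)
    then show "off_diagonal (?C ** B Z z - B Z z ** ?C)"
      unfolding off_diagonal_def using kPp pPk k
      by (simp add: mm_diff_left mm_diff_right mm_minus_left mm_minus_right matrix_mul_assoc' mm_zero_right)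
        (simp add: matrix_mul_assoc k)
  qed
  have "beta (B X z) (dzb (B Z) z Y) = beta (?C ** B Z z - B Z z ** ?C) (B X z)"
    unfolding key beta_antisym[OF commute_S(1)[OF z] od] by simp
  also have "\<dots> = beta (B Z z) (dzb (B X) z Y)" unfolding inv key ..
  finally show ?thesis .
qed

text \<open>As the trace of a single matrix function the metric is accessible to
  \<open>dzs_trace\<close> and the product rules.\<close>

lemma metric_trace:
  "metric z X Y = trace (\<theta> X z ** cnj_mat (\<theta> Y z) + mat \<i> ** (B X z ** K ** transpose (cnj_mat (B Y z)) ** q0))"
  by (simp add: metric_def beta_def trace_mat_mult)

lemma metric_smooth: "smooth_on (\<lambda>z. metric z X Y) N"
  unfolding metric_trace by (rule smooth_on_linear[OF bounded_linear_trace N], intro sm)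

text \<open>Differentiating the conjugated factor of the first term gives nothing, by
  \<open>trace_theta_dzb\<close> and \<open>trace_theta_off_diagonal\<close>. Of the remaining terms
  two are symmetric because second derivatives commute, the third by
  \<open>beta_symmetric\<close>.\<close>

lemma metric_derivative:
  assumes z: "z \<in> N"
  shows "dzs (\<lambda>z. metric z X Y) z Z = dzs (\<lambda>z. metric z Z Y) z X"
proof -
  have d: "(\<theta> X) differentiable at z" "(B X) differentiable at z"
     "(\<lambda>w. cnj_mat (\<theta> X w)) differentiable at z" "(\<lambda>w. cnj_mat (B X w)) differentiable at z"
     "(\<lambda>w. transpose (cnj_mat (B X w))) differentiable at z" for X
    by (rule smooth_diff[OF _ z], intro sm)+
  have d2: "(\<lambda>w. \<theta> X w ** cnj_mat (\<theta> Y w)) differentiable at z"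
    "(\<lambda>w. B X w ** K) differentiable at z"
    "(\<lambda>w. B X w ** K ** transpose (cnj_mat (B Y w))) differentiable at z"
    "(\<lambda>w. B X w ** K ** transpose (cnj_mat (B Y w)) ** q0) differentiable at z"
    "(\<lambda>w. mat \<i> ** (B X w ** K ** transpose (cnj_mat (B Y w)) ** q0)) differentiable at z"
    "(\<lambda>w. \<theta> X w ** cnj_mat (\<theta> Y w) + mat \<i> ** (B X w ** K ** transpose (cnj_mat (B Y w)) ** q0)) differentiable at z" for X Y
    by (rule smooth_diff[OF _ z], intro sm)+
  have c: "(\<lambda>z. A) differentiable at z" for A :: "complex^'n^'n" by simp
  note lt = dz_linear(1)[OF bounded_linear_transpose transpose_mat_mult d(4)]
  have "dzs (\<lambda>z. metric z X Y) z Z = trace (dz (\<theta> X) z Z ** cnj_mat (\<theta> Y z))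
      + \<i> * beta (dz (B X) z Z) (cnj_mat (B Y z)) + \<i> * beta (B X z) (dzb (B Z) z Y)" for X Z
  proof -
    have "dzs (\<lambda>z. metric z X Y) z Z = trace (dz (\<theta> X) z Z ** cnj_mat (\<theta> Y z) + \<theta> X z ** (dzb (B Z) z Y - dzb (\<theta> Z) z Y)
       + mat \<i> ** ((dz (B X) z Z ** K ** transpose (cnj_mat (B Y z)) + B X z ** K ** transpose (dzb (B Z) z Y)) ** q0))"
      unfolding metric_trace dzs_trace[OF d2(6)] dz_add(1)[OF d2(1,5)] dz_mult[OF d(1,3)] dz_mult[OF c d2(4)]
        dz_mult[OF d2(3) c] dz_mult[OF d2(2) d(5)] dz_mult[OF d(2) c] dz_const mm_zero_left mm_zero_right
        add_0_left add_0_right dz_cnj_theta[OF z] lt dz_cnj_B[OF z] ..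
    then show ?thesis
      by (simp add: mm_diff_right mm_add_left mm_add_right trace_mat_mult beta_def trace_theta_dzb[OF z]
          trace_theta_off_diagonal[OF z commute_S(3)[OF z]] algebra_simps)
  qed
  moreover have "dz (\<theta> X) z Z = dz (\<theta> Z) z X" "dz (B X) z Z = dz (B Z) z X"
    by (rule dz_commute(1)[OF N z sP], rule dz_commute(1)[OF N z sS])
  ultimately show ?thesis using beta_symmetric[OF z, of X Z Y] by simp
qed

lemma cnj_beta: "cnj (beta C D) = beta (cnj_mat C) (cnj_mat D)"
  by (simp add: beta_def trace_cnj_mat[symmetric] cnj_mat_mult cnj_mat_transpose real)

text \<open>Conjugation replaces \<open>\<i>\<close> by its negative, and the antisymmetry of
  \<open>beta\<close> takes the sign back.\<close>

lemma metric_hermitian: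
  assumes z: "z \<in> N"
  shows "metric z Y X = cnj (metric z X Y)"
proof -
  have "cnj (metric z X Y) = trace (cnj_mat (\<theta> X z) ** \<theta> Y z) - \<i> * beta (cnj_mat (B X z)) (B Y z)"
    by (simp add: metric_def cnj_beta trace_cnj_mat[symmetric] cnj_mat_mult)
  also have "\<dots> = metric z Y X"
    unfolding metric_def beta_antisym[OF commute_S(1)[OF z] commute_S(2)[OF z]]
    by (simp add: trace_mult_commute[of "\<theta> Y z"])
  finally show ?thesis ..
qed

lemma metric_linear:
  assumes z: "z \<in> N"
  shows "metric z (s *s X + X') Y = s * metric z X Y + metric z X' Y"
proof -
  have d: "P differentiable at z" "S differentiable at z" using smooth_diff z sP sS by auto
  show ?thesis
    by (simp add: metric_def dz_add_right[OF d(1)] dz_add_right[OF d(2)] dz_smult[OF d(1)] dz_smult[OF d(2)]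
        beta_def mm_add_left matrix_mul_assoc' trace_mat_mult algebra_simps)
qed

text \<open>The form is minus the imaginary part of the metric. A real derivative is a (1,0)
  derivative plus a (0,1) derivative, and hermitian symmetry rewrites the latter as the conjugate of
  a (1,0) derivative with exchanged arguments; the cyclic sum then cancels by
  \<open>metric_derivative\<close>.\<close>

lemma metric_closed:
  assumes z: "z \<in> N"
  shows "ext_deriv2 (fundamental_form metric) z X Y Z = 0"
proof -
  have d: "(\<lambda>z. metric z X Y) differentiable at z" for X Y
    by (rule smooth_on_differentiable[OF metric_smooth z])
  have ff: "fundamental_form metric w X Y = - Im (metric w X Y)" if "w \<in> N" for w X Y
    unfolding fundamental_form_def metric_hermitian[OF that, of Y X] by simp
  have dc: "(\<lambda>w. cnj (metric w X Y)) differentiable at z" for X Y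
    by (rule differentiable_linear[OF bounded_linear_cnj d])
  have D: "frechet_derivative (\<lambda>w. fundamental_form metric w Y Z) (at z) X =
      - Im (dzs (\<lambda>w. metric w Y Z) z X + cnj (dzs (\<lambda>w. metric w Z Y) z X))" for X Y Z
  proof -
    have m: "bounded_linear (\<lambda>c. - Im c)" by (intro bounded_linear_minus bounded_linear_Im)
    have dm: "(\<lambda>w. - Im (metric w Y Z)) differentiable at z"
      by (rule differentiable_linear[OF m d])
    have "frechet_derivative (\<lambda>w. fundamental_form metric w Y Z) (at z) = frechet_derivative (\<lambda>w. - Im (metric w Y Z)) (at z)"
      by (rule frechet_derivative_cong_open[OF N z _ dm]) (simp add: ff)
    then have 1: "frechet_derivative (\<lambda>w. fundamental_form metric w Y Z) (at z) X =
        - Im (frechet_derivative (\<lambda>w. metric w Y Z) (at z) X)"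
      by (simp add: frechet_derivative_linear[OF m d])
    have "frechet_derivative (\<lambda>w. metric w Z Y) (at z) = frechet_derivative (\<lambda>w. cnj (metric w Y Z)) (at z)"
      by (rule frechet_derivative_cong_open[OF N z _ dc]) (rule metric_hermitian[symmetric])
    then have "frechet_derivative (\<lambda>w. metric w Z Y) (at z) V = cnj (frechet_derivative (\<lambda>w. metric w Y Z) (at z) V)" for V
      by (simp add: frechet_derivative_linear[OF bounded_linear_cnj d])
    then show ?thesis unfolding 1 dzs_def by (simp add: field_simps)
  qed
  show ?thesis
    unfolding ext_deriv2_def D
    using metric_derivative[OF z, of Y Z X] metric_derivative[OF z, of Z Y X] metric_derivative[OF z, of Z X Y]
    by simp
qed

end

section \<open>Direct sum decompositions\<close>

definition direct_sum :: "('j \<Rightarrow> (complex^'n) set) \<Rightarrow> 'j set \<Rightarrow> bool" where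
  "direct_sum I J \<longleftrightarrow> finite J \<and> (\<forall>j\<in>J. vec.subspace (I j)) \<and>
     (\<forall>v. \<exists>x. (\<forall>j\<in>J. x j \<in> I j) \<and> v = sum x J) \<and>
     (\<forall>x. (\<forall>j\<in>J. x j \<in> I j) \<longrightarrow> sum x J = 0 \<longrightarrow> (\<forall>j\<in>J. x j = 0))"

text \<open>A matrix rather than a function, so that its dependence on a parameter can be
  differentiated; indices outside \<open>J\<close> get the zero matrix.\<close>

definition summand_proj :: "('j \<Rightarrow> (complex^'n) set) \<Rightarrow> 'j set \<Rightarrow> 'j \<Rightarrow> complex^'n::finite^'n" where
  "summand_proj I J j = (if j \<in> J then matrix (\<lambda>v. (SOME x. (\<forall>j\<in>J. x j \<in> I j) \<and> v = sum x J) j) else 0)"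

lemma vec_linearI:
  fixes f :: "complex^'n \<Rightarrow> complex^'m"
  assumes "\<And>a b. f (a + b) = f a + f b" "\<And>r b. f (r *s b) = r *s f b"
  shows "Vector_Spaces.linear (*s) (*s) f"
  by (simp add: Vector_Spaces.linear_iff vec.vector_space_axioms assms)

context
  fixes I :: "'j \<Rightarrow> (complex^'n::finite) set" and J
  assumes ds: "direct_sum I J"
begin

lemma direct_sum_unique:
  assumes "\<And>j. j \<in> J \<Longrightarrow> x j \<in> I j" "\<And>j. j \<in> J \<Longrightarrow> y j \<in> I j" "sum x J = sum y J" "j \<in> J"
  shows "x j = y j"
proof -
  have U: "\<forall>j\<in>J. x j = 0" if "\<forall>j\<in>J. x j \<in> I j" "sum x J = 0" for x
    using ds that unfolding direct_sum_def by blast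
  have "\<forall>j\<in>J. x j - y j \<in> I j" using assms(1,2) ds unfolding direct_sum_def by (auto intro: vec.subspace_diff)
  moreover have "sum (\<lambda>j. x j - y j) J = 0" using assms(3) by (simp add: sum_subtractf)
  ultimately have "\<forall>j\<in>J. x j - y j = 0" by (rule U)
  then show ?thesis using assms(4) by simp
qed

lemma summand_proj_eqI:
  assumes "\<And>j. j \<in> J \<Longrightarrow> x j \<in> I j" "v = sum x J" "j \<in> J"
  shows "summand_proj I J j *v v = x j"
proof -
  define c where "c = (\<lambda>v. SOME x. (\<forall>j\<in>J. x j \<in> I j) \<and> v = sum x J)"
  have "\<exists>x. (\<forall>j\<in>J. x j \<in> I j) \<and> v = sum x J" for v using ds unfolding direct_sum_def by blast
  then have c: "(\<forall>j\<in>J. c v j \<in> I j) \<and> v = sum (c v) J" for v unfolding c_def by (rule someI_ex)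
  have c_eq: "c v j = x j" if "\<And>j. j \<in> J \<Longrightarrow> x j \<in> I j" "v = sum x J" for v x
    by (rule direct_sum_unique[OF _ that(1) _ assms(3)]) (use c[of v] that(2) in auto)
  have sub: "vec.subspace (I j)" if "j \<in> J" for j using ds that unfolding direct_sum_def by blast
  have "Vector_Spaces.linear (*s) (*s) (\<lambda>v. c v j)"
  proof (rule vec_linearI)
    fix a b show "c (a + b) j = c a j + c b j"
      using c[of a] c[of b] sub by (intro c_eq) (auto simp: sum.distrib intro: vec.subspace_add)
  next
    fix r b show "c (r *s b) j = r *s c b j"
      using c[of b] sub by (intro c_eq) (auto simp: vec.scale_sum_right[symmetric] intro: vec.subspace_scale)
  qed
  moreover have "summand_proj I J j = matrix (\<lambda>v. c v j)"
    using assms(3) by (simp add: summand_proj_def c_def)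
  ultimately have "summand_proj I J j *v v = c v j" by (simp add: matrix_works)
  then show ?thesis using c_eq[OF assms(1,2)] by simp
qed

lemma summand_proj_in: "j \<in> J \<Longrightarrow> summand_proj I J j *v v \<in> I j"
  and summand_proj_sum_vec: "(\<Sum>j\<in>J. summand_proj I J j *v v) = v"
proof -
  obtain x where x: "\<And>j. j \<in> J \<Longrightarrow> x j \<in> I j" "v = sum x J"
    using ds unfolding direct_sum_def by blast
  show "summand_proj I J j *v v \<in> I j" if "j \<in> J"
    using summand_proj_eqI[OF x that] x(1)[OF that] by simp
  show "(\<Sum>j\<in>J. summand_proj I J j *v v) = v"
    using summand_proj_eqI[OF x] x(2) by simp
qed

lemma summand_proj_on:
  assumes "j \<in> J" "k \<in> J" "v \<in> I j"
  shows "summand_proj I J k *v v = (if k = j then v else 0)"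
proof (rule summand_proj_eqI)
  show "(if i = j then v else 0) \<in> I i" if "i \<in> J" for i
    using ds assms that unfolding direct_sum_def by (auto intro: vec.subspace_0)
  show "v = (\<Sum>i\<in>J. if i = j then v else 0)" using ds assms unfolding direct_sum_def by simp
qed fact

lemma summand_proj_mult:
  assumes "j \<in> J" "k \<in> J"
  shows "summand_proj I J k ** summand_proj I J j = (if k = j then summand_proj I J j else 0)"
  unfolding matrix_eq matrix_vector_mul_assoc[symmetric] summand_proj_on[OF assms summand_proj_in[OF assms(1)]]
  by simp

end

section \<open>The Deligne bigrading in the case of two adjacent weights\<close>

lemma cnj_vec_simps [simp]:
  "cnj_vec (cnj_vec x) = x" "cnj_vec (x + y) = cnj_vec x + cnj_vec y" "cnj_vec (x - y) = cnj_vec x - cnj_vec y"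
  "cnj_vec (- x) = - cnj_vec x" "cnj_vec 0 = 0" "cnj_vec (c *s x) = cnj c *s cnj_vec x"
  by (simp_all add: cnj_vec_def vec_eq_iff)

lemma cnj_vec_mult: "cnj_vec (A *v x) = cnj_mat A *v cnj_vec x"
  by (simp add: cnj_vec_def cnj_mat_def matrix_vector_mult_def vec_eq_iff)

lemma cnj_vec_sum: "cnj_vec (sum f I) = (\<Sum>i\<in>I. cnj_vec (f i))"
  by (induction I rule: infinite_finite_induct) auto

lemma cnj_vec_image_iff: "x \<in> cnj_vec ` A \<longleftrightarrow> cnj_vec x \<in> A"
  by (metis cnj_vec_simps(1) image_iff)

lemma subspace_cnj_image: "vec.subspace A \<Longrightarrow> vec.subspace (cnj_vec ` A)"
  unfolding vec.subspace_def by (auto simp: cnj_vec_image_iff)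

lemma complexify_subspace:
  assumes "subspace U"
  shows "vec.subspace (complexify U)"
proof (rule vec.subspaceI)
  show "0 \<in> complexify U" using subspace_0[OF assms] by (simp add: complexify_def re_vec_def im_vec_def zero_vec_def)
next
  fix x y assume *: "x \<in> complexify U" "y \<in> complexify U"
  have "re_vec (x + y) = re_vec x + re_vec y" "im_vec (x + y) = im_vec x + im_vec y"
    by (simp_all add: re_vec_def im_vec_def vec_eq_iff)
  then show "x + y \<in> complexify U" using * subspace_add[OF assms] by (auto simp: complexify_def)
next
  fix c x assume *: "x \<in> complexify U"
  have "re_vec (c *s x) = Re c *\<^sub>R re_vec x - Im c *\<^sub>R im_vec x"
    "im_vec (c *s x) = Re c *\<^sub>R im_vec x + Im c *\<^sub>R re_vec x"
    by (simp_all add: re_vec_def im_vec_def vec_eq_iff)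
  then show "c *s x \<in> complexify U"
    using * by (auto simp: complexify_def intro!: subspace_add[OF assms] subspace_diff[OF assms] subspace_scale[OF assms])
qed

lemma complexify_cnj:
  assumes "subspace U"
  shows "cnj_vec x \<in> complexify U \<longleftrightarrow> x \<in> complexify U"
proof -
  have "re_vec (cnj_vec x) = re_vec x" "im_vec (cnj_vec x) = - im_vec x"
    by (simp_all add: re_vec_def im_vec_def cnj_vec_def vec_eq_iff)
  then show ?thesis using subspace_neg[OF assms, of "im_vec x"] subspace_neg[OF assms, of "- im_vec x"]
    by (auto simp: complexify_def)
qed

lemma complexify_0 [simp]: "complexify {0} = {0}"
  by (auto simp: complexify_def re_vec_def im_vec_def vec_eq_iff complex_eq_iff)

lemma complexify_UNIV [simp]: "complexify UNIV = UNIV"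
  by (simp add: complexify_def)

lemma subspace_sum_0 [simp]: "subspace_sum A {0} = A"
  by (auto simp: subspace_sum_def)

lemma subspace_sum_iff: "x \<in> subspace_sum A B \<longleftrightarrow> (\<exists>u\<in>A. \<exists>v\<in>B. x = u + v)"
  by (auto simp: subspace_sum_def)

text \<open>\<open>hi\<close> bounds the Hodge filtration and, by conjugation, both indices. As a
  parameter it yields an index set \<open>J\<close> that is finite and common to all
  \<open>F\<close> sharing the bound.\<close>

locale adjacent_mhs =
  fixes W :: "'n::finite weight" and Q :: "'n forms" and F :: "'n filtration" and m hi :: int
  assumes mhs: "mixed_hodge_structure W F"
    and W_low: "\<And>k. k < m \<Longrightarrow> W k = {0}" and W_high: "\<And>k. k > m \<Longrightarrow> W k = UNIV"
    and F_hi: "F hi = {0}"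
begin

abbreviation "Wc \<equiv> complexify (W m)"

definition "cF q = cnj_vec ` F q"

text \<open>The correction terms of the Deligne bigrading have weight at most \<open>p + q - 2\<close>, so they vanish
  and \<open>I\<^sup>p\<^sup>,\<^sup>q\<close> is an intersection of \<open>F\<close> with its conjugate.\<close>

definition bigr :: "int \<times> int \<Rightarrow> (complex^'n) set" where
  "bigr = (\<lambda>(p, q). if p + q = m then F p \<inter> cF q \<inter> Wc else if p + q = m + 1 then F p \<inter> cF q else {0})"

definition "J = {(p, q). p < hi \<and> q < hi \<and> (p + q = m \<or> p + q = m + 1)}"

abbreviation "pr j \<equiv> summand_proj bigr J j"

lemma W_sub: "subspace (W k)" and F_sub: "vec.subspace (F p)" and F_anti: "p \<le> p' \<Longrightarrow> F p' \<subseteq> F p"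
  and F_UNIV: "\<exists>p. F p = UNIV"
  using mhs unfolding mixed_hodge_structure_def weight_filtration_def hodge_filtration_def antimono_def by auto

lemma Wc_sub: "vec.subspace (complexify (W k))" by (rule complexify_subspace[OF W_sub])
lemma cF_sub: "vec.subspace (cF p)" unfolding cF_def by (rule subspace_cnj_image[OF F_sub])
lemma Wc_cnj: "cnj_vec x \<in> complexify (W k) \<longleftrightarrow> x \<in> complexify (W k)" by (rule complexify_cnj[OF W_sub])
lemma cF_iff: "x \<in> cF q \<longleftrightarrow> cnj_vec x \<in> F q" unfolding cF_def by (rule cnj_vec_image_iff)

lemma gr_hodge_m: "gr_hodge W F m p = F p \<inter> Wc"
  by (simp add: gr_hodge_def W_low)

lemma gr_hodge_m1: "gr_hodge W F (m + 1) p = subspace_sum (F p) Wc"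
  by (simp add: gr_hodge_def W_high)

lemma F_zero: "p \<ge> hi \<Longrightarrow> F p = {0}"
  using F_anti[of hi p] F_hi vec.subspace_0[OF F_sub, of p] by auto

lemma pure_m_sum:
  assumes pq: "p + q = m + 1" and "x \<in> Wc"
  shows "\<exists>u v. u \<in> F p \<and> u \<in> Wc \<and> v \<in> cF q \<and> v \<in> Wc \<and> x = u + v"
proof -
  have q: "m + 1 - p = q" using pq by simp
  have "x \<in> subspace_sum (gr_hodge W F m p) (cnj_vec ` gr_hodge W F m (m + 1 - p))"
    using mhs assms(2) unfolding mixed_hodge_structure_def by blast
  then show ?thesis unfolding subspace_sum_iff gr_hodge_m q
    by (auto simp: cF_iff Wc_cnj)
qed

lemma pure_m_int:
  assumes pq: "p + q = m + 1" and "x \<in> F p" "x \<in> Wc" "x \<in> cF q"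
  shows "x = 0"
proof -
  have q: "m + 1 - p = q" using pq by simp
  have "x \<in> gr_hodge W F m p \<inter> cnj_vec ` gr_hodge W F m (m + 1 - p)"
    unfolding gr_hodge_m q using assms by (auto simp: cF_iff Wc_cnj cnj_vec_image_iff)
  then have "x \<in> complexify (W (m - 1))" using mhs unfolding mixed_hodge_structure_def by blast
  then show ?thesis by (simp add: W_low)
qed

lemma pure_m1_sum:
  assumes pq: "p + q = m + 2"
  shows "\<exists>u w v. u \<in> F p \<and> w \<in> Wc \<and> v \<in> cF q \<and> x = u + w + v"
proof -
  have q: "m + 1 + 1 - p = q" using pq by simp
  have "x \<in> complexify (W (m + 1))" by (simp add: W_high)
  then have "x \<in> subspace_sum (gr_hodge W F (m+1) p) (cnj_vec ` gr_hodge W F (m+1) (m + 1 + 1 - p))"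
    using mhs unfolding mixed_hodge_structure_def by blast
  then obtain u w v w' where *: "u \<in> F p" "w \<in> Wc" "v \<in> F q" "w' \<in> Wc" "x = u + w + (cnj_vec v + cnj_vec w')"
    unfolding gr_hodge_m1 q by (auto simp: subspace_sum_iff)
  have "w + cnj_vec w' \<in> Wc" using * by (intro vec.subspace_add[OF Wc_sub]) (auto simp: Wc_cnj)
  moreover have "x = u + (w + cnj_vec w') + cnj_vec v" using * by simp
  ultimately show ?thesis using * by (metis cF_iff cnj_vec_simps(1))
qed

lemma pure_m1_int:
  assumes pq: "p + q = m + 2" and "f \<in> F p" "w \<in> Wc" "f + w \<in> cF q"
  shows "f + w \<in> Wc"
proof -
  have q: "m + 1 + 1 - p = q" using pq by simp
  have "cnj_vec (f + w) \<in> subspace_sum (F q) Wc"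
    unfolding subspace_sum_iff using assms(4) vec.subspace_0[OF Wc_sub, of m]
    by (intro bexI[of _ "cnj_vec (f + w)"] bexI[of _ 0]) (auto simp: cF_iff)
  then have "f + w \<in> gr_hodge W F (m+1) p \<inter> cnj_vec ` gr_hodge W F (m+1) (m + 1 + 1 - p)"
    unfolding gr_hodge_m1 q Int_iff cnj_vec_image_iff using assms by (auto simp only: subspace_sum_iff)
  then have "f + w \<in> complexify (W (m + 1 - 1))" using mhs unfolding mixed_hodge_structure_def by blast
  then show ?thesis by simp
qed

lemma bigr_m: "p + q = m \<Longrightarrow> bigr (p, q) = F p \<inter> cF q \<inter> Wc"
  and bigr_m1: "p + q = m + 1 \<Longrightarrow> bigr (p, q) = F p \<inter> cF q"
  and bigr_other: "p + q \<noteq> m \<Longrightarrow> p + q \<noteq> m + 1 \<Longrightarrow> bigr (p, q) = {0}"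
  by (auto simp: bigr_def)

lemma bigr_sub: "vec.subspace (bigr j)"
  unfolding bigr_def by (auto intro!: vec.subspace_inter F_sub cF_sub Wc_sub split: prod.split)

lemma bigr_F: "bigr (p, q) \<subseteq> F p" and bigr_cF: "bigr (p, q) \<subseteq> cF q"
  unfolding bigr_def using vec.subspace_0[OF F_sub] vec.subspace_0[OF cF_sub] by auto

lemma bigr_zero: "j \<notin> J \<Longrightarrow> bigr j = {0}"
proof (cases j)
  case (Pair p q)
  assume "j \<notin> J"
  then have "bigr (p, q) \<subseteq> {0}"
    using bigr_F[of p q] bigr_cF[of p q] F_zero[of p] F_zero[of q] bigr_other[of p q]
    unfolding Pair J_def cF_def by (auto simp: not_less)
  then show ?thesis unfolding Pair using vec.subspace_0[OF bigr_sub] by blast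
qed

lemma finite_J: "finite J"
proof -
  have "J \<subseteq> {m - hi..hi} \<times> {m - hi..hi}" by (auto simp: J_def)
  then show ?thesis by (rule finite_subset) simp
qed

text \<open>Purity in weight m + 1 decomposes \<open>x\<close> up to an error in W_m, and purity in
  weight m decomposes the error. No weight lies below m, so the pieces satisfy the conditions of
  \<open>bigr\<close> exactly and not only modulo lower weight.\<close>

lemma F_step:
  assumes x: "x \<in> F p"
  shows "\<exists>f a b. f \<in> F (p + 1) \<and> a \<in> bigr (p, m - p) \<and> b \<in> bigr (p, m + 1 - p) \<and> x = f + a + b"
proof -
  have sub: "F (p + 1) \<subseteq> F p" by (rule F_anti) simp
  obtain f w c where 1: "f \<in> F (p + 1)" "w \<in> Wc" "c \<in> cF (m + 1 - p)" "x = f + w + c"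
    using pure_m1_sum[of "p + 1" "m + 1 - p" x] by auto
  obtain w1 w2 where 2: "w1 \<in> F p" "w1 \<in> Wc" "w2 \<in> cF (m + 1 - p)" "w = w1 + w2"
    using pure_m_sum[OF _ 1(2), of p "m + 1 - p"] by auto
  have "c + w2 \<in> cF (m + 1 - p)" using 1 2 vec.subspace_add[OF cF_sub] by simp
  moreover have "c + w2 = x - f - w1" using 1 2 by simp
  moreover have "x - f - w1 \<in> F p" using x 1(1) 2(1) sub by (intro vec.subspace_diff[OF F_sub]) auto
  ultimately have b: "c + w2 \<in> bigr (p, m + 1 - p)" by (simp add: bigr_m1)
  obtain f' a where 3: "f' \<in> F (p + 1)" "f' \<in> Wc" "a \<in> cF (m - p)" "a \<in> Wc" "w1 = f' + a"
    using pure_m_sum[OF _ 2(2), of "p + 1" "m - p"] by auto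
  have "a = w1 - f'" using 3 by simp
  then have "a \<in> F p" using 2 3 sub vec.subspace_diff[OF F_sub, of w1 p f'] by auto
  then have a: "a \<in> bigr (p, m - p)" using 3 by (simp add: bigr_m)
  have "f + f' \<in> F (p + 1)" using 1 3 vec.subspace_add[OF F_sub] by blast
  moreover have "x = (f + f') + a + (c + w2)" using 1 2 3 by simp
  ultimately show ?thesis using a b by blast
qed

text \<open>The weight m + 1 component is forced into W_m by purity of that quotient and then to
  zero by purity in weight m; the other component follows.\<close>

lemma F_step_unique:
  assumes a: "a \<in> bigr (p, m - p)" and b: "b \<in> bigr (p, m + 1 - p)" and f: "a + b \<in> F (p + 1)"
  shows "a = 0 \<and> b = 0"
proof -
  have a': "a \<in> F p" "a \<in> cF (m - p)" "a \<in> Wc" and b': "b \<in> F p" "b \<in> cF (m + 1 - p)"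
    using a b by (auto simp: bigr_m bigr_m1)
  have "(a + b) + (- a) \<in> Wc"
    by (rule pure_m1_int[OF _ f, of "m + 1 - p"]) (use a' b' vec.subspace_neg[OF Wc_sub] in auto)
  then have "b \<in> Wc" by simp
  then have b0: "b = 0" using pure_m_int[OF _ b'(1) _ b'(2)] by simp
  moreover have "a = 0" using pure_m_int[of "p + 1" "m - p" a] f a' b0 by simp
  ultimately show ?thesis by simp
qed

text \<open>Descending induction from F^hi = 0, peeling off one index by \<open>F_step\<close>. The
  families are total on pairs of integers and vanish below the range, which allows sums over
  different ranges to be compared.\<close>

lemma F_decompose:
  assumes "x \<in> F (hi - int k)"
  shows "\<exists>e. (\<forall>j. e j \<in> bigr j) \<and> (\<forall>j. fst j < hi - int k \<longrightarrow> e j = 0) \<and>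
    x = (\<Sum>p\<in>{hi - int k..<hi}. e (p, m - p) + e (p, m + 1 - p))"
  using assms
proof (induction k arbitrary: x)
  case 0
  then show ?case using F_hi vec.subspace_0[OF bigr_sub] by (intro exI[of _ "\<lambda>j. 0"]) auto
next
  case (Suc k)
  define p where "p = hi - int (Suc k)"
  have p1: "p + 1 = hi - int k" and pu: "{hi - int (Suc k)..<hi} = insert p {hi - int k..<hi}"
    by (auto simp: p_def)
  obtain f a b where fab: "f \<in> F (p + 1)" "a \<in> bigr (p, m - p)" "b \<in> bigr (p, m + 1 - p)" "x = f + a + b"
    using F_step Suc.prems unfolding p_def by blast
  obtain e where e: "\<forall>j. e j \<in> bigr j" "\<forall>j. fst j < hi - int k \<longrightarrow> e j = 0"
    "f = (\<Sum>p\<in>{hi - int k..<hi}. e (p, m - p) + e (p, m + 1 - p))"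
    using Suc.IH fab(1) unfolding p1 by blast
  define e' where "e' = e((p, m - p) := a, (p, m + 1 - p) := b)"
  have "f = (\<Sum>p\<in>{hi - int k..<hi}. e' (p, m - p) + e' (p, m + 1 - p))"
    unfolding e(3) by (rule sum.cong) (auto simp: e'_def p_def)
  then have "x = (\<Sum>p\<in>{hi - int (Suc k)..<hi}. e' (p, m - p) + e' (p, m + 1 - p))"
    unfolding pu by (subst sum.insert) (auto simp: p_def fab(4) e'_def)
  moreover have "\<forall>j. e' j \<in> bigr j" using e fab by (auto simp: e'_def)
  moreover have "\<forall>j. fst j < hi - int (Suc k) \<longrightarrow> e' j = 0" using e by (auto simp: e'_def p_def)
  ultimately show ?case by blast
qed

text \<open>In \<open>J\<close> the bound on the second index forces the first above m - hi, so the
  range covers \<open>J\<close> as soon as it reaches down to m - hi.\<close>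

lemma sum_J:
  fixes e :: "int \<times> int \<Rightarrow> complex^'n"
  assumes k: "m - hi \<ge> hi - int k" and e: "\<And>j. j \<notin> J \<Longrightarrow> e j = 0"
  shows "(\<Sum>p\<in>{hi - int k..<hi}. e (p, m - p) + e (p, m + 1 - p)) = sum e J"
proof -
  define f where "f = (\<lambda>p. (p, m - p))"
  define g where "g = (\<lambda>p. (p, m + 1 - p))"
  let ?R = "{hi - int k..<hi}"
  have inj: "inj_on f ?R" "inj_on g ?R" by (auto simp: inj_on_def f_def g_def)
  have "(\<Sum>p\<in>?R. e (p, m - p) + e (p, m + 1 - p)) = sum e (f ` ?R) + sum e (g ` ?R)"
    unfolding sum.distrib using inj by (simp add: sum.reindex f_def g_def comp_def)
  also have "\<dots> = sum e (f ` ?R \<union> g ` ?R)"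
    by (rule sum.union_disjoint[symmetric]) (auto simp: f_def g_def)
  also have "\<dots> = sum e J"
  proof (rule sum.mono_neutral_right)
    show "J \<subseteq> f ` ?R \<union> g ` ?R"
    proof
      fix j assume "j \<in> J"
      then obtain p q where j: "j = (p, q)" "p < hi" "q < hi" "p + q = m \<or> p + q = m + 1" by (auto simp: J_def)
      then have "p \<in> ?R" using k by auto
      moreover have "j = f p \<or> j = g p" using j by (auto simp: f_def g_def)
      ultimately show "j \<in> f ` ?R \<union> g ` ?R" by blast
    qed
  qed (auto simp: e)
  finally show ?thesis .
qed

lemma F_unique:
  assumes "\<And>j. e j \<in> bigr j" "(\<Sum>p\<in>{hi - int k..<hi}. e (p, m - p) + e (p, m + 1 - p)) = 0"
    "p \<in> {hi - int k..<hi}"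
  shows "e (p, m - p) = 0 \<and> e (p, m + 1 - p) = 0"
  using assms(2,3)
proof (induction k arbitrary: p)
  case 0
  then show ?case by simp
next
  case (Suc k)
  define r where "r = hi - int (Suc k)"
  have pu: "{hi - int (Suc k)..<hi} = insert r {hi - int k..<hi}" by (auto simp: r_def)
  let ?s = "\<Sum>p\<in>{hi - int k..<hi}. e (p, m - p) + e (p, m + 1 - p)"
  have s: "e (r, m - r) + e (r, m + 1 - r) + ?s = 0" using Suc.prems(1) unfolding pu
    by (subst (asm) sum.insert) (auto simp: r_def)
  have "?s \<in> F (r + 1)"
  proof (rule vec.subspace_sum[OF F_sub])
    fix p assume "p \<in> {hi - int k..<hi}"
    then have "F p \<subseteq> F (r + 1)" by (intro F_anti) (auto simp: r_def)
    then show "e (p, m - p) + e (p, m + 1 - p) \<in> F (r + 1)"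
      using assms(1) bigr_F by (intro vec.subspace_add[OF F_sub]) blast+
  qed
  moreover have "e (r, m - r) + e (r, m + 1 - r) = - ?s" using s by (simp add: add_eq_0_iff2)
  ultimately have "e (r, m - r) + e (r, m + 1 - r) \<in> F (r + 1)" by (simp add: vec.subspace_neg[OF F_sub])
  then have z: "e (r, m - r) = 0 \<and> e (r, m + 1 - r) = 0" by (rule F_step_unique[OF assms(1) assms(1)])
  then have "?s = 0" using s by simp
  then show ?case using Suc.IH[of p] Suc.prems(2) z unfolding pu by auto
qed

lemma decompose: "direct_sum bigr J"
  and F_proj: "v \<in> F p \<longleftrightarrow> (\<forall>j\<in>J. fst j < p \<longrightarrow> pr j *v v = 0)"
proof -
  obtain lo where lo: "F lo = UNIV" using F_UNIV by blast
  \<comment> \<open>Large enough for the range of first indices to start at or below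
    \<open>lo\<close>, where the filtration is everything, \<open>m - hi\<close>, where the range
    covers \<open>J\<close>, and \<open>p\<close>.\<close>
  define k0 where "k0 p = nat (hi - min (min lo (m - hi)) p)" for p
  have k0: "m - hi \<ge> hi - int (k0 p)" "F (hi - int (k0 p)) = UNIV" for p
  proof -
    show "m - hi \<ge> hi - int (k0 p)" by (auto simp: k0_def)
    have "hi - int (k0 p) \<le> lo" by (auto simp: k0_def)
    then show "F (hi - int (k0 p)) = UNIV" using F_anti[of "hi - int (k0 p)" lo] lo by auto
  qed
  have e0: "e j = 0" if "\<And>j. e j \<in> bigr j" "j \<notin> J" for e :: "int \<times> int \<Rightarrow> complex^'n" and j
    using that(1)[of j] unfolding bigr_zero[OF that(2)] by simp
  show ds: "direct_sum bigr J"
    unfolding direct_sum_def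
  proof (intro conjI finite_J ballI bigr_sub allI impI)
    fix v
    obtain e where e: "\<forall>j. e j \<in> bigr j" "v = (\<Sum>p\<in>{hi - int (k0 0)..<hi}. e (p, m - p) + e (p, m + 1 - p))"
      using F_decompose[of v "k0 0"] k0(2) by blast
    have "e j = 0" if "j \<notin> J" for j using e0[of e j] e(1) that by blast
    then have "v = sum e J" using sum_J[OF k0(1)[of 0], of e] e(2) by simp
    then show "\<exists>x. (\<forall>j\<in>J. x j \<in> bigr j) \<and> v = sum x J" using e(1) by blast
  next
    fix x j assume x: "\<forall>j\<in>J. x j \<in> bigr j" "sum x J = 0" and j: "j \<in> J"
    define e where "e j = (if j \<in> J then x j else 0)" for j
    have e: "e j \<in> bigr j" for j using x vec.subspace_0[OF bigr_sub] by (auto simp: e_def)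
    have "(\<Sum>p\<in>{hi - int (k0 0)..<hi}. e (p, m - p) + e (p, m + 1 - p)) = sum e J"
      by (rule sum_J[OF k0(1)]) (auto simp: e_def)
    also have "\<dots> = 0" using x by (simp add: e_def)
    finally have *: "e (p, m - p) = 0 \<and> e (p, m + 1 - p) = 0" if "p \<in> {hi - int (k0 0)..<hi}" for p
      using F_unique[OF e] that by blast
    obtain p q where pq: "j = (p, q)" "p < hi" "q < hi" "p + q = m \<or> p + q = m + 1" using j by (auto simp: J_def)
    then have "p \<in> {hi - int (k0 0)..<hi}" using k0(1)[of 0] by auto
    moreover have "q = m - p \<or> q = m + 1 - p" using pq by auto
    ultimately have "e j = 0" using * pq(1) by blast
    then show "x j = 0" using j by (simp add: e_def)
  qed
  show "v \<in> F p \<longleftrightarrow> (\<forall>j\<in>J. fst j < p \<longrightarrow> pr j *v v = 0)"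
  proof
    assume v: "v \<in> F p"
    show "\<forall>j\<in>J. fst j < p \<longrightarrow> pr j *v v = 0"
    proof (cases "p < hi")
      case True
      then have p: "hi - int (nat (hi - p)) = p" by simp
      obtain e where e: "\<forall>j. e j \<in> bigr j" "\<forall>j. fst j < p \<longrightarrow> e j = 0"
        "v = (\<Sum>p\<in>{p..<hi}. e (p, m - p) + e (p, m + 1 - p))"
        using F_decompose[of v "nat (hi - p)"] v unfolding p by blast
      have "v = (\<Sum>p\<in>{hi - int (k0 p)..<hi}. e (p, m - p) + e (p, m + 1 - p))"
        unfolding e(3)
      proof (rule sum.mono_neutral_left)
        show "{p..<hi} \<subseteq> {hi - int (k0 p)..<hi}" by (auto simp: k0_def)
      qed (use e(2) in auto)
      also have "\<dots> = sum e J"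
      proof (rule sum_J[OF k0(1)])
        show "e j = 0" if "j \<notin> J" for j using e0[of e j] e(1) that by blast
      qed
      finally have "pr j *v v = e j" if "j \<in> J" for j
        using summand_proj_eqI[OF ds _ _ that, of e v] e(1) by blast
      then show ?thesis using e(2) by auto
    next
      case False
      then have "v = 0" using v F_zero[of p] by auto
      then show ?thesis by simp
    qed
  next
    assume *: "\<forall>j\<in>J. fst j < p \<longrightarrow> pr j *v v = 0"
    have "(\<Sum>j\<in>J. pr j *v v) \<in> F p"
    proof (rule vec.subspace_sum[OF F_sub])
      fix j assume j: "j \<in> J"
      obtain a b where ab: "j = (a, b)" by (cases j)
      show "pr j *v v \<in> F p"
      proof (cases "a < p")
        case True
        then show ?thesis using * j ab vec.subspace_0[OF F_sub] by auto
      next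
        case False
        then have "F a \<subseteq> F p" by (intro F_anti) simp
        then show ?thesis using summand_proj_in[OF ds j, of v] bigr_F[of a b] ab by auto
      qed
    qed
    then show "v \<in> F p" by (simp add: summand_proj_sum_vec[OF ds])
  qed
qed

lemmas pr_in = summand_proj_in[OF decompose]
  and pr_sum_vec = summand_proj_sum_vec[OF decompose]
  and pr_on = summand_proj_on[OF decompose]
  and pr_mult = summand_proj_mult[OF decompose]
  and pr_eqI = summand_proj_eqI[OF decompose]

lemma J_swap: "(p, q) \<in> J \<longleftrightarrow> (q, p) \<in> J" by (auto simp: J_def algebra_simps)

lemma bigr_swap: "cnj_vec x \<in> bigr (q, p) \<longleftrightarrow> x \<in> bigr (p, q)"
  unfolding bigr_def by (auto simp: cF_iff Wc_cnj algebra_simps dest: arg_cong[of _ 0 cnj_vec])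

lemma pr_cnj_vec:
  assumes "(p, q) \<in> J"
  shows "pr (p, q) *v cnj_vec v = cnj_vec (pr (q, p) *v v)"
proof -
  have "pr (p, q) *v cnj_vec v = (\<lambda>j. cnj_vec (pr (prod.swap j) *v v)) (p, q)"
  proof (rule pr_eqI)
    fix j assume j: "j \<in> J"
    obtain a b where ab: "j = (a, b)" by (cases j)
    then have "pr (b, a) *v v \<in> bigr (b, a)" using j J_swap by (intro pr_in) blast
    then show "cnj_vec (pr (prod.swap j) *v v) \<in> bigr j" unfolding ab by (simp add: bigr_swap)
  next
    have "cnj_vec v = cnj_vec (\<Sum>j\<in>J. pr j *v v)" by (simp add: pr_sum_vec)
    also have "\<dots> = (\<Sum>j\<in>J. cnj_vec (pr j *v v))" by (rule cnj_vec_sum)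
    also have "\<dots> = (\<Sum>j\<in>J. cnj_vec (pr (prod.swap j) *v v))"
      by (rule sum.reindex_bij_witness[of _ prod.swap prod.swap]) (auto simp: J_swap)
    finally show "cnj_vec v = (\<Sum>j\<in>J. cnj_vec (pr (prod.swap j) *v v))" .
  qed (rule assms)
  then show ?thesis by simp
qed

lemma cF_proj: "v \<in> cF q \<longleftrightarrow> (\<forall>j\<in>J. snd j < q \<longrightarrow> pr j *v v = 0)"
proof -
  have *: "pr (a, b) *v cnj_vec v = 0 \<longleftrightarrow> pr (b, a) *v v = 0" if "(a, b) \<in> J" for a b
    unfolding pr_cnj_vec[OF that] by (metis cnj_vec_simps(1,5))
  show ?thesis unfolding cF_iff F_proj
  proof (intro iffI ballI impI)
    fix j assume A: "\<forall>j\<in>J. fst j < q \<longrightarrow> pr j *v cnj_vec v = 0" and j: "j \<in> J" "snd j < q"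
    obtain a b where ab: "j = (a, b)" by (cases j)
    then have "(b, a) \<in> J" using j J_swap by blast
    then show "pr j *v v = 0" using A[rule_format, of "(b, a)"] *[of b a] j ab by simp
  next
    fix j assume A: "\<forall>j\<in>J. snd j < q \<longrightarrow> pr j *v v = 0" and j: "j \<in> J" "fst j < q"
    obtain a b where ab: "j = (a, b)" by (cases j)
    then have "(b, a) \<in> J" using j J_swap by blast
    then show "pr j *v cnj_vec v = 0" using A[rule_format, of "(b, a)"] *[of a b] j ab by simp
  qed
qed

lemma Wc_proj: "v \<in> Wc \<longleftrightarrow> (\<forall>j\<in>J. fst j + snd j = m + 1 \<longrightarrow> pr j *v v = 0)"
proof
  assume v: "v \<in> Wc"
  obtain lo where lo: "F lo = UNIV" using F_UNIV by blast
  \<comment> \<open>As in \<open>F_decompose\<close>, but inside W_m: purity in weight m alone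
    splits off the components, so those of weight m + 1 never occur.\<close>
  have step: "\<exists>e. (\<forall>j. e j \<in> bigr j) \<and> (\<forall>j. fst j + snd j \<noteq> m \<longrightarrow> e j = 0) \<and> (\<forall>j. fst j < hi - int k \<longrightarrow> e j = 0) \<and>
     x = (\<Sum>p\<in>{hi - int k..<hi}. e (p, m - p) + e (p, m + 1 - p))" if "x \<in> F (hi - int k)" "x \<in> Wc" for k x
    using that
  proof (induction k arbitrary: x)
    case 0
    then show ?case using F_hi vec.subspace_0[OF bigr_sub] by (intro exI[of _ "\<lambda>j. 0"]) auto
  next
    case (Suc k)
    define p where "p = hi - int (Suc k)"
    have p1: "p + 1 = hi - int k" and pu: "{hi - int (Suc k)..<hi} = insert p {hi - int k..<hi}"
      by (auto simp: p_def)
    have sub: "F (p + 1) \<subseteq> F p" by (rule F_anti) simp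
    obtain f a where 3: "f \<in> F (p + 1)" "f \<in> Wc" "a \<in> cF (m - p)" "a \<in> Wc" "x = f + a"
      using pure_m_sum[OF _ Suc.prems(2), of "p + 1" "m - p"] by auto
    have "a = x - f" using 3 by simp
    then have "a \<in> F p" using 3 sub Suc.prems(1) vec.subspace_diff[OF F_sub, of x p f] by (auto simp: p_def)
    then have a: "a \<in> bigr (p, m - p)" using 3 by (simp add: bigr_m)
    obtain e where e: "\<forall>j. e j \<in> bigr j" "\<forall>j. fst j + snd j \<noteq> m \<longrightarrow> e j = 0" "\<forall>j. fst j < hi - int k \<longrightarrow> e j = 0"
      "f = (\<Sum>p\<in>{hi - int k..<hi}. e (p, m - p) + e (p, m + 1 - p))"
      using Suc.IH 3(1,2) unfolding p1 by blast
    define e' where "e' = e((p, m - p) := a)"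
    have "f = (\<Sum>p\<in>{hi - int k..<hi}. e' (p, m - p) + e' (p, m + 1 - p))"
      unfolding e(4) by (rule sum.cong) (auto simp: e'_def p_def)
    then have "x = (\<Sum>p\<in>{hi - int (Suc k)..<hi}. e' (p, m - p) + e' (p, m + 1 - p))"
      unfolding pu using e(2) by (subst sum.insert) (auto simp: p_def 3(5) e'_def)
    moreover have "\<forall>j. e' j \<in> bigr j" using e a by (auto simp: e'_def)
    moreover have "\<forall>j. fst j < hi - int (Suc k) \<longrightarrow> e' j = 0" using e by (auto simp: e'_def p_def)
    moreover have "\<forall>j. fst j + snd j \<noteq> m \<longrightarrow> e' j = 0" using e by (auto simp: e'_def p_def)
    ultimately show ?case by blast
  qed
  define k where "k = nat (hi - min lo (m - hi))"
  have k: "m - hi \<ge> hi - int k" by (auto simp: k_def)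
  have "hi - int k \<le> lo" by (auto simp: k_def)
  then have "F (hi - int k) = UNIV" using F_anti[of "hi - int k" lo] lo by auto
  then obtain e where e: "\<forall>j. e j \<in> bigr j" "\<forall>j. fst j + snd j \<noteq> m \<longrightarrow> e j = 0"
    "v = (\<Sum>p\<in>{hi - int k..<hi}. e (p, m - p) + e (p, m + 1 - p))"
    using step[of v k] v by blast
  have "e j = 0" if "j \<notin> J" for j using e(1)[rule_format, of j] unfolding bigr_zero[OF that] by simp
  then have "v = sum e J" using sum_J[OF k, of e] e(3) by simp
  then have "pr j *v v = e j" if "j \<in> J" for j using pr_eqI[of e v j] that e(1) by blast
  then show "\<forall>j\<in>J. fst j + snd j = m + 1 \<longrightarrow> pr j *v v = 0" using e(2) by auto
next
  assume *: "\<forall>j\<in>J. fst j + snd j = m + 1 \<longrightarrow> pr j *v v = 0"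
  have "(\<Sum>j\<in>J. pr j *v v) \<in> Wc"
  proof (rule vec.subspace_sum[OF Wc_sub])
    fix j assume j: "j \<in> J"
    obtain a b where ab: "j = (a, b)" by (cases j)
    show "pr j *v v \<in> Wc"
      using * j pr_in[OF j, of v] vec.subspace_0[OF Wc_sub] unfolding ab by (auto simp: bigr_def J_def)
  qed
  then show "v \<in> Wc" by (simp add: pr_sum_vec)
qed

end

section \<open>Identification with the Deligne bigrading\<close>

context adjacent_mhs
begin

lemma bigraded_part_bigr:
  "bigraded_part (\<lambda>p q. bigr (p, q)) S = {v. \<forall>j\<in>J. j \<notin> S \<longrightarrow> pr j *v v = 0}" (is "?L = ?R")
proof
  have sub: "vec.subspace ?R"
    unfolding vec.subspace_def by (auto simp: matrix_vector_right_distrib vector_scalar_commute)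
  have "(\<Union>(p, q)\<in>S. bigr (p, q)) \<subseteq> ?R"
  proof safe
    fix x p q a b assume *: "(p, q) \<in> S" "x \<in> bigr (p, q)" "(a, b) \<in> J" "(a, b) \<notin> S"
    show "pr (a, b) *v x = 0"
    proof (cases "(p, q) \<in> J")
      case True
      then show ?thesis using pr_on[OF True *(3,2)] * by auto
    next
      case False
      then show ?thesis using bigr_zero[OF False] * by simp
    qed
  qed
  then show "?L \<subseteq> ?R" unfolding bigraded_part_def by (rule vec.span_minimal[OF _ sub])
  show "?R \<subseteq> ?L"
  proof
    fix v assume v: "v \<in> ?R"
    have "(\<Sum>j\<in>J. pr j *v v) \<in> ?L"
      unfolding bigraded_part_def
    proof (rule vec.span_sum)
      fix j assume j: "j \<in> J"
      show "pr j *v v \<in> vec.span (\<Union>(p, q)\<in>S. bigr (p, q))"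
      proof (cases "j \<in> S")
        case True
        then show ?thesis using pr_in[OF j, of v] by (intro vec.span_base) auto
      next
        case False
        then show ?thesis using v j by (simp add: vec.span_zero)
      qed
    qed
    then show "v \<in> ?L" by (simp add: pr_sum_vec)
  qed
qed

lemma is_deligne_bigr: "is_deligne_bigrading W F (\<lambda>p q. bigr (p, q))"
  unfolding is_deligne_bigrading_def bigraded_part_bigr Let_def
proof (intro conjI allI)
  fix p q
  show "vec.subspace (bigr (p, q))" by (rule bigr_sub)
  show "bigr (p, q) \<inter> {v. \<forall>j\<in>J. j \<notin> - {(p, q)} \<longrightarrow> pr j *v v = 0} = {0}"
  proof (cases "(p, q) \<in> J")
    case True
    have "x = 0" if "x \<in> bigr (p, q)" "pr (p, q) *v x = 0" for x
      using pr_on[OF True True that(1)] that by simp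
    then show ?thesis using True vec.subspace_0[OF bigr_sub] by auto
  next
    case False
    then show ?thesis using bigr_zero[OF False] by auto
  qed
next
  show "{v. \<forall>j\<in>J. j \<notin> UNIV \<longrightarrow> pr j *v v = 0} = UNIV" by simp
next
  fix p show "F p = {v. \<forall>j\<in>J. j \<notin> {(a, b). p \<le> a} \<longrightarrow> pr j *v v = 0}"
    using F_proj[of _ p] by (auto simp: not_le)
next
  fix k show "complexify (W k) = {v. \<forall>j\<in>J. j \<notin> {(a, b). a + b \<le> k} \<longrightarrow> pr j *v v = 0}"
  proof -
    consider "k < m" | "k = m" | "k > m" by linarith
    then show ?thesis
    proof cases
      case 1
      then have "v = 0" if "\<forall>j\<in>J. j \<notin> {(a, b). a + b \<le> k} \<longrightarrow> pr j *v v = 0" for v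
      proof -
        have "pr j *v v = 0" if j: "j \<in> J" for j
        proof -
          have "j \<notin> {(a, b). a + b \<le> k}" using j 1 unfolding J_def by auto
          then show ?thesis using \<open>\<forall>j\<in>J. j \<notin> {(a, b). a + b \<le> k} \<longrightarrow> pr j *v v = 0\<close> j by blast
        qed
        then show ?thesis using pr_sum_vec[of v] by simp
      qed
      then show ?thesis using W_low[OF 1] by auto
    next
      case 2
      have "(\<forall>j\<in>J. fst j + snd j = m + 1 \<longrightarrow> pr j *v v = 0) \<longleftrightarrow>
        (\<forall>j\<in>J. j \<notin> {(a, b). a + b \<le> k} \<longrightarrow> pr j *v v = 0)" for v
        using 2 by (intro ball_cong) (auto simp: J_def)
      then show ?thesis using 2 Wc_proj by auto
    next
      case 3
      then show ?thesis using W_high[OF 3] by (auto simp: J_def)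
    qed
  qed
next
  fix p q
  have "cnj_vec ` bigr (p, q) = bigr (q, p)"
    using bigr_swap by (auto simp: cnj_vec_image_iff)
  then show "subspace_sum (cnj_vec ` bigr (p, q)) {v. \<forall>j\<in>J. j \<notin> {(a, b). a < q \<and> b < p} \<longrightarrow> pr j *v v = 0} =
     subspace_sum (bigr (q, p)) {v. \<forall>j\<in>J. j \<notin> {(a, b). a < q \<and> b < p} \<longrightarrow> pr j *v v = 0}" by simp
qed

lemma bigraded_part_mono:
  "(\<And>p q. (p, q) \<in> S \<Longrightarrow> I p q \<subseteq> I' p q) \<Longrightarrow> S \<subseteq> S' \<Longrightarrow> bigraded_part I S \<subseteq> bigraded_part I' S'"
  unfolding bigraded_part_def by (rule vec.span_mono) fast

lemma bigraded_part_base: "x \<in> I p q \<Longrightarrow> (p, q) \<in> S \<Longrightarrow> x \<in> bigraded_part I S"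
  unfolding bigraded_part_def by (intro vec.span_base) auto

text \<open>The inclusion into \<open>bigr\<close> uses the two weights; equality then holds because
  a componentwise inclusion between two direct sum decompositions is an equality.\<close>

lemma deligne_unique:
  assumes I: "is_deligne_bigrading W F I"
  shows "I = (\<lambda>p q. bigr (p, q))"
proof -
  have sub: "vec.subspace (I p q)" and int: "I p q \<inter> bigraded_part I (- {(p, q)}) = {0}"
    and F: "F p = bigraded_part I {(a, b). p \<le> a}" and W: "complexify (W k) = bigraded_part I {(a, b). a + b \<le> k}"
    and cnj: "subspace_sum (cnj_vec ` I p q) (bigraded_part I {(a, b). a < q \<and> b < p}) =
      subspace_sum (I q p) (bigraded_part I {(a, b). a < q \<and> b < p})"
    and top: "bigraded_part I UNIV = UNIV" for p q k
    using I unfolding is_deligne_bigrading_def Let_def by auto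
  have IF: "I p q \<subseteq> F p" for p q unfolding F by (auto intro: bigraded_part_base)
  have IW: "I p q \<subseteq> complexify (W (p + q))" for p q unfolding W by (auto intro: bigraded_part_base)
  have le: "I p q \<subseteq> bigr (p, q)" for p q
  proof -
    have IcF: "I p q \<subseteq> cF q" if pq: "p + q = m \<or> p + q = m + 1"
    proof -
      \<comment> \<open>Both strict inequalities lose at least one, so the correction terms have
        weight at most p + q - 2, which is below m for either weight.\<close>
      have "bigraded_part I {(a, b). a < q \<and> b < p} \<subseteq> complexify (W (p + q - 2))"
        unfolding W by (rule bigraded_part_mono) auto
      also have "\<dots> = {0}" using pq W_low[of "p + q - 2"] by auto
      finally have R: "bigraded_part I {(a, b). a < q \<and> b < p} = {0}"
        unfolding bigraded_part_def using vec.span_zero by blast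
      have "cnj_vec ` I p q = I q p" using cnj[of p q] unfolding R by simp
      then have "cnj_vec x \<in> F q" if "x \<in> I p q" for x using IF[of q p] that by blast
      then show ?thesis by (auto simp: cF_iff)
    qed
    consider "p + q < m" | "p + q = m" | "p + q = m + 1" | "p + q > m + 1" by linarith
    then show ?thesis
    proof cases
      case 1 then show ?thesis using IW[of p q] W_low[OF 1] vec.subspace_0[OF bigr_sub] by auto
    next
      case 2 then show ?thesis using IF[of p q] IcF IW[of p q] by (auto simp: bigr_m)
    next
      case 3 then show ?thesis using IF[of p q] IcF by (auto simp: bigr_m1)
    next
      case 4
      \<comment> \<open>In weights above m + 1 the other components already span everything, so this
        one must vanish.\<close>
      have "UNIV = complexify (W (p + q - 1))" using W_high[of "p + q - 1"] 4 by simp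
      also have "\<dots> \<subseteq> bigraded_part I (- {(p, q)})" unfolding W by (rule bigraded_part_mono) auto
      finally have "I p q = {0}" using int by blast
      then show ?thesis using vec.subspace_0[OF bigr_sub] by simp
    qed
  qed
  have ge: "bigr (p, q) \<subseteq> I p q" for p q
  proof
    fix x assume x: "x \<in> bigr (p, q)"
    have "x \<in> vec.span (I p q \<union> (\<Union>(a, b)\<in>- {(p, q)}. I a b))"
    proof -
      have "(\<Union>(a, b)\<in>UNIV. I a b) = I p q \<union> (\<Union>(a, b)\<in>- {(p, q)}. I a b)" by auto
      then show ?thesis using top unfolding bigraded_part_def by auto
    qed
    then obtain y r where yr: "x = y + r" "y \<in> vec.span (I p q)" "r \<in> bigraded_part I (- {(p, q)})"
      unfolding vec.span_Un bigraded_part_def by auto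
    have y: "y \<in> I p q" using yr(2) vec.span_subspace[OF order_refl _ sub, of p q] vec.span_superset by blast
    have "r \<in> bigraded_part (\<lambda>p q. bigr (p, q)) (- {(p, q)})"
      using yr(3) bigraded_part_mono[of "- {(p, q)}" I "\<lambda>p q. bigr (p, q)" "- {(p, q)}"] le by blast
    moreover have "r = x - y" using yr by simp
    moreover have "x - y \<in> bigr (p, q)" using x y le vec.subspace_diff[OF bigr_sub] by blast
    ultimately have "r \<in> bigr (p, q) \<inter> bigraded_part (\<lambda>p q. bigr (p, q)) (- {(p, q)})" by simp
    then have "r = 0" using is_deligne_bigr unfolding is_deligne_bigrading_def by blast
    then show "x \<in> I p q" using yr y by simp
  qed
  show ?thesis using le ge by (intro ext equalityI)
qed

lemma deligne_bigrading_eq: "deligne_bigrading W F p q = bigr (p, q)"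
proof -
  have "deligne_bigrading W F = (\<lambda>p q. bigr (p, q))"
    unfolding deligne_bigrading_def by (rule the_equality) (rule is_deligne_bigr, rule deligne_unique)
  then show ?thesis by simp
qed

lemma deligne_proj_eq:
  assumes j: "(p, q) \<in> J"
  shows "deligne_proj W F p q v = pr (p, q) *v v"
proof -
  have db: "deligne_bigrading W F = (\<lambda>p q. bigr (p, q))" by (intro ext deligne_bigrading_eq)
  show ?thesis unfolding deligne_proj_def db bigraded_part_bigr
  proof (rule the_equality)
    show "pr (p, q) *v v \<in> bigr (p, q) \<and> v - pr (p, q) *v v \<in> {w. \<forall>i\<in>J. i \<notin> - {(p, q)} \<longrightarrow> pr i *v w = 0}"
      using pr_in[OF j] j
      by (auto simp: matrix_vector_mult_diff_distrib matrix_vector_mul_assoc pr_mult)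
  next
    fix w assume w: "w \<in> bigr (p, q) \<and> v - w \<in> {w. \<forall>i\<in>J. i \<notin> - {(p, q)} \<longrightarrow> pr i *v w = 0}"
    then have "pr (p, q) *v (v - w) = 0" using j by auto
    then show "w = pr (p, q) *v v" using pr_on[OF j j, of w] w by (simp add: matrix_vector_mult_diff_distrib)
  qed
qed

lemma complex_form_zero:
  assumes "graded_forms W Q"
  shows "complex_form (Q k) 0 0 = 0"
proof -
  have 0: "0 \<in> W k" by (rule subspace_0[OF W_sub])
  have "Q k (1 *\<^sub>R 0 + 0) 0 = 1 * Q k 0 0 + Q k 0 0"
    using assms 0 unfolding graded_forms_def by blast
  then have "Q k 0 0 = 0" by simp
  moreover have "re_vec (0::complex^'n) = 0" "im_vec (0::complex^'n) = 0" by (simp_all add: re_vec_def im_vec_def vec_eq_iff)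
  ultimately show ?thesis by (simp add: complex_form_def complex_eq_iff)
qed

text \<open>Replaces the set of nonzero components, which depends on \<open>F\<close>, by the fixed
  index set \<open>J\<close>; the added terms are values of the forms at zero.\<close>

lemma mixed_hodge_metric_eq:
  assumes "graded_forms W Q"
  shows "mixed_hodge_metric W Q F u v =
    (\<Sum>(p, q)\<in>J. \<i> powi (p - q) * complex_form (Q (p + q)) (pr (p, q) *v u) (cnj_vec (pr (p, q) *v v)))"
proof -
  have sub: "{(p, q). deligne_bigrading W F p q \<noteq> {0}} \<subseteq> J"
    using bigr_zero by (auto simp: deligne_bigrading_eq)
  have "mixed_hodge_metric W Q F u v =
    (\<Sum>(p, q)\<in>{(p, q). deligne_bigrading W F p q \<noteq> {0}}. \<i> powi (p - q) * complex_form (Q (p + q)) (pr (p, q) *v u) (cnj_vec (pr (p, q) *v v)))"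
    unfolding mixed_hodge_metric_def
  proof (rule sum.cong[OF refl])
    fix j assume "j \<in> {(p, q). deligne_bigrading W F p q \<noteq> {0}}"
    moreover obtain a b where ab: "j = (a, b)" by (cases j)
    ultimately have "(a, b) \<in> J" using sub by blast
    then have "\<i> powi (a - b) * complex_form (Q (a + b)) (deligne_proj W F a b u) (cnj_vec (deligne_proj W F a b v)) =
      \<i> powi (a - b) * complex_form (Q (a + b)) (pr (a, b) *v u) (cnj_vec (pr (a, b) *v v))"
      by (simp add: deligne_proj_eq)
    then show "(case j of (p, q) \<Rightarrow> \<i> powi (p - q) * complex_form (Q (p + q)) (deligne_proj W F p q u) (cnj_vec (deligne_proj W F p q v))) =
      (case j of (p, q) \<Rightarrow> \<i> powi (p - q) * complex_form (Q (p + q)) (pr (p, q) *v u) (cnj_vec (pr (p, q) *v v)))"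
      by (simp add: ab)
  qed
  also have "\<dots> = (\<Sum>(p, q)\<in>J. \<i> powi (p - q) * complex_form (Q (p + q)) (pr (p, q) *v u) (cnj_vec (pr (p, q) *v v)))"
  proof (rule sum.mono_neutral_left[OF finite_J sub], rule ballI)
    fix j assume j: "j \<in> J - {(p, q). deligne_bigrading W F p q \<noteq> {0}}"
    obtain p q where pq: "j = (p, q)" by (cases j)
    have "bigr (p, q) = {0}" using j by (simp add: deligne_bigrading_eq pq)
    then have "pr (p, q) *v w = 0" for w using pr_in[of "(p, q)" w] j pq by simp
    then show "(case j of (p, q) \<Rightarrow> \<i> powi (p - q) * complex_form (Q (p + q)) (pr (p, q) *v u) (cnj_vec (pr (p, q) *v v))) = 0"
      using complex_form_zero[OF assms] by (simp add: pq)
  qed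
  finally show ?thesis .
qed

end

section \<open>Matrices of the polarizations\<close>

definition bil :: "complex^'n^'n \<Rightarrow> complex^'n \<Rightarrow> complex^'n \<Rightarrow> complex" where
  "bil A u v = (\<Sum>i\<in>UNIV. u $ i * (A *v v) $ i)"

lemma bil_sum_eq: "bil A u v = (\<Sum>i\<in>UNIV. \<Sum>j\<in>UNIV. u $ i * A $ i $ j * v $ j)"
  by (simp add: bil_def matrix_vector_mult_def sum_distrib_left mult.assoc)

lemma bil_linear:
  "bil A (u + u') v = bil A u v + bil A u' v" "bil A u (v + v') = bil A u v + bil A u v'"
  "bil A (u - u') v = bil A u v - bil A u' v" "bil A u (v - v') = bil A u v - bil A u v'"
  "bil A (c *s u) v = c * bil A u v" "bil A u (c *s v) = c * bil A u v"
  "bil A (- u) v = - bil A u v" "bil A u (- v) = - bil A u v" "bil A 0 v = 0" "bil A u 0 = 0"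
  by (simp_all add: bil_sum_eq algebra_simps sum.distrib sum_subtractf sum_negf sum_distrib_left)

lemma bil_linear_matrix:
  "bil (A + B) u v = bil A u v + bil B u v" "bil (- A) u v = - bil A u v"
  by (simp_all add: bil_sum_eq algebra_simps sum.distrib sum_negf)

lemma bil_scaleR: "bil (r *\<^sub>R A) u v = of_real r * bil A u v"
  unfolding bil_sum_eq by (simp add: sum_distrib_left mult_ac) (simp add: scaleR_conv_of_real mult_ac)

lemma bil_sum: "bil A (sum f I) v = (\<Sum>i\<in>I. bil A (f i) v)" "bil A u (sum f I) = (\<Sum>i\<in>I. bil A u (f i))"
  by (induction I rule: infinite_finite_induct) (auto simp: bil_linear)

lemma bil_mult_right: "bil A u (B *v v) = bil (A ** B) u v"
  by (simp add: bil_def matrix_vector_mul_assoc)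

lemma bil_transpose: "bil (transpose A) u v = bil A v u"
  unfolding bil_sum_eq transpose_def by (subst sum.swap) (simp add: mult_ac)

lemma bil_mult_left: "bil A (B *v u) v = bil (transpose B ** A) u v"
  by (metis bil_mult_right bil_transpose transpose_mult transpose_transpose)

lemma bil_cnj: "cnj (bil A u v) = bil (cnj_mat A) (cnj_vec u) (cnj_vec v)"
  by (simp add: bil_sum_eq cnj_mat_def cnj_vec_def)

lemma bil_axis: "bil A (axis i 1) (axis j 1) = A $ i $ j"
proof -
  have "bil A (axis i 1) (axis j 1) = (\<Sum>k\<in>UNIV. if k = i then (A *v axis j 1) $ k else 0)"
    unfolding bil_def by (rule sum.cong) (auto simp: axis_def)
  then show ?thesis by (simp add: matrix_vector_mul_component inner_axis row_def)
     (simp add: matrix_vector_mult_def axis_def if_distrib cong: if_cong)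
qed

lemma bil_eqI: "(\<And>u v. bil A u v = bil B u v) \<Longrightarrow> A = B"
  by (simp add: vec_eq_iff flip: bil_axis)

lemma re_vec_complex_mat: "re_vec (complex_mat A *v v) = A *v re_vec v"
  and im_vec_complex_mat: "im_vec (complex_mat A *v v) = A *v im_vec v"
  by (simp_all add: re_vec_def im_vec_def complex_mat_def matrix_vector_mult_def vec_eq_iff)

lemma complex_mat_mult: "complex_mat (A ** B) = complex_mat A ** complex_mat B"
  by (simp add: complex_mat_def matrix_matrix_mult_def vec_eq_iff)

lemma complex_mat_simps [simp]:
  "complex_mat (mat 1) = mat 1" "complex_mat 0 = 0" "cnj_mat (complex_mat A) = complex_mat A"
  "complex_mat (A - B) = complex_mat A - complex_mat B" "complex_mat (- A) = - complex_mat A"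
  "complex_mat (transpose A) = transpose (complex_mat A)" "complex_mat (r *\<^sub>R A) = r *\<^sub>R complex_mat A"
  by (simp_all add: complex_mat_def mat_def cnj_mat_def transpose_def vec_eq_iff scaleR_complex.ctr complex_eq_iff)

lemma complex_form_bil:
  assumes "B (re_vec u) (re_vec v) = re_vec u \<bullet> (A *v re_vec v)" "B (im_vec u) (im_vec v) = im_vec u \<bullet> (A *v im_vec v)"
    "B (re_vec u) (im_vec v) = re_vec u \<bullet> (A *v im_vec v)" "B (im_vec u) (re_vec v) = im_vec u \<bullet> (A *v re_vec v)"
  shows "complex_form B u v = bil (complex_mat A) u v"
proof -
  have *: "(complex_mat A *v v) $ i = Complex ((A *v re_vec v) $ i) ((A *v im_vec v) $ i)" for i
    by (simp add: complex_mat_def matrix_vector_mult_def re_vec_def im_vec_def complex_eq_iff)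
  show ?thesis
    unfolding complex_form_def assms bil_def * inner_vec_def
    by (simp add: complex_eq_iff re_vec_def im_vec_def sum_subtractf sum.distrib)
qed

lemma bilinear_matrix:
  fixes b :: "real^'n \<Rightarrow> real^'n \<Rightarrow> real"
  assumes "bilinear b"
  shows "b u v = u \<bullet> ((\<chi> i j. b (axis i 1) (axis j 1)) *v v)"
proof -
  have exp: "x = (\<Sum>i\<in>UNIV. x $ i *\<^sub>R axis i 1)" for x :: "real^'n"
    by (simp add: vec_eq_iff axis_def if_distrib cong: if_cong)
  have l: "linear (\<lambda>x. b x y)" and r: "linear (b y)" for y using assms by (auto simp: bilinear_def)
  have "b u v = (\<Sum>i\<in>UNIV. u $ i * b (axis i 1) v)"
    by (subst exp[of u]) (simp add: linear_sum[OF l] linear_cmul[OF l])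
  also have "\<dots> = (\<Sum>i\<in>UNIV. u $ i * (\<Sum>j\<in>UNIV. v $ j * b (axis i 1) (axis j 1)))"
    by (rule sum.cong[OF refl], subst exp[of v]) (simp add: linear_sum[OF r] linear_cmul[OF r])
  also have "\<dots> = u \<bullet> ((\<chi> i j. b (axis i 1) (axis j 1)) *v v)"
    by (simp add: inner_vec_def matrix_vector_mult_def mult.commute)
  finally show ?thesis .
qed

text \<open>A predicate, since the projector \<open>p\<close> and the partial inverse
  \<open>K\<close> are choices. Values of \<open>Q m\<close> outside W_m mean nothing; the
  identities between \<open>p\<close> and \<open>q0\<close> pin \<open>q0\<close> down as the form
  on W_m pulled back by \<open>p\<close>.\<close>

definition form_matrices ::
  "'n::finite weight \<Rightarrow> 'n forms \<Rightarrow> int \<Rightarrow> complex^'n^'n \<Rightarrow> complex^'n^'n \<Rightarrow> complex^'n^'n \<Rightarrow> complex^'n^'n \<Rightarrow> bool" where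
  "form_matrices W Q m p q0 q1 K \<longleftrightarrow>
    graded_forms_matrix p q0 q1 K (if even m then 1 else - 1) \<and>
    cnj_mat p = p \<and> cnj_mat q0 = q0 \<and> cnj_mat q1 = q1 \<and> cnj_mat K = K \<and>
    (\<forall>v. p *v v \<in> complexify (W m)) \<and> (\<forall>v\<in>complexify (W m). p *v v = v) \<and>
    transpose p ** q0 = q0 \<and> q0 ** p = q0 \<and>
    (\<forall>u\<in>complexify (W m). \<forall>v\<in>complexify (W m). complex_form (Q m) u v = bil q0 u v) \<and>
    (\<forall>u v. complex_form (Q (m + 1)) u v = bil q1 u v)"

lemma matrix_eqI_inner:
  fixes A B :: "real^'n^'n"
  assumes "\<And>u v. u \<bullet> (A *v v) = u \<bullet> (B *v v)"
  shows "A = B"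
  unfolding matrix_eq using assms by (metis vector_eq_ldot)

text \<open>\<open>p\<close> comes from a linear retraction \<open>g\<close> onto W_m. The kernel of
  \<open>q1\<close> is W_m, so \<open>q1\<close> is injective on the complement \<open>V\<close>,
  the range of 1 - g, and \<open>K\<close> is a left inverse of it there.\<close>

lemma form_matrices_exist:
  fixes W :: "'n::finite weight"
  assumes gf: "graded_forms W Q" and sub: "\<And>k. subspace (W k)"
    and low: "W (m - 1) = {0}" and high: "W (m + 1) = UNIV"
  shows "\<exists>p q0 q1 K. form_matrices W Q m p q0 q1 K"
proof -
  define \<epsilon> :: real where "\<epsilon> = (if even m then 1 else - 1)"
  have Ql: "Q k (c *\<^sub>R u + u') v = c * Q k u v + Q k u' v" if "u \<in> W k" "u' \<in> W k" "v \<in> W k" for k c u u' v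
    using gf that unfolding graded_forms_def by blast
  have Qs: "Q k v u = (if even k then Q k u v else - Q k u v)" if "u \<in> W k" "v \<in> W k" for k u v
    using gf that unfolding graded_forms_def by blast
  have Qn: "u \<in> W (k - 1) \<longleftrightarrow> (\<forall>v\<in>W k. Q k u v = 0)" if "u \<in> W k" for k u
    using gf that unfolding graded_forms_def by blast
  have Q0: "Q k 0 v = 0" if "v \<in> W k" for k v
    using Ql[of 0 k 0 v 1] subspace_0[OF sub] that by simp
  have bilQ: "bilinear (\<lambda>u v. Q k (f u) (f v))" if f: "linear f" "\<And>x. f x \<in> W k" for f :: "real^'n \<Rightarrow> real^'n" and k
  proof -
    have l: "linear (\<lambda>x. Q k (f x) (f y))" for y
    proof (rule linearI)
      fix a b show "Q k (f (a + b)) (f y) = Q k (f a) (f y) + Q k (f b) (f y)"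
        using Ql[OF f(2) f(2) f(2), of 1 a b y] by (simp add: linear_add[OF f(1)])
    next
      fix r b show "Q k (f (r *\<^sub>R b)) (f y) = r *\<^sub>R Q k (f b) (f y)"
        using Ql[OF f(2) subspace_0[OF sub] f(2), of r b y] Q0[OF f(2)] by (simp add: linear_cmul[OF f(1)])
    qed
    have "(\<lambda>x. Q k (f y) (f x)) = (\<lambda>x. (if even k then 1 else - 1) *\<^sub>R Q k (f x) (f y))" for y
      by (rule ext, subst Qs[OF f(2) f(2)]) simp
    then have "linear (\<lambda>x. Q k (f y) (f x))" for y using linear_compose_scale_right[OF l] by simp
    then show ?thesis using l unfolding bilinear_def by simp
  qed
  obtain g where g: "range g \<subseteq> W m" "linear g" "\<And>v. v \<in> W m \<Longrightarrow> g v = v"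
    using linear_exists_left_inverse_on[OF linear_id sub[of m]] by auto
  define pR where "pR = matrix g"
  have pR: "pR *v v = g v" for v unfolding pR_def by (simp add: matrix_works g(2))
  define q0R where "q0R = (\<chi> i j. Q m (g (axis i 1)) (g (axis j 1)))"
  define q1R where "q1R = (\<chi> i j. Q (m + 1) (axis i 1) (axis j 1))"
  have gW: "g x \<in> W m" for x using g(1) by auto
  have q0R: "Q m (g u) (g v) = u \<bullet> (q0R *v v)" for u v
    unfolding q0R_def by (rule bilinear_matrix[OF bilQ[OF g(2) gW]])
  have "bilinear (\<lambda>u v. Q (m + 1) u v)"
    using bilQ[of "\<lambda>x. x" "m + 1"] high linear_id[unfolded id_def] by simp
  then have q1R: "Q (m + 1) u v = u \<bullet> (q1R *v v)" for u v
    unfolding q1R_def by (rule bilinear_matrix)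
  have q1R0: "q1R *v x = 0 \<longleftrightarrow> x \<in> W m" for x
  proof -
    have "x \<in> W m \<longleftrightarrow> (\<forall>v. Q (m + 1) x v = 0)" using Qn[of x "m + 1"] high by simp
    also have "\<dots> \<longleftrightarrow> (\<forall>v. Q (m + 1) v x = 0)"
    proof -
      have "Q (m + 1) v x = 0 \<longleftrightarrow> Q (m + 1) x v = 0" for v using Qs[of x "m + 1" v] high by simp
      then show ?thesis by simp
    qed
    also have "\<dots> \<longleftrightarrow> q1R *v x = 0" unfolding q1R by (metis inner_zero_right vector_eq_ldot)
    finally show ?thesis by simp
  qed
  define V where "V = range (\<lambda>x. x - g x)"
  have Vl: "linear (\<lambda>x. x - g x)" using linear_compose_sub[OF linear_id g(2)] by (simp add: id_def)
  have "subspace V" unfolding V_def using linear_subspace_image[OF Vl subspace_UNIV] .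
  moreover have inj: "inj_on (\<lambda>x. q1R *v x) V"
  proof (rule inj_onI)
    fix x y assume xy: "x \<in> V" "y \<in> V" "q1R *v x = q1R *v y"
    have "x - y \<in> V" using xy subspace_diff[OF \<open>subspace V\<close>] by blast
    then obtain w where w: "x - y = w - g w" unfolding V_def by auto
    have "x - y \<in> W m" using xy by (simp add: q1R0[symmetric] matrix_vector_mult_diff_distrib)
    moreover have "g (x - y) = 0" unfolding w using linear_diff[OF g(2)] g(3)[OF gW] by simp
    ultimately show "x = y" using g(3) by simp
  qed
  ultimately obtain k where k: "linear k" "\<And>v. v \<in> V \<Longrightarrow> k (q1R *v v) = v"
    using linear_exists_left_inverse_on[OF matrix_vector_mul_linear[of q1R], of V] by auto
  define KR where "KR = matrix k"
  have KR: "KR *v x = k x" for x unfolding KR_def by (simp add: matrix_works k(1))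
  have q1p: "q1R ** pR = 0"
    unfolding matrix_eq by (simp add: matrix_vector_mul_assoc[symmetric] pR q1R0 gW)
  have Kq1: "KR ** q1R = mat 1 - pR"
  proof -
    have "KR *v (q1R *v x) = x - g x" for x
    proof -
      have "q1R *v (x - g x) = q1R *v x" using q1R0[of "g x"] gW by (simp add: matrix_vector_mult_diff_distrib)
      then show ?thesis using k(2)[of "x - g x"] by (simp add: KR V_def)
    qed
    then show ?thesis unfolding matrix_eq by (simp add: matrix_vector_mul_assoc[symmetric] matrix_vector_mult_diff_rdistrib pR)
  qed
  have tr: "u \<bullet> (transpose A *v v) = v \<bullet> (A *v u)" for A :: "real^'n^'n" and u v
    by (metis dot_lmul_matrix inner_commute vector_transpose_matrix)
  have q0t: "transpose q0R = \<epsilon> *\<^sub>R q0R"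
  proof (rule matrix_eqI_inner)
    fix u v have "u \<bullet> (transpose q0R *v v) = Q m (g v) (g u)" by (simp only: tr q0R)
    also have "\<dots> = \<epsilon> * Q m (g u) (g v)" using Qs[OF gW gW, of u v] by (simp add: \<epsilon>_def)
    finally show "u \<bullet> (transpose q0R *v v) = u \<bullet> (\<epsilon> *\<^sub>R q0R *v v)"
      by (simp add: q0R scaleR_matrix_vector_assoc[symmetric])
  qed
  have q1t: "transpose q1R = - (\<epsilon> *\<^sub>R q1R)"
  proof (rule matrix_eqI_inner)
    fix u v have "u \<bullet> (transpose q1R *v v) = Q (m+1) v u" by (simp only: tr q1R)
    also have "\<dots> = (- \<epsilon>) * Q (m+1) u v" using Qs[of u "m+1" v] high by (simp add: \<epsilon>_def)
    finally show "u \<bullet> (transpose q1R *v v) = u \<bullet> (- (\<epsilon> *\<^sub>R q1R) *v v)"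
      by (simp add: q1R scaleR_matrix_vector_assoc[symmetric] flip: scaleR_minus_left)
  qed
  have gg: "g (g x) = g x" for x using g(3)[OF gW] .
  have q0p: "q0R ** pR = q0R"
    by (rule matrix_eqI_inner) (simp add: matrix_vector_mul_assoc[symmetric] pR flip: q0R, simp add: gg)
  have "transpose (q0R ** pR) = transpose q0R" by (simp add: q0p)
  then have "\<epsilon> *\<^sub>R (transpose pR ** q0R) = \<epsilon> *\<^sub>R q0R"
    unfolding matrix_transpose_mul q0t by (simp add: vec_eq_iff matrix_matrix_mult_def sum_distrib_left mult_ac)
  then have pq0: "transpose pR ** q0R = q0R" by (simp add: \<epsilon>_def split: if_splits)
  have eps: "\<epsilon> * \<epsilon> = 1" by (simp add: \<epsilon>_def)
  show ?thesis
  proof (intro exI, unfold form_matrices_def, intro conjI ballI allI)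
    show "graded_forms_matrix (complex_mat pR) (complex_mat q0R) (complex_mat q1R) (complex_mat KR) (if even m then 1 else - 1)"
      unfolding \<epsilon>_def[symmetric]
      by unfold_locales (simp_all add: eps q0t q1t Kq1 q1p flip: complex_mat_simps(6) complex_mat_mult)
    fix v
    show "complex_mat pR *v v \<in> complexify (W m)"
      by (simp add: complexify_def re_vec_complex_mat im_vec_complex_mat pR gW)
    show "complex_form (Q (m + 1)) u v = bil (complex_mat q1R) u v" for u by (rule complex_form_bil) (rule q1R)+
  next
    fix v assume v: "v \<in> complexify (W m)"
    have "re_vec (complex_mat pR *v v) = re_vec v" "im_vec (complex_mat pR *v v) = im_vec v"
      using v by (simp_all add: complexify_def re_vec_complex_mat im_vec_complex_mat pR g(3))
    then show "complex_mat pR *v v = v" by (simp add: re_vec_def im_vec_def vec_eq_iff complex_eq_iff)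
  next
    fix u v assume "u \<in> complexify (W m)" "v \<in> complexify (W m)"
    then have *: "g (re_vec u) = re_vec u" "g (re_vec v) = re_vec v" "g (im_vec u) = im_vec u" "g (im_vec v) = im_vec v"
      using g(3) by (auto simp: complexify_def)
    show "complex_form (Q m) u v = bil (complex_mat q0R) u v"
      by (rule complex_form_bil) (metis * q0R)+
  qed (simp_all add: pq0 q0p flip: complex_mat_simps(6) complex_mat_mult)
qed

section \<open>The trace form of a definite hermitian form\<close>

locale definite_hermitian =
  fixes H :: "complex^'n::finite^'n"
  assumes hermitian: "transpose (cnj_mat H) = H"
    and definite: "v \<noteq> 0 \<Longrightarrow> 0 < Re (bil H v (cnj_vec v))"
begin

abbreviation "hf u v \<equiv> bil H u (cnj_vec v)"

lemma hf_sym: "hf v u = cnj (hf u v)"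
proof -
  have "cnj (hf u v) = bil (cnj_mat H) (cnj_vec u) v" by (simp add: bil_cnj)
  also have "\<dots> = bil (transpose (cnj_mat H)) v (cnj_vec u)" by (simp only: bil_transpose)
  finally show ?thesis by (simp add: hermitian)
qed

lemma hf_real: "hf v v = of_real (Re (hf v v))"
  using hf_sym[of v v] by (metis Reals_cnj_iff of_real_Re)

lemma hf_nz: "v \<noteq> 0 \<Longrightarrow> hf v v \<noteq> 0"
  using definite by fastforce

lemma hf_nondegenerate: "(\<And>u. hf u v = hf u w) \<Longrightarrow> v = w"
proof -
  assume "\<And>u. hf u v = hf u w"
  then have "hf (v - w) (v - w) = 0" by (simp add: bil_linear)
  then show "v = w" using hf_nz[of "v - w"] by auto
qed

definition orthogonal_set :: "(complex^'n) set \<Rightarrow> bool" where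
  "orthogonal_set B \<longleftrightarrow> finite B \<and> (\<forall>b\<in>B. b \<noteq> 0) \<and> (\<forall>b\<in>B. \<forall>c\<in>B. b \<noteq> c \<longrightarrow> hf b c = 0)"

lemma orthogonal_coeff:
  assumes B: "orthogonal_set B" and c: "c \<in> B"
  shows "hf (\<Sum>b\<in>B. f b *s b) c = f c * hf c c"
proof -
  have "hf (\<Sum>b\<in>B. f b *s b) c = (\<Sum>b\<in>B. f b * hf b c)" by (simp add: bil_sum bil_linear)
  also have "\<dots> = (\<Sum>b\<in>B. if b = c then f c * hf c c else 0)"
    using B c unfolding orthogonal_set_def by (intro sum.cong) auto
  also have "\<dots> = f c * hf c c" using B c unfolding orthogonal_set_def by simp
  finally show ?thesis .
qed

lemma orthogonal_set_card:
  assumes B: "orthogonal_set B"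
  shows "card B \<le> CARD('n)"
proof -
  have fin: "finite B" using B by (simp add: orthogonal_set_def)
  have "vec.independent B"
  proof (rule ccontr)
    assume "\<not> vec.independent B"
    then obtain f c where f: "(\<Sum>b\<in>B. f b *s b) = 0" "c \<in> B" "f c \<noteq> 0"
      using vec.dependent_finite[OF fin] by auto
    have "f c * hf c c = 0" using orthogonal_coeff[OF B f(2), of f] f(1) by (simp add: bil_linear)
    then show False using f hf_nz[of c] B unfolding orthogonal_set_def by auto
  qed
  then have "card B \<le> vec.dim (UNIV :: (complex^'n) set)" by (intro vec.independent_card_le_dim) auto
  then show ?thesis by (metis vec_dim_card)
qed

text \<open>Take an orthogonal set of maximal cardinality: a vector that it does not represent,
  corrected by its coefficients, could be added to it.\<close>

lemma orthogonal_basis_exists: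
  "\<exists>B. orthogonal_set B \<and> (\<forall>v. v = (\<Sum>b\<in>B. (hf v b / hf b b) *s b))"
proof -
  have "orthogonal_set {}" by (simp add: orthogonal_set_def)
  then obtain B where B: "orthogonal_set B" and max: "\<And>B'. orthogonal_set B' \<Longrightarrow> card B' \<le> card B"
    using ex_has_greatest_nat[of orthogonal_set "{}" card "CARD('n) + 1"] orthogonal_set_card
    by (metis less_Suc_eq_le Suc_eq_plus1)
  have fin: "finite B" using B by (simp add: orthogonal_set_def)
  have "v = (\<Sum>b\<in>B. (hf v b / hf b b) *s b)" for v
  proof (rule ccontr)
    define w where "w = v - (\<Sum>b\<in>B. (hf v b / hf b b) *s b)"
    assume "v \<noteq> (\<Sum>b\<in>B. (hf v b / hf b b) *s b)"
    then have w0: "w \<noteq> 0" by (simp add: w_def)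
    have wb: "hf w b = 0" if "b \<in> B" for b
    proof -
      have "hf b b \<noteq> 0" using hf_nz that B unfolding orthogonal_set_def by blast
      then show ?thesis unfolding w_def bil_linear(3) orthogonal_coeff[OF B that] by simp
    qed
    then have bw: "hf b w = 0" if "b \<in> B" for b using that hf_sym[of w b] by simp
    have wB: "w \<notin> B" using wb[of w] hf_nz[OF w0] by auto
    have "orthogonal_set (insert w B)"
      using B w0 wb bw unfolding orthogonal_set_def by auto
    then have "card (insert w B) \<le> card B" by (rule max)
    then show False using wB fin by simp
  qed
  then show ?thesis using B by blast
qed

lemma trace_orthogonal:
  assumes v: "\<And>v. v = (\<Sum>b\<in>B. (hf v b / hf b b) *s b)"
  shows "trace A = (\<Sum>b\<in>B. hf (A *v b) b / hf b b)"
proof -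
  have rank1: "bil H (axis i 1) y = (H *v y) $ i" for i y
  proof -
    have "bil H (axis i 1) y = (\<Sum>k\<in>UNIV. if k = i then (H *v y) $ k else 0)"
      unfolding bil_def by (rule sum.cong) (auto simp: axis_def)
    then show ?thesis by simp
  qed
  have col: "A $ i $ i = (\<Sum>b\<in>B. ((H *v cnj_vec b) $ i / hf b b) * (A *v b) $ i)" for i
  proof -
    have "A *v axis i 1 = A *v (\<Sum>b\<in>B. (hf (axis i 1) b / hf b b) *s b)" using v[of "axis i 1"] by simp
    also have "\<dots> = (\<Sum>b\<in>B. (hf (axis i 1) b / hf b b) *s (A *v b))"
      by (induction B rule: infinite_finite_induct) (auto simp: matrix_vector_right_distrib vector_scalar_commute)
    finally have "(A *v axis i 1) $ i = (\<Sum>b\<in>B. (hf (axis i 1) b / hf b b) * (A *v b) $ i)" by simp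
    moreover have "(A *v axis i 1) $ i = A $ i $ i"
      by (simp add: matrix_vector_mult_def axis_def if_distrib cong: if_cong)
    ultimately show ?thesis by (simp add: rank1)
  qed
  have "trace A = (\<Sum>i\<in>UNIV. \<Sum>b\<in>B. (A *v b) $ i * (H *v cnj_vec b) $ i / hf b b)"
    unfolding trace_def col by (simp add: mult_ac)
  also have "\<dots> = (\<Sum>b\<in>B. \<Sum>i\<in>UNIV. (A *v b) $ i * (H *v cnj_vec b) $ i / hf b b)" by (rule sum.swap)
  also have "\<dots> = (\<Sum>b\<in>B. hf (A *v b) b / hf b b)" by (simp add: bil_def sum_divide_distrib)
  finally show ?thesis .
qed

text \<open>In an orthogonal basis the trace is the sum of the quotients |A' b|^2 / |b|^2.\<close>

lemma trace_adjoint_nonneg: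
  assumes adj: "\<And>u v. hf (A *v u) v = hf u (A' *v v)"
  shows "0 \<le> Re (trace (A ** A'))"
proof -
  obtain B where B: "orthogonal_set B" and v: "\<And>v. v = (\<Sum>b\<in>B. (hf v b / hf b b) *s b)"
    using orthogonal_basis_exists by blast
  have "0 \<le> Re (hf ((A ** A') *v b) b / hf b b)" if b: "b \<in> B" for b
  proof -
    have b0: "b \<noteq> 0" using b B by (auto simp: orthogonal_set_def)
    have "hf ((A ** A') *v b) b = hf (A' *v b) (A' *v b)"
      by (simp add: adj flip: matrix_vector_mul_assoc)
    then have "hf ((A ** A') *v b) b / hf b b = of_real (Re (hf (A' *v b) (A' *v b)) / Re (hf b b))"
      using hf_real[of b] hf_real[of "A' *v b"] by (metis of_real_divide)
    moreover have "0 \<le> Re (hf (A' *v b) (A' *v b))"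
    proof (cases "A' *v b = 0")
      case True then show ?thesis by (simp add: bil_linear)
    next
      case False then show ?thesis using definite less_imp_le by blast
    qed
    moreover have "0 < Re (hf b b)" by (rule definite[OF b0])
    ultimately show ?thesis by simp
  qed
  then show ?thesis unfolding trace_orthogonal[OF v] Re_sum by (rule sum_nonneg)
qed

end

section \<open>The mixed Hodge metric at a point\<close>

lemma sum_matrix_vec: "sum f A *v v = (\<Sum>j\<in>A. f j *v v)" for f :: "'b \<Rightarrow> complex^'n^'n"
  by (induction A rule: infinite_finite_induct) (auto simp: matrix_vector_mult_add_rdistrib)

lemma matrix_vec_sum: "A *v sum f I = (\<Sum>i\<in>I. A *v f i)" for A :: "complex^'n^'n"
  by (induction I rule: infinite_finite_induct) (auto simp: matrix_vector_right_distrib)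

context adjacent_mhs
begin

text \<open>The operators that are scalar on each summand; they commute with one another, and a map
  of pure type commutes with them up to a shift of the eigenvalues.\<close>

definition opr :: "(int \<times> int \<Rightarrow> complex) \<Rightarrow> complex^'n^'n" where
  "opr f = (\<Sum>j\<in>J. mat (f j) ** pr j)"

definition "P = opr (\<lambda>j. of_int (fst j))"
definition "S = opr (\<lambda>j. if fst j + snd j = m + 1 then 1 else 0)"
definition "weil = opr (\<lambda>j. \<i> powi (fst j - snd j))"

lemma opr_on: "x \<in> bigr j \<Longrightarrow> opr f *v x = f j *s x"
proof (cases "j \<in> J")
  case True
  assume x: "x \<in> bigr j"
  have "opr f *v x = (\<Sum>k\<in>J. f k *s (pr k *v x))"
    by (simp add: opr_def sum_matrix_vec mat_mult_vec flip: matrix_vector_mul_assoc)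
  also have "\<dots> = (\<Sum>k\<in>J. if k = j then f j *s x else 0)"
    by (rule sum.cong) (auto simp: pr_on[OF True _ x])
  finally show ?thesis using True finite_J by simp
next
  case False
  assume "x \<in> bigr j"
  then show ?thesis using bigr_zero[OF False] by simp
qed

lemmas P_on = opr_on[of _ _ "\<lambda>j. of_int (fst j)", folded P_def]
  and S_on = opr_on[of _ _ "\<lambda>j. if fst j + snd j = m + 1 then 1 else 0", folded S_def]
  and weil_on = opr_on[of _ _ "\<lambda>j. \<i> powi (fst j - snd j)", folded weil_def]

lemma matrix_eq_on_bigr:
  fixes A B :: "complex^'n^'n"
  assumes "\<And>j x. j \<in> J \<Longrightarrow> x \<in> bigr j \<Longrightarrow> A *v x = B *v x"
  shows "A = B"
  unfolding matrix_eq
proof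
  fix v
  have "A *v (\<Sum>j\<in>J. pr j *v v) = B *v (\<Sum>j\<in>J. pr j *v v)"
    unfolding matrix_vec_sum by (rule sum.cong[OF refl]) (rule assms[OF _ pr_in])
  then show "A *v v = B *v v" by (simp add: pr_sum_vec)
qed

lemma bil_eq_on_bigr:
  assumes "\<And>j k x y. j \<in> J \<Longrightarrow> k \<in> J \<Longrightarrow> x \<in> bigr j \<Longrightarrow> y \<in> bigr k \<Longrightarrow> bil A x y = bil B x y"
  shows "A = B"
proof (rule bil_eqI)
  fix u v
  have "bil A (\<Sum>j\<in>J. pr j *v u) (\<Sum>j\<in>J. pr j *v v) = bil B (\<Sum>j\<in>J. pr j *v u) (\<Sum>j\<in>J. pr j *v v)"
    unfolding bil_sum by (intro sum.cong refl) (rule assms; auto intro: pr_in)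
  then show "bil A u v = bil B u v" by (simp only: pr_sum_vec)
qed

definition has_type :: "int \<Rightarrow> int \<Rightarrow> complex^'n^'n \<Rightarrow> bool" where
  "has_type r s A \<longleftrightarrow> (\<forall>p q x. x \<in> bigr (p, q) \<longrightarrow> A *v x \<in> bigr (p + r, q + s))"

lemma opr_type:
  assumes A: "has_type r s A" and f: "\<And>p q. (p, q) \<in> J \<Longrightarrow> f (p + r, q + s) = c * f (p, q)"
  shows "opr f ** A = mat c ** (A ** opr f)"
proof (rule matrix_eq_on_bigr)
  fix j x assume j: "j \<in> J" and x: "x \<in> bigr j"
  obtain p q where pq: "j = (p, q)" by (cases j)
  have Ax: "A *v x \<in> bigr (p + r, q + s)" using A x pq by (auto simp: has_type_def)
  show "(opr f ** A) *v x = (mat c ** (A ** opr f)) *v x"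
    using f[of p q] j pq
    by (simp add: matrix_vector_mul_assoc[symmetric] opr_on[OF Ax] opr_on[OF x] mat_mult_vec vector_scalar_commute)
qed

lemma opr_bracket:
  assumes A: "has_type r s A"
  shows "P ** A - A ** P = of_int r *\<^sub>R A"
proof (rule matrix_eq_on_bigr)
  fix j x assume j: "j \<in> J" and x: "x \<in> bigr j"
  obtain p q where pq: "j = (p, q)" by (cases j)
  have Ax: "A *v x \<in> bigr (p + r, q + s)" using A x pq by (auto simp: has_type_def)
  show "(P ** A - A ** P) *v x = (of_int r *\<^sub>R A) *v x"
    by (simp add: matrix_vector_mult_diff_rdistrib matrix_vector_mul_assoc[symmetric] P_on[OF Ax] P_on[OF x]
        vector_scalar_commute scaleR_matrix mat_mult_vec pq vector_sub_rdistrib[symmetric])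
qed

lemma S_kernel: "S *v x = 0 \<longleftrightarrow> x \<in> Wc"
proof -
  have pS: "pr j *v (S *v x) = (if fst j + snd j = m + 1 then pr j *v x else 0)" if j: "j \<in> J" for j
  proof (rule pr_eqI[OF _ _ j])
    fix j assume "j \<in> J" then show "(if fst j + snd j = m + 1 then pr j *v x else 0) \<in> bigr j"
      using pr_in vec.subspace_0[OF bigr_sub] by auto
  next
    have "S *v x = S *v (\<Sum>j\<in>J. pr j *v x)" by (simp add: pr_sum_vec)
    also have "\<dots> = (\<Sum>j\<in>J. if fst j + snd j = m + 1 then pr j *v x else 0)"
      unfolding matrix_vec_sum by (rule sum.cong) (auto simp: S_on[OF pr_in])
    finally show "S *v x = (\<Sum>j\<in>J. if fst j + snd j = m + 1 then pr j *v x else 0)" .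
  qed
  have "S *v x = 0 \<longleftrightarrow> (\<forall>j\<in>J. pr j *v (S *v x) = 0)"
  proof
    assume "\<forall>j\<in>J. pr j *v (S *v x) = 0"
    then have "(\<Sum>j\<in>J. pr j *v (S *v x)) = 0" by simp
    then show "S *v x = 0" by (simp only: pr_sum_vec)
  qed simp
  also have "\<dots> \<longleftrightarrow> x \<in> Wc" unfolding Wc_proj using pS by auto
  finally show ?thesis .
qed

lemma S_idem: "S ** S = S"
  by (rule matrix_eq_on_bigr) (auto simp: matrix_vector_mul_assoc[symmetric] S_on vector_scalar_commute)

lemma weight_part: "(mat 1 - S) *v x \<in> Wc"
  unfolding S_kernel[symmetric]
  by (simp add: matrix_vector_mul_assoc mm_diff_right S_idem)

lemma bigr_Wc: "x \<in> bigr (p, q) \<Longrightarrow> p + q = m \<Longrightarrow> x \<in> Wc"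
  by (simp add: bigr_m)

lemma cnj_S: "cnj_mat S = S"
  and cnj_P: "cnj_mat P = S + of_int m *\<^sub>R mat 1 - P"
proof -
  have *: "cnj_vec (opr f *v cnj_vec x) = cnj (f (q, p)) *s x" if "x \<in> bigr (p, q)" for x f p q
    using opr_on[of "cnj_vec x" "(q, p)" f] that by (simp add: bigr_swap)
  show "cnj_mat S = S"
  proof (rule matrix_eq_on_bigr)
    fix j x assume j: "j \<in> J" and x: "x \<in> bigr j"
    obtain p q where pq: "j = (p, q)" by (cases j)
    have "cnj_mat S *v x = cnj_vec (S *v cnj_vec x)" by (simp add: cnj_vec_mult)
    then show "cnj_mat S *v x = S *v x"
      using *[of x p q] x pq by (simp add: S_on[OF x]) (simp add: S_def add.commute)
  qed
  show "cnj_mat P = S + of_int m *\<^sub>R mat 1 - P"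
  proof (rule matrix_eq_on_bigr)
    fix j x assume j: "j \<in> J" and x: "x \<in> bigr j"
    obtain p q where pq: "j = (p, q)" by (cases j)
    \<comment> \<open>The conjugate of \<open>P\<close> has eigenvalue q, which is the weight minus
      p, and the weight is m plus the eigenvalue of \<open>S\<close>.\<close>
    have "q = (if p + q = m + 1 then 1 else 0) + m - p" using j by (auto simp: J_def pq)
    from arg_cong[OF this, of complex_of_int]
    have q: "complex_of_int q = (if p + q = m + 1 then 1 else 0) + of_int m - of_int p"
      by (simp only: of_int_add of_int_diff if_distrib[of of_int] of_int_0 of_int_1)
    have "cnj_mat P *v x = cnj_vec (P *v cnj_vec x)" by (simp add: cnj_vec_mult)
    also have "\<dots> = of_int q *s x" using *[of x p q] x pq by (simp add: P_def)
    also have "of_int q *s x = (S + of_int m *\<^sub>R mat 1 - P) *v x"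
      unfolding q
      by (simp add: matrix_vector_mult_diff_rdistrib matrix_vector_mult_add_rdistrib S_on[OF x] P_on[OF x]
          scaleR_matrix mat_mult_vec matrix_vector_mul_assoc[symmetric] pq vector_sub_rdistrib vector_sadd_rdistrib)
    finally show "cnj_mat P *v x = (S + of_int m *\<^sub>R mat 1 - P) *v x" .
  qed
qed

end

section \<open>Polarizations and orthogonality of the Hodge components\<close>

lemma cnj_i_powi: "cnj (\<i> powi d) = (if even d then 1 else - 1) * \<i> powi d"
proof -
  have "cnj (\<i> powi d) = (- \<i>) powi d" by (simp add: power_int_def)
  then show ?thesis by (simp add: power_int_minus_left)
qed

locale polarized_mhs = adjacent_mhs W Q F m hi
  for W :: "'n::finite weight" and Q F m hi +
  fixes p q0 q1 K
  assumes pol: "graded_polarized W Q F" and fm: "form_matrices W Q m p q0 q1 K"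

sublocale polarized_mhs \<subseteq> graded_forms_matrix p q0 q1 K "if even m then 1 else - 1"
  using fm unfolding form_matrices_def by blast

context polarized_mhs
begin

lemma fm_real: "cnj_mat p = p" "cnj_mat q0 = q0" "cnj_mat q1 = q1" "cnj_mat K = K"
  and p_in: "p *v v \<in> Wc" and p_on: "v \<in> Wc \<Longrightarrow> p *v v = v"
  and pq0: "transpose p ** q0 = q0" and q0p: "q0 ** p = q0"
  and form0: "u \<in> Wc \<Longrightarrow> v \<in> Wc \<Longrightarrow> complex_form (Q m) u v = bil q0 u v"
  and form1: "complex_form (Q (m + 1)) u v = bil q1 u v"
  using fm unfolding form_matrices_def by auto

lemma gforms: "graded_forms W Q"
  using pol unfolding graded_polarized_def by blast

lemma q1_Wc: "x \<in> Wc \<Longrightarrow> q1 *v x = 0"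
  using arg_cong[OF q1p, of "\<lambda>A. A *v x"] p_on[of x] by (simp add: matrix_vector_mul_assoc[symmetric])

lemma bil_q_sym: "bil q0 x y = (if even m then 1 else - 1) * bil q0 y x"
  "bil q1 x y = (if even (m + 1) then 1 else - 1) * bil q1 y x"
proof -
  have "bil q0 x y = bil (transpose q0) y x" by (simp only: bil_transpose)
  then show "bil q0 x y = (if even m then 1 else - 1) * bil q0 y x" by (simp add: q0_sym bil_scaleR)
  have "bil q1 x y = bil (transpose q1) y x" by (simp only: bil_transpose)
  then show "bil q1 x y = (if even (m + 1) then 1 else - 1) * bil q1 y x"
    by (simp add: q1_sym bil_scaleR bil_linear_matrix)
qed

lemma bil_q1_Wc: "x \<in> Wc \<Longrightarrow> bil q1 u x = 0" "x \<in> Wc \<Longrightarrow> bil q1 x u = 0"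
proof -
  show *: "x \<in> Wc \<Longrightarrow> bil q1 u x = 0" for u by (simp add: bil_def q1_Wc)
  show "x \<in> Wc \<Longrightarrow> bil q1 x u = 0" using *[of u] bil_q_sym(2)[of x u] by simp
qed

lemma q1_ker: "q1 *v x = 0 \<Longrightarrow> x \<in> Wc"
proof -
  assume "q1 *v x = 0"
  then have "(mat 1 - p) *v x = 0" unfolding Kq1[symmetric] by (simp add: matrix_vector_mul_assoc[symmetric])
  then have "x = p *v x" by (simp add: matrix_vector_mult_diff_rdistrib)
  then show ?thesis using p_in[of x] by simp
qed

lemma orthogonal_F: "u \<in> gr_hodge W F k r \<Longrightarrow> v \<in> gr_hodge W F k s \<Longrightarrow> r + s \<ge> k + 1 \<Longrightarrow> complex_form (Q k) u v = 0"
proof -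
  assume *: "u \<in> gr_hodge W F k r" "v \<in> gr_hodge W F k s" "r + s \<ge> k + 1"
  have "F s \<subseteq> F (k + 1 - r)" using * by (intro F_anti) simp
  then have "gr_hodge W F k s \<subseteq> gr_hodge W F k (k + 1 - r)"
    unfolding gr_hodge_def subspace_sum_def by blast
  then show ?thesis using * pol unfolding graded_polarized_def by blast
qed

lemma bigr_gr_hodge:
  assumes "x \<in> bigr (r, s)" "r + s = k" "k = m \<or> k = m + 1"
  shows "x \<in> gr_hodge W F k r" "cnj_vec x \<in> gr_hodge W F k s"
proof -
  have sum: "y \<in> F t \<Longrightarrow> y \<in> subspace_sum (F t) Wc" for y t
    unfolding subspace_sum_iff using vec.subspace_0[OF Wc_sub, of m] by (intro bexI[of _ y] bexI[of _ 0]) auto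
  have x: "x \<in> F r" "cnj_vec x \<in> F s" using bigr_F bigr_cF assms(1) cF_iff by blast+
  have "x \<in> gr_hodge W F k r \<and> cnj_vec x \<in> gr_hodge W F k s"
    using assms(3)
  proof (elim disjE)
    assume k: "k = m"
    then have "x \<in> Wc" using bigr_Wc[OF assms(1)] assms(2) by blast
    then show ?thesis
      unfolding k gr_hodge_m using x by (auto simp: Wc_cnj)
  next
    assume k: "k = m + 1"
    show ?thesis unfolding k gr_hodge_m1 using x sum by auto
  qed
  then show "x \<in> gr_hodge W F k r" "cnj_vec x \<in> gr_hodge W F k s" by auto
qed

text \<open>If \<open>r' \<noteq> s\<close>, then either the first indices add up to more than m or
  the second ones do. The first bilinear relation applies to the vectors in the first case and to
  their conjugates in the second.\<close>

lemma orthogonal0: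
  assumes x: "x \<in> bigr (r, s)" "r + s = m" and y: "y \<in> bigr (r', s')" "r' + s' = m" and ne: "r' \<noteq> s"
  shows "bil q0 x y = 0"
proof (cases "r + r' \<ge> m + 1")
  case True
  have "complex_form (Q m) x y = 0"
    by (rule orthogonal_F[OF bigr_gr_hodge(1)[OF x] bigr_gr_hodge(1)[OF y] True]) auto
  then show ?thesis using form0[OF bigr_Wc[OF x] bigr_Wc[OF y]] by simp
next
  case False
  then have "s + s' \<ge> m + 1" using x y ne by linarith
  from orthogonal_F[OF bigr_gr_hodge(2)[OF x] bigr_gr_hodge(2)[OF y] this]
  have "complex_form (Q m) (cnj_vec x) (cnj_vec y) = 0" by auto
  moreover have "cnj_vec x \<in> Wc" "cnj_vec y \<in> Wc" using bigr_Wc x y by (auto simp: Wc_cnj)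
  ultimately have "bil q0 (cnj_vec x) (cnj_vec y) = 0" using form0 by simp
  then have "cnj (bil q0 x y) = 0" by (simp add: bil_cnj fm_real)
  then show ?thesis by simp
qed

lemma orthogonal1:
  assumes x: "x \<in> bigr (r, s)" "r + s = m + 1" and y: "y \<in> bigr (r', s')" "r' + s' = m + 1" and ne: "r' \<noteq> s"
  shows "bil q1 x y = 0"
proof (cases "r + r' \<ge> m + 1 + 1")
  case True
  have "complex_form (Q (m + 1)) x y = 0"
    by (rule orthogonal_F[OF bigr_gr_hodge(1)[OF x] bigr_gr_hodge(1)[OF y] True]) auto
  then show ?thesis using form1 by simp
next
  case False
  then have "s + s' \<ge> m + 1 + 1" using x y ne by linarith
  from orthogonal_F[OF bigr_gr_hodge(2)[OF x] bigr_gr_hodge(2)[OF y] this]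
  have "complex_form (Q (m + 1)) (cnj_vec x) (cnj_vec y) = 0" by auto
  then have "bil q1 (cnj_vec x) (cnj_vec y) = 0" using form1 by simp
  then have "cnj (bil q1 x y) = 0" by (simp add: bil_cnj fm_real)
  then show ?thesis by simp
qed

text \<open>\<open>q1\<close> pairs the component (r, s) only with (s, r), where the eigenvalues r
  and s of \<open>P\<close> add up to m + 1.\<close>

lemma P_q1: "transpose P ** q1 + q1 ** P = of_int (m + 1) *\<^sub>R q1"
proof (rule bil_eq_on_bigr)
  fix j k x y assume j: "j \<in> J" "k \<in> J" and xy: "x \<in> bigr j" "y \<in> bigr k"
  obtain r s r' s' where jk: "j = (r, s)" "k = (r', s')" by (cases j, cases k)
  have "bil (transpose P ** q1 + q1 ** P) x y = of_int (r + r') * bil q1 x y"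
    unfolding bil_linear_matrix bil_mult_left[symmetric] bil_mult_right[symmetric, where B = P] P_on[OF xy(1)] P_on[OF xy(2)] by (simp add: jk bil_linear algebra_simps)
  also have "\<dots> = of_int (m + 1) * bil q1 x y"
  proof (cases "r + s = m + 1 \<and> r' + s' = m + 1 \<and> r' = s")
    case True
    then have "r + r' = m + 1" by simp
    then show ?thesis by simp
  next
    case False
    have "bil q1 x y = 0"
      using False orthogonal1[of x r s y r' s'] bil_q1_Wc bigr_Wc[of x r s] bigr_Wc[of y r' s'] xy j
      unfolding jk J_def by blast
    then show ?thesis by simp
  qed
  finally show "bil (transpose P ** q1 + q1 ** P) x y = bil (of_int (m + 1) *\<^sub>R q1) x y" by (simp add: bil_scaleR)
qed

lemma S_p: "S ** p = 0"
  unfolding matrix_eq by (simp add: matrix_vector_mul_assoc[symmetric] S_kernel p_in)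

lemma p_S: "p ** (mat 1 - S) = mat 1 - S"
  unfolding matrix_eq by (simp add: matrix_vector_mul_assoc[symmetric] p_on weight_part)

lemma P_Wc: "x \<in> Wc \<Longrightarrow> P *v x \<in> Wc"
proof -
  assume "x \<in> Wc"
  have "S ** P = P ** S"
    by (rule matrix_eq_on_bigr) (auto simp: matrix_vector_mul_assoc[symmetric] P_on S_on vector_scalar_commute)
  then have "S *v (P *v x) = P *v (S *v x)" by (simp add: matrix_vector_mul_assoc)
  also have "S *v x = 0" using \<open>x \<in> Wc\<close> by (simp add: S_kernel)
  finally show ?thesis by (simp add: S_kernel)
qed

lemma pPp: "p ** (P ** p) = P ** p"
  unfolding matrix_eq by (simp add: matrix_vector_mul_assoc[symmetric] p_on P_Wc p_in)

text \<open>The analogous computation for \<open>q0\<close>, which is controlled on W_m only. It is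
  first compressed by 1 - S, which is adapted to the bigrading; as 1 - S fixes the range of
  \<open>p\<close>, the result carries over to the compression by \<open>p\<close>.\<close>

lemma P_q0: "transpose p ** (transpose P ** q0 + q0 ** P) ** p = of_int m *\<^sub>R q0"
proof -
  let ?T = "mat 1 - S"
  have conv: "bil (transpose ?T ** A ** ?T) x y = bil A (?T *v x) (?T *v y)" for A x y
    unfolding bil_mult_right[symmetric, where B = ?T] bil_mult_left[symmetric] ..
  have T: "transpose ?T ** (transpose P ** q0 + q0 ** P) ** ?T = of_int m *\<^sub>R (transpose ?T ** q0 ** ?T)"
  proof (rule bil_eq_on_bigr)
    fix j k x y assume j: "j \<in> J" "k \<in> J" and xy: "x \<in> bigr j" "y \<in> bigr k"
    obtain r s r' s' where jk: "j = (r, s)" "k = (r', s')" by (cases j, cases k)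
    have Tx: "?T *v x = (if r + s = m then x else 0)"
      using xy(1) j by (simp add: matrix_vector_mult_diff_rdistrib S_on jk J_def) auto
    have Ty: "?T *v y = (if r' + s' = m then y else 0)"
      using xy(2) j by (simp add: matrix_vector_mult_diff_rdistrib S_on jk J_def) auto
    have "bil (transpose P ** q0 + q0 ** P) x y = of_int (r + r') * bil q0 x y"
      unfolding bil_linear_matrix bil_mult_left[symmetric] bil_mult_right[symmetric, where B = P] P_on[OF xy(1)] P_on[OF xy(2)] by (simp add: jk bil_linear algebra_simps)
    moreover have "of_int (r + r') * bil q0 x y = of_int m * bil q0 x y" if "r + s = m" "r' + s' = m"
    proof (cases "r' = s")
      case True
      then have "r + r' = m" using that by simp
      then show ?thesis by simp
    next
      case False
      then have "bil q0 x y = 0" using orthogonal0[of x r s y r' s'] xy that jk by blast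
      then show ?thesis by simp
    qed
    ultimately show "bil (transpose ?T ** (transpose P ** q0 + q0 ** P) ** ?T) x y = bil (of_int m *\<^sub>R (transpose ?T ** q0 ** ?T)) x y"
      unfolding bil_scaleR conv Tx Ty by (simp add: bil_linear)
  qed
  have Tp: "?T ** p = p" by (simp add: mm_simps S_p)
  then have Tp': "transpose p ** transpose ?T = transpose p" by (metis transpose_mult)
  have "transpose p ** (transpose ?T ** (transpose P ** q0 + q0 ** P) ** ?T) ** p =
    of_int m *\<^sub>R (transpose p ** (transpose ?T ** q0 ** ?T) ** p)"
    unfolding T by (simp only: mm_simps)
  then have "(transpose p ** transpose ?T) ** (transpose P ** q0 + q0 ** P) ** (?T ** p) =
    of_int m *\<^sub>R ((transpose p ** transpose ?T) ** q0 ** (?T ** p))"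
    by (simp only: matrix_mul_assoc)
  then show ?thesis unfolding Tp Tp' by (simp add: pq0 q0p)
qed

end

section \<open>Smoothness of inverse matrices\<close>

lemma matrix_inv_invertible:
  assumes "invertible A"
  shows "A ** matrix_inv A = mat 1" "matrix_inv A ** A = mat 1"
  using someI_ex[OF assms[unfolded invertible_def]] unfolding matrix_inv_def by auto

lemma matrix_inv_eqI: "A ** B = mat 1 \<Longrightarrow> matrix_inv A = B" for A B :: "'a::field^'n^'n"
proof -
  assume AB: "A ** B = mat 1"
  then have BA: "B ** A = mat 1" by (simp add: matrix_left_right_inverse)
  then have "invertible A" using AB invertible_def by blast
  then have "matrix_inv A ** A = mat 1" by (rule matrix_inv_invertible)
  then have "matrix_inv A ** A ** B = B" by (simp add: matrix_mul_lid)
  then show ?thesis using AB by (simp flip: matrix_mul_assoc)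
qed

lemma matrix_inv_mult:
  fixes A :: "'a::field^'n^'n"
  assumes "det A \<noteq> 0"
  shows "A ** matrix_inv A = mat 1" "matrix_inv A ** A = mat 1"
  using assms matrix_inv_invertible[of A] by (simp_all add: invertible_det_nz)

lemma smooth_on_det:
  fixes A :: "'a::real_normed_vector \<Rightarrow> complex^'n::finite^'n"
  assumes N: "open N" and A: "\<And>i j. smooth_on (\<lambda>x. A x $ i $ j) N"
  shows "smooth_on (\<lambda>x. det (A x)) N"
  unfolding det_def
  by (intro smooth_on_sum smooth_on_mult smooth_on_prod smooth_on_const N A)

lemma smooth_on_matrix_entry:
  fixes A :: "'a::real_normed_vector \<Rightarrow> complex^'n::finite^'n"
  shows "open N \<Longrightarrow> smooth_on A N \<Longrightarrow> smooth_on (\<lambda>x. A x $ i $ j) N"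
  by (intro smooth_on_nth)

text \<open>Cramer's rule writes the entries of the inverse as quotients of polynomials in the
  entries of \<open>A\<close>.\<close>

lemma smooth_on_matrix_inv:
  fixes A :: "'a::real_normed_vector \<Rightarrow> complex^'n::finite^'n"
  assumes N: "open N" and A: "smooth_on A N" and det: "\<And>x. x \<in> N \<Longrightarrow> det (A x) \<noteq> 0"
  shows "smooth_on (\<lambda>x. matrix_inv (A x)) N"
proof (intro smooth_on_vec N)
  fix i j
  let ?C = "\<lambda>x. \<chi> r c. if c = i then axis j 1 $ r else A x $ r $ c"
  have eq: "det (?C x) * inverse (det (A x)) = matrix_inv (A x) $ i $ j" if x: "x \<in> N" for x
  proof -
    have "A x *v (matrix_inv (A x) *v axis j 1) = axis j 1"
      by (simp add: matrix_vector_mul_assoc matrix_inv_mult[OF det[OF x]])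
    then have "matrix_inv (A x) *v axis j 1 = (\<chi> k. det (\<chi> r c. if c = k then axis j 1 $ r else A x $ r $ c) / det (A x))"
      using cramer[OF det[OF x]] by blast
    then have "(matrix_inv (A x) *v axis j 1) $ i = det (?C x) / det (A x)" by simp
    moreover have "(matrix_inv (A x) *v axis j 1) $ i = matrix_inv (A x) $ i $ j"
      by (simp add: matrix_vector_mult_def axis_def if_distrib cong: if_cong)
    ultimately show ?thesis by (simp add: divide_inverse)
  qed
  have "smooth_on (\<lambda>x. ?C x $ r $ c) N" for r c
    using smooth_on_matrix_entry[OF N A] smooth_on_const[OF N] by (cases "c = i") simp_all
  then have "smooth_on (\<lambda>x. det (?C x) * inverse (det (A x))) N"
    by (intro smooth_on_mult[OF N] smooth_on_inverse[OF N] det smooth_on_det[OF N] smooth_on_matrix_entry[OF N A])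
  then show "smooth_on (\<lambda>x. matrix_inv (A x) $ i $ j) N"
    by (rule smooth_on_cong[OF N, rotated]) (rule eq)
qed

context polarized_mhs
begin

section \<open>The Lie algebra\<close>

text \<open>The linearised equations of \<open>G_C\<close> in terms of the Gram matrices.\<close>

definition infinitesimal :: "complex^'n^'n \<Rightarrow> bool" where
  "infinitesimal X \<longleftrightarrow> p ** (X ** p) = X ** p \<and> transpose X ** q1 + q1 ** X = 0 \<and>
     transpose p ** (transpose X ** q0 + q0 ** X) ** p = 0"

text \<open>There W_(k-1) and W_k are both everything, so every vector lies in the radical of the
  form.\<close>

lemma Q_high: "k > m + 1 \<Longrightarrow> complex_form (Q k) u v = 0"
proof -
  assume k: "k > m + 1"
  have "Q k x y = 0" for x y
    using gforms W_high[of k] W_high[of "k - 1"] k unfolding graded_forms_def by (metis UNIV_I less_diff_eq less_trans zless_add1_eq)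
  then show ?thesis by (simp add: complex_form_def complex_eq_iff)
qed

lemma bil_Wc:
  assumes "transpose p ** A ** p = transpose p ** A' ** p" "u \<in> Wc" "v \<in> Wc"
  shows "bil A u v = bil A' u v"
proof -
  have "bil A u v = bil A (p *v u) (p *v v)" for A using assms p_on by simp
  then have "bil A u v = bil (transpose p ** A ** p) u v" for A
    by (simp only: bil_mult_left bil_mult_right matrix_mul_assoc)
  then show ?thesis using assms(1) by metis
qed

text \<open>The Cayley transform provides curves in the group with a prescribed velocity, without recourse
  to the exponential of matrices.\<close>

lemma cayley_in_G:
  assumes X: "infinitesimal Y" and det: "det (mat 1 - Y) \<noteq> 0" "det (mat 1 + Y) \<noteq> 0"
  shows "(mat 1 + Y) ** matrix_inv (mat 1 - Y) \<in> G_C W Q"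
proof -
  let ?M = "matrix_inv (mat 1 - Y)" and ?g = "(mat 1 + Y) ** matrix_inv (mat 1 - Y)"
  have YWc: "Y *v x \<in> Wc" if "x \<in> Wc" for x
    using X p_in[of "Y *v x"] p_on[OF that] unfolding infinitesimal_def
    by (metis matrix_vector_mul_assoc)
  have skew1: "bil q1 (Y *v x) y + bil q1 x (Y *v y) = 0" for x y
  proof -
    have "bil q1 (Y *v x) y + bil q1 x (Y *v y) = bil (transpose Y ** q1 + q1 ** Y) x y"
      by (simp only: bil_linear_matrix bil_mult_left bil_mult_right)
    also have "\<dots> = 0" using X by (simp add: infinitesimal_def bil_def)
    finally show ?thesis .
  qed
  have skew0: "bil q0 (Y *v x) y + bil q0 x (Y *v y) = 0" if "x \<in> Wc" "y \<in> Wc" for x y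
  proof -
    have "bil q0 (Y *v x) y + bil q0 x (Y *v y) = bil (transpose Y ** q0 + q0 ** Y) x y"
      by (simp only: bil_linear_matrix bil_mult_left bil_mult_right)
    also have "\<dots> = bil 0 x y"
      by (rule bil_Wc[OF _ that]) (use X in \<open>simp add: infinitesimal_def mm_zero_left mm_zero_right\<close>)
    finally show ?thesis by (simp add: bil_def)
  qed
  have MM: "(mat 1 - Y) *v (?M *v x) = x" "?M *v ((mat 1 - Y) *v x) = x" for x
    by (simp_all only: matrix_vector_mul_assoc matrix_inv_mult[OF det(1)] matrix_vector_mul_lid)
  have q1Y: "transpose Y ** q1 = - (q1 ** Y)" using X by (simp add: infinitesimal_def add_eq_0_iff2)
  \<comment> \<open>W_m is the kernel of \<open>q1\<close>. Skewness moves \<open>Y\<close> across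
    \<open>q1\<close>, and the claim reduces to the invertibility of
    \<open>mat 1 + transpose Y\<close>.\<close>
  have pre: "x \<in> Wc" if "(mat 1 - Y) *v x \<in> Wc" for x
  proof -
    have "(mat 1 + transpose Y) *v (q1 *v x) = q1 *v ((mat 1 - Y) *v x)"
      by (simp add: matrix_vector_mul_assoc mm_simps q1Y)
    also have "\<dots> = 0" using q1_Wc[OF that] .
    finally have "(mat 1 + transpose Y) *v (q1 *v x) = 0" .
    moreover have "det (mat 1 + transpose Y) = det (mat 1 + Y)"
      using det_transpose[of "mat 1 + Y"] by (simp add: transpose_mat)
    ultimately have "q1 *v x = 0"
      using matrix_inv_mult(2)[of "mat 1 + transpose Y"] det(2)
      by (metis matrix_vector_mul_assoc matrix_vector_mul_lid matrix_vector_mult_0_right)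
    then show ?thesis by (rule q1_ker)
  qed
  have q1Y': "transpose (- Y) ** q1 = - (q1 ** (- Y))" using q1Y by (simp add: mm_simps)
  have pre': "x \<in> Wc" if "(mat 1 + Y) *v x \<in> Wc" for x
  proof -
    have "(mat 1 - transpose Y) *v (q1 *v x) = q1 *v ((mat 1 + Y) *v x)"
      by (simp add: matrix_vector_mul_assoc mm_simps q1Y)
    also have "\<dots> = 0" using q1_Wc[OF that] .
    finally have "(mat 1 - transpose Y) *v (q1 *v x) = 0" .
    moreover have "det (mat 1 - transpose Y) = det (mat 1 - Y)"
      using det_transpose[of "mat 1 - Y"] by (simp add: transpose_mat)
    ultimately have "q1 *v x = 0"
      using matrix_inv_mult(2)[of "mat 1 - transpose Y"] det(1)
      by (metis matrix_vector_mul_assoc matrix_vector_mul_lid matrix_vector_mult_0_right)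
    then show ?thesis by (rule q1_ker)
  qed
  let ?N = "matrix_inv (mat 1 + Y)"
  have NN: "(mat 1 + Y) *v (?N *v x) = x" for x
    by (simp only: matrix_vector_mul_assoc matrix_inv_mult[OF det(2)] matrix_vector_mul_lid)
  have gv: "?g *v x = (mat 1 + Y) *v (?M *v x)" for x by (simp add: matrix_vector_mul_assoc)
  have inv: "invertible ?g"
    by (intro invertible_mult) (use det matrix_inv_mult[OF det(1)] in \<open>auto simp: invertible_det_nz[symmetric] invertible_def\<close>)
  have onto: "(*v) ?g ` Wc = Wc"
  proof safe
    fix x assume "x \<in> Wc"
    then have "?M *v x \<in> Wc" using pre[of "?M *v x"] MM by simp
    then show "?g *v x \<in> Wc"
      unfolding gv by (simp add: matrix_vector_mult_add_rdistrib vec.subspace_add[OF Wc_sub] YWc)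
  next
    fix x assume x: "x \<in> Wc"
    have "?N *v x \<in> Wc" using pre'[of "?N *v x"] NN x by simp
    then have "(mat 1 - Y) *v (?N *v x) \<in> Wc"
      by (simp add: matrix_vector_mult_diff_rdistrib vec.subspace_diff[OF Wc_sub] YWc)
    moreover have "?g *v ((mat 1 - Y) *v (?N *v x)) = x" unfolding gv MM NN ..
    ultimately show "x \<in> (*v) ?g ` Wc" by (metis imageI)
  qed
  have onto': "(*v) ?g ` complexify (W k) = complexify (W k)" for k
  proof -
    consider "k < m" | "k = m" | "k > m" by linarith
    then show ?thesis
    proof cases
      case 1 then show ?thesis by (simp add: W_low)
    next
      case 2 then show ?thesis using onto by simp
    next
      case 3
      have "surj ((*v) ?g)" using inv invertible_right_inverse matrix_right_invertible_surjective by blast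
      then show ?thesis using W_high[OF 3] by simp
    qed
  qed
  \<comment> \<open>For a, b the images of \<open>u\<close>, \<open>v\<close> under
    \<open>?M\<close>, the values of the form at (1 + Y) a, (1 + Y) b and at (1 - Y) a, (1 - Y) b
    differ by twice the skewness expression.\<close>
  have pres: "bil A (?g *v u) (?g *v v) = bil A u v"
    if sk: "bil A (Y *v (?M *v u)) (?M *v v) + bil A (?M *v u) (Y *v (?M *v v)) = 0" for A u v
  proof -
    have "bil A u v = bil A ((mat 1 - Y) *v (?M *v u)) ((mat 1 - Y) *v (?M *v v))" by (simp only: MM)
    moreover have "bil A ((mat 1 + Y) *v a) ((mat 1 + Y) *v b) - bil A ((mat 1 - Y) *v a) ((mat 1 - Y) *v b) =
      2 * (bil A (Y *v a) b + bil A a (Y *v b))" for a b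
      by (simp only: matrix_vector_mult_diff_rdistrib matrix_vector_mult_add_rdistrib matrix_vector_mul_lid bil_linear)
        (simp add: algebra_simps)
    ultimately show ?thesis unfolding gv using sk by (metis eq_iff_diff_eq_0 mult_zero_right)
  qed
  have form: "complex_form (Q k) (?g *v u) (?g *v v) = complex_form (Q k) u v"
    if uv: "u \<in> complexify (W k)" "v \<in> complexify (W k)" for k u v
  proof -
    consider "k < m" | "k = m" | "k = m + 1" | "k > m + 1" by linarith
    then show ?thesis
    proof cases
      case 1 then show ?thesis using uv by (simp add: W_low)
    next
      case 2
      then have uv: "u \<in> Wc" "v \<in> Wc" using uv by auto
      then have g: "?g *v u \<in> Wc" "?g *v v \<in> Wc" using onto by blast+
      have M: "?M *v u \<in> Wc" "?M *v v \<in> Wc" using pre[of "?M *v u"] pre[of "?M *v v"] MM uv by simp_all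
      show ?thesis unfolding 2 form0[OF uv] form0[OF g] by (rule pres) (rule skew0[OF M])
    next
      case 3
      show ?thesis unfolding 3 form1 by (rule pres) (rule skew1)
    next
      case 4 then show ?thesis by (simp add: Q_high)
    qed
  qed
  show ?thesis unfolding G_C_def using inv onto' form by blast
qed

lemma mat_1_in_G: "mat 1 \<in> G_C W Q"
proof -
  have "invertible (mat 1 :: complex^'n^'n)" unfolding invertible_def by (intro exI[of _ "mat 1"]) simp
  then show ?thesis unfolding G_C_def by simp
qed

lemma infinitesimal_scaleR: "infinitesimal X \<Longrightarrow> infinitesimal (r *\<^sub>R X)"
  unfolding infinitesimal_def by (simp add: mm_scaleR_left mm_scaleR_right flip: scaleR_add_right)

lemma infinitesimal_lie:
  assumes X: "infinitesimal X"
  shows "X \<in> lie_algebra (G_C W Q)"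
proof -
  \<comment> \<open>The Cayley transform of tX/2 has velocity X at t = 0, hence the halves.\<close>
  define N where "N = {t::real. det (mat 1 - (t/2) *\<^sub>R X) \<noteq> 0} \<inter> {t. det (mat 1 + (t/2) *\<^sub>R X) \<noteq> 0}"
  have lin: "smooth_on (\<lambda>t::real. (t/2) *\<^sub>R X) UNIV"
  proof -
    have "bounded_linear (\<lambda>t::real. (t/2) *\<^sub>R X)"
      unfolding linear_conv_bounded_linear[symmetric] by (rule linearI) (simp_all add: add_divide_distrib scaleR_left.add)
    moreover have "smooth_on (\<lambda>t::real. t) UNIV"
      unfolding smooth_on_def
    proof
      fix k show "Ck_on k (\<lambda>t::real. t) UNIV"
        by (cases k) (auto intro!: Ck_on_SucI[OF _ has_derivative_ident] Ck_on_const simp del: Ck_on.simps(2))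
    qed
    ultimately show ?thesis by (rule smooth_on_linear[OF _ open_UNIV])
  qed
  have sm: "smooth_on (\<lambda>t::real. mat 1 - (t/2) *\<^sub>R X) UNIV" "smooth_on (\<lambda>t::real. mat 1 + (t/2) *\<^sub>R X) UNIV"
    by (intro smooth_on_diff smooth_on_add smooth_on_const lin open_UNIV)+
  have "open {t::real. det (mat 1 - (t/2) *\<^sub>R X) \<noteq> 0}" "open {t::real. det (mat 1 + (t/2) *\<^sub>R X) \<noteq> 0}"
    by (intro open_Collect_neq continuous_on_const smooth_on_continuous[OF smooth_on_det[OF open_UNIV smooth_on_matrix_entry[OF open_UNIV sm(1)]]]
        smooth_on_continuous[OF smooth_on_det[OF open_UNIV smooth_on_matrix_entry[OF open_UNIV sm(2)]]])+
  then have N: "open N" "0 \<in> N" unfolding N_def by auto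
  define M where "M = (\<lambda>t::real. matrix_inv (mat 1 - (t/2) *\<^sub>R X))"
  \<comment> \<open>\<open>lie_algebra\<close> asks for an element of the group at every
    \<open>t\<close>; off \<open>N\<close> the identity serves, without influence on the derivative
    at 0.\<close>
  define g where "g t = (if t \<in> N then (mat 1 + (t/2) *\<^sub>R X) ** M t else mat 1)" for t
  have "g t \<in> G_C W Q" for t
    unfolding g_def M_def
    using cayley_in_G[OF infinitesimal_scaleR[OF X, of "t/2"]] mat_1_in_G by (auto simp: N_def)
  moreover have M0: "M 0 = mat 1" unfolding M_def by (rule matrix_inv_eqI) simp
  then have "g 0 = mat 1" using N by (simp add: g_def)
  moreover have "(g has_vector_derivative X) (at 0)"
  proof -
    have "smooth_on M N" unfolding M_def
      by (rule smooth_on_matrix_inv[OF N(1) smooth_on_subset[OF sm(1)]]) (auto simp: N_def)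
    then have "continuous_on N M" by (rule smooth_on_continuous)
    then have "(M \<longlongrightarrow> M 0) (at 0)"
      using N(2) unfolding continuous_on_eq_continuous_at[OF N(1)] isCont_def by blast
    then have lim: "((\<lambda>t. X ** M t) \<longlongrightarrow> X) (at 0)"
      using bounded_bilinear.tendsto[OF bounded_bilinear_matrix_mult tendsto_const[of X]
          \<open>(M \<longlongrightarrow> M 0) (at 0)\<close>]
      unfolding M0 matrix_mul_rid by blast
    \<comment> \<open>The difference quotient of the Cayley transform is exactly
      \<open>X ** M t\<close>, so continuity of \<open>M\<close> at 0 suffices.\<close>
    have eq: "norm (g (0 + t) - g 0 - t *\<^sub>R X) / norm t = norm (X ** M t - X)" if t: "t \<in> N" "t \<noteq> 0" for t
    proof -
      have "(mat 1 - (t/2) *\<^sub>R X) ** M t = mat 1" unfolding M_def using t by (intro matrix_inv_mult) (simp add: N_def)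
      then have "g t - mat 1 = (mat 1 + (t/2) *\<^sub>R X) ** M t - (mat 1 - (t/2) *\<^sub>R X) ** M t" using t by (simp add: g_def)
      also have "\<dots> = (t/2) *\<^sub>R (X ** M t) + (t/2) *\<^sub>R (X ** M t)" by (simp add: mm_simps)
      also have "\<dots> = t *\<^sub>R (X ** M t)" by (simp flip: scaleR_left.add)
      finally have "g (0 + t) - g 0 - t *\<^sub>R X = t *\<^sub>R (X ** M t - X)"
        using \<open>g 0 = mat 1\<close> by (simp add: scaleR_diff_right)
      then show ?thesis using t by simp
    qed
    have "((\<lambda>t. norm (X ** M t - X)) \<longlongrightarrow> 0) (at 0)"
      using tendsto_norm[OF tendsto_diff[OF lim tendsto_const[of X]]] by simp
    moreover have "\<forall>\<^sub>F t in at 0. norm (X ** M t - X) = norm (g (0 + t) - g 0 - t *\<^sub>R X) / norm t"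
      unfolding eventually_at_topological using eq N by (intro exI[of _ N]) auto
    ultimately have "((\<lambda>t. norm (g (0 + t) - g 0 - t *\<^sub>R X) / norm t) \<longlongrightarrow> 0) (at 0)"
      using tendsto_cong by force
    then show ?thesis
      unfolding has_vector_derivative_def has_derivative_at by (simp add: bounded_linear_scaleR_left)
  qed
  ultimately show ?thesis unfolding lie_algebra_def by blast
qed

lemma q_space_I:
  assumes A: "infinitesimal A" "has_type (- 1) 1 A" and B: "infinitesimal B" "has_type (- 1) 0 B"
  shows "A + B \<in> q_space W Q F"
proof -
  have "C \<in> q_space W Q F" if "infinitesimal C" "has_type r s C" "r < 0" for C r s
  proof -
    have "C \<in> g_component W Q F r s"
      unfolding g_component_def using infinitesimal_lie[OF that(1)] that(2)
      by (auto simp: deligne_bigrading_eq has_type_def)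
    then show ?thesis unfolding q_space_def using that(3) by (intro span_base) auto
  qed
  then have "A \<in> q_space W Q F" "B \<in> q_space W Q F" using A B by (metis neg_less_0_iff_less zero_less_one)+
  then show ?thesis unfolding q_space_def by (rule span_add)
qed

end

context polarized_mhs
begin

section \<open>The metric on endomorphisms\<close>

abbreviation "T \<equiv> mat 1 - S"

text \<open>Gram matrix of the mixed Hodge metric: \<open>T\<close> and \<open>S\<close> separate
  the two weights and the Weil operator supplies the powers of i.\<close>

definition H :: "complex^'n^'n" where
  "H = transpose (weil ** T) ** q0 ** T + transpose (weil ** S) ** q1 ** S"

lemma bil_H: "bil H x y = bil q0 (weil *v (T *v x)) (T *v y) + bil q1 (weil *v (S *v x)) (S *v y)"
  unfolding H_def bil_linear_matrix bil_mult_right[symmetric, where B = T] bil_mult_right[symmetric, where B = S]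
    bil_mult_left[symmetric] matrix_vector_mul_assoc ..

lemma T_on: "j \<in> J \<Longrightarrow> x \<in> bigr j \<Longrightarrow> T *v x = (if fst j + snd j = m then x else 0)"
  by (auto simp: matrix_vector_mult_diff_rdistrib S_on J_def)

lemma S_on': "j \<in> J \<Longrightarrow> x \<in> bigr j \<Longrightarrow> S *v x = (if fst j + snd j = m then 0 else x)"
  by (auto simp: S_on J_def)

lemma H_on:
  assumes j: "(r, s) \<in> J" and k: "k \<in> J" and x: "x \<in> bigr (r, s)" and y: "y \<in> bigr k"
  shows "bil H x y = (if k = (s, r) then \<i> powi (r - s) * bil (if r + s = m then q0 else q1) x y else 0)"
proof -
  obtain r' s' where k': "k = (r', s')" by (cases k)
  have w: "weil *v x = \<i> powi (r - s) *s x" using weil_on[OF x] by simp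
  have J: "r + s = m \<or> r + s = m + 1" "r' + s' = m \<or> r' + s' = m + 1" using j k by (auto simp: J_def k')
  show ?thesis
  proof (cases "r + s = m")
    case True
    have "bil H x y = bil q0 (\<i> powi (r - s) *s x) (if r' + s' = m then y else 0)"
      unfolding bil_H T_on[OF j x] T_on[OF k y] S_on'[OF j x] using True by (simp add: w k' bil_linear)
    moreover have "bil q0 x y = 0" if "r' + s' = m" "k \<noteq> (s, r)"
      using orthogonal0[of x r s y r' s'] x y True that k' by auto
    ultimately show ?thesis using True k' by (auto simp: bil_linear)
  next
    case False
    then have rs: "r + s = m + 1" using J by simp
    have "bil H x y = bil q1 (\<i> powi (r - s) *s x) (if r' + s' = m then 0 else y)"
      unfolding bil_H T_on[OF j x] S_on'[OF k y] S_on'[OF j x] using False by (simp add: w k' bil_linear)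
    moreover have "bil q1 x y = 0" if "r' + s' = m + 1" "k \<noteq> (s, r)"
      using orthogonal1[of x r s y r' s'] x y rs that k' by auto
    ultimately show ?thesis using rs k' J by (auto simp: bil_linear)
  qed
qed

lemma mixed_hodge_metric_H: "mixed_hodge_metric W Q F u v = bil H u (cnj_vec v)"
proof -
  have sw: "prod.swap j \<in> J" if "j \<in> J" for j using that J_swap by (cases j) auto
  have "bil H u (cnj_vec v) = bil H (\<Sum>j\<in>J. pr j *v u) (\<Sum>k\<in>J. pr k *v cnj_vec v)"
    by (simp only: pr_sum_vec)
  also have "\<dots> = (\<Sum>k\<in>J. \<Sum>j\<in>J. bil H (pr j *v u) (pr k *v cnj_vec v))" by (simp only: bil_sum)
  also have "\<dots> = (\<Sum>j\<in>J. \<Sum>k\<in>J. bil H (pr j *v u) (pr k *v cnj_vec v))" by (rule sum.swap)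
  also have "\<dots> = (\<Sum>(r, s)\<in>J. \<i> powi (r - s) * complex_form (Q (r + s)) (pr (r, s) *v u) (cnj_vec (pr (r, s) *v v)))"
  proof (rule sum.cong[OF refl])
    fix j assume j: "j \<in> J"
    obtain r s where rs: "j = (r, s)" by (cases j)
    have j': "(r, s) \<in> J" "(s, r) \<in> J" using j rs J_swap by auto
    have x: "pr (r, s) *v u \<in> bigr (r, s)" by (rule pr_in[OF j'(1)])
    have y: "cnj_vec (pr (r, s) *v v) \<in> bigr (s, r)" using pr_in[OF j'(1), of v] by (simp add: bigr_swap)
    let ?t = "\<i> powi (r - s) * bil (if r + s = m then q0 else q1) (pr (r, s) *v u) (cnj_vec (pr (r, s) *v v))"
    have "(\<Sum>k\<in>J. bil H (pr j *v u) (pr k *v cnj_vec v)) = (\<Sum>k\<in>J. if k = (s, r) then ?t else 0)"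
    proof (rule sum.cong[OF refl])
      fix k assume k: "k \<in> J"
      show "bil H (pr j *v u) (pr k *v cnj_vec v) = (if k = (s, r) then ?t else 0)"
        unfolding rs H_on[OF j'(1) k x pr_in[OF k]] using pr_cnj_vec[OF j'(2)] by auto
    qed
    also have "\<dots> = ?t" using j'(2) finite_J by simp
    also have "?t = \<i> powi (r - s) * complex_form (Q (r + s)) (pr (r, s) *v u) (cnj_vec (pr (r, s) *v v))"
    proof (cases "r + s = m")
      case True
      then have "pr (r, s) *v u \<in> Wc" "cnj_vec (pr (r, s) *v v) \<in> Wc"
        using bigr_Wc[OF x] bigr_Wc[OF y] by auto
      then show ?thesis using True form0 by simp
    next
      case False
      then have "r + s = m + 1" using j' by (auto simp: J_def)
      then show ?thesis using form1 by simp
    qed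
    finally show "(\<Sum>k\<in>J. bil H (pr j *v u) (pr k *v cnj_vec v)) =
      (case j of (r, s) \<Rightarrow> \<i> powi (r - s) * complex_form (Q (r + s)) (pr (r, s) *v u) (cnj_vec (pr (r, s) *v v)))"
      by (simp add: rs)
  qed
  finally show ?thesis unfolding mixed_hodge_metric_eq[OF gforms] by simp
qed

text \<open>Conjugation changes i^(r - s) by the sign of the parity of r - s. This is the parity of
  the weight, hence also the symmetry sign of the form on that weight.\<close>

lemma H_hermitian: "transpose (cnj_mat H) = H"
proof (rule bil_eq_on_bigr)
  fix j k x y assume j: "j \<in> J" "k \<in> J" and xy: "x \<in> bigr j" "y \<in> bigr k"
  obtain r s r' s' where jk: "j = (r, s)" "k = (r', s')" by (cases j, cases k)
  have j1: "(r, s) \<in> J" and j2: "(s', r') \<in> J" "(s, r) \<in> J" using j jk J_swap by auto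
  have "bil (transpose (cnj_mat H)) x y = bil (cnj_mat H) y x" by (simp only: bil_transpose)
  also have "\<dots> = cnj (bil H (cnj_vec y) (cnj_vec x))" by (simp add: bil_cnj)
  also have "\<dots> = bil H x y"
  proof (cases "r' = s \<and> s' = r")
    case False
    then show ?thesis
      using H_on[OF j1 j(2), of x y] H_on[OF j2, of "cnj_vec y" "cnj_vec x"] xy jk by (auto simp: bigr_swap)
  next
    case True
    have J: "r + s = m \<or> r + s = m + 1" using j1 by (auto simp: J_def)
    have "bil H (cnj_vec y) (cnj_vec x) = \<i> powi (r - s) * bil (if r + s = m then q0 else q1) (cnj_vec y) (cnj_vec x)"
      using H_on[OF j2, of "cnj_vec y" "cnj_vec x"] xy jk True by (auto simp: bigr_swap add.commute)
    then have "cnj (bil H (cnj_vec y) (cnj_vec x)) =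
        (if even (r - s) then 1 else - 1) * \<i> powi (r - s) * bil (if r + s = m then q0 else q1) y x"
      by (simp only: complex_cnj_mult cnj_i_powi bil_cnj) (simp add: fm_real)
    also have "\<dots> = \<i> powi (r - s) * bil (if r + s = m then q0 else q1) x y"
    proof (cases "r + s = m")
      case True
      have "even (r - s) = even m" using True by presburger
      then show ?thesis using bil_q_sym(1)[of x y] True by simp
    next
      case False
      then have "r + s = m + 1" using J by simp
      then have "even (r - s) = even (m + 1)" by presburger
      then show ?thesis using bil_q_sym(2)[of x y] False by simp
    qed
    also have "\<dots> = bil H x y" using H_on[OF j1 j(2), of x y] xy jk True by simp
    finally show ?thesis .
  qed
  finally show "bil (transpose (cnj_mat H)) x y = bil H x y" .
qed

lemma hodge_positive:
  assumes j: "(r, s) \<in> J" and x: "x \<in> bigr (r, s)" "x \<noteq> 0"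
  shows "0 < Re (\<i> powi (r - s) * complex_form (Q (r + s)) x (cnj_vec x))"
proof -
  have J: "r + s = m \<or> r + s = m + 1" using j by (auto simp: J_def)
  have "x \<in> hodge_component W F r s"
    unfolding hodge_component_def Int_iff cnj_vec_image_iff
    using bigr_gr_hodge[OF x(1) refl] J by blast
  moreover have "x \<notin> complexify (W (r + s - 1))"
  proof (cases "r + s = m")
    case True then show ?thesis using x W_low[of "r + s - 1"] by simp
  next
    case False
    then have rs: "r + s = m + 1" using J by simp
    have "x \<notin> Wc"
    proof
      assume "x \<in> Wc"
      then have "pr (r, s) *v x = 0" using j rs unfolding Wc_proj by auto
      then show False using pr_on[OF j j x(1)] x(2) by simp
    qed
    then show ?thesis using rs by simp
  qed
  ultimately show ?thesis using pol unfolding graded_polarized_def by blast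
qed

lemma H_definite:
  assumes "v \<noteq> 0"
  shows "0 < Re (bil H v (cnj_vec v))"
proof -
  let ?t = "\<lambda>j. case j of (r, s) \<Rightarrow> \<i> powi (r - s) * complex_form (Q (r + s)) (pr (r, s) *v v) (cnj_vec (pr (r, s) *v v))"
  have t0: "0 \<le> Re (?t j)" and t1: "pr j *v v \<noteq> 0 \<Longrightarrow> 0 < Re (?t j)" if "j \<in> J" for j
  proof -
    obtain r s where rs: "j = (r, s)" by (cases j)
    show 1: "pr j *v v \<noteq> 0 \<Longrightarrow> 0 < Re (?t j)"
      unfolding rs prod.case using hodge_positive[OF _ pr_in] that rs by blast
    show "0 \<le> Re (?t j)"
    proof (cases "pr j *v v = 0")
      case True
      then show ?thesis using complex_form_zero[OF gforms] by (simp add: rs)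
    next
      case False
      then show ?thesis using 1 less_imp_le by blast
    qed
  qed
  obtain j where j: "j \<in> J" "pr j *v v \<noteq> 0"
    using pr_sum_vec[of v] assms by (metis sum.neutral)
  have "0 < (\<Sum>j\<in>J. Re (?t j))"
    by (rule sum_pos2[where f = "\<lambda>j. Re (?t j)", OF finite_J j(1) t1[OF j]]) (rule t0)
  also have "\<dots> = Re (mixed_hodge_metric W Q F v v)"
    unfolding mixed_hodge_metric_eq[OF gforms] Re_sum ..
  finally show ?thesis by (simp add: mixed_hodge_metric_H)
qed

sublocale hm: definite_hermitian H
  by unfold_locales (fact H_hermitian, fact H_definite)

lemma q1S: "q1 ** S = q1"
proof -
  have "q1 ** T = 0"
    unfolding matrix_eq by (simp add: matrix_vector_mul_assoc[symmetric] q1_Wc weight_part)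
  then show ?thesis by (simp add: mm_simps)
qed

text \<open>A map of this type lowers the weight by one, so it can only lead from weight m + 1 to
  weight m, and the statements follow by blocks. The factor -i is the change of i^(p - q) when p
  drops by one.\<close>

lemma type_B:
  assumes B: "has_type (- 1) 0 B"
  shows "S ** B = 0" "B ** S = B" "weil ** B = - (mat \<i> ** (B ** weil))" "off_diagonal B" "infinitesimal B"
    "T ** B = B" "B ** T = 0"
proof -
  have Bx: "B *v x \<in> bigr (r - 1, s)" if "x \<in> bigr (r, s)" for x r s using B that by (auto simp: has_type_def)
  show SB: "S ** B = 0"
  proof (rule matrix_eq_on_bigr)
    fix j x assume j: "j \<in> J" and x: "x \<in> bigr j"
    obtain r s where rs: "j = (r, s)" by (cases j)
    have "r - 1 + s \<noteq> m + 1" using j rs by (auto simp: J_def)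
    then show "(S ** B) *v x = 0 *v x"
      using S_on[OF Bx, of x r s] x rs by (simp add: matrix_vector_mul_assoc[symmetric])
  qed
  show BS: "B ** S = B"
  proof (rule matrix_eq_on_bigr)
    fix j x assume j: "j \<in> J" and x: "x \<in> bigr j"
    obtain r s where rs: "j = (r, s)" by (cases j)
    have "bigr (r - 1, s) = {0}" if "r + s = m" using that by (intro bigr_other) auto
    then have "B *v x = 0" if "r + s = m" using Bx[of x r s] x rs that by auto
    then show "(B ** S) *v x = B *v x"
      using S_on'[OF j x] rs by (auto simp: matrix_vector_mul_assoc[symmetric])
  qed
  have "weil ** B = mat (- \<i>) ** (B ** weil)"
    unfolding weil_def by (rule opr_type[OF B]) (simp add: power_int_diff)
  moreover have "mat (- \<i>) ** A = - (mat \<i> ** A)" for A :: "complex^'n^'n"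
    by (simp add: vec_eq_iff mat_mult_entry)
  ultimately show "weil ** B = - (mat \<i> ** (B ** weil))" by simp
  show TB: "T ** B = B" by (simp add: mm_simps SB)
  show "B ** T = 0" by (simp add: mm_diff_right BS)
  have Bp: "B ** p = 0" by (subst BS[symmetric]) (simp add: matrix_mul_assoc' S_p mm_zero_right)
  have pB: "p ** B = B" by (subst TB[symmetric]) (simp add: matrix_mul_assoc p_S, simp add: mm_diff_left SB)
  show "off_diagonal B" using Bp pB by (simp add: off_diagonal_def)
  have qB: "q1 ** B = 0"
    unfolding matrix_eq using S_kernel[of "B *v _"] q1_Wc SB
    by (metis matrix_vector_mul_assoc matrix_vector_mult_0)
  have "transpose B ** transpose q1 = 0"
    using arg_cong[OF qB, of transpose] by (simp only: transpose_mult transpose_linear(4))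
  then have "transpose B ** q1 = 0"
    by (cases "even m") (simp_all add: q1_sym mm_simps)
  moreover have "transpose p ** transpose B = 0"
    using arg_cong[OF Bp, of transpose] by (simp only: transpose_mult transpose_linear(4))
  then have "transpose p ** (transpose B ** q0 + q0 ** B) ** p = transpose p ** q0 ** (B ** p)"
    by (simp only: mm_add_left mm_add_right matrix_mul_assoc mm_zero_left add_0_left)
  ultimately show "infinitesimal B"
    unfolding infinitesimal_def using qB Bp by (simp add: mm_zero_right)
qed

text \<open>The formula for the adjoint of an element of \<open>q\<^sub>F\<close> with components \<open>\<theta> - B\<close> of type \<open>(-1, 1)\<close> and
  \<open>B\<close> of type \<open>(-1, 0)\<close>.\<close>

definition adj :: "complex^'n^'n \<Rightarrow> complex^'n^'n \<Rightarrow> complex^'n^'n" where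
  "adj \<theta> B = cnj_mat (\<theta> - B) + mat \<i> ** (S ** K ** transpose (cnj_mat B) ** q0 ** T)"

text \<open>The weight is preserved, and i^(p - q) changes sign because p - q drops by two.\<close>

lemma type_A:
  assumes A: "has_type (- 1) 1 A"
  shows "S ** A = A ** S" "weil ** A = - (A ** weil)" "T ** A = A ** T"
proof -
  have "S ** A = mat 1 ** (A ** S)"
    unfolding S_def by (rule opr_type[OF A]) simp
  then show SA: "S ** A = A ** S" by simp
  then show "T ** A = A ** T" by (simp add: mm_simps)
  have "weil ** A = mat (- 1) ** (A ** weil)"
    unfolding weil_def
  proof (rule opr_type[OF A])
    fix r s
    have "\<i> powi (r - 1 - (s + 1)) = \<i> powi (r - s - 2)" by (simp add: algebra_simps)
    also have "\<dots> = - 1 * \<i> powi (r - s)" by (simp add: power_int_diff)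
    finally show "\<i> powi (fst (r + - 1, s + 1) - snd (r + - 1, s + 1)) = - 1 * \<i> powi (fst (r, s) - snd (r, s))"
      by simp
  qed
  then show "weil ** A = - (A ** weil)" by (simp add: vec_eq_iff mat_mult_entry)
qed

lemma weil_S: "weil ** S = S ** weil" "weil ** T = T ** weil"
proof -
  show 1: "weil ** S = S ** weil"
    by (rule matrix_eq_on_bigr) (auto simp: matrix_vector_mul_assoc[symmetric] weil_on S_on vector_scalar_commute)
  then show "weil ** T = T ** weil" by (simp add: mm_simps)
qed

text \<open>\<open>K\<close> is a left inverse of \<open>q1\<close> modulo \<open>p\<close>; on the
  transpose of an off-diagonal matrix, which factors through \<open>q1\<close>, it is a right
  inverse too.\<close>

lemma q1KBT: "off_diagonal B \<Longrightarrow> q1 ** (K ** transpose B) = transpose B"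
proof -
  assume B: "off_diagonal B"
  define e :: real where "e = (if even m then 1 else - 1)"
  note o = off_diagonal_factor'[OF B, folded e_def]
  have "q1 ** (K ** transpose B) = - (e *\<^sub>R ((q1 ** (K ** q1)) ** (transpose K ** transpose B)))"
    by (subst o) (simp only: mm_minus_right mm_scaleR_right matrix_mul_assoc)
  then show ?thesis unfolding q1Kq1 o[symmetric] .
qed

text \<open>The component of type (-1, 1) is skew for the polarizations and anticommutes with the
  Weil operator; the two signs cancel and its adjoint is its conjugate. For \<open>B\<close> the
  Weil operator contributes a factor i instead.\<close>

lemma adj_works:
  assumes A: "has_type (- 1) 1 (\<theta> - B)" "infinitesimal (\<theta> - B)" and B: "has_type (- 1) 0 B"
  shows "bil H (\<theta> *v u) (cnj_vec v) = bil H u (cnj_vec (adj \<theta> B *v v))"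
proof -
  define A where "A = \<theta> - B"
  note tA = type_A[OF A(1), folded A_def] and tB = type_B[OF B]
  define Z0 where "Z0 = weil ** T"
  define Z1 where "Z1 = weil ** S"
  have H: "H = transpose Z0 ** q0 ** T + transpose Z1 ** q1 ** S" by (simp add: H_def Z0_def Z1_def)
  have pT: "p ** T = T" by (rule p_S)
  have "p ** Z0 = Z0" unfolding Z0_def weil_S(2) by (simp only: matrix_mul_assoc pT)
  then have Z0p: "transpose Z0 ** transpose p = transpose Z0" by (metis transpose_mult)
  have "Z0 ** A = - (A ** Z0)"
    unfolding Z0_def matrix_mul_assoc'[of weil] tA(3) by (simp only: matrix_mul_assoc tA(2) mm_minus_left)
  then have Z0A: "transpose A ** transpose Z0 = - (transpose Z0 ** transpose A)"
    by (metis transpose_mult transpose_linear(3))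
  have "Z1 ** A = - (A ** Z1)"
    unfolding Z1_def matrix_mul_assoc'[of weil] tA(1) by (simp only: matrix_mul_assoc tA(2) mm_minus_left)
  then have Z1A: "transpose A ** transpose Z1 = - (transpose Z1 ** transpose A)"
    by (metis transpose_mult transpose_linear(3))
  have sk1: "transpose A ** q1 = - (q1 ** A)"
    using A(2) by (simp add: infinitesimal_def A_def add_eq_0_iff2)
  have sk0: "transpose p ** transpose A ** q0 ** p = - (transpose p ** q0 ** A ** p)"
    using A(2) by (simp add: infinitesimal_def A_def mm_add_left mm_add_right matrix_mul_assoc add_eq_0_iff2)
  have "transpose A ** (transpose Z0 ** q0 ** T) = - (transpose Z0 ** transpose A ** q0 ** T)"
    by (simp only: matrix_mul_assoc Z0A mm_minus_left)
  also have "\<dots> = - (transpose Z0 ** (transpose p ** transpose A ** q0 ** p) ** T)"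
    by (subst Z0p[symmetric], subst pT[symmetric]) (simp only: matrix_mul_assoc)
  also have "\<dots> = (transpose Z0 ** transpose p) ** q0 ** A ** (p ** T)"
    unfolding sk0 by (simp only: mm_minus_left mm_minus_right matrix_mul_assoc minus_minus)
  also have "\<dots> = transpose Z0 ** q0 ** T ** A"
    unfolding Z0p pT by (simp only: matrix_mul_assoc'[of _ A] tA(3)[symmetric]) (simp only: matrix_mul_assoc)
  finally have 1: "transpose A ** (transpose Z0 ** q0 ** T) = transpose Z0 ** q0 ** T ** A" .
  have "transpose A ** (transpose Z1 ** q1 ** S) = - (transpose Z1 ** (transpose A ** q1) ** S)"
    by (simp only: matrix_mul_assoc Z1A mm_minus_left)
  also have "\<dots> = transpose Z1 ** q1 ** (A ** S)"
    unfolding sk1 by (simp only: mm_minus_left mm_minus_right matrix_mul_assoc minus_minus)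
  also have "\<dots> = transpose Z1 ** q1 ** S ** A" by (simp only: tA(1)[symmetric] matrix_mul_assoc)
  finally have AH: "transpose A ** H = H ** A" using 1 unfolding H by (simp only: mm_add_left mm_add_right)
  \<comment> \<open>The adjoint of \<open>B\<close> with respect to the bilinear forms
    \<open>q1\<close> on the source and \<open>q0\<close> on the target, extended by zero.\<close>
  define G where "G = S ** K ** transpose B ** q0 ** T"
  have TS: "T ** S = 0" by (simp add: mm_diff_left S_idem)
  have "Z0 ** B = - (mat \<i> ** (B ** weil))"
    unfolding Z0_def matrix_mul_assoc'[of weil] tB(6) tB(3) ..
  then have Z0B: "transpose B ** transpose Z0 = - (mat \<i> ** transpose (B ** weil))"
    by (metis transpose_mult transpose_linear(3) transpose_mat_mult)
  have "Z1 ** B = 0" unfolding Z1_def matrix_mul_assoc'[of weil] tB(1) mm_zero_right ..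
  then have Z1B: "transpose B ** transpose Z1 = 0" by (metis transpose_mult transpose_linear(4))
  have BH: "transpose B ** H = - (mat \<i> ** (transpose (B ** weil) ** q0 ** T))"
    unfolding H mm_add_right matrix_mul_assoc Z0B Z1B by (simp only: mm_minus_left mm_zero_left matrix_mul_assoc) simp
  have "B ** Z1 = B ** weil" unfolding Z1_def weil_S(1) by (simp only: matrix_mul_assoc tB(2))
  then have BZ: "transpose Z1 ** transpose B = transpose (B ** weil)" by (metis transpose_mult)
  have "H ** G = transpose Z0 ** q0 ** (T ** S) ** K ** transpose B ** q0 ** T
     + transpose Z1 ** (q1 ** S) ** S ** K ** transpose B ** q0 ** T"
    unfolding H G_def by (simp only: mm_add_left matrix_mul_assoc)
  also have "\<dots> = transpose Z1 ** (q1 ** S) ** K ** transpose B ** q0 ** T"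
    unfolding TS q1S by (simp only: mm_zero_left mm_zero_right matrix_mul_assoc'[of _ q1] q1S add_0_left)
  also have "\<dots> = transpose Z1 ** (q1 ** (K ** transpose B)) ** q0 ** T"
    unfolding q1S by (simp only: matrix_mul_assoc)
  also have "\<dots> = transpose (B ** weil) ** q0 ** T" unfolding q1KBT[OF tB(4)] BZ ..
  finally have BH': "transpose B ** H = - (mat \<i> ** (H ** G))" using BH by simp
  have cadj: "cnj_mat (adj \<theta> B) = A - mat \<i> ** G"
  proof -
    have "mat (- \<i>) ** M = - (mat \<i> ** M)" for M :: "complex^'n^'n"
      by (simp add: vec_eq_iff mat_mult_entry)
    then show ?thesis
      unfolding adj_def A_def G_def by (simp add: cnj_mat_mult cnj_S fm_real cnj_mat_transpose)
  qed
  have "\<theta> = A + B" by (simp add: A_def)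
  then have "transpose \<theta> ** H = H ** cnj_mat (adj \<theta> B)"
    unfolding cadj by (simp add: mm_add_left mm_diff_right AH BH' mat_left_commute)
  then show ?thesis by (simp only: cnj_vec_mult bil_mult_left bil_mult_right)
qed

lemma metric_adjoint_eq:
  assumes "has_type (- 1) 1 (\<theta> - B)" "infinitesimal (\<theta> - B)" "has_type (- 1) 0 B"
  shows "metric_adjoint W Q F \<theta> = adj \<theta> B"
  unfolding metric_adjoint_def mixed_hodge_metric_H
proof (rule the_equality)
  show "\<forall>u v. bil H (\<theta> *v u) (cnj_vec v) = bil H u (cnj_vec (adj \<theta> B *v v))"
    using adj_works[OF assms] by blast
  fix C assume C: "\<forall>u v. bil H (\<theta> *v u) (cnj_vec v) = bil H u (cnj_vec (C *v v))"
  show "C = adj \<theta> B"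
    unfolding matrix_eq
  proof
    fix v show "C *v v = adj \<theta> B *v v"
      by (rule hm.hf_nondegenerate) (metis C adj_works[OF assms])
  qed
qed

text \<open>\<open>\<theta>1\<close> has no block from weight m to weight m + 1, so it is
  trace-orthogonal to the conjugate of \<open>B2\<close>. Its block from weight m + 1 to weight m is
  \<open>B1\<close>, and only this block meets the correction term of the adjoint.\<close>

lemma metric_End_eq:
  assumes 1: "has_type (- 1) 1 (\<theta>1 - B1)" "has_type (- 1) 0 B1"
    and 2: "has_type (- 1) 1 (\<theta>2 - B2)" "infinitesimal (\<theta>2 - B2)" "has_type (- 1) 0 B2"
  shows "mixed_hodge_metric_End W Q F \<theta>1 \<theta>2 = trace (\<theta>1 ** cnj_mat \<theta>2) + \<i> * beta B1 (cnj_mat B2)"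
proof -
  note tA = type_A[OF 1(1)] and tB1 = type_B[OF 1(2)] and tB2 = type_B[OF 2(3)]
  have TS: "T ** S = 0" "S ** T = 0" by (simp_all add: mm_diff_left mm_diff_right S_idem)
  have th: "\<theta>1 = (\<theta>1 - B1) + B1" by simp
  have "S ** \<theta>1 ** T = S ** (\<theta>1 - B1) ** T + S ** B1 ** T"
    by (subst th) (simp only: mm_add_left mm_add_right)
  also have "\<dots> = (\<theta>1 - B1) ** (S ** T)" unfolding tA(1) tB1(1) mm_zero_left by (simp add: matrix_mul_assoc)
  finally have SthT: "S ** \<theta>1 ** T = 0" by (simp add: TS mm_zero_right)
  have "T ** \<theta>1 ** S = T ** (\<theta>1 - B1) ** S + T ** B1 ** S"
    by (subst th) (simp only: mm_add_left mm_add_right)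
  also have "\<dots> = (\<theta>1 - B1) ** (T ** S) + B1" unfolding tA(3) tB1(6) tB1(2) by (simp add: matrix_mul_assoc)
  finally have TthS: "T ** \<theta>1 ** S = B1" by (simp add: TS mm_zero_right)
  have c1: "cnj_mat B2 ** S = cnj_mat B2" using arg_cong[OF tB2(2), of cnj_mat] by (simp add: cnj_mat_mult cnj_S)
  have c2: "T ** cnj_mat B2 = cnj_mat B2" using arg_cong[OF tB2(6), of cnj_mat] by (simp add: cnj_mat_mult cnj_S)
  have "trace (\<theta>1 ** cnj_mat B2) = trace (\<theta>1 ** T ** cnj_mat B2 ** S)"
    by (simp only: matrix_mul_assoc'[of _ T] c2 matrix_mul_assoc'[of _ "cnj_mat B2" S] c1)
  also have "\<dots> = trace (S ** \<theta>1 ** T ** cnj_mat B2)"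
    by (subst trace_mult_commute) (simp only: matrix_mul_assoc)
  also have "\<dots> = 0" unfolding SthT by (simp add: mm_zero_left)
  finally have t1: "trace (\<theta>1 ** cnj_mat B2) = 0" .
  define G where "G = S ** K ** transpose (cnj_mat B2) ** q0 ** T"
  have "trace (\<theta>1 ** (S ** K ** transpose (cnj_mat B2) ** q0 ** T)) = trace ((\<theta>1 ** S ** K ** transpose (cnj_mat B2) ** q0) ** T)"
    by (simp only: matrix_mul_assoc)
  also have "\<dots> = trace ((T ** \<theta>1 ** S) ** K ** transpose (cnj_mat B2) ** q0)"
    by (subst trace_mult_commute) (simp only: matrix_mul_assoc)
  also have "\<dots> = beta B1 (cnj_mat B2)" unfolding TthS beta_def ..
  finally have t2: "trace (\<theta>1 ** G) = beta B1 (cnj_mat B2)" unfolding G_def .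
  show ?thesis
    unfolding mixed_hodge_metric_End_def metric_adjoint_eq[OF 2] adj_def G_def[symmetric]
    by (simp add: mm_add_right mm_diff_right t1 mat_left_commute trace_mat_mult t2)
qed

lemma metric_End_nonneg:
  assumes "has_type (- 1) 1 (\<theta> - B)" "infinitesimal (\<theta> - B)" "has_type (- 1) 0 B"
  shows "0 \<le> Re (mixed_hodge_metric_End W Q F \<theta> \<theta>)"
  unfolding mixed_hodge_metric_End_def metric_adjoint_eq[OF assms]
  by (rule hm.trace_adjoint_nonneg) (rule adj_works[OF assms])

text \<open>Elements of q_F lower the first index strictly, whereas a map preserving
  \<open>F\<close> never lowers it. This gives uniqueness of the representative of a tangent
  vector.\<close>

lemma q_space_zero:
  assumes u: "u \<in> q_space W Q F" and F: "\<And>r x. x \<in> F r \<Longrightarrow> u *v x \<in> F r"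
  shows "u = 0"
proof -
  define L where "L = {u. \<forall>j\<in>J. \<forall>k\<in>J. \<forall>x\<in>bigr j. fst j \<le> fst k \<longrightarrow> pr k *v (u *v x) = 0}"
  have sub: "subspace L"
    unfolding subspace_def L_def
    by (auto simp: matrix_vector_mult_add_rdistrib matrix_vector_right_distrib scaleR_matrix mat_mult_vec
        matrix_vector_mul_assoc[symmetric] vector_scalar_commute)
  have "(\<Union>(r, s)\<in>{(r, s). r < 0}. g_component W Q F r s) \<subseteq> L"
  proof clarify
    fix X r s assume r: "r < (0::int)" and X: "X \<in> g_component W Q F r s"
    show "X \<in> L"
      unfolding L_def
    proof (clarify)
      fix a b c d x assume j: "(a, b) \<in> J" "(c, d) \<in> J" "x \<in> bigr (a, b)" "fst (a, b) \<le> fst (c, d)"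
      have Xx: "X *v x \<in> bigr (a + r, b + s)"
        using X j(3) unfolding g_component_def deligne_bigrading_eq by blast
      show "pr (c, d) *v (X *v x) = 0"
      proof (cases "(a + r, b + s) \<in> J")
        case True
        then show ?thesis using pr_on[OF True j(2) Xx] j(4) r by auto
      next
        case False
        then show ?thesis using bigr_zero[OF False] Xx by simp
      qed
    qed
  qed
  then have uL: "u \<in> L" using u span_minimal[OF _ sub] unfolding q_space_def by blast
  show ?thesis
  proof (rule matrix_eq_on_bigr)
    fix j x assume j: "j \<in> J" and x: "x \<in> bigr j"
    obtain r s where rs: "j = (r, s)" by (cases j)
    have "u *v x \<in> F r" using F x bigr_F rs by blast
    then have "pr k *v (u *v x) = 0" if "k \<in> J" for k
      using that uL j x rs unfolding F_proj L_def by (cases "fst k < r") force+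
    then have "(\<Sum>k\<in>J. pr k *v (u *v x)) = 0" by simp
    then show "u *v x = 0 *v x" by (simp only: pr_sum_vec matrix_vector_mult_0)
  qed
qed

end

section \<open>Smoothness of intersections and projections\<close>

abbreviation hip :: "complex^'n::finite \<Rightarrow> complex^'n \<Rightarrow> complex" where
  "hip u v \<equiv> bil (mat 1) u (cnj_vec v)"

definition ctr :: "complex^'n::finite^'n \<Rightarrow> complex^'n^'n" where
  "ctr A = cnj_mat (transpose A)"

lemma hip_sum: "hip u v = (\<Sum>i\<in>UNIV. u $ i * cnj (v $ i))"
  by (simp add: bil_def cnj_vec_def)

lemma hip_self: "hip v v = of_real (\<Sum>i\<in>UNIV. (cmod (v $ i))\<^sup>2)"
  by (simp add: hip_sum complex_norm_square[symmetric])

lemma hip_eq_0: "hip v v = 0 \<Longrightarrow> v = 0"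
  unfolding hip_self of_real_eq_0_iff by (subst (asm) sum_nonneg_eq_0_iff) (auto simp: vec_eq_iff)

lemma hip_self_ge: "0 \<le> Re (hip v v)"
  unfolding hip_self by (simp add: sum_nonneg)

lemma hip_ctr: "hip (A *v u) v = hip u (ctr A *v v)"
  by (simp only: bil_mult_left bil_mult_right cnj_vec_mult ctr_def cnj_mat_cnj_mat matrix_mul_lid matrix_mul_rid)

lemma ctr_ctr [simp]: "ctr (ctr A) = A"
  by (simp add: ctr_def cnj_mat_transpose)

lemma bounded_linear_ctr: "bounded_linear ctr"
  unfolding ctr_def
  by (rule bounded_linear_compose[OF bounded_linear_cnj_mat bounded_linear_transpose])

lemma subspace_range: "vec.subspace (range ((*v) A))" for A :: "complex^'n::finite^'n"
proof (rule vec.subspaceI)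
  show "0 \<in> range ((*v) A)" by (rule range_eqI[of _ _ 0]) simp
next
  fix x y assume "x \<in> range ((*v) A)" "y \<in> range ((*v) A)"
  then obtain u v where "x = A *v u" "y = A *v v" by auto
  then show "x + y \<in> range ((*v) A)" by (intro range_eqI[of _ _ "u + v"]) (simp add: matrix_vector_right_distrib)
next
  fix c x assume "x \<in> range ((*v) A)"
  then obtain u where "x = A *v u" by auto
  then show "c *s x \<in> range ((*v) A)" by (intro range_eqI[of _ _ "c *s u"]) (simp add: vector_scalar_commute)
qed

lemma real_subspace: "vec.subspace U \<Longrightarrow> subspace U" for U :: "(complex^'n::finite) set"
  unfolding subspace_def vec.subspace_def scaleR_eq_smult by blast

text \<open>A vector orthogonal to the range of the total Gram matrix is killed by every
  \<open>ctr (K i)\<close>, as the sum of the squared norms vanishes. Thus the span of a frame of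
  any length becomes the range of one square matrix depending smoothly on the frame.\<close>

lemma range_gram_sum:
  fixes K :: "'i \<Rightarrow> complex^'n::finite^'n"
  assumes fin: "finite I"
  shows "range ((*v) (\<Sum>i\<in>I. K i ** ctr (K i))) = {\<Sum>i\<in>I. K i *v x i | x. True}" (is "?U = ?V")
proof
  have GU: "(\<Sum>i\<in>I. K i ** ctr (K i)) *v u = (\<Sum>i\<in>I. K i *v (ctr (K i) *v u))" for u
    by (simp add: sum_matrix_vec matrix_vector_mul_assoc)
  show UV: "?U \<subseteq> ?V"
  proof
    fix y assume "y \<in> ?U"
    then obtain u where "y = (\<Sum>i\<in>I. K i ** ctr (K i)) *v u" by auto
    then show "y \<in> ?V" unfolding GU by (intro CollectI exI[of _ "\<lambda>i. ctr (K i) *v u"]) simp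
  qed
  have sU: "vec.subspace ?U" by (rule subspace_range)
  have rU: "subspace ?U" by (rule real_subspace[OF sU])
  show "?V \<subseteq> ?U"
  proof
    fix x assume "x \<in> ?V"
    then obtain a where a: "x = (\<Sum>i\<in>I. K i *v a i)" by blast
    obtain y z where yz: "y \<in> span ?U" "\<And>w. w \<in> span ?U \<Longrightarrow> orthogonal z w" "x = y + z"
      by (rule orthogonal_subspace_decomp_exists[of ?U x]) blast
    have sp: "span ?U = ?U" using rU by (rule span_eq_iff[THEN iffD2])
    have orth: "z \<bullet> w = 0" if "w \<in> ?U" for w using yz(2) that unfolding sp orthogonal_def by blast
    have ip: "u \<bullet> w = Re (hip u w)" for u w :: "complex^'n"
      by (simp add: hip_sum inner_vec_def inner_complex_def)
    have "hip z w = 0" if w: "w \<in> ?U" for w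
    proof -
      \<comment> \<open>The decomposition is orthogonal for the real inner product only; as
        \<open>?U\<close> is a complex subspace, testing against \<open>\<i> *s w\<close> yields
        hermitian orthogonality.\<close>
      have "\<i> *s w \<in> ?U" using sU w vec.subspace_scale by blast
      then have "Re (hip z (\<i> *s w)) = 0" using orth ip by metis
      moreover have "hip z (\<i> *s w) = - \<i> * hip z w" by (simp add: bil_linear)
      moreover have "Re (hip z w) = 0" using orth[OF w] ip by metis
      ultimately show ?thesis by (simp add: complex_eq_iff)
    qed
    then have "cnj (hip z ((\<Sum>i\<in>I. K i ** ctr (K i)) *v z)) = 0" by blast
    moreover have "cnj (hip u v) = hip v u" for u v :: "complex^'n" by (simp add: hip_sum mult.commute)
    ultimately have "hip ((\<Sum>i\<in>I. K i ** ctr (K i)) *v z) z = 0" by metis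
    then have "(\<Sum>i\<in>I. hip (ctr (K i) *v z) (ctr (K i) *v z)) = 0"
      unfolding GU by (simp add: bil_sum hip_ctr)
    then have "(\<Sum>i\<in>I. Re (hip (ctr (K i) *v z) (ctr (K i) *v z))) = 0" by (simp flip: Re_sum)
    then have R0: "\<forall>i\<in>I. Re (hip (ctr (K i) *v z) (ctr (K i) *v z)) = 0"
      using sum_nonneg_eq_0_iff[OF fin, of "\<lambda>i. Re (hip (ctr (K i) *v z) (ctr (K i) *v z))"] hip_self_ge by blast
    have cz: "ctr (K i) *v z = 0" if "i \<in> I" for i
    proof -
      have "Re (hip (ctr (K i) *v z) (ctr (K i) *v z)) = 0" using R0 that by blast
      then have "hip (ctr (K i) *v z) (ctr (K i) *v z) = 0" unfolding hip_self by simp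
      then show ?thesis by (rule hip_eq_0)
    qed
    obtain b where b: "y = (\<Sum>i\<in>I. K i *v b i)" using yz(1) UV unfolding sp by blast
    have "z = (\<Sum>i\<in>I. K i *v a i) - (\<Sum>i\<in>I. K i *v b i)" using yz(3) a b by simp
    also have "\<dots> = (\<Sum>i\<in>I. K i *v (a i - b i))"
      by (simp add: matrix_vector_mult_diff_distrib sum_subtractf)
    finally have t: "z = (\<Sum>i\<in>I. K i *v (a i - b i))" .
    have "hip z z = hip (\<Sum>i\<in>I. K i *v (a i - b i)) z" by (subst t) simp
    also have "\<dots> = (\<Sum>i\<in>I. hip (a i - b i) (ctr (K i) *v z))" by (simp add: bil_sum hip_ctr)
    also have "\<dots> = 0" using cz by (simp add: bil_linear)
    finally have "z = 0" by (rule hip_eq_0)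
    then show "x \<in> ?U" using yz(1,3) sp by simp
  qed
qed

lemma range_gram: "range ((*v) (A ** ctr A)) = range ((*v) A)" for A :: "complex^'n::finite^'n"
  using range_gram_sum[of "{()}" "\<lambda>_. A"] by auto

lemma gram_det:
  fixes K :: "'i \<Rightarrow> complex^'n::finite^'n"
  assumes fin: "finite I" and span: "\<And>v. \<exists>x. v = (\<Sum>i\<in>I. K i *v x i)"
  shows "det (\<Sum>i\<in>I. K i ** ctr (K i)) \<noteq> 0"
proof -
  have "surj ((*v) (\<Sum>i\<in>I. K i ** ctr (K i)))"
    unfolding range_gram_sum[OF fin] using span by auto
  then show ?thesis
    by (simp add: invertible_det_nz[symmetric] invertible_right_inverse matrix_right_invertible_surjective)
qed

text \<open>The parallel sum of the Gram matrices of two spanning families; its range is the intersection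
  of the ranges.\<close>

definition parallel_sum :: "complex^'n::finite^'n \<Rightarrow> complex^'n^'n \<Rightarrow> complex^'n^'n" where
  "parallel_sum A B = A ** ctr A ** matrix_inv (A ** ctr A + B ** ctr B) ** (B ** ctr B)"

lemma parallel_sum_det:
  fixes A B :: "complex^'n::finite^'n"
  assumes "\<And>v. \<exists>a b. v = A *v a + B *v b"
  shows "det (A ** ctr A + B ** ctr B) \<noteq> 0"
proof -
  have "det (\<Sum>i\<in>{True, False}. (if i then A else B) ** ctr (if i then A else B)) \<noteq> 0"
  proof (rule gram_det)
    fix v
    obtain a b where "v = A *v a + B *v b" using assms by blast
    then show "\<exists>x. v = (\<Sum>i\<in>{True, False}. (if i then A else B) *v x i)"
      by (intro exI[of _ "\<lambda>i. if i then a else b"]) simp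
  qed simp
  then show ?thesis by simp
qed

text \<open>With X, Y the Gram matrices and M the inverse of X + Y, both X M Y and Y M X equal X - X
  M X, so the range lies in both ranges. If v = X a = Y b, then applying X M Y to a + b returns
  v.\<close>

lemma parallel_sum_range:
  fixes A B :: "complex^'n::finite^'n"
  assumes AB: "\<And>v. \<exists>a b. v = A *v a + B *v b"
  shows "range ((*v) (parallel_sum A B)) = range ((*v) A) \<inter> range ((*v) B)"
proof -
  define X where "X = A ** ctr A"
  define Y where "Y = B ** ctr B"
  define M where "M = matrix_inv (X + Y)"
  have M: "(X + Y) ** M = mat 1" "M ** (X + Y) = mat 1"
    unfolding M_def X_def Y_def using matrix_inv_mult[OF parallel_sum_det[OF AB]] by auto
  have sw: "X ** M ** Y = Y ** M ** X"
  proof -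
    have "X ** M ** Y = X ** (M ** (X + Y)) - X ** M ** X" by (simp only: mm_add_right matrix_mul_assoc) simp
    also have "\<dots> = (X + Y) ** M ** X - X ** M ** X" by (simp only: M matrix_mul_rid matrix_mul_lid)
    also have "\<dots> = Y ** M ** X" by (simp only: mm_add_left) simp
    finally show ?thesis .
  qed
  have P: "parallel_sum A B = X ** M ** Y" by (simp add: parallel_sum_def X_def Y_def M_def)
  show ?thesis
  proof (intro equalityI subsetI)
    fix v assume "v \<in> range ((*v) (parallel_sum A B))"
    then obtain u where u: "v = (X ** M ** Y) *v u" unfolding P by auto
    then have "v = X *v (M *v (Y *v u))" "v = Y *v (M *v (X *v u))"
      using u sw by (simp_all only: matrix_vector_mul_assoc matrix_mul_assoc)
    then show "v \<in> range ((*v) A) \<inter> range ((*v) B)"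
      unfolding X_def Y_def by (metis IntI matrix_vector_mul_assoc rangeI)
  next
    fix v assume v: "v \<in> range ((*v) A) \<inter> range ((*v) B)"
    then obtain a b where ab: "v = X *v a" "v = Y *v b"
      using range_gram[of A] range_gram[of B] unfolding X_def Y_def by blast
    have "(X ** M ** Y) *v (a + b) = (Y ** M ** X) *v a + (X ** M ** Y) *v b"
      by (simp add: matrix_vector_right_distrib sw)
    also have "\<dots> = Y *v (M *v v) + X *v (M *v v)"
      unfolding matrix_vector_mul_assoc[symmetric] ab[symmetric] ..
    also have "\<dots> = ((X + Y) ** M) *v v" by (simp add: matrix_vector_mult_add_rdistrib matrix_vector_mul_assoc[symmetric] add.commute)
    finally show "v \<in> range ((*v) (parallel_sum A B))" unfolding P M(1) matrix_vector_mul_lid by (metis rangeI)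
  qed
qed

lemma smooth_on_ctr: "open N \<Longrightarrow> smooth_on A N \<Longrightarrow> smooth_on (\<lambda>x. ctr (A x)) N"
  by (rule smooth_on_linear[OF bounded_linear_ctr])

lemma smooth_on_parallel_sum:
  fixes A B :: "complex^'m::finite \<Rightarrow> complex^'n::finite^'n"
  assumes N: "open N" and "smooth_on A N" "smooth_on B N"
    and "\<And>x v. x \<in> N \<Longrightarrow> \<exists>a b. v = A x *v a + B x *v b"
  shows "smooth_on (\<lambda>x. parallel_sum (A x) (B x)) N"
  unfolding parallel_sum_def
  by (intro smooth_on_mm smooth_on_matrix_inv smooth_on_add smooth_on_ctr N assms(2,3) parallel_sum_det[OF assms(4)])

text \<open>With M the total Gram matrix, R = R M M^-1, and \<open>R\<close> kills all summands of M
  except that of \<open>K j\<close>; this is an explicit expression in the \<open>K i\<close>. The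
  right factor is recorded on its own because it supplies smooth coefficients with respect to a
  frame.\<close>

lemma smooth_on_gram_proj:
  fixes K :: "'i \<Rightarrow> complex^'m::finite \<Rightarrow> complex^'n::finite^'n"
  assumes N: "open N" and fin: "finite I" and K: "\<And>i. i \<in> I \<Longrightarrow> smooth_on (K i) N"
    and span: "\<And>x v. x \<in> N \<Longrightarrow> \<exists>y. v = (\<Sum>i\<in>I. K i x *v y i)"
    and j: "j \<in> I" and R: "\<And>x i. x \<in> N \<Longrightarrow> i \<in> I \<Longrightarrow> R x ** K i x = (if i = j then K i x else 0)"
  shows "smooth_on (\<lambda>x. ctr (K j x) ** matrix_inv (\<Sum>i\<in>I. K i x ** ctr (K i x))) N"
    "x \<in> N \<Longrightarrow> R x = K j x ** (ctr (K j x) ** matrix_inv (\<Sum>i\<in>I. K i x ** ctr (K i x)))"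
    "smooth_on R N"
proof -
  define M where "M x = (\<Sum>i\<in>I. K i x ** ctr (K i x))" for x
  have det: "det (M x) \<noteq> 0" if "x \<in> N" for x unfolding M_def by (rule gram_det[OF fin span[OF that]])
  have sM: "smooth_on M N" unfolding M_def
    by (intro smooth_on_sum smooth_on_mm smooth_on_ctr N K)
  show s: "smooth_on (\<lambda>x. ctr (K j x) ** matrix_inv (\<Sum>i\<in>I. K i x ** ctr (K i x))) N"
    unfolding M_def[symmetric] by (intro smooth_on_mm smooth_on_ctr smooth_on_matrix_inv N K j sM det)
  show eq: "R x = K j x ** (ctr (K j x) ** matrix_inv (\<Sum>i\<in>I. K i x ** ctr (K i x)))" if x: "x \<in> N" for x
  proof -
    have "R x = R x ** (M x ** matrix_inv (M x))" by (simp add: matrix_inv_mult(1)[OF det[OF x]])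
    also have "\<dots> = (\<Sum>i\<in>I. R x ** K i x ** ctr (K i x)) ** matrix_inv (M x)"
      unfolding matrix_mul_assoc by (subst M_def) (simp only: mm_sum_right matrix_mul_assoc)
    also have "(\<Sum>i\<in>I. R x ** K i x ** ctr (K i x)) = (\<Sum>i\<in>I. if i = j then K j x ** ctr (K j x) else 0)"
      by (rule sum.cong) (auto simp: R[OF x] mm_zero_left)
    also have "\<dots> = K j x ** ctr (K j x)" using fin j by simp
    finally show ?thesis unfolding M_def by (simp only: matrix_mul_assoc)
  qed
  show "smooth_on R N"
    by (rule smooth_on_cong[OF N, rotated, OF smooth_on_mm[OF N K[OF j] s]]) (rule eq[symmetric])
qed

section \<open>Families of mixed Hodge structures\<close>

text \<open>A vector repeated in all columns, so that sections of bundles fit the calculus of square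
  matrices; applying it to a basis vector recovers the section.\<close>

definition column_mat :: "complex^'n::finite \<Rightarrow> complex^'n^'n" where
  "column_mat f = (\<chi> i j. f $ i)"

lemma column_mat_vec: "column_mat f *v u = (\<Sum>i\<in>UNIV. u $ i) *s f"
  by (simp add: column_mat_def matrix_vector_mult_def vec_eq_iff sum_distrib_left mult.commute)

lemma column_mat_axis: "column_mat f *v axis i 1 = f"
proof -
  have "(\<Sum>k\<in>UNIV. axis i (1::complex) $ k) = 1" by (simp add: axis_def)
  then show ?thesis by (simp add: column_mat_vec)
qed

lemma bounded_linear_column_mat: "bounded_linear column_mat"
  unfolding linear_conv_bounded_linear[symmetric]
  by (rule linearI) (auto simp: column_mat_def vec_eq_iff)

lemma column_mat_smult: "column_mat (c *s f) = mat c ** column_mat f"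
  by (simp add: vec_eq_iff mat_mult_entry) (simp add: column_mat_def)

lemma smooth_on_column_mat:
  "open N \<Longrightarrow> smooth_on f N \<Longrightarrow> smooth_on (\<lambda>z. column_mat (f z)) N"
  by (rule smooth_on_linear[OF bounded_linear_column_mat])

lemma dz_column_mat:
  assumes f: "holomorphic_map f N" and N: "open N" "z \<in> N"
  shows "dz (\<lambda>z. column_mat (f z)) z X = column_mat (frechet_derivative f (at z) X)"
    "dzb (\<lambda>z. column_mat (f z)) z X = 0"
proof -
  have d: "f differentiable at z" by (rule smooth_on_differentiable[OF holomorphic_map_smooth[OF f N(1)] N(2)])
  note D = frechet_derivative_linear[OF bounded_linear_column_mat d]
  have h: "frechet_derivative (\<lambda>z. column_mat (f z)) (at z) (c *s v) = mat c ** frechet_derivative (\<lambda>z. column_mat (f z)) (at z) v" for c v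
    unfolding D holomorphic_mapD(2)[OF f N(2)] column_mat_smult ..
  show "dz (\<lambda>z. column_mat (f z)) z X = column_mat (frechet_derivative f (at z) X)"
    unfolding dz_holomorphic(2)[OF h] D ..
  show "dzb (\<lambda>z. column_mat (f z)) z X = 0" by (rule dz_holomorphic(1)[OF h])
qed

text \<open>Both weights are at least m, so an index with first entry below \<open>r\<close> has
  second entry at least \<open>s\<close>. This is the spanning condition for the parallel
  sum.\<close>

lemma (in adjacent_mhs) F_cF_span:
  assumes rs: "r + s \<le> m + 1"
  shows "\<exists>a b. a \<in> F r \<and> b \<in> cF s \<and> v = a + b"
proof -
  let ?A = "{j \<in> J. r \<le> fst j}" and ?B = "{j \<in> J. fst j < r}"
  have "(\<Sum>j\<in>?A. pr j *v v) \<in> F r"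
  proof (rule vec.subspace_sum[OF F_sub])
    fix j assume j: "j \<in> ?A"
    then have "pr j *v v \<in> F (fst j)" using pr_in[of j v] bigr_F[of "fst j" "snd j"] by auto
    then show "pr j *v v \<in> F r" using F_anti[of r "fst j"] j by auto
  qed
  moreover have "(\<Sum>j\<in>?B. pr j *v v) \<in> cF s"
  proof (rule vec.subspace_sum[OF cF_sub])
    fix j assume j: "j \<in> ?B"
    then have "pr j *v v \<in> cF (snd j)" using pr_in[of j v] bigr_cF[of "fst j" "snd j"] by auto
    moreover have "s \<le> snd j" using j rs by (auto simp: J_def)
    ultimately show "pr j *v v \<in> cF s" using F_anti[of s "snd j"] by (auto simp: cF_def)
  qed
  moreover have "v = (\<Sum>j\<in>?A. pr j *v v) + (\<Sum>j\<in>?B. pr j *v v)"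
  proof -
    have "J = ?A \<union> ?B" by auto
    then have "(\<Sum>j\<in>J. pr j *v v) = (\<Sum>j\<in>?A \<union> ?B. pr j *v v)" by simp
    also have "\<dots> = (\<Sum>j\<in>?A. pr j *v v) + (\<Sum>j\<in>?B. pr j *v v)"
      by (rule sum.union_disjoint) (use finite_J in auto)
    finally show ?thesis by (simp only: pr_sum_vec)
  qed
  ultimately show ?thesis by blast
qed

lemma (in adjacent_mhs) bigrI:
  assumes "\<And>k. k \<in> J \<Longrightarrow> k \<noteq> j \<Longrightarrow> pr k *v x = 0"
  shows "x \<in> bigr j"
proof (cases "j \<in> J")
  case True
  have "x = (\<Sum>k\<in>J. pr k *v x)" by (simp add: pr_sum_vec)
  also have "\<dots> = (\<Sum>k\<in>J. if k = j then pr j *v x else 0)" using assms by (intro sum.cong) auto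
  also have "\<dots> = pr j *v x" using True finite_J by simp
  finally show ?thesis using pr_in[OF True, of x] by simp
next
  case False
  then have "(\<Sum>k\<in>J. pr k *v x) = 0" using assms by (intro sum.neutral) auto
  then have "x = 0" by (simp only: pr_sum_vec)
  then show ?thesis using vec.subspace_0[OF bigr_sub] by simp
qed

lemma (in adjacent_mhs) pr_opr:
  assumes k: "k \<in> J"
  shows "pr k *v (opr f *v y) = f k *s (pr k *v y)"
proof -
  have "pr k *v (opr f *v y) = (\<Sum>j\<in>J. f j *s (pr k *v (pr j *v y)))"
    by (simp add: opr_def sum_matrix_vec matrix_vec_sum mat_mult_vec vector_scalar_commute flip: matrix_vector_mul_assoc)
  also have "\<dots> = (\<Sum>j\<in>J. if j = k then f k *s (pr k *v y) else 0)"
    by (rule sum.cong) (auto simp: pr_on[OF _ k pr_in])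
  finally show ?thesis using k finite_J by simp
qed

lemma (in adjacent_mhs) pr_P: "k \<in> J \<Longrightarrow> pr k *v (P *v y) = of_int (fst k) *s (pr k *v y)"
  unfolding P_def by (rule pr_opr)

lemma (in adjacent_mhs) pr_S: "k \<in> J \<Longrightarrow> pr k *v (S *v y) = (if fst k + snd k = m + 1 then pr k *v y else 0)"
  unfolding S_def by (simp add: pr_opr)

text \<open>The situation in a flat frame: \<open>W\<close>, \<open>Q\<close> and the form matrices
  are constant, and only the filtration moves, holomorphically and horizontally.\<close>

locale hodge_family =
  fixes W :: "'n::finite weight" and Q and F :: "complex^'m::finite \<Rightarrow> 'n filtration"
    and N :: "(complex^'m) set" and m hi and p q0 q1 K
  assumes N: "open N" and ph: "\<And>z. z \<in> N \<Longrightarrow> polarized_mhs W Q (F z) m hi p q0 q1 K"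
    and sub: "\<And>r. holomorphic_subbundle (\<lambda>z. F z r) N"
    and transversal: "\<And>r N' f z X. open N' \<Longrightarrow> N' \<subseteq> N \<Longrightarrow> holomorphic_map f N' \<Longrightarrow>
      (\<And>w. w \<in> N' \<Longrightarrow> f w \<in> F w r) \<Longrightarrow> z \<in> N' \<Longrightarrow> frechet_derivative f (at z) X \<in> F z (r - 1)"
begin

abbreviation "J \<equiv> adjacent_mhs.J m hi"
abbreviation "bg z \<equiv> adjacent_mhs.bigr W (F z) m"
abbreviation "cF z \<equiv> adjacent_mhs.cF (F z)"
abbreviation "pr z j \<equiv> summand_proj (bg z) J j"
abbreviation "P z \<equiv> adjacent_mhs.P W (F z) m hi"
abbreviation "S z \<equiv> adjacent_mhs.S W (F z) m hi"
abbreviation "T z \<equiv> mat 1 - S z"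
abbreviation "Wc \<equiv> complexify (W m)"

lemma adj: "z \<in> N \<Longrightarrow> adjacent_mhs W (F z) m hi"
  using ph polarized_mhs.axioms(1) by blast

lemma finite_J: "z \<in> N \<Longrightarrow> finite J"
  by (rule adjacent_mhs.finite_J[OF adj])

section \<open>Smoothness of the Hodge projections\<close>

lemma local_frame:
  assumes "z \<in> N"
  shows "\<exists>N1 k f. open N1 \<and> z \<in> N1 \<and> N1 \<subseteq> N \<and> (\<forall>i<k. holomorphic_map (f i) N1) \<and>
     (\<forall>w\<in>N1. F w r = vec.span ((\<lambda>i. f i w) ` {..<k::nat}))"
  using sub[of r] assms unfolding holomorphic_subbundle_def by meson

lemma span_frame:
  fixes f :: "nat \<Rightarrow> complex^'n"
  shows "x \<in> vec.span (f ` {..<k}) \<longleftrightarrow> (\<exists>c. x = (\<Sum>i<k. c i *s f i))"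
proof
  assume "x \<in> vec.span (f ` {..<k})"
  then show "\<exists>c. x = (\<Sum>i<k. c i *s f i)"
  proof (induction rule: vec.span_induct_alt)
    case base
    then show ?case by (intro exI[of _ "\<lambda>_. 0"]) simp
  next
    case (step c x y)
    then obtain i d where i: "i < k" "x = f i" and d: "y = (\<Sum>i<k. d i *s f i)" by auto
    have "c *s x = (\<Sum>l<k. if l = i then c *s f i else 0)" using i by simp
    then have "c *s x + y = (\<Sum>l<k. (if l = i then c *s f i else 0) + d l *s f l)"
      unfolding d by (simp add: sum.distrib)
    also have "\<dots> = (\<Sum>l<k. ((if l = i then c else 0) + d l) *s f l)"
      by (rule sum.cong) (auto simp: vector_sadd_rdistrib)
    finally show ?case by (rule exI[of _ "\<lambda>l. (if l = i then c else 0) + d l"])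
  qed
next
  assume "\<exists>c. x = (\<Sum>i<k. c i *s f i)"
  then obtain c where "x = (\<Sum>i<k. c i *s f i)" ..
  moreover have "(\<Sum>i<k. c i *s f i) \<in> vec.span (f ` {..<k})"
    by (intro vec.span_sum vec.span_scale vec.span_base) auto
  ultimately show "x \<in> vec.span (f ` {..<k})" by simp
qed

lemma frame_range:
  assumes F: "F w r = vec.span ((\<lambda>i. f i w) ` {..<k::nat})"
  shows "range ((*v) (\<Sum>i<k. column_mat (f i w) ** ctr (column_mat (f i w)))) = F w r"
proof -
  have "x \<in> F w r \<longleftrightarrow> (\<exists>u. x = (\<Sum>i<k. column_mat (f i w) *v u i))" for x
  proof
    assume "x \<in> F w r"
    then obtain c where "x = (\<Sum>i<k. c i *s f i w)" unfolding F span_frame by blast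
    then have "x = (\<Sum>i<k. column_mat (f i w) *v (c i *s axis undefined 1))"
      by (simp add: column_mat_axis vector_scalar_commute)
    then show "\<exists>u. x = (\<Sum>i<k. column_mat (f i w) *v u i)"
      by (rule exI[of _ "\<lambda>i. c i *s axis undefined 1"])
  next
    assume "\<exists>u. x = (\<Sum>i<k. column_mat (f i w) *v u i)"
    then obtain u where "x = (\<Sum>i<k. column_mat (f i w) *v u i)" ..
    then have "x = (\<Sum>i<k. (\<Sum>l\<in>UNIV. u i $ l) *s f i w)" by (simp only: column_mat_vec)
    then show "x \<in> F w r" unfolding F span_frame by (rule exI[of _ "\<lambda>i. \<Sum>l\<in>UNIV. u i $ l"])
  qed
  then show ?thesis unfolding range_gram_sum[OF finite_lessThan] by auto
qed

lemma local_generator: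
  assumes z: "z \<in> N"
  shows "\<exists>N1 (G :: ('m, 'n) mfun). open N1 \<and> z \<in> N1 \<and> N1 \<subseteq> N \<and> smooth_on G N1 \<and> (\<forall>w\<in>N1. range ((*v) (G w)) = F w r)"
proof -
  obtain N1 k f where f: "open N1" "z \<in> N1" "N1 \<subseteq> N" "\<And>i. i < k \<Longrightarrow> holomorphic_map (f i) N1"
    "\<And>w. w \<in> N1 \<Longrightarrow> F w r = vec.span ((\<lambda>i. f i w) ` {..<k::nat})"
    using local_frame[OF z, of r] by metis
  let ?G = "\<lambda>w. \<Sum>i<k. column_mat (f i w) ** ctr (column_mat (f i w))"
  have "smooth_on ?G N1"
    by (intro smooth_on_sum smooth_on_mm smooth_on_ctr smooth_on_column_mat holomorphic_map_smooth f) auto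
  moreover have "range ((*v) (?G w)) = F w r" if "w \<in> N1" for w
    by (rule frame_range[where f = f and w = w, OF f(5)[OF that]])
  ultimately show ?thesis using f(1-3) by blast
qed

lemma range_cnj: "range ((*v) (cnj_mat A)) = cnj_vec ` range ((*v) A)" for A :: "complex^'n^'n"
proof -
  have "cnj_mat A *v x = cnj_vec (A *v cnj_vec x)" for x by (simp add: cnj_vec_mult)
  then show ?thesis by (auto simp: image_iff) (metis cnj_vec_simps(1) cnj_vec_mult)
qed

text \<open>Since the two steps of the filtrations together span everything, the parallel sum of
  their generators is defined and smooth.\<close>

lemma local_intersection:
  assumes z: "z \<in> N" and rs: "r + s \<le> m + 1"
  shows "\<exists>N1 (G :: ('m, 'n) mfun). open N1 \<and> z \<in> N1 \<and> N1 \<subseteq> N \<and> smooth_on G N1 \<and> (\<forall>w\<in>N1. range ((*v) (G w)) = F w r \<inter> cF w s)"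
proof -
  obtain N1 and G1 :: "('m, 'n) mfun" where 1: "open N1" "z \<in> N1" "N1 \<subseteq> N" "smooth_on G1 N1" "\<And>w. w \<in> N1 \<Longrightarrow> range ((*v) (G1 w)) = F w r"
    using local_generator[OF z, of r] by metis
  obtain N2 and G2 :: "('m, 'n) mfun" where 2: "open N2" "z \<in> N2" "N2 \<subseteq> N" "smooth_on G2 N2" "\<And>w. w \<in> N2 \<Longrightarrow> range ((*v) (G2 w)) = F w s"
    using local_generator[OF z, of s] by metis
  define N3 where "N3 = N1 \<inter> N2"
  have N3: "open N3" "z \<in> N3" "N3 \<subseteq> N" using 1 2 by (auto simp: N3_def)
  have r2: "range ((*v) (cnj_mat (G2 w))) = cF w s" if "w \<in> N3" for w
    using 2(5)[of w] that range_cnj[of "G2 w"] N3 adjacent_mhs.cF_def[OF adj[of w], of s] by (auto simp: N3_def)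
  have r1: "range ((*v) (G1 w)) = F w r" if "w \<in> N3" for w using 1(5) that by (simp add: N3_def)
  have span: "\<exists>a b. v = G1 w *v a + cnj_mat (G2 w) *v b" if "w \<in> N3" for w v
  proof -
    interpret a: adjacent_mhs W Q "F w" m hi using adj that N3 by blast
    obtain x y where "x \<in> F w r" "y \<in> cF w s" "v = x + y" using a.F_cF_span[OF rs] by blast
    then show ?thesis unfolding r1[OF that, symmetric] r2[OF that, symmetric] by auto
  qed
  have "smooth_on (\<lambda>w. parallel_sum (G1 w) (cnj_mat (G2 w))) N3"
    by (intro smooth_on_parallel_sum N3 smooth_on_linear[OF bounded_linear_cnj_mat] span)
      (use smooth_on_subset[OF 1(4), of N3] smooth_on_subset[OF 2(4), of N3] in \<open>auto simp: N3_def\<close>)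
  moreover have "range ((*v) (parallel_sum (G1 w) (cnj_mat (G2 w)))) = F w r \<inter> cF w s" if "w \<in> N3" for w
    using parallel_sum_range[OF span[OF that]] r1[OF that] r2[OF that] by simp
  ultimately show ?thesis using N3 by blast
qed

lemma common_neighbourhood:
  fixes R :: "(complex^'m \<Rightarrow> complex^'n^'n) \<Rightarrow> 'j \<Rightarrow> complex^'m \<Rightarrow> bool"
  assumes "finite A" "z \<in> N"
    "\<And>j. j \<in> A \<Longrightarrow> \<exists>N1 G. open N1 \<and> z \<in> N1 \<and> N1 \<subseteq> N \<and> smooth_on G N1 \<and> (\<forall>w\<in>N1. R G j w)"
  shows "\<exists>N1 (G :: _ \<Rightarrow> ('m, 'n) mfun). open N1 \<and> z \<in> N1 \<and> N1 \<subseteq> N \<and> (\<forall>j\<in>A. smooth_on (G j) N1 \<and> (\<forall>w\<in>N1. R (G j) j w))"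
proof -
  have "\<forall>j. \<exists>NG. j \<in> A \<longrightarrow> (open (fst NG) \<and> z \<in> fst NG \<and> fst NG \<subseteq> N \<and> smooth_on (snd NG) (fst NG) \<and> (\<forall>w\<in>fst NG. R (snd NG) j w))"
    using assms(3) by (metis fst_conv snd_conv)
  then obtain NG where NG: "\<And>j. j \<in> A \<Longrightarrow> open (fst (NG j)) \<and> z \<in> fst (NG j) \<and> fst (NG j) \<subseteq> N \<and>
     smooth_on (snd (NG j)) (fst (NG j)) \<and> (\<forall>w\<in>fst (NG j). R (snd (NG j)) j w)" by metis
  define N1 where "N1 = N \<inter> (\<Inter>j\<in>A. fst (NG j))"
  have "open N1" unfolding N1_def using N assms(1) NG by (intro open_Int open_INT) auto
  moreover have "z \<in> N1" "N1 \<subseteq> N" using assms NG by (auto simp: N1_def)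
  moreover have "smooth_on (snd (NG j)) N1 \<and> (\<forall>w\<in>N1. R (snd (NG j)) j w)" if "j \<in> A" for j
    using NG[OF that] smooth_on_subset[of "snd (NG j)" "fst (NG j)" N1] that by (auto simp: N1_def)
  ultimately show ?thesis by (intro exI[of _ N1] exI[of _ "\<lambda>j. snd (NG j)"]) simp
qed

text \<open>1 - S is the projection onto W_m along the components of weight m + 1. The former has
  the constant generator \<open>p\<close>, the latter are intersections with smooth generators. The
  index \<open>None\<close> stands for W_m.\<close>

lemma smooth_S: "smooth_on S N"
proof (rule smooth_on_local)
  fix z assume z: "z \<in> N"
  define A where "A = {j \<in> J. fst j + snd j = m + 1}"
  have finA: "finite A" unfolding A_def using finite_J[OF z] by simp
  have "\<exists>N1 (G :: _ \<Rightarrow> ('m, 'n) mfun). open N1 \<and> z \<in> N1 \<and> N1 \<subseteq> N \<and> (\<forall>j\<in>A. smooth_on (G j) N1 \<and> (\<forall>w\<in>N1. range ((*v) (G j w)) = bg w j))"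
  proof (rule common_neighbourhood[OF finA z, where R = "\<lambda>G j w. range ((*v) (G w)) = bg w j"])
    fix j assume "j \<in> A"
    then obtain r s where rs: "j = (r, s)" "r + s = m + 1" by (cases j) (auto simp: A_def)
    then obtain N1 and G :: "('m, 'n) mfun" where G: "open N1" "z \<in> N1" "N1 \<subseteq> N" "smooth_on G N1" "\<And>w. w \<in> N1 \<Longrightarrow> range ((*v) (G w)) = F w r \<inter> cF w s"
      using local_intersection[OF z, of r s] by auto
    have "range ((*v) (G w)) = bg w j" if "w \<in> N1" for w
      using G(5)[OF that] adjacent_mhs.bigr_m1[OF adj rs(2), of w] that G(3) rs by blast
    then show "\<exists>N1 (G :: ('m, 'n) mfun). open N1 \<and> z \<in> N1 \<and> N1 \<subseteq> N \<and> smooth_on G N1 \<and> (\<forall>w\<in>N1. range ((*v) (G w)) = bg w j)"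
      using G by blast
  qed
  then obtain N1 and G :: "_ \<Rightarrow> ('m, 'n) mfun" where G: "open N1" "z \<in> N1" "N1 \<subseteq> N" "\<And>j. j \<in> A \<Longrightarrow> smooth_on (G j) N1"
    "\<And>j w. j \<in> A \<Longrightarrow> w \<in> N1 \<Longrightarrow> range ((*v) (G j w)) = bg w j" by metis
  let ?I = "insert None (Some ` A)"
  define Kf where "Kf i w = (case i of None \<Rightarrow> p | Some j \<Rightarrow> G j w)" for i w
  have Kf: "Kf None = (\<lambda>w. p)" "Kf (Some j) = G j" for j by (simp_all add: Kf_def fun_eq_iff)
  have "smooth_on T N1"
  proof (rule smooth_on_gram_proj(3)[OF G(1), where I = ?I and K = Kf and j = None])
    show "finite ?I" using finA by simp
    show "smooth_on (Kf i) N1" if "i \<in> ?I" for i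
      using that G(4) smooth_on_const[OF G(1)] by (auto simp: Kf)
    fix w assume w: "w \<in> N1"
    interpret a: polarized_mhs W Q "F w" m hi p q0 q1 K using ph w G(3) by blast
    show "\<exists>y. v = (\<Sum>i\<in>?I. Kf i w *v y i)" for v
    proof -
      have "a.pr j *v v \<in> range ((*v) (G j w))" if "j \<in> A" for j
        using G(5)[OF that w] a.pr_in that by (auto simp: A_def)
      then have "\<forall>j\<in>A. \<exists>u. a.pr j *v v = G j w *v u" by auto
      then obtain u where u: "\<And>j. j \<in> A \<Longrightarrow> a.pr j *v v = G j w *v u j" by metis
      have "S w *v v = S w *v (\<Sum>j\<in>J. a.pr j *v v)" by (simp only: a.pr_sum_vec)
      also have "\<dots> = (\<Sum>j\<in>J. if fst j + snd j = m + 1 then a.pr j *v v else 0)"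
        unfolding matrix_vec_sum by (rule sum.cong) (auto simp: a.S_on[OF a.pr_in])
      also have "\<dots> = (\<Sum>j\<in>A. a.pr j *v v)" unfolding A_def using finite_J[OF z] by (simp add: sum.inter_filter)
      finally have Sv: "S w *v v = (\<Sum>j\<in>A. G j w *v u j)" using u by simp
      have "v = T w *v v + S w *v v" by (simp add: matrix_vector_mult_diff_rdistrib)
      also have "\<dots> = p *v (T w *v v) + (\<Sum>j\<in>A. G j w *v u j)"
        using a.p_on[OF a.weight_part] Sv by simp
      also have "\<dots> = (\<Sum>i\<in>?I. Kf i w *v (case i of None \<Rightarrow> T w *v v | Some j \<Rightarrow> u j))"
        using finA by (subst sum.insert) (auto simp: Kf_def sum.reindex)
      finally show ?thesis by blast
    qed
    show "T w ** Kf i w = (if i = None then Kf i w else 0)" if "i \<in> ?I" for i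
    proof (cases i)
      case None
      then show ?thesis by (simp add: Kf_def mm_diff_left a.S_p)
    next
      case (Some j)
      then have j: "j \<in> A" using that by auto
      have "(T w ** G j w) *v x = 0" for x
      proof -
        have "G j w *v x \<in> a.bigr j" using G(5)[OF j w] by auto
        then show ?thesis using a.T_on[of j "G j w *v x"] j by (auto simp: A_def matrix_vector_mul_assoc[symmetric])
      qed
      then show ?thesis using Some by (simp add: Kf_def matrix_eq)
    qed
  qed simp
  then have "smooth_on (\<lambda>w. mat 1 - T w) N1" by (rule smooth_on_diff[OF G(1) smooth_on_const[OF G(1)]])
  then show "\<exists>N'. open N' \<and> z \<in> N' \<and> smooth_on S N'" using G by auto
qed

lemma smooth_pr: "j \<in> J \<Longrightarrow> smooth_on (\<lambda>z. pr z j) N"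
proof (rule smooth_on_local)
  fix z assume j: "j \<in> J" and z: "z \<in> N"
  have "\<exists>N1 (G :: _ \<Rightarrow> ('m, 'n) mfun). open N1 \<and> z \<in> N1 \<and> N1 \<subseteq> N \<and> (\<forall>j\<in>J. smooth_on (G j) N1 \<and> (\<forall>w\<in>N1. range ((*v) (G j w)) = bg w j))"
  proof (rule common_neighbourhood[OF finite_J[OF z] z, where R = "\<lambda>G j w. range ((*v) (G w)) = bg w j"])
    fix j assume j: "j \<in> J"
    then obtain r s where rs: "j = (r, s)" "r + s = m \<or> r + s = m + 1" by (cases j) (auto simp: adjacent_mhs.J_def[OF adj[OF z]])
    then obtain N1 and G :: "('m, 'n) mfun" where G: "open N1" "z \<in> N1" "N1 \<subseteq> N" "smooth_on G N1" "\<And>w. w \<in> N1 \<Longrightarrow> range ((*v) (G w)) = F w r \<inter> cF w s"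
      using local_intersection[OF z, of r s] by auto
    show "\<exists>N1 (G :: ('m, 'n) mfun). open N1 \<and> z \<in> N1 \<and> N1 \<subseteq> N \<and> smooth_on G N1 \<and> (\<forall>w\<in>N1. range ((*v) (G w)) = bg w j)"
    proof (cases "r + s = m + 1")
      case True
      have "range ((*v) (G w)) = bg w j" if "w \<in> N1" for w
        using G(5)[OF that] adjacent_mhs.bigr_m1[OF adj True, of w] that G(3) rs by blast
      then show ?thesis using G by blast
    next
      case False
      \<comment> \<open>In weight m the intersection of F^r with the conjugate of F^s may also
        contain vectors of weight m + 1. Applying \<open>T\<close>, already known to be smooth,
        replaces the further intersection with W_m.\<close>
      then have rsm: "r + s = m" using rs by simp
      have "range ((*v) (T w ** G w)) = bg w j" if w: "w \<in> N1" for w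
      proof -
        interpret a: polarized_mhs W Q "F w" m hi p q0 q1 K using ph w G(3) by blast
        have Tx: "T w *v x \<in> a.bigr (r, s)" if x: "x \<in> F w r" "x \<in> cF w s" for x
        proof (rule a.bigrI)
          fix k assume k: "k \<in> J" "k \<noteq> (r, s)"
          have pT: "a.pr k *v (T w *v x) = (if fst k + snd k = m + 1 then 0 else a.pr k *v x)"
            by (simp add: matrix_vector_mult_diff_rdistrib matrix_vector_mult_diff_distrib a.pr_S[OF k(1)])
          show "a.pr k *v (T w *v x) = 0"
          proof (cases "fst k + snd k = m + 1")
            case True then show ?thesis using pT by simp
          next
            case False
            then have km: "fst k + snd k = m" using k by (auto simp: a.J_def)
            then have "fst k < r \<or> snd k < s" using k(2) rsm by (cases k) auto
            then have "a.pr k *v x = 0" using x k(1) unfolding a.F_proj a.cF_proj by blast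
            then show ?thesis using pT by simp
          qed
        qed
        show ?thesis
        proof (intro equalityI subsetI)
          fix y assume "y \<in> range ((*v) (T w ** G w))"
          then obtain x where "y = T w *v (G w *v x)" by (auto simp: matrix_vector_mul_assoc)
          moreover have "G w *v x \<in> F w r \<inter> cF w s" using G(5)[OF w] by auto
          ultimately show "y \<in> bg w j" using Tx rs by auto
        next
          fix y assume y: "y \<in> bg w j"
          then have "y \<in> F w r \<inter> cF w s" using a.bigr_F a.bigr_cF rs by blast
          then obtain x where x: "y = G w *v x" using G(5)[OF w] by auto
          have "T w *v y = y" using a.T_on[OF j y] rs rsm by simp
          then have "y = (T w ** G w) *v x" using x by (simp add: matrix_vector_mul_assoc[symmetric])
          then show "y \<in> range ((*v) (T w ** G w))" by blast
        qed
      qed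
      moreover have "smooth_on (\<lambda>w. T w ** G w) N1"
        by (intro smooth_on_mm smooth_on_diff smooth_on_const G smooth_on_subset[OF smooth_S])
      ultimately show ?thesis using G by blast
    qed
  qed
  then obtain N1 and G :: "_ \<Rightarrow> ('m, 'n) mfun" where G: "open N1" "z \<in> N1" "N1 \<subseteq> N" "\<And>j. j \<in> J \<Longrightarrow> smooth_on (G j) N1"
    "\<And>j w. j \<in> J \<Longrightarrow> w \<in> N1 \<Longrightarrow> range ((*v) (G j w)) = bg w j" by metis
  have "smooth_on (\<lambda>w. pr w j) N1"
  proof (rule smooth_on_gram_proj(3)[OF G(1) finite_J[OF z] G(4) _ j])
    fix w assume w: "w \<in> N1"
    interpret a: adjacent_mhs W Q "F w" m hi using adj w G(3) by blast
    show "\<exists>y. v = (\<Sum>i\<in>J. G i w *v y i)" for v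
    proof -
      have "\<forall>i\<in>J. \<exists>u. a.pr i *v v = G i w *v u" using G(5)[OF _ w] a.pr_in by blast
      then obtain u where u: "\<And>i. i \<in> J \<Longrightarrow> a.pr i *v v = G i w *v u i" by metis
      have "v = (\<Sum>i\<in>J. a.pr i *v v)" by (simp only: a.pr_sum_vec)
      also have "\<dots> = (\<Sum>i\<in>J. G i w *v u i)" using u by simp
      finally show ?thesis by blast
    qed
    show "a.pr j ** G i w = (if i = j then G i w else 0)" if i: "i \<in> J" for i
      unfolding matrix_eq
    proof
      fix x
      have "G i w *v x \<in> a.bigr i" using G(5)[OF i w] by auto
      then show "a.pr j ** G i w *v x = (if i = j then G i w else 0) *v x"
        using a.pr_on[OF i j] by (auto simp: matrix_vector_mul_assoc[symmetric])
    qed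
  qed auto
  then show "\<exists>N'. open N' \<and> z \<in> N' \<and> smooth_on (\<lambda>z. pr z j) N'" using G by blast
qed

lemma smooth_P: "smooth_on P N"
proof -
  have "smooth_on (\<lambda>z. \<Sum>j\<in>J. mat (of_int (fst j)) ** pr z j) N"
    by (intro smooth_on_sum smooth_on_mm smooth_on_const N smooth_pr)
  then show ?thesis
    by (rule smooth_on_cong[OF N, rotated]) (simp add: adjacent_mhs.P_def[OF adj] adjacent_mhs.opr_def[OF adj])
qed

end

context hodge_family
begin

section \<open>The differential of the period map\<close>

text \<open>A smooth projection onto F^r is factored through the holomorphic frame; this expresses
  vectors of F^r in the frame with smooth coefficients.\<close>

lemma F_projection_frame:
  assumes z: "z \<in> N"
  obtains N1 f and k :: nat and Y :: "nat \<Rightarrow> ('m, 'n) mfun"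
  where "open N1" "z \<in> N1" "N1 \<subseteq> N" "\<And>i. i < k \<Longrightarrow> holomorphic_map (f i) N1"
    "\<And>i w. i < k \<Longrightarrow> w \<in> N1 \<Longrightarrow> f i w \<in> F w r" "\<And>i. i < k \<Longrightarrow> smooth_on (Y i) N1"
    "\<And>w x. w \<in> N1 \<Longrightarrow> x \<in> F w r \<Longrightarrow> x = (\<Sum>i<k. column_mat (f i w) ** Y i w) *v x"
proof -
  obtain N1 k f where f: "open N1" "z \<in> N1" "N1 \<subseteq> N" "\<And>i. i < k \<Longrightarrow> holomorphic_map (f i) N1"
    "\<And>w. w \<in> N1 \<Longrightarrow> F w r = vec.span ((\<lambda>i. f i w) ` {..<k::nat})"
    using local_frame[OF z, of r] by metis
  define G where "G w = (\<Sum>i<k. column_mat (f i w) ** ctr (column_mat (f i w)))" for w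
  have cm: "smooth_on (\<lambda>w. column_mat (f i w)) N1" if "i < k" for i
    by (intro smooth_on_column_mat holomorphic_map_smooth f that)
  have sG: "smooth_on G N1" unfolding G_def
    by (intro smooth_on_sum smooth_on_mm smooth_on_ctr f(1) cm) auto
  have rG: "range ((*v) (G w)) = F w r" if "w \<in> N1" for w
    unfolding G_def by (rule frame_range[where f = f and w = w, OF f(5)[OF that]])
  define A where "A = {j \<in> J. fst j < r}"
  have finA: "finite A" unfolding A_def using finite_J[OF z] by simp
  let ?I = "insert None (Some ` A)"
  define Kf where "Kf i w = (case i of None \<Rightarrow> G w | Some j \<Rightarrow> pr w j)" for i w
  have Kf: "Kf None = G" "Kf (Some j) = (\<lambda>w. pr w j)" for j by (simp_all add: Kf_def fun_eq_iff)
  define R where "R w = (\<Sum>j\<in>{j \<in> J. r \<le> fst j}. pr w j)" for w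
  define Z where "Z w = ctr (Kf None w) ** matrix_inv (\<Sum>i\<in>?I. Kf i w ** ctr (Kf i w))" for w
  have RF: "R w *v x = x" if w: "w \<in> N1" and x: "x \<in> F w r" for w x
  proof -
    interpret a: adjacent_mhs W Q "F w" m hi using adj w f(3) by blast
    have "R w *v x = (\<Sum>j\<in>{j \<in> J. r \<le> fst j}. a.pr j *v x)" by (simp add: R_def sum_matrix_vec)
    also have "\<dots> = (\<Sum>j\<in>J. a.pr j *v x)"
      using x unfolding a.F_proj by (intro sum.mono_neutral_left) (auto simp: a.finite_J)
    finally show ?thesis by (simp only: a.pr_sum_vec)
  qed
  have *: "\<exists>y. v = (\<Sum>i\<in>?I. Kf i w *v y i)"
    "i \<in> ?I \<Longrightarrow> R w ** Kf i w = (if i = None then Kf i w else 0)" if w: "w \<in> N1" for w v i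
  proof -
    interpret a: adjacent_mhs W Q "F w" m hi using adj w f(3) by blast
    have "R w *v v \<in> F w r"
      unfolding R_def sum_matrix_vec
    proof (rule vec.subspace_sum[OF a.F_sub])
      fix j assume j: "j \<in> {j \<in> J. r \<le> fst j}"
      then have "a.pr j *v v \<in> F w (fst j)" using a.pr_in[of j v] a.bigr_F[of "fst j" "snd j"] by auto
      then show "a.pr j *v v \<in> F w r" using a.F_anti[of r "fst j"] j by auto
    qed
    then obtain u where u: "R w *v v = G w *v u" using rG[OF w] by auto
    have "J = {j \<in> J. r \<le> fst j} \<union> A" by (auto simp: A_def)
    then have "v = (\<Sum>j\<in>{j \<in> J. r \<le> fst j} \<union> A. a.pr j *v v)" using a.pr_sum_vec[of v] by simp
    also have "\<dots> = (\<Sum>j\<in>{j \<in> J. r \<le> fst j}. a.pr j *v v) + (\<Sum>j\<in>A. a.pr j *v v)"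
      by (rule sum.union_disjoint) (use a.finite_J finA in \<open>auto simp: A_def\<close>)
    also have "\<dots> = G w *v u + (\<Sum>j\<in>A. a.pr j *v v)" using u by (simp add: R_def sum_matrix_vec)
    also have "\<dots> = (\<Sum>i\<in>?I. Kf i w *v (case i of None \<Rightarrow> u | Some j \<Rightarrow> v))"
      using finA by (subst sum.insert) (auto simp: Kf_def sum.reindex)
    finally show "\<exists>y. v = (\<Sum>i\<in>?I. Kf i w *v y i)"
      by (intro exI[of _ "case_option u (\<lambda>_. v)"])
    assume i: "i \<in> ?I"
    show "R w ** Kf i w = (if i = None then Kf i w else 0)"
    proof (cases i)
      case None
      have "(R w ** G w) *v x = G w *v x" for x
      proof -
        have "G w *v x \<in> F w r" using rG[OF w] by auto
        then show ?thesis using RF[OF w] by (simp add: matrix_vector_mul_assoc[symmetric])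
      qed
      then show ?thesis using None by (simp add: Kf_def matrix_eq)
    next
      case (Some j)
      then have j: "j \<in> A" using i by auto
      have "R w ** a.pr j = (\<Sum>k\<in>{j \<in> J. r \<le> fst j}. a.pr k ** a.pr j)" by (simp add: R_def mm_sum_left)
      also have "\<dots> = 0"
        using j by (intro sum.neutral) (auto simp: A_def a.pr_mult)
      finally show ?thesis using Some by (simp add: Kf_def)
    qed
  qed
  have sK: "smooth_on (Kf i) N1" if "i \<in> ?I" for i
    using that sG smooth_on_subset[OF smooth_pr f(3)] by (auto simp: Kf A_def)
  have fin: "finite ?I" using finA by simp
  have sZ: "smooth_on Z N1" unfolding Z_def
    by (rule smooth_on_gram_proj(1)[OF f(1) fin sK *(1), where R = R]) (use *(2) in auto)
  have RZ: "R w = G w ** Z w" if "w \<in> N1" for w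
    using smooth_on_gram_proj(2)[OF f(1) fin sK *(1), where R = R and j = None] *(2) that
    unfolding Z_def Kf(1) by auto
  define Y where "Y i w = ctr (column_mat (f i w)) ** Z w" for i w
  have 1: "x = (\<Sum>i<k. column_mat (f i w) ** Y i w) *v x" if w: "w \<in> N1" and x: "x \<in> F w r" for w x
  proof -
    have "R w = (\<Sum>i<k. column_mat (f i w) ** Y i w)"
      unfolding RZ[OF w] G_def Y_def by (simp add: mm_sum_left matrix_mul_assoc)
    then show ?thesis using RF[OF w x] by simp
  qed
  have 2: "smooth_on (Y i) N1" if "i < k" for i
    unfolding Y_def by (intro smooth_on_mm smooth_on_ctr cm that f(1) sZ)
  have 3: "f i w \<in> F w r" if "i < k" "w \<in> N1" for i w
    unfolding f(5)[OF that(2)] by (rule vec.span_base) (use that in auto)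
  show thesis by (rule that[OF f(1-4) 3 2 1])
qed

text \<open>In a holomorphic frame \<open>dzb\<close> sees only the coefficients and stays in F^r;
  \<open>dz\<close> also differentiates the frame, which by transversality costs one step of the
  filtration.\<close>

lemma section_derivative:
  assumes N': "open N'" "N' \<subseteq> N" and X: "smooth_on X N'" and XF: "\<And>w v. w \<in> N' \<Longrightarrow> X w *v v \<in> F w r"
    and z: "z \<in> N'"
  shows "dzb X z Y *v v \<in> F z r" "dz X z Y *v v \<in> F z (r - 1)"
proof -
  have zN: "z \<in> N" using z N' by blast
  obtain N1 k f C where f: "open N1" "z \<in> N1" "N1 \<subseteq> N" "\<And>i. i < k \<Longrightarrow> holomorphic_map (f i) N1"
    "\<And>i w. i < k \<Longrightarrow> w \<in> N1 \<Longrightarrow> f i w \<in> F w r" "\<And>i. i < k \<Longrightarrow> smooth_on (C i :: ('m, 'n) mfun) N1"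
    "\<And>w x. w \<in> N1 \<Longrightarrow> x \<in> F w r \<Longrightarrow> x = (\<Sum>i<k::nat. column_mat (f i w) ** C i w) *v x"
    by (rule F_projection_frame[OF zN, of r]) blast
  interpret a: adjacent_mhs W Q "F z" m hi using adj zN by blast
  define N2 where "N2 = N1 \<inter> N'"
  have N2: "open N2" "z \<in> N2" "N2 \<subseteq> N1" "N2 \<subseteq> N'" using f N' z by (auto simp: N2_def)
  define D where "D i w = C i w ** X w" for i w
  have sD: "smooth_on (D i) N2" if "i < k" for i
    unfolding D_def by (intro smooth_on_mm N2(1) smooth_on_subset[OF f(6)[OF that] N2(3)] smooth_on_subset[OF X N2(4)])
  have scm: "smooth_on (\<lambda>w. column_mat (f i w)) N2" if "i < k" for i
    by (rule smooth_on_subset[OF smooth_on_column_mat[OF f(1) holomorphic_map_smooth[OF f(4)[OF that] f(1)]] N2(3)])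
  have eq: "(\<Sum>i<k. column_mat (f i w) ** D i w) = X w" if w: "w \<in> N2" for w
    unfolding matrix_eq
  proof
    fix v
    have "X w *v v = (\<Sum>i<k. column_mat (f i w) ** C i w) *v (X w *v v)"
      using f(7)[of w "X w *v v"] XF w by (auto simp: N2_def)
    moreover have "(\<Sum>i<k. column_mat (f i w) ** D i w) = (\<Sum>i<k. column_mat (f i w) ** C i w) ** X w"
      by (simp add: D_def mm_sum_left matrix_mul_assoc)
    ultimately show "(\<Sum>i<k. column_mat (f i w) ** D i w) *v v = X w *v v"
      by (simp add: matrix_vector_mul_assoc)
  qed
  have d: "(\<lambda>w. column_mat (f i w)) differentiable at z" "(D i) differentiable at z"
    "(\<lambda>w. column_mat (f i w) ** D i w) differentiable at z" if "i < k" for i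
    by (rule smooth_on_differentiable[OF _ N2(2)], intro smooth_on_mm N2(1) scm sD that)+
  have ds: "(\<lambda>w. \<Sum>i<k. column_mat (f i w) ** D i w) differentiable at z"
    by (rule differentiable_sum') (simp add: d)
  have cg: "dz X z Y = dz (\<lambda>w. \<Sum>i<k. column_mat (f i w) ** D i w) z Y"
    "dzb X z Y = dzb (\<lambda>w. \<Sum>i<k. column_mat (f i w) ** D i w) z Y"
    by (rule dz_cong[OF N2(1,2) _ ds], rule eq, assumption)+
  have cmv: "(column_mat u ** A) *v v = (\<Sum>l\<in>UNIV. (A *v v) $ l) *s u" for u :: "complex^'n" and A
    by (simp add: column_mat_vec flip: matrix_vector_mul_assoc)
  have fz: "f i z \<in> F z r" if "i < k" for i using f(5)[OF that f(2)] .
  have Df: "frechet_derivative (f i) (at z) Y \<in> F z (r - 1)" if "i < k" for i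
    by (rule transversal[OF f(1,3) f(4)[OF that] _ f(2)]) (rule f(5)[OF that])
  have le: "F z r \<subseteq> F z (r - 1)" by (rule a.F_anti) simp
  have "dzb X z Y = (\<Sum>i<k. dzb (\<lambda>w. column_mat (f i w) ** D i w) z Y)"
    unfolding cg(2) by (rule dz_sum(2)) (simp add: d)
  also have "\<dots> = (\<Sum>i<k. column_mat (f i z) ** dzb (D i) z Y)"
    by (rule sum.cong) (auto simp: d dzb_mult dz_column_mat(2)[OF f(4) f(1,2)] mm_zero_left)
  finally have 1: "dzb X z Y *v v = (\<Sum>i<k. (column_mat (f i z) ** dzb (D i) z Y) *v v)"
    by (simp add: sum_matrix_vec)
  have in1: "(column_mat (f i z) ** A) *v v \<in> F z r" if "i < k" for i A
    unfolding cmv by (rule vec.subspace_scale[OF a.F_sub fz[OF that]])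
  have in2: "(column_mat (frechet_derivative (f i) (at z) Y) ** A) *v v \<in> F z (r - 1)" if "i < k" for i A
    unfolding cmv by (rule vec.subspace_scale[OF a.F_sub Df[OF that]])
  show "dzb X z Y *v v \<in> F z r"
    unfolding 1 by (rule vec.subspace_sum[OF a.F_sub]) (simp add: in1)
  have "dz X z Y = (\<Sum>i<k. dz (\<lambda>w. column_mat (f i w) ** D i w) z Y)"
    unfolding cg(1) by (rule dz_sum(1)) (simp add: d)
  also have "\<dots> = (\<Sum>i<k. column_mat (frechet_derivative (f i) (at z) Y) ** D i z + column_mat (f i z) ** dz (D i) z Y)"
    by (rule sum.cong) (auto simp: d dz_mult dz_column_mat(1)[OF f(4) f(1,2)])
  finally have 2: "dz X z Y *v v = (\<Sum>i<k. (column_mat (frechet_derivative (f i) (at z) Y) ** D i z) *v v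
      + (column_mat (f i z) ** dz (D i) z Y) *v v)"
    by (simp add: sum_matrix_vec matrix_vector_mult_add_rdistrib)
  show "dz X z Y *v v \<in> F z (r - 1)"
    unfolding 2 using in1 in2 le
    by (intro vec.subspace_sum[OF a.F_sub] vec.subspace_add[OF a.F_sub]) auto
qed

lemma conj_section_derivative:
  assumes N': "open N'" "N' \<subseteq> N" and X: "smooth_on X N'" and XF: "\<And>w v. w \<in> N' \<Longrightarrow> X w *v v \<in> cF w r"
    and z: "z \<in> N'"
  shows "dz X z Y *v v \<in> cF z r"
proof -
  have zN: "z \<in> N" using z N' by blast
  have d: "X differentiable at z" by (rule smooth_on_differentiable[OF X z])
  have "cnj_mat (X w) *v v \<in> F w r" if w: "w \<in> N'" for w v
  proof -
    have "w \<in> N" using w N' by blast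
    then have "cnj_vec (X w *v cnj_vec v) \<in> F w r" using XF[OF w, of "cnj_vec v"] adjacent_mhs.cF_iff[OF adj] by blast
    then show ?thesis by (simp add: cnj_vec_mult)
  qed
  then have "dzb (\<lambda>w. cnj_mat (X w)) z Y *v cnj_vec v \<in> F z r"
    by (intro section_derivative(1)[OF N' _ _ z] smooth_on_linear[OF bounded_linear_cnj_mat N'(1) X])
  then have "cnj_vec (dz X z Y *v v) \<in> F z r" unfolding dz_cnj(2)[OF d] by (simp add: cnj_vec_mult)
  then show ?thesis using adjacent_mhs.cF_iff[OF adj[OF zN]] by blast
qed

lemma dz_const_on:
  assumes "z \<in> N" "\<And>w. w \<in> N \<Longrightarrow> A w = C" "smooth_on A N"
  shows "dz A z X = 0"
  using dz_cong(1)[OF N assms(1) assms(2) smooth_on_differentiable[OF assms(3,1)], of X] by (simp add: dz_const)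

text \<open>The projection has values in F^r and in the conjugate of F^s; for the latter a
  \<open>dz\<close> derivative costs nothing. The last two identities come from differentiating the
  eigenvalue equations of \<open>P\<close> and \<open>S\<close>.\<close>

lemma pr_derivative:
  fixes X :: "complex^'m" and v :: "complex^'n"
  assumes z: "z \<in> N" and j: "(r, s) \<in> J"
  defines "D \<equiv> dz (\<lambda>w. pr w (r, s)) z X"
  shows "D *v v \<in> F z (r - 1)" "D *v v \<in> cF z s" "r + s = m \<Longrightarrow> D *v v \<in> Wc"
    "dz P z X ** pr z (r, s) = of_int r *\<^sub>R D - P z ** D"
    "dz S z X ** pr z (r, s) = (if r + s = m + 1 then D else 0) - S z ** D"
proof -
  note sp = smooth_pr[OF j]
  have dp: "(\<lambda>w. pr w (r, s)) differentiable at z" and dP: "P differentiable at z" and dS: "S differentiable at z"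
    using smooth_on_differentiable[OF _ z] sp smooth_P smooth_S by auto
  have inb: "pr w (r, s) *v v \<in> bg w (r, s)" if "w \<in> N" for w v
    by (rule adjacent_mhs.pr_in[OF adj[OF that] j])
  show "D *v v \<in> F z (r - 1)" unfolding D_def
    by (rule section_derivative(2)[OF N order_refl sp _ z]) (use inb adjacent_mhs.bigr_F[OF adj] in blast)
  show "D *v v \<in> cF z s" unfolding D_def
    by (rule conj_section_derivative[OF N order_refl sp _ z]) (use inb adjacent_mhs.bigr_cF[OF adj] in blast)
  interpret a: polarized_mhs W Q "F z" m hi p q0 q1 K using ph z by blast
  show "D *v v \<in> Wc" if rs: "r + s = m"
  proof -
    have "p ** pr w (r, s) = pr w (r, s)" if w: "w \<in> N" for w
      unfolding matrix_eq
    proof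
      fix v
      have "pr w (r, s) *v v \<in> Wc" using inb[OF w] adjacent_mhs.bigr_Wc[OF adj[OF w] _ rs] by blast
      then show "p ** pr w (r, s) *v v = pr w (r, s) *v v" using a.p_on by (simp add: matrix_vector_mul_assoc[symmetric])
    qed
    then have "dz (\<lambda>w. p ** pr w (r, s) - pr w (r, s)) z X = 0"
      by (intro dz_const_on[OF z, where C = 0] smooth_on_diff smooth_on_mm smooth_on_const N sp) auto
    moreover have "(\<lambda>w::complex^'m. p) differentiable at z" by simp
    ultimately have "p ** D = D"
      by (simp add: dz_diff dz_mult dp frechet_derivative_mm(2) dz_const mm_zero_left D_def)
    then have "D *v v = p *v (D *v v)" by (simp add: matrix_vector_mul_assoc)
    then show ?thesis using a.p_in by metis
  qed
  have "P w ** pr w (r, s) = of_int r *\<^sub>R pr w (r, s)" if w: "w \<in> N" for w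
    unfolding matrix_eq
    using adjacent_mhs.P_on[OF adj[OF w] inb[OF w]]
    by (simp add: matrix_vector_mul_assoc[symmetric] scaleR_matrix mat_mult_vec)
  then have "dz (\<lambda>w. P w ** pr w (r, s) - of_int r *\<^sub>R pr w (r, s)) z X = 0"
    by (intro dz_const_on[OF z, where C = 0] smooth_on_diff smooth_on_mm smooth_on_linear[OF bounded_linear_scaleR_right] N sp smooth_P) auto
  moreover have "(\<lambda>w. of_int r *\<^sub>R pr w (r, s)) differentiable at z"
    by (rule differentiable_linear[OF bounded_linear_scaleR_right dp])
  moreover have "dz (\<lambda>w. of_int r *\<^sub>R pr w (r, s)) z X = of_int r *\<^sub>R D"
    unfolding D_def by (rule dz_linear(1)[OF bounded_linear_scaleR_right _ dp]) (simp add: mm_scaleR_right)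
  ultimately show "dz P z X ** pr z (r, s) = of_int r *\<^sub>R D - P z ** D"
    by (simp add: dz_diff dz_mult dp dP frechet_derivative_mm(2) D_def[symmetric] algebra_simps add_eq_0_iff2)
  define c :: real where "c = (if r + s = m + 1 then 1 else 0)"
  have "S w ** pr w (r, s) = c *\<^sub>R pr w (r, s)" if w: "w \<in> N" for w
    unfolding matrix_eq
    using adjacent_mhs.S_on[OF adj[OF w] inb[OF w]]
    by (simp add: matrix_vector_mul_assoc[symmetric] scaleR_matrix mat_mult_vec c_def)
  then have "dz (\<lambda>w. S w ** pr w (r, s) - c *\<^sub>R pr w (r, s)) z X = 0"
    by (intro dz_const_on[OF z, where C = 0] smooth_on_diff smooth_on_mm smooth_on_linear[OF bounded_linear_scaleR_right] N sp smooth_S) auto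
  moreover have "(\<lambda>w. c *\<^sub>R pr w (r, s)) differentiable at z"
    by (rule differentiable_linear[OF bounded_linear_scaleR_right dp])
  moreover have "dz (\<lambda>w. c *\<^sub>R pr w (r, s)) z X = c *\<^sub>R D"
    unfolding D_def by (rule dz_linear(1)[OF bounded_linear_scaleR_right _ dp]) (simp add: mm_scaleR_right)
  ultimately have "dz S z X ** pr z (r, s) = c *\<^sub>R D - S z ** D"
    by (simp add: dz_diff dz_mult dp dS frechet_derivative_mm(2) D_def[symmetric] algebra_simps add_eq_0_iff2)
  then show "dz S z X ** pr z (r, s) = (if r + s = m + 1 then D else 0) - S z ** D" by (simp add: c_def)
qed

text \<open>Let y be the derivative of the projection applied to \<open>x\<close>. Its three
  memberships leave only the indices (r, s), (r - 1, s + 1) and, when r + s = m + 1, (r - 1, s). The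
  factor r - fst k removes the first from the derivative of \<open>P\<close>, and the derivative of
  \<open>S\<close> keeps exactly the components where the weight drops.\<close>

lemma differential_type:
  assumes z: "z \<in> N"
  shows "adjacent_mhs.has_type W (F z) m (- 1) 1 (dz P z X - dz S z X)" "adjacent_mhs.has_type W (F z) m (- 1) 0 (dz S z X)"
proof -
  interpret a: polarized_mhs W Q "F z" m hi p q0 q1 K using ph z by blast
  have "(dz P z X - dz S z X) *v x \<in> a.bigr (r - 1, s + 1) \<and> dz S z X *v x \<in> a.bigr (r - 1, s)"
    if x: "x \<in> a.bigr (r, s)" for r s x
  proof (cases "(r, s) \<in> J")
    case False
    then have "x = 0" using a.bigr_zero[OF False] x by simp
    then show ?thesis using vec.subspace_0[OF a.bigr_sub] by simp
  next
    case True
    define D where "D = dz (\<lambda>w. pr w (r, s)) z X"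
    note pd = pr_derivative[OF z True, of X, folded D_def]
    define y where "y = D *v x"
    have px: "pr z (r, s) *v x = x" using a.pr_on[OF True True x] by simp
    have Px: "dz P z X *v x = of_int r *s y - a.P *v y"
    proof -
      have "dz P z X *v x = (dz P z X ** pr z (r, s)) *v x" by (simp add: matrix_vector_mul_assoc[symmetric] px)
      then show ?thesis unfolding pd(4) y_def
        by (simp add: matrix_vector_mult_diff_rdistrib matrix_vector_mul_assoc[symmetric] scaleR_matrix mat_mult_vec)
    qed
    have Sx: "dz S z X *v x = (if r + s = m + 1 then y else 0) - a.S *v y"
    proof -
      have "dz S z X *v x = (dz S z X ** pr z (r, s)) *v x" by (simp add: matrix_vector_mul_assoc[symmetric] px)
      then show ?thesis unfolding pd(5) y_def
        by (simp add: matrix_vector_mult_diff_rdistrib matrix_vector_mul_assoc[symmetric])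
    qed
    have rs: "r + s = m \<or> r + s = m + 1" using True by (auto simp: a.J_def)
    have y0: "a.pr k *v y = 0" if "k \<in> J" "fst k < r - 1 \<or> snd k < s \<or> (r + s = m \<and> fst k + snd k = m + 1)" for k
      using pd(1)[of x] pd(2)[of x] pd(3)[of x] that unfolding y_def a.F_proj a.cF_proj a.Wc_proj by blast
    have kJ: "fst k + snd k = m \<or> fst k + snd k = m + 1" if "k \<in> J" for k using that by (auto simp: a.J_def)
    have pS: "a.pr k *v (dz S z X *v x) = (if r + s = m + 1 \<and> fst k + snd k = m then a.pr k *v y else 0)" if k: "k \<in> J" for k
    proof -
      have "a.pr k *v (dz S z X *v x) = (if r + s = m + 1 then a.pr k *v y else 0) - (if fst k + snd k = m + 1 then a.pr k *v y else 0)"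
        unfolding Sx by (simp add: matrix_vector_mult_diff_distrib a.pr_S[OF k])
      then show ?thesis using kJ[OF k] rs y0[OF k] by auto
    qed
    have pP: "a.pr k *v (dz P z X *v x) = of_int (r - fst k) *s (a.pr k *v y)" if k: "k \<in> J" for k
      unfolding Px
      by (simp add: matrix_vector_mult_diff_distrib a.pr_P[OF k] vector_scalar_commute[symmetric] vector_sub_rdistrib)
    have "dz S z X *v x \<in> a.bigr (r - 1, s)"
    proof (rule a.bigrI)
      fix k assume k: "k \<in> J" "k \<noteq> (r - 1, s)"
      have "a.pr k *v y = 0" if "r + s = m + 1" "fst k + snd k = m"
      proof -
        have "fst k < r - 1 \<or> snd k < s" using that k(2) by (cases k) auto
        then show ?thesis using y0[OF k(1)] by blast
      qed
      then show "a.pr k *v (dz S z X *v x) = 0" using pS[OF k(1)] by simp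
    qed
    moreover have "(dz P z X - dz S z X) *v x \<in> a.bigr (r - 1, s + 1)"
    proof (rule a.bigrI)
      fix k assume k: "k \<in> J" "k \<noteq> (r - 1, s + 1)"
      have "a.pr k *v ((dz P z X - dz S z X) *v x) =
        of_int (r - fst k) *s (a.pr k *v y) - (if r + s = m + 1 \<and> fst k + snd k = m then a.pr k *v y else 0)"
        by (simp only: matrix_vector_mult_diff_rdistrib matrix_vector_mult_diff_distrib pP[OF k(1)] pS[OF k(1)])
      also have "\<dots> = 0"
      proof (cases "fst k < r - 1 \<or> snd k < s \<or> (r + s = m \<and> fst k + snd k = m + 1)")
        case True
        then show ?thesis using y0[OF k(1)] by simp
      next
        case False
        \<comment> \<open>In the first case both terms vanish; in the second the contributions of
          \<open>P\<close> and \<open>S\<close> are equal and cancel.\<close>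
        then consider "fst k = r" "r + s = fst k + snd k" | "fst k = r - 1" "r + s = m + 1" "fst k + snd k = m"
          using rs kJ[OF k(1)] k(2) by (cases k) auto
        then show ?thesis by cases (use rs in auto)
      qed
      finally show "a.pr k *v ((dz P z X - dz S z X) *v x) = 0" .
    qed
    ultimately show ?thesis by blast
  qed
  then show "adjacent_mhs.has_type W (F z) m (- 1) 1 (dz P z X - dz S z X)" "adjacent_mhs.has_type W (F z) m (- 1) 0 (dz S z X)"
    unfolding a.has_type_def by (simp_all only: add_uminus_conv_diff add_0_right) blast+
qed

end

lemma holomorphic_map_lincomb:
  assumes "\<And>i. i < k \<Longrightarrow> holomorphic_map (f i) N"
  shows "holomorphic_map (\<lambda>w. \<Sum>i<k::nat. c i *s f i w) N"
  unfolding holomorphic_map_def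
proof
  fix z assume z: "z \<in> N"
  have bl: "bounded_linear (\<lambda>v::complex^'b. c i *s v)" for i
    unfolding linear_conv_bounded_linear[symmetric]
    by (rule linearI) (auto simp: vec_eq_iff algebra_simps)
  have "((\<lambda>w. \<Sum>i<k. c i *s f i w) has_derivative (\<lambda>v. \<Sum>i<k. c i *s frechet_derivative (f i) (at z) v)) (at z)"
    by (rule has_derivative_sum, rule bounded_linear.has_derivative[OF bl])
      (use holomorphic_mapD(1)[OF assms z] in auto)
  moreover have "(\<Sum>i<k. c i *s frechet_derivative (f i) (at z) (d *s v)) = d *s (\<Sum>i<k. c i *s frechet_derivative (f i) (at z) v)" for d v
    by (simp add: vec.scale_sum_right vector_smult_assoc mult.commute holomorphic_mapD(2)[OF assms z])
  ultimately show "\<exists>f'. ((\<lambda>w. \<Sum>i<k. c i *s f i w) has_derivative f') (at z) \<and> (\<forall>d v. f' (d *s v) = d *s f' v)"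
    by blast
qed

context hodge_family
begin

lemma hodge_operator_family:
  assumes z0: "z0 \<in> N"
  shows "hodge_operator p q0 q1 K (if even m then 1 else - 1) N P S (of_int m)"
proof -
  interpret z0: polarized_mhs W Q "F z0" m hi p q0 q1 K using ph z0 by blast
  show ?thesis
  proof unfold_locales
    fix z X assume z: "z \<in> N"
    interpret a: polarized_mhs W Q "F z" m hi p q0 q1 K using ph z by blast
    note t = differential_type[OF z, of X]
    show "cnj_mat (S z) = S z" by (rule a.cnj_S)
    show "cnj_mat (P z) = S z + of_int m *\<^sub>R mat 1 - P z" by (rule a.cnj_P)
    have B: "P z ** dz S z X - dz S z X ** P z = - dz S z X" using a.opr_bracket[OF t(2)] by simp
    then show "P z ** dz S z X - dz S z X ** P z = - dz S z X" .
    show "P z ** dz P z X - dz P z X ** P z = - dz P z X"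
    proof -
      let ?t = "dz P z X - dz S z X"
      have A: "P z ** ?t - ?t ** P z = - ?t" using a.opr_bracket[OF t(1)] by simp
      have "P z ** dz P z X - dz P z X ** P z = (P z ** ?t - ?t ** P z) + (P z ** dz S z X - dz S z X ** P z)"
        by (simp add: mm_diff_left mm_diff_right)
      also have "\<dots> = - dz P z X" unfolding A B by simp
      finally show ?thesis .
    qed
    show "S z ** p = 0" by (rule a.S_p)
    show "p ** (mat 1 - S z) = mat 1 - S z" by (rule a.p_S)
    show "p ** (P z ** p) = P z ** p" by (rule a.pPp)
    show "transpose p ** (transpose (P z) ** q0 + q0 ** P z) ** p = of_int m *\<^sub>R q0" by (rule a.P_q0)
    show "transpose (P z) ** q1 + q1 ** P z = (of_int m + 1) *\<^sub>R q1" using a.P_q1 by simp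
  qed (fact N smooth_P smooth_S z0.fm_real)+
qed

text \<open>The right-hand sides of \<open>P_q0\<close> and \<open>P_q1\<close> are constant, so
  differentiating these identities gives the linearised isometry conditions.\<close>

lemma differential_infinitesimal:
  assumes z: "z \<in> N"
  shows "polarized_mhs.infinitesimal p q0 q1 (dz P z X)" "polarized_mhs.infinitesimal p q0 q1 (dz S z X)"
    "polarized_mhs.infinitesimal p q0 q1 (dz P z X - dz S z X)"
proof -
  interpret a: polarized_mhs W Q "F z" m hi p q0 q1 K using ph z by blast
  interpret ho: hodge_operator p q0 q1 K "if even m then 1 else - 1" N P S "of_int m"
    by (rule hodge_operator_family[OF z])
  let ?t = "dz P z X"
  have d: "P differentiable at z" by (rule ho.smooth_diff[OF smooth_P z])
  have dt: "(\<lambda>z. transpose (P z)) differentiable at z" by (rule ho.smooth_diff[OF _ z]) (intro ho.sm)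
  have lt: "dz (\<lambda>z. transpose (P z)) z X = transpose ?t"
    by (rule dz_linear(1)[OF bounded_linear_transpose transpose_mat_mult d])
  have d2: "(\<lambda>z. transpose (P z) ** q0) differentiable at z" "(\<lambda>z. q0 ** P z) differentiable at z"
    "(\<lambda>z. transpose (P z) ** q1) differentiable at z" "(\<lambda>z. q1 ** P z) differentiable at z"
    "(\<lambda>z. transpose p ** (transpose (P z) ** q0 + q0 ** P z)) differentiable at z"
    by (rule ho.smooth_diff[OF _ z], intro ho.sm)+
  have "dz (\<lambda>z. transpose p ** (transpose (P z) ** q0 + q0 ** P z) ** p) z X = 0"
    by (rule ho.dz_eq_const(1)[OF z ho.P_q0]) (auto intro!: ho.sm)
  then have c0: "transpose p ** (transpose ?t ** q0 + q0 ** ?t) ** p = 0"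
    by (simp add: dz_mult d2 d dt dz_const differentiable_add mm_zero_left mm_zero_right dz_add lt)
  have "dz (\<lambda>z. transpose (P z) ** q1 + q1 ** P z) z X = 0"
    by (rule ho.dz_eq_const(1)[OF z ho.P_q1]) (auto intro!: ho.sm)
  then have c1: "transpose ?t ** q1 + q1 ** ?t = 0"
    by (simp add: dz_mult d2 d dt dz_const mm_zero_left mm_zero_right dz_add lt)
  show 1: "a.infinitesimal ?t" unfolding a.infinitesimal_def using ho.theta_p[OF z] c0 c1 by blast
  show 2: "a.infinitesimal (dz S z X)" by (rule a.type_B(5)[OF differential_type(2)[OF z]])
  have eq: "transpose p ** (transpose (?t - dz S z X) ** q0 + q0 ** (?t - dz S z X)) ** p =
      transpose p ** (transpose ?t ** q0 + q0 ** ?t) ** p - transpose p ** (transpose (dz S z X) ** q0 + q0 ** dz S z X) ** p"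
    by (simp add: mm_diff_left mm_diff_right mm_add_left mm_add_right)
  have eq1: "transpose (?t - dz S z X) ** q1 + q1 ** (?t - dz S z X) =
      (transpose ?t ** q1 + q1 ** ?t) - (transpose (dz S z X) ** q1 + q1 ** dz S z X)"
    by (simp add: mm_diff_left mm_diff_right)
  show "a.infinitesimal (?t - dz S z X)"
    using 1 2 unfolding a.infinitesimal_def eq eq1 by (simp add: mm_diff_left mm_diff_right)
qed

text \<open>For a section f of F^r, (P - r) f lies in F^(r+1), so its derivative lies in F^r. The
  derivative u of f lies in F^(r-1), so (P - r + 1) u lies in F^r as well. The difference of the two
  is u minus the derivative of \<open>P\<close> applied to f.\<close>

lemma represents_derivative_P:
  assumes z: "z \<in> N"
  shows "represents_derivative F z \<xi> (dz P z \<xi>)"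
  unfolding represents_derivative_def
proof (intro allI impI, elim conjE)
  fix r N' f
  assume N': "open N'" "z \<in> N'" "holomorphic_map f N'" and fF: "\<forall>w\<in>N'. f w \<in> F w r"
  interpret a: polarized_mhs W Q "F z" m hi p q0 q1 K using ph z by blast
  define N1 where "N1 = N \<inter> N'"
  have N1: "open N1" "N1 \<subseteq> N" "z \<in> N1" using N N' z by (auto simp: N1_def)
  have f1: "holomorphic_map f N1" using N'(3) unfolding holomorphic_map_def N1_def by blast
  have fF1: "f w \<in> F w r" if "w \<in> N1" for w using fF that by (auto simp: N1_def)
  define X where "X w = column_mat (f w)" for w
  have sX: "smooth_on X N1" unfolding X_def by (intro smooth_on_column_mat holomorphic_map_smooth N1 f1)
  define Y where "Y w = P w ** X w - of_int r *\<^sub>R X w" for w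
  have sP: "smooth_on P N1" by (rule smooth_on_subset[OF smooth_P N1(2)])
  have sY: "smooth_on Y N1" unfolding Y_def
    by (intro smooth_on_diff smooth_on_mm smooth_on_linear[OF bounded_linear_scaleR_right] N1(1) sX sP)
  have step: "P w *v x - of_int r *s x \<in> F w (r + 1)" if w: "w \<in> N" and x: "x \<in> F w r" for w x and r :: int
  proof -
    interpret b: adjacent_mhs W Q "F w" m hi using adj w by blast
    have "b.pr k *v (P w *v x - of_int r *s x) = 0" if k: "k \<in> J" "fst k < r + 1" for k
    proof -
      have "b.pr k *v (P w *v x - of_int r *s x) = of_int (fst k - r) *s (b.pr k *v x)"
        by (simp add: matrix_vector_mult_diff_distrib b.pr_P[OF k(1)] vector_scalar_commute[symmetric] vector_sub_rdistrib)
      moreover have "b.pr k *v x = 0" if "fst k < r" using x k(1) that unfolding b.F_proj by blast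
      ultimately show ?thesis using k(2) by (cases "fst k = r") auto
    qed
    then show ?thesis unfolding b.F_proj by blast
  qed
  have "Y w *v v \<in> F w (r + 1)" if w: "w \<in> N1" for w v
  proof -
    interpret b: adjacent_mhs W Q "F w" m hi using adj w N1 by blast
    have "X w *v v \<in> F w r" unfolding X_def column_mat_vec by (rule vec.subspace_scale[OF b.F_sub fF1[OF w]])
    from step[OF _ this] have "P w *v (X w *v v) - of_int r *s (X w *v v) \<in> F w (r + 1)" using w N1 by blast
    then show ?thesis
      by (simp add: Y_def matrix_vector_mult_diff_rdistrib matrix_vector_mul_assoc[symmetric] scaleR_matrix mat_mult_vec)
  qed
  from section_derivative(2)[OF N1(1,2) sY this N1(3)]
  have dY: "dz Y z \<xi> *v v \<in> F z r" for v by simp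
  have dP: "P differentiable at z" and dX: "X differentiable at z"
    using smooth_on_differentiable[OF sP N1(3)] smooth_on_differentiable[OF sX N1(3)] by auto
  have "dz Y z \<xi> = dz P z \<xi> ** X z + P z ** dz X z \<xi> - of_int r *\<^sub>R dz X z \<xi>"
  proof -
    have l: "dz (\<lambda>w. of_int r *\<^sub>R X w) z \<xi> = of_int r *\<^sub>R dz X z \<xi>"
      by (rule dz_linear(1)[OF bounded_linear_scaleR_right _ dX]) (simp add: mm_scaleR_right)
    show ?thesis unfolding Y_def
      by (subst dz_diff(1)[OF frechet_derivative_mm(2)[OF dP dX] differentiable_linear[OF bounded_linear_scaleR_right dX]])
        (simp only: dz_mult[OF dP dX] l)
  qed
  note dzY = this
  have dzX: "dz X z \<xi> = column_mat (frechet_derivative f (at z) \<xi>)"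
    unfolding X_def by (rule dz_column_mat(1)[OF f1 N1(1,3)])
  define e where "e = (axis undefined 1 :: complex^'n)"
  define u where "u = frechet_derivative f (at z) \<xi>"
  have Xe: "X z *v e = f z" "dz X z \<xi> *v e = u" unfolding dzX X_def e_def u_def column_mat_axis by simp_all
  have "dz P z \<xi> *v f z + P z *v u - of_int r *s u \<in> F z r"
    using dY[of e] unfolding dzY
    by (simp add: matrix_vector_mult_diff_rdistrib matrix_vector_mult_add_rdistrib matrix_vector_mul_assoc[symmetric]
        scaleR_matrix mat_mult_vec Xe)
  moreover have "u \<in> F z (r - 1)"
    unfolding u_def by (rule transversal[OF N1(1,2) f1 fF1 N1(3)])
  then have "P z *v u - of_int (r - 1) *s u \<in> F z r" using step[OF z, of u "r - 1"] by simp
  ultimately have "(P z *v u - of_int (r - 1) *s u) - (dz P z \<xi> *v f z + P z *v u - of_int r *s u) \<in> F z r"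
    using vec.subspace_diff[OF a.F_sub] by blast
  moreover have "(P z *v u - of_int (r - 1) *s u) - (dz P z \<xi> *v f z + P z *v u - of_int r *s u) = u - dz P z \<xi> *v f z"
    by (simp add: vec_eq_iff algebra_simps)
  ultimately show "frechet_derivative f (at z) \<xi> - dz P z \<xi> *v f z \<in> F z r" by (simp add: u_def)
qed

text \<open>Every vector of F^r extends to a holomorphic section, with constant coefficients in a
  frame. Two representatives therefore differ by a map preserving \<open>F\<close>, and
  \<open>q_space_zero\<close> applies.\<close>

lemma tangent_vector_eq:
  assumes z: "z \<in> N"
  shows "tangent_vector W Q F z \<xi> = dz P z \<xi>"
  unfolding tangent_vector_def
proof (rule the_equality)
  interpret a: polarized_mhs W Q "F z" m hi p q0 q1 K using ph z by blast
  have q: "dz P z \<xi> \<in> q_space W Q (F z)"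
    using a.q_space_I[OF differential_infinitesimal(3)[OF z] differential_type(1)[OF z]
        differential_infinitesimal(2)[OF z] differential_type(2)[OF z], of \<xi> \<xi>] by simp
  show "dz P z \<xi> \<in> q_space W Q (F z) \<and> represents_derivative F z \<xi> (dz P z \<xi>)"
    using q represents_derivative_P[OF z] by blast
  fix u assume u: "u \<in> q_space W Q (F z) \<and> represents_derivative F z \<xi> u"
  have "u - dz P z \<xi> = 0"
  proof (rule a.q_space_zero)
    show "u - dz P z \<xi> \<in> q_space W Q (F z)" using u q unfolding q_space_def by (blast intro: span_diff)
    fix r x assume x: "x \<in> F z r"
    obtain N1 k f where f: "open N1" "z \<in> N1" "N1 \<subseteq> N" "\<And>i. i < k \<Longrightarrow> holomorphic_map (f i) N1"
      "\<And>w. w \<in> N1 \<Longrightarrow> F w r = vec.span ((\<lambda>i. f i w) ` {..<k::nat})"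
      using local_frame[OF z, of r] by metis
    obtain c where c: "x = (\<Sum>i<k. c i *s f i z)" using x unfolding f(5)[OF f(2)] span_frame by blast
    define g where "g w = (\<Sum>i<k. c i *s f i w)" for w
    have hg: "holomorphic_map g N1" unfolding g_def by (rule holomorphic_map_lincomb[OF f(4)])
    have gF: "\<forall>w\<in>N1. g w \<in> F w r"
    proof
      fix w assume w: "w \<in> N1"
      show "g w \<in> F w r" unfolding f(5)[OF w] span_frame g_def by blast
    qed
    have gz: "g z = x" by (simp add: g_def c)
    have "frechet_derivative g (at z) \<xi> - u *v x \<in> F z r" "frechet_derivative g (at z) \<xi> - dz P z \<xi> *v x \<in> F z r"
      using u represents_derivative_P[OF z, of \<xi>] f(1,2) hg gF unfolding represents_derivative_def gz[symmetric] by blast+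
    then have "(frechet_derivative g (at z) \<xi> - dz P z \<xi> *v x) - (frechet_derivative g (at z) \<xi> - u *v x) \<in> F z r"
      using vec.subspace_diff[OF a.F_sub] by blast
    then show "(u - dz P z \<xi>) *v x \<in> F z r" by (simp add: matrix_vector_mult_diff_rdistrib)
  qed
  then show "u = dz P z \<xi>" by simp
qed

definition fmetric :: "complex^'m \<Rightarrow> complex^'m \<Rightarrow> complex^'m \<Rightarrow> complex" where
  "fmetric z X Y = mixed_hodge_metric_End W Q (F z) (tangent_vector W Q F z X) (tangent_vector W Q F z Y)"

lemma fmetric_eq:
  assumes z: "z \<in> N"
  shows "fmetric z X Y = trace (dz P z X ** cnj_mat (dz P z Y)) + \<i> * trace (dz S z X ** K ** transpose (cnj_mat (dz S z Y)) ** q0)"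
proof -
  interpret a: polarized_mhs W Q "F z" m hi p q0 q1 K using ph z by blast
  show ?thesis
    unfolding fmetric_def tangent_vector_eq[OF z]
    using a.metric_End_eq[OF differential_type[OF z] differential_type(1)[OF z] differential_infinitesimal(3)[OF z] differential_type(2)[OF z]]
    by (simp add: a.beta_def)
qed

text \<open>Positivity comes from the definition by adjoints, the other properties from the explicit
  formula.\<close>

lemma fmetric_props:
  shows "z \<in> N \<Longrightarrow> fmetric z (s *s X + X') Y = s * fmetric z X Y + fmetric z X' Y"
    "z \<in> N \<Longrightarrow> fmetric z Y X = cnj (fmetric z X Y)" "z \<in> N \<Longrightarrow> 0 \<le> Re (fmetric z X X)"
    "smooth_on (\<lambda>z. fmetric z X Y) N" "z \<in> N \<Longrightarrow> ext_deriv2 (fundamental_form fmetric) z X Y Z = 0"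
proof -
  have *: "fmetric z X Y = hodge_operator.metric q0 K P S z X Y" if z: "z \<in> N" for z X Y
  proof -
    interpret ho: hodge_operator p q0 q1 K "if even m then 1 else - 1" N P S "of_int m"
      by (rule hodge_operator_family[OF z])
    show ?thesis unfolding fmetric_eq[OF z] ho.metric_def ho.beta_def ..
  qed
  show "fmetric z (s *s X + X') Y = s * fmetric z X Y + fmetric z X' Y" if z: "z \<in> N" for z
    unfolding *[OF z] by (rule hodge_operator.metric_linear[OF hodge_operator_family[OF z] z])
  show "fmetric z Y X = cnj (fmetric z X Y)" if z: "z \<in> N" for z
    unfolding *[OF z] by (rule hodge_operator.metric_hermitian[OF hodge_operator_family[OF z] z])
  show "0 \<le> Re (fmetric z X X)" if z: "z \<in> N" for z
    unfolding fmetric_def tangent_vector_eq[OF z]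
    by (rule polarized_mhs.metric_End_nonneg[OF ph[OF z] differential_type(1)[OF z] differential_infinitesimal(3)[OF z] differential_type(2)[OF z]])
  show sm: "smooth_on (\<lambda>z. fmetric z X Y) N" for X Y
  proof (cases "N = {}")
    case True then show ?thesis by (intro smooth_on_local) simp
  next
    case False
    then obtain z0 where z0: "z0 \<in> N" by blast
    show ?thesis
      by (rule smooth_on_cong[OF N _ hodge_operator.metric_smooth[OF hodge_operator_family[OF z0]]]) (simp add: *)
  qed
  show "ext_deriv2 (fundamental_form fmetric) z X Y Z = 0" if z: "z \<in> N"
  proof -
    interpret ho: hodge_operator p q0 q1 K "if even m then 1 else - 1" N P S "of_int m"
      by (rule hodge_operator_family[OF z])
    have ff: "frechet_derivative (\<lambda>w. fundamental_form fmetric w X Y) (at z) = frechet_derivative (\<lambda>w. fundamental_form ho.metric w X Y) (at z)" for X Y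
    proof (rule frechet_derivative_cong_open[OF N z])
      show "fundamental_form ho.metric w X Y = fundamental_form fmetric w X Y" if "w \<in> N" for w
        by (simp add: fundamental_form_def *[OF that])
      have "(\<lambda>w. \<i> / 2 * (ho.metric w X Y - ho.metric w Y X)) differentiable at z"
        by (rule smooth_on_differentiable[OF _ z])
          (intro smooth_on_mult smooth_on_const smooth_on_diff N ho.metric_smooth)
      then show "(\<lambda>w. fundamental_form ho.metric w X Y) differentiable at z"
        unfolding fundamental_form_def by (rule differentiable_linear[OF bounded_linear_Re])
    qed
    show ?thesis using ho.metric_closed[OF z, of X Y Z] unfolding ext_deriv2_def ff .
  qed
qed

end

section \<open>Real isometries\<close>

text \<open>For one weight \<open>k\<close> at a time, because flatness of weights and forms
  provides neighbourhoods that may depend on \<open>k\<close>.\<close>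

definition isometry_at ::
  "'n::finite weight \<Rightarrow> 'n forms \<Rightarrow> 'n weight \<Rightarrow> 'n forms \<Rightarrow> int \<Rightarrow> real^'n^'n \<Rightarrow> bool" where
  "isometry_at W Q W' Q' k g \<longleftrightarrow> invertible g \<and> (*v) g ` W k = W' k \<and>
     (\<forall>u\<in>W k. \<forall>v\<in>W k. Q' k (g *v u) (g *v v) = Q k u v)"

lemma matrix_inv_vec [simp]:
  fixes g :: "'a::field^'n^'n"
  assumes "invertible g"
  shows "matrix_inv g *v (g *v u) = u" "g *v (matrix_inv g *v u) = u"
  using matrix_inv_invertible[OF assms] by (simp_all add: matrix_vector_mul_assoc)

lemma invertible_matrix_inv: "invertible g \<Longrightarrow> invertible (matrix_inv g)"
  using matrix_inv_invertible invertible_def by metis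

lemma matrix_inv_matrix_mul:
  fixes A B :: "'a::field^'n^'n"
  assumes "invertible A" "invertible B"
  shows "matrix_inv (A ** B) = matrix_inv B ** matrix_inv A"
  by (rule matrix_inv_eqI) (metis assms matrix_inv_invertible(1) matrix_mul_assoc matrix_mul_rid)

lemma matrix_inv_matrix_inv: "invertible A \<Longrightarrow> matrix_inv (matrix_inv A) = A" for A :: "'a::field^'n^'n"
  by (rule matrix_inv_eqI) (rule matrix_inv_invertible)

lemma isometry_at_comp:
  assumes "isometry_at W Q W' Q' k g" "isometry_at W' Q' W'' Q'' k h"
  shows "isometry_at W Q W'' Q'' k (h ** g)"
  unfolding isometry_at_def
proof (intro conjI ballI)
  show "invertible (h ** g)" using assms by (simp add: isometry_at_def invertible_mult)
  have "(*v) (h ** g) ` W k = (*v) h ` (*v) g ` W k" by (simp add: image_image matrix_vector_mul_assoc)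
  then show "(*v) (h ** g) ` W k = W'' k" using assms by (simp add: isometry_at_def)
  fix u v assume uv: "u \<in> W k" "v \<in> W k"
  then have "g *v u \<in> W' k" "g *v v \<in> W' k" using assms by (auto simp: isometry_at_def)
  then show "Q'' k (h ** g *v u) (h ** g *v v) = Q k u v"
    using uv assms by (simp add: isometry_at_def flip: matrix_vector_mul_assoc)
qed

lemma isometry_at_inv:
  assumes "isometry_at W Q W' Q' k g"
  shows "isometry_at W' Q' W Q k (matrix_inv g)"
proof -
  have g: "invertible g" and W': "W' k = (*v) g ` W k"
    and Q: "\<And>u v. u \<in> W k \<Longrightarrow> v \<in> W k \<Longrightarrow> Q' k (g *v u) (g *v v) = Q k u v"
    using assms unfolding isometry_at_def by auto
  show ?thesis unfolding isometry_at_def W'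
    by (auto simp: invertible_matrix_inv[OF g] g Q image_image)
qed

lemma isometry_at_id: "isometry_at W Q W Q k (mat 1)"
  by (auto simp: isometry_at_def invertible_def intro!: exI[of _ "mat 1"])

lemma complex_mat_inv:
  assumes "invertible g"
  shows "complex_mat g ** complex_mat (matrix_inv g) = mat 1" "complex_mat (matrix_inv g) ** complex_mat g = mat 1"
  by (simp_all add: complex_mat_mult[symmetric] matrix_inv_invertible[OF assms])

lemma complex_mat_inv_vec:
  assumes "invertible g"
  shows "complex_mat g *v (complex_mat (matrix_inv g) *v u) = u" "complex_mat (matrix_inv g) *v (complex_mat g *v u) = u"
  by (simp_all add: complex_mat_inv[OF assms] matrix_vector_mul_assoc)

lemma inj_complex_mat: "invertible g \<Longrightarrow> inj ((*v) (complex_mat g))"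
  by (rule inj_on_inverseI[of _ "(*v) (complex_mat (matrix_inv g))"]) (simp add: complex_mat_inv_vec)

lemma surj_complex_mat: "invertible g \<Longrightarrow> range ((*v) (complex_mat g)) = UNIV"
  by (rule surjI[of _ "(*v) (complex_mat (matrix_inv g))"]) (simp add: complex_mat_inv_vec)

lemma complexify_image:
  assumes "invertible g"
  shows "complexify ((*v) g ` U) = (*v) (complex_mat g) ` complexify U"
proof (intro equalityI subsetI)
  fix x assume x: "x \<in> complexify ((*v) g ` U)"
  have "complex_mat (matrix_inv g) *v x \<in> complexify U"
    using x assms by (auto simp: complexify_def re_vec_complex_mat im_vec_complex_mat)
  then show "x \<in> (*v) (complex_mat g) ` complexify U" by (metis complex_mat_inv_vec(1) assms imageI)
next
  fix x assume "x \<in> (*v) (complex_mat g) ` complexify U"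
  then show "x \<in> complexify ((*v) g ` U)" by (auto simp: complexify_def re_vec_complex_mat im_vec_complex_mat)
qed

lemma cnj_vec_complex_mat: "cnj_vec (complex_mat g *v v) = complex_mat g *v cnj_vec v"
  by (simp add: cnj_vec_mult)

lemma cnj_vec_image_complex_mat: "cnj_vec ` (*v) (complex_mat g) ` A = (*v) (complex_mat g) ` cnj_vec ` A"
  by (simp add: image_image cnj_vec_complex_mat)

lemma subspace_sum_image: "subspace_sum ((*v) G ` A) ((*v) G ` B) = (*v) G ` subspace_sum A B"
  by (force simp: subspace_sum_def matrix_vector_right_distrib)

lemma act_mult: "act g (act h F) = act (g ** h) F"
  by (simp add: act_def image_image complex_mat_mult matrix_vector_mul_assoc)

lemma act_id: "act (mat 1) F = F"
  by (simp add: act_def)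

lemma mem_act_iff: "invertible g \<Longrightarrow> x \<in> act g F r \<longleftrightarrow> complex_mat (matrix_inv g) *v x \<in> F r"
  unfolding act_def using complex_mat_inv_vec[of g] by (metis (no_types, lifting) imageE imageI)

lemma linear_image_subspace: "vec.subspace A \<Longrightarrow> vec.subspace ((*v) G ` A)" for G :: "complex^'n^'n"
  unfolding vec.subspace_def
  by (auto simp: matrix_vector_right_distrib[symmetric] vector_scalar_commute[symmetric] intro: image_eqI[of 0 _ 0])

lemma isometry_transport:
  assumes I: "\<And>k. isometry_at W Q W' Q' k g" and mhs: "mixed_hodge_structure W F" and pol: "graded_polarized W Q F"
  shows "mixed_hodge_structure W' (act g F)" "graded_polarized W' Q' (act g F)"
proof -
  let ?G = "(*v) (complex_mat g)"
  have g: "invertible g" and W': "\<And>k. W' k = (*v) g ` W k"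
    and Q: "\<And>k u v. u \<in> W k \<Longrightarrow> v \<in> W k \<Longrightarrow> Q' k (g *v u) (g *v v) = Q k u v"
    using I unfolding isometry_at_def by auto
  note inj = inj_complex_mat[OF g]
  have inj': "inj ((*v) g)" by (rule inj_on_inverseI[of _ "(*v) (matrix_inv g)"]) (simp add: g)
  have Wc: "complexify (W' k) = ?G ` complexify (W k)" for k unfolding W' by (rule complexify_image[OF g])
  have F': "act g F r = ?G ` F r" for r by (simp add: act_def)
  note img = Wc F' subspace_sum_image cnj_vec_image_complex_mat image_Int[OF inj, symmetric]
  have gr: "gr_hodge W' (act g F) k r = ?G ` gr_hodge W F k r" for k r
    unfolding gr_hodge_def by (simp only: img)
  have hc: "hodge_component W' (act g F) r s = ?G ` hodge_component W F r s" for r s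
    unfolding hodge_component_def gr by (simp only: img)
  have wf: "weight_filtration W" and hf: "hodge_filtration F"
    and pure: "\<And>k r. subspace_sum (gr_hodge W F k r) (cnj_vec ` gr_hodge W F k (k + 1 - r)) = complexify (W k)"
      "\<And>k r. gr_hodge W F k r \<inter> cnj_vec ` gr_hodge W F k (k + 1 - r) = complexify (W (k - 1))"
    using mhs unfolding mixed_hodge_structure_def by auto
  have "weight_filtration W'"
    unfolding weight_filtration_def
  proof (intro conjI allI)
    show "subspace (W' k)" for k unfolding W' by (rule linear_subspace_image[OF matrix_vector_mul_linear]) (use wf in \<open>auto simp: weight_filtration_def\<close>)
    show "mono W'" using wf unfolding weight_filtration_def mono_def W' by blast
    obtain k l where "W k = {0}" "W l = UNIV" using wf unfolding weight_filtration_def by blast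
    moreover have "range ((*v) g) = UNIV" by (rule surjI[of _ "(*v) (matrix_inv g)"]) (simp add: g)
    ultimately show "\<exists>k. W' k = {0}" "\<exists>k. W' k = UNIV"
      unfolding W' by (auto intro: exI[of _ k] exI[of _ l])
  qed
  moreover have "hodge_filtration (act g F)"
    unfolding hodge_filtration_def
  proof (intro conjI allI)
    show "vec.subspace (act g F r)" for r unfolding F' by (rule linear_image_subspace) (use hf in \<open>auto simp: hodge_filtration_def\<close>)
    show "antimono (act g F)" using hf unfolding hodge_filtration_def antimono_def act_def le_fun_def by blast
    obtain k l where "F k = {0}" "F l = UNIV" using hf unfolding hodge_filtration_def by blast
    then have "act g F l = UNIV" "act g F k = {0}" unfolding F' using surj_complex_mat[OF g] by auto
    then show "\<exists>k. act g F k = UNIV" "\<exists>k. act g F k = {0}" by blast+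
  qed
  ultimately show "mixed_hodge_structure W' (act g F)"
    unfolding mixed_hodge_structure_def gr cnj_vec_image_complex_mat subspace_sum_image image_Int[OF inj, symmetric] pure Wc
    by blast
  have gf: "graded_forms W Q" using pol unfolding graded_polarized_def by blast
  have "graded_forms W' Q'"
    unfolding graded_forms_def
  proof (intro allI conjI)
    fix k
    show "\<forall>u\<in>W' k. \<forall>u'\<in>W' k. \<forall>v\<in>W' k. \<forall>c. Q' k (c *\<^sub>R u + u') v = c * Q' k u v + Q' k u' v"
    proof (intro ballI allI)
      fix u u' v c assume "u \<in> W' k" "u' \<in> W' k" "v \<in> W' k"
      then obtain x x' y where x: "u = g *v x" "u' = g *v x'" "v = g *v y" "x \<in> W k" "x' \<in> W k" "y \<in> W k"
        unfolding W' by blast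
      have 1: "c *\<^sub>R u + u' = g *v (c *\<^sub>R x + x')" unfolding x by (simp add: matrix_vector_right_distrib matrix_vector_mult_scaleR)
      have "subspace (W k)" using wf by (simp add: weight_filtration_def)
      then have 2: "c *\<^sub>R x + x' \<in> W k" using x by (intro subspace_add subspace_scale)
      have "Q k (c *\<^sub>R x + x') y = c * Q k x y + Q k x' y" using gf x(4-6) unfolding graded_forms_def by blast
      then show "Q' k (c *\<^sub>R u + u') v = c * Q' k u v + Q' k u' v"
        unfolding 1 unfolding x(1-3) using 2 x(4-6) by (simp add: Q)
    qed
    show "\<forall>u\<in>W' k. \<forall>v\<in>W' k. Q' k v u = (if even k then Q' k u v else - Q' k u v)"
    proof (intro ballI)
      fix u v assume "u \<in> W' k" "v \<in> W' k"
      then obtain x y where x: "u = g *v x" "v = g *v y" "x \<in> W k" "y \<in> W k" unfolding W' by blast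
      have "Q k y x = (if even k then Q k x y else - Q k x y)" using gf x(3,4) unfolding graded_forms_def by blast
      then show "Q' k v u = (if even k then Q' k u v else - Q' k u v)" unfolding x(1,2) Q[OF x(3,4)] Q[OF x(4,3)] .
    qed
    have "u \<in> W (k - 1) \<longleftrightarrow> (\<forall>v\<in>W k. Q k u v = 0)" if "u \<in> W k" for u using gf that unfolding graded_forms_def by blast
    then show "\<forall>u\<in>W' k. u \<in> W' (k - 1) \<longleftrightarrow> (\<forall>v\<in>W' k. Q' k u v = 0)"
      unfolding W' by (auto simp: Q inj_image_mem_iff[OF inj'])
  qed
  moreover have cf: "complex_form (Q' k) (?G u) (?G v) = complex_form (Q k) u v"
    if "u \<in> complexify (W k)" "v \<in> complexify (W k)" for u v k
    using that by (simp add: complex_form_def complexify_def re_vec_complex_mat im_vec_complex_mat Q)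
  \<comment> \<open>\<open>Q k\<close> is preserved only on W_k, so the vectors entering the
    bilinear relations have to be located there.\<close>
  moreover have grW: "gr_hodge W F k r \<subseteq> complexify (W k)" for k r
    unfolding pure(1)[of k r, symmetric] subspace_sum_def
  proof
    fix x assume x: "x \<in> gr_hodge W F k r"
    have "0 \<in> F r'" "0 \<in> complexify (W j)" for r' j
      using hf wf vec.subspace_0 complexify_subspace unfolding hodge_filtration_def weight_filtration_def by blast+
    then have "0 \<in> gr_hodge W F k r'" for r' unfolding gr_hodge_def subspace_sum_def by force
    then have "0 \<in> cnj_vec ` gr_hodge W F k (k + 1 - r)" by (simp add: cnj_vec_image_iff)
    then show "x \<in> {u + v |u v. u \<in> gr_hodge W F k r \<and> v \<in> cnj_vec ` gr_hodge W F k (k + 1 - r)}"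
      using x by force
  qed
  moreover have hcW: "u \<in> complexify (W (r + s)) \<and> cnj_vec u \<in> complexify (W (r + s))" if "u \<in> hodge_component W F r s" for u r s
    using that grW[of "r + s" r] complexify_cnj[of "W (r + s)" u] wf unfolding hodge_component_def weight_filtration_def by auto
  ultimately show "graded_polarized W' Q' (act g F)"
    unfolding graded_polarized_def
  proof (intro conjI allI ballI)
    fix k r u v assume "u \<in> gr_hodge W' (act g F) k r" "v \<in> gr_hodge W' (act g F) k (k + 1 - r)"
    then obtain x y where x: "u = ?G x" "v = ?G y" "x \<in> gr_hodge W F k r" "y \<in> gr_hodge W F k (k + 1 - r)"
      unfolding gr by blast
    have "complex_form (Q k) x y = 0" using pol x(3,4) unfolding graded_polarized_def by blast
    moreover have "x \<in> complexify (W k)" "y \<in> complexify (W k)" using x(3,4) grW by blast+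
    ultimately show "complex_form (Q' k) u v = 0" unfolding x(1,2) by (simp add: cf)
  next
    fix r s u assume u: "u \<in> hodge_component W' (act g F) r s - complexify (W' (r + s - 1))"
    then obtain x where x: "u = ?G x" "x \<in> hodge_component W F r s" unfolding hc by blast
    have "x \<notin> complexify (W (r + s - 1))" using u unfolding x Wc by blast
    then have "0 < Re (\<i> powi (r - s) * complex_form (Q (r + s)) x (cnj_vec x))" using pol x(2) unfolding graded_polarized_def by blast
    then show "0 < Re (\<i> powi (r - s) * complex_form (Q' (r + s)) u (cnj_vec u))"
      unfolding x(1) cnj_vec_complex_mat using hcW[OF x(2)] by (simp add: cf)
  qed
qed

lemma bil_congruence: "bil (transpose H ** q ** H) u v = bil q (H *v u) (H *v v)" for H q :: "complex^'n^'n"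
  by (rule trans[OF _ bil_mult_left[symmetric]]) (rule bil_mult_right[symmetric])

text \<open>The form matrices involve choices. For filtrations related by \<open>g\<close>,
  transporting the choices by \<open>g\<close> as well makes the two metrics comparable term by
  term.\<close>

lemma form_matrices_transport:
  assumes fm: "form_matrices W Q m p q0 q1 K" and high: "W (m + 1) = UNIV"
    and I: "isometry_at W Q W Q m g" "isometry_at W Q W Q (m + 1) g"
    and G: "G = complex_mat g" and H: "H = complex_mat (matrix_inv g)"
  shows "form_matrices W Q m (G ** p ** H) (transpose H ** q0 ** H) (transpose H ** q1 ** H) (G ** K ** transpose G)"
proof -
  interpret gm: graded_forms_matrix p q0 q1 K "if even m then 1 else - 1" using fm unfolding form_matrices_def by blast
  have g: "invertible g" using I unfolding isometry_at_def by blast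
  have GH: "G ** H = mat 1" "H ** G = mat 1" unfolding G H by (rule complex_mat_inv[OF g])+
  have GHr: "G ** (H ** A) = A" "H ** (G ** A) = A" for A by (simp_all add: GH matrix_mul_assoc)
  have tGH: "transpose G ** transpose H = mat 1" "transpose H ** transpose G = mat 1"
    by (simp_all add: GH transpose_mat flip: matrix_transpose_mul)
  have tGHr: "transpose G ** (transpose H ** A) = A" "transpose H ** (transpose G ** A) = A" for A
    by (simp_all add: tGH matrix_mul_assoc)
  have cr: "cnj_mat G = G" "cnj_mat H = H" by (simp_all add: G H)
  note S = matrix_mul_assoc' GHr tGHr GH tGH
  have fr: "cnj_mat p = p" "cnj_mat q0 = q0" "cnj_mat q1 = q1" "cnj_mat K = K"
    and p_in: "\<And>v. p *v v \<in> complexify (W m)" and p_on: "\<And>v. v \<in> complexify (W m) \<Longrightarrow> p *v v = v"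
    and pq: "transpose p ** q0 = q0" "q0 ** p = q0"
    and f0: "\<And>u v. u \<in> complexify (W m) \<Longrightarrow> v \<in> complexify (W m) \<Longrightarrow> complex_form (Q m) u v = bil q0 u v"
    and f1: "\<And>u v. complex_form (Q (m + 1)) u v = bil q1 u v"
    using fm unfolding form_matrices_def by blast+
  have J: "isometry_at W Q W Q m (matrix_inv g)" "isometry_at W Q W Q (m + 1) (matrix_inv g)"
    by (rule isometry_at_inv[OF I(1)], rule isometry_at_inv[OF I(2)])
  have inW: "complex_mat h *v u \<in> complexify (W m)" if "u \<in> complexify (W m)" "isometry_at W Q W Q m h" for u h
  proof -
    have "(*v) h ` W m = W m" "invertible h" using that(2) unfolding isometry_at_def by auto
    then have "(*v) (complex_mat h) ` complexify (W m) = complexify (W m)" using complexify_image[of h "W m"] by simp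
    then show ?thesis using that(1) by blast
  qed
  have cf: "complex_form (Q k) (complex_mat h *v u) (complex_mat h *v v) = complex_form (Q k) u v"
    if "u \<in> complexify (W k)" "v \<in> complexify (W k)" "isometry_at W Q W Q k h" for u v k h
    using that by (simp add: complex_form_def complexify_def isometry_at_def re_vec_complex_mat im_vec_complex_mat)
  show ?thesis unfolding form_matrices_def
  proof (intro conjI allI ballI)
    show "graded_forms_matrix (G ** p ** H) (transpose H ** q0 ** H) (transpose H ** q1 ** H) (G ** K ** transpose G)
        (if even m then 1 else - 1)"
    proof (unfold_locales, goal_cases)
      case 1 show ?case by (rule gm.eps)
      case 2 show ?case by (simp only: matrix_transpose_mul transpose_transpose gm.q0_sym mm_simps)
      case 3 show ?case by (simp only: matrix_transpose_mul transpose_transpose gm.q1_sym mm_simps)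
      case 4
      have "G ** K ** transpose G ** (transpose H ** q1 ** H) = G ** (K ** q1) ** H" by (simp only: S)
      also have "\<dots> = mat 1 - G ** p ** H" unfolding gm.Kq1 by (simp add: mm_diff_left mm_diff_right GH)
      finally show ?case .
      case 5
      have "transpose H ** q1 ** H ** (G ** p ** H) = transpose H ** (q1 ** p) ** H" by (simp only: S)
      then show ?case unfolding gm.q1p by (simp add: mm_zero_left mm_zero_right)
    qed
    show "cnj_mat (G ** p ** H) = G ** p ** H" "cnj_mat (transpose H ** q0 ** H) = transpose H ** q0 ** H"
      "cnj_mat (transpose H ** q1 ** H) = transpose H ** q1 ** H" "cnj_mat (G ** K ** transpose G) = G ** K ** transpose G"
      by (simp_all add: cnj_mat_mult cnj_mat_transpose cr fr)
    show "G ** p ** H *v v \<in> complexify (W m)" for v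
      unfolding matrix_vector_mul_assoc[symmetric] G by (rule inW[OF p_in I(1)])
    show "G ** p ** H *v v = v" if "v \<in> complexify (W m)" for v
    proof -
      have "p *v (H *v v) = H *v v" unfolding H by (rule p_on[OF inW[OF that J(1)]])
      then show ?thesis by (simp add: matrix_vector_mul_assoc[symmetric]) (simp add: G H complex_mat_inv_vec[OF g])
    qed
    have "transpose (G ** p ** H) ** (transpose H ** q0 ** H) = transpose H ** (transpose p ** q0) ** H"
      by (simp only: matrix_transpose_mul S)
    then show "transpose (G ** p ** H) ** (transpose H ** q0 ** H) = transpose H ** q0 ** H" unfolding pq .
    have "transpose H ** q0 ** H ** (G ** p ** H) = transpose H ** (q0 ** p) ** H" by (simp only: S)
    then show "transpose H ** q0 ** H ** (G ** p ** H) = transpose H ** q0 ** H" unfolding pq .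
    show "complex_form (Q m) u v = bil (transpose H ** q0 ** H) u v" if "u \<in> complexify (W m)" "v \<in> complexify (W m)" for u v
      unfolding bil_congruence H using f0[OF inW[OF that(1) J(1)] inW[OF that(2) J(1)]] cf[OF that J(1)] by simp
    show "complex_form (Q (m + 1)) u v = bil (transpose H ** q1 ** H) u v" for u v
      unfolding bil_congruence H f1[symmetric] using cf[OF _ _ J(2), of u v] high by simp
  qed
qed

lemma bigr_act:
  assumes A: "adjacent_mhs W F m hi" and B: "adjacent_mhs W (act g F) m hi" and g: "invertible g" "(*v) g ` W m = W m"
    and x: "x \<in> adjacent_mhs.bigr W (act g F) m j"
  shows "complex_mat (matrix_inv g) *v x \<in> adjacent_mhs.bigr W F m j"
proof -
  interpret a: adjacent_mhs W Q F m hi for Q by (rule A)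
  interpret b: adjacent_mhs W Q "act g F" m hi for Q by (rule B)
  have 1: "complex_mat (matrix_inv g) *v x \<in> F r" if "x \<in> act g F r" for r using that mem_act_iff[OF g(1)] by blast
  have 2: "complex_mat (matrix_inv g) *v x \<in> a.cF r" if "x \<in> b.cF r" for r
    using that unfolding a.cF_def b.cF_def cnj_vec_image_iff mem_act_iff[OF g(1)] cnj_vec_complex_mat .
  have 3: "complex_mat (matrix_inv g) *v x \<in> complexify (W m)" if "x \<in> complexify (W m)"
  proof -
    have e: "(*v) (complex_mat g) ` complexify (W m) = complexify (W m)" using complexify_image[OF g(1), of "W m"] g(2) by simp
    have "x \<in> (*v) (complex_mat g) ` complexify (W m)" unfolding e by (rule that)
    then obtain y where "x = complex_mat g *v y" "y \<in> complexify (W m)" by (rule imageE)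
    then show ?thesis by (simp add: complex_mat_inv_vec[OF g(1)])
  qed
  obtain r s where j: "j = (r, s)" by (cases j)
  consider "r + s = m" | "r + s \<noteq> m" "r + s = m + 1" | "r + s \<noteq> m" "r + s \<noteq> m + 1" by blast
  then show ?thesis
    by cases (use x 1 2 3 in \<open>simp_all add: a.bigr_def b.bigr_def j\<close>)
qed

lemma operators_act:
  assumes A: "adjacent_mhs W F m hi" and B: "adjacent_mhs W (act g F) m hi" and g: "invertible g" "(*v) g ` W m = W m"
  shows "adjacent_mhs.P W (act g F) m hi = complex_mat g ** adjacent_mhs.P W F m hi ** complex_mat (matrix_inv g)"
    "adjacent_mhs.S W (act g F) m hi = complex_mat g ** adjacent_mhs.S W F m hi ** complex_mat (matrix_inv g)"
proof -
  interpret a: adjacent_mhs W Q F m hi for Q by (rule A)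
  interpret b: adjacent_mhs W Q "act g F" m hi for Q by (rule B)
  note * = bigr_act[OF A B g] vector_scalar_commute complex_mat_inv_vec[OF g(1)]
  show "b.P = complex_mat g ** a.P ** complex_mat (matrix_inv g)"
  proof (rule b.matrix_eq_on_bigr)
    fix j x assume x: "x \<in> b.bigr j"
    show "b.P *v x = complex_mat g ** a.P ** complex_mat (matrix_inv g) *v x"
      unfolding b.P_on[OF x] matrix_vector_mul_assoc[symmetric] a.P_on[OF *(1)[OF x]] by (simp add: *)
  qed
  show "b.S = complex_mat g ** a.S ** complex_mat (matrix_inv g)"
  proof (rule b.matrix_eq_on_bigr)
    fix j x assume x: "x \<in> b.bigr j"
    show "b.S *v x = complex_mat g ** a.S ** complex_mat (matrix_inv g) *v x"
      unfolding b.S_on[OF x] matrix_vector_mul_assoc[symmetric] a.S_on[OF *(1)[OF x]] by (simp add: *)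
  qed
qed

section \<open>Parallel transport\<close>

lemma locally_constant_onD:
  assumes "locally_constant_on f T" "x \<in> T"
  obtains N where "open N" "x \<in> N" "\<And>y. y \<in> N \<Longrightarrow> y \<in> T \<Longrightarrow> f y = f x"
proof -
  have "\<exists>N. open N \<and> x \<in> N \<and> (\<forall>y\<in>N \<inter> T. f y = f x)"
    using assms(2) by (rule bspec[OF assms(1)[unfolded locally_constant_on_def]])
  then show ?thesis using that by auto
qed

lemma locally_constant_onI:
  assumes "\<And>x. x \<in> T \<Longrightarrow> \<exists>N. open N \<and> x \<in> N \<and> (\<forall>y. y \<in> N \<longrightarrow> y \<in> T \<longrightarrow> f y = f x)"
  shows "locally_constant_on f T"
  unfolding locally_constant_on_def using assms by (simp add: Ball_def imp_conjL)

lemma locally_constant_on_subset: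
  assumes "locally_constant_on f T" "T' \<subseteq> T"
  shows "locally_constant_on f T'"
proof (rule locally_constant_onI)
  fix x assume "x \<in> T'"
  then have x: "x \<in> T" using assms(2) by (rule rev_subsetD)
  obtain N where N: "open N" "x \<in> N" "\<And>y. y \<in> N \<Longrightarrow> y \<in> T \<Longrightarrow> f y = f x"
    by (rule locally_constant_onD[OF assms(1) x]) (rule that)
  show "\<exists>N. open N \<and> x \<in> N \<and> (\<forall>y. y \<in> N \<longrightarrow> y \<in> T' \<longrightarrow> f y = f x)"
    by (intro exI[of _ N] conjI allI impI N subsetD[OF assms(2)])
qed

lemma locally_constant_on_map:
  assumes "locally_constant_on f T"
  shows "locally_constant_on (\<lambda>x. h (f x)) T"
proof (rule locally_constant_onI)
  fix x assume x: "x \<in> T"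
  obtain N where N: "open N" "x \<in> N" "\<And>y. y \<in> N \<Longrightarrow> y \<in> T \<Longrightarrow> f y = f x"
    by (rule locally_constant_onD[OF assms x]) (rule that)
  then show "\<exists>N. open N \<and> x \<in> N \<and> (\<forall>y. y \<in> N \<longrightarrow> y \<in> T \<longrightarrow> h (f y) = h (f x))"
    by (intro exI[of _ N]) (simp add: N(3))
qed

lemma locally_constant_on_cong:
  "locally_constant_on f T \<Longrightarrow> (\<And>x. x \<in> T \<Longrightarrow> g x = f x) \<Longrightarrow> locally_constant_on g T"
  unfolding locally_constant_on_def by simp

lemma locally_constant_on_compose:
  assumes h: "continuous_on S h" and f: "locally_constant_on f T"
  shows "locally_constant_on (\<lambda>x. f (h x)) {x \<in> S. h x \<in> T}"
  unfolding locally_constant_on_def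
proof
  fix x assume x: "x \<in> {x \<in> S. h x \<in> T}"
  then have hx: "h x \<in> T" by simp
  obtain N where N: "open N" "h x \<in> N" "\<And>y. y \<in> N \<Longrightarrow> y \<in> T \<Longrightarrow> f y = f (h x)"
    by (rule locally_constant_onD[OF f hx]) (rule that)
  obtain A where A: "open A" "A \<inter> S = h -` N \<inter> S" using h N(1) unfolding continuous_on_open_invariant by metis
  have "x \<in> A" using A(2) N(2) x by fastforce
  moreover have "f (h y) = f (h x)" if "y \<in> A \<inter> {x \<in> S. h x \<in> T}" for y using N(3)[of "h y"] A(2) that by fastforce
  ultimately show "\<exists>N. open N \<and> x \<in> N \<and> (\<forall>y\<in>N \<inter> {x \<in> S. h x \<in> T}. f (h y) = f (h x))"
    using A(1) by (intro exI[of _ A]) simp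
qed

lemma locally_constant_on_closed_Un:
  assumes "locally_constant_on f (T \<inter> C)" "locally_constant_on f (T \<inter> D)" "closed C" "closed D" "T \<subseteq> C \<union> D"
  shows "locally_constant_on f T"
  unfolding locally_constant_on_def
proof
  fix x assume x: "x \<in> T"
  have *: "\<exists>N. open N \<and> x \<in> N \<and> (\<forall>y\<in>N \<inter> (T \<inter> E). f y = f x)" if "locally_constant_on f (T \<inter> E)" "closed E" for E
  proof (cases "x \<in> E")
    case True
    then have "x \<in> T \<inter> E" using x by simp
    then show ?thesis by (rule bspec[OF that(1)[unfolded locally_constant_on_def]])
  next
    case False
    then have "open (- E) \<and> x \<in> - E \<and> (\<forall>y\<in>- E \<inter> (T \<inter> E). f y = f x)" using that(2) by auto
    then show ?thesis by (rule exI)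
  qed
  obtain N where N: "open N" "x \<in> N" "\<forall>y\<in>N \<inter> (T \<inter> C). f y = f x" using *[OF assms(1,3)] by blast
  obtain N' where N': "open N'" "x \<in> N'" "\<forall>y\<in>N' \<inter> (T \<inter> D). f y = f x" using *[OF assms(2,4)] by blast
  show "\<exists>N. open N \<and> x \<in> N \<and> (\<forall>y\<in>N \<inter> T. f y = f x)"
    using N N' assms(5) by (intro exI[of _ "N \<inter> N'"]) blast
qed

lemma flat_frameD:
  assumes "flat_frame V U A"
  shows "open U" "x \<in> U \<Longrightarrow> invertible (A x)"
    "(U', A') \<in> frames V \<Longrightarrow> locally_constant_on (\<lambda>x. matrix_inv (A' x) ** A x) (U \<inter> U')"
  using assms unfolding flat_frame_def by (simp_all add: split_beta Ball_def)

lemma frame_flat: "local_system V \<Longrightarrow> (U, A) \<in> frames V \<Longrightarrow> flat_frame V U A"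
  unfolding local_system_def by (simp add: split_beta Ball_def)

lemma transport_in_frame:
  assumes A: "flat_frame V U A" and \<gamma>: "path \<gamma>" "path_image \<gamma> \<subseteq> U"
  shows "A (pathfinish \<gamma>) ** matrix_inv (A (pathstart \<gamma>)) \<in> parallel_transports V (pathstart \<gamma>) (pathfinish \<gamma>)"
proof -
  define C where "C = matrix_inv (A (pathstart \<gamma>))"
  have U: "\<gamma> t \<in> U" if "t \<in> {0..1}" for t using \<gamma>(2) that unfolding path_image_def by blast
  have "invertible (A (\<gamma> 0))" by (rule flat_frameD(2)[OF A U]) simp
  then have 0: "A (\<gamma> 0) ** C = mat 1" unfolding C_def pathstart_def by (rule matrix_inv_invertible)
  have lc: "locally_constant_on (\<lambda>t. matrix_inv (A' (\<gamma> t)) ** (A (\<gamma> t) ** C)) {t \<in> {0..1}. \<gamma> t \<in> U'}"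
    if "(U', A') \<in> frames V" for U' A'
  proof -
    from locally_constant_on_map[OF flat_frameD(3)[OF A that], of "\<lambda>X. X ** C"]
    have "locally_constant_on (\<lambda>x. matrix_inv (A' x) ** (A x ** C)) (U \<inter> U')" by (simp add: matrix_mul_assoc)
    from locally_constant_on_compose[OF \<gamma>(1)[unfolded path_def] this] show ?thesis
      by (rule locally_constant_on_subset) (use U in auto)
  qed
  show ?thesis unfolding parallel_transports_def
    by (rule CollectI, rule exI[of _ \<gamma>], rule exI[of _ "\<lambda>t. A (\<gamma> t) ** C"])
      (use \<gamma> 0 lc in \<open>auto simp: pathfinish_def C_def\<close>)
qed

lemma parallel_transports_refl: "mat 1 \<in> parallel_transports V x x"
  unfolding parallel_transports_def
  by (rule CollectI, rule exI[of _ "\<lambda>_. x"], rule exI[of _ "\<lambda>_. mat 1"])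
    (auto simp: path_def pathstart_def pathfinish_def locally_constant_on_def intro: exI[of _ UNIV])

lemma parallel_transports_trans:
  assumes "P \<in> parallel_transports V x y" "R \<in> parallel_transports V y z"
  shows "R ** P \<in> parallel_transports V x z"
proof -
  obtain \<gamma>1 B1 where 1: "path \<gamma>1" "pathstart \<gamma>1 = x" "pathfinish \<gamma>1 = y" "B1 (0::real) = mat 1" "B1 1 = P"
    "\<And>U A. (U, A) \<in> frames V \<Longrightarrow> locally_constant_on (\<lambda>t. matrix_inv (A (\<gamma>1 t)) ** B1 t) {t \<in> {0..1}. \<gamma>1 t \<in> U}"
    using assms(1) unfolding parallel_transports_def by blast
  obtain \<gamma>2 B2 where 2: "path \<gamma>2" "pathstart \<gamma>2 = y" "pathfinish \<gamma>2 = z" "B2 (0::real) = mat 1" "B2 1 = R"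
    "\<And>U A. (U, A) \<in> frames V \<Longrightarrow> locally_constant_on (\<lambda>t. matrix_inv (A (\<gamma>2 t)) ** B2 t) {t \<in> {0..1}. \<gamma>2 t \<in> U}"
    using assms(2) unfolding parallel_transports_def by blast
  define \<gamma> where "\<gamma> = \<gamma>1 +++ \<gamma>2"
  define B where "B t = (if t \<le> 1 / 2 then B1 (2 * t) else B2 (2 * t - 1) ** P)" for t
  have lo: "\<gamma> t = \<gamma>1 (2 * t)" "B t = B1 (2 * t)" if "t \<le> 1 / 2" for t using that by (simp_all add: \<gamma>_def B_def joinpaths_def)
  have hi: "\<gamma> t = \<gamma>2 (2 * t - 1) \<and> B t = B2 (2 * t - 1) ** P" if "t \<ge> 1 / 2" for t
  proof (cases "t = 1 / 2")
    case True
    then have t: "t \<le> 1 / 2" "2 * t = 1" "2 * t - 1 = 0" by simp_all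
    have "\<gamma>1 1 = \<gamma>2 0" using 1(3) 2(2) by (simp add: pathstart_def pathfinish_def)
    then show ?thesis unfolding lo[OF t(1)] t(2,3) using 1(5) 2(4) by simp
  next
    case False
    then show ?thesis using that by (simp add: \<gamma>_def B_def joinpaths_def)
  qed
  have "locally_constant_on (\<lambda>t. matrix_inv (A (\<gamma> t)) ** B t) {t \<in> {0..1}. \<gamma> t \<in> U}" (is "locally_constant_on _ ?T")
    if UA: "(U, A) \<in> frames V" for U A
  proof (rule locally_constant_on_closed_Un)
    have "continuous_on UNIV (\<lambda>t::real. 2 * t)" by (intro continuous_intros)
    from locally_constant_on_compose[OF this 1(6)[OF UA]]
    have "locally_constant_on (\<lambda>t. matrix_inv (A (\<gamma>1 (2 * t))) ** B1 (2 * t)) (?T \<inter> {..1 / 2})"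
      by (rule locally_constant_on_subset) (auto simp: lo)
    then show "locally_constant_on (\<lambda>t. matrix_inv (A (\<gamma> t)) ** B t) (?T \<inter> {..1 / 2})"
      by (rule locally_constant_on_cong) (simp add: lo)
    have "continuous_on UNIV (\<lambda>t::real. 2 * t - 1)" by (intro continuous_intros)
    from locally_constant_on_map[OF locally_constant_on_compose[OF this 2(6)[OF UA]], of "\<lambda>X. X ** P"]
    have "locally_constant_on (\<lambda>t. matrix_inv (A (\<gamma>2 (2 * t - 1))) ** B2 (2 * t - 1) ** P) (?T \<inter> {1 / 2..})"
      by (rule locally_constant_on_subset) (use hi in auto)
    then show "locally_constant_on (\<lambda>t. matrix_inv (A (\<gamma> t)) ** B t) (?T \<inter> {1 / 2..})"
      by (rule locally_constant_on_cong) (use hi in \<open>simp add: matrix_mul_assoc\<close>)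
  qed auto
  moreover have "path \<gamma>" "pathstart \<gamma> = x" "pathfinish \<gamma> = z" using 1 2 by (auto simp: \<gamma>_def)
  moreover have "B 0 = mat 1" "B 1 = R ** P" using 1 2 by (auto simp: B_def)
  ultimately show ?thesis unfolding parallel_transports_def by blast
qed

lemma frame_at:
  assumes "local_system V"
  shows "\<exists>U A. (U, A) \<in> frames V \<and> x \<in> U \<and> flat_frame V U A"
proof -
  have "x \<in> (\<Union>(U, A)\<in>frames V. U)" using assms unfolding local_system_def by simp
  then obtain U A where "(U, A) \<in> frames V" "x \<in> U" by auto
  then show ?thesis using frame_flat[OF assms] by auto
qed

context
  fixes V :: "('s::topological_space, 'n::finite) variation"
  assumes ls: "local_system V" and fw: "flat_weight V" and ff: "flat_forms V"
begin

lemma frame_isometry: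
  assumes UA: "(U, A) \<in> frames V" and x: "x \<in> U"
  shows "\<exists>N. open N \<and> x \<in> N \<and> N \<subseteq> U \<and>
    (\<forall>y\<in>N. isometry_at (weight V x) (forms V x) (weight V y) (forms V y) k (A y ** matrix_inv (A x)))"
proof -
  have fr: "open U" "\<And>y. y \<in> U \<Longrightarrow> invertible (A y)" using flat_frameD(1,2)[OF frame_flat[OF ls UA]] by auto
  have "locally_constant_on (\<lambda>x. (*v) (matrix_inv (A x)) ` weight V x k) U"
    using fw UA unfolding flat_weight_def by (simp add: split_beta Ball_def)
  note lc = locally_constant_onD[OF this x]
  obtain N1 where N1: "open N1" "x \<in> N1"
    "\<And>y. y \<in> N1 \<Longrightarrow> y \<in> U \<Longrightarrow> (*v) (matrix_inv (A y)) ` weight V y k = (*v) (matrix_inv (A x)) ` weight V x k"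
    by (rule lc) (rule that)
  have "\<exists>N. open N \<and> x \<in> N \<and> (\<forall>y\<in>N \<inter> U. \<forall>u\<in>weight V x k. \<forall>v\<in>weight V x k.
        let T = A y ** matrix_inv (A x) in forms V y k (T *v u) (T *v v) = forms V x k u v)"
    using ff UA x unfolding flat_forms_def by (simp add: split_beta Ball_def)
  then obtain N2 where N2: "open N2" "x \<in> N2"
    "\<And>y u v. y \<in> N2 \<inter> U \<Longrightarrow> u \<in> weight V x k \<Longrightarrow> v \<in> weight V x k \<Longrightarrow>
      forms V y k (A y ** matrix_inv (A x) *v u) (A y ** matrix_inv (A x) *v v) = forms V x k u v"
    unfolding Let_def by (elim exE conjE) (rule that, auto)
  have "isometry_at (weight V x) (forms V x) (weight V y) (forms V y) k (A y ** matrix_inv (A x))" if y: "y \<in> N1 \<inter> N2 \<inter> U" for y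
    unfolding isometry_at_def
  proof (intro conjI ballI)
    show "invertible (A y ** matrix_inv (A x))" using fr x y by (simp add: invertible_mult invertible_matrix_inv)
    have "(*v) (A y ** matrix_inv (A x)) ` weight V x k = (*v) (A y) ` (*v) (matrix_inv (A x)) ` weight V x k"
      by (simp add: image_image matrix_vector_mul_assoc)
    also have "\<dots> = (*v) (A y) ` (*v) (matrix_inv (A y)) ` weight V y k" using N1(3)[of y] y by simp
    also have "\<dots> = weight V y k" using fr(2) y by (simp add: image_image)
    finally show "(*v) (A y ** matrix_inv (A x)) ` weight V x k = weight V y k" .
  qed (use N2 y in auto)
  then show ?thesis using N1 N2 fr x by (intro exI[of _ "N1 \<inter> N2 \<inter> U"]) auto
qed

text \<open>Connectedness of the unit interval: near \<open>t\<close> the transport changes by the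
  frame isometry \<tau>, so being an isometry is an open and closed condition along the
  path.\<close>

lemma transport_isometry:
  assumes P: "P \<in> parallel_transports V s x"
  shows "isometry_at (weight V s) (forms V s) (weight V x) (forms V x) k P"
proof -
  obtain \<gamma> B where \<gamma>: "path \<gamma>" "pathstart \<gamma> = s" "pathfinish \<gamma> = x" "B (0::real) = mat 1" "B 1 = P"
    "\<And>U A. (U, A) \<in> frames V \<Longrightarrow> locally_constant_on (\<lambda>t. matrix_inv (A (\<gamma> t)) ** B t) {t \<in> {0..1}. \<gamma> t \<in> U}"
    using P unfolding parallel_transports_def by blast
  define I where "I t t' g = isometry_at (weight V t) (forms V t) (weight V t') (forms V t') k g" for t t' g
  have "I s (\<gamma> 1) (B 1)"
  proof (rule connected_induction_simple[of "{0..1::real}" 0 1 "\<lambda>t. I s (\<gamma> t) (B t)"])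
    show "I s (\<gamma> 0) (B 0)" using \<gamma>(2,4) isometry_at_id by (simp add: I_def pathstart_def)
    fix t :: real assume t: "t \<in> {0..1}"
    obtain U A where UA: "(U, A) \<in> frames V" "\<gamma> t \<in> U" "flat_frame V U A" using frame_at[OF ls] by blast
    obtain N where N: "open N" "\<gamma> t \<in> N" "N \<subseteq> U" "\<And>y. y \<in> N \<Longrightarrow> I (\<gamma> t) y (A y ** matrix_inv (A (\<gamma> t)))"
      using frame_isometry[OF UA(1,2), where k = k] unfolding I_def by auto
    obtain N' where N': "open N'" "t \<in> N'"
      "\<And>r. r \<in> N' \<Longrightarrow> r \<in> {t \<in> {0..1}. \<gamma> t \<in> U} \<Longrightarrow> matrix_inv (A (\<gamma> r)) ** B r = matrix_inv (A (\<gamma> t)) ** B t"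
    proof (rule locally_constant_onD[OF \<gamma>(6)[OF UA(1)], where x = t])
      show "t \<in> {t \<in> {0..1}. \<gamma> t \<in> U}" using t UA(2) by simp
    qed (rule that)
    obtain O' where O': "open O'" "O' \<inter> {0..1} = \<gamma> -` N \<inter> {0..1}"
      using \<gamma>(1) N(1) unfolding path_def continuous_on_open_invariant by metis
    define T where "T = {0..1} \<inter> (O' \<inter> N')"
    have inv: "invertible (A y)" if "y \<in> U" for y by (rule flat_frameD(2)[OF UA(3) that])
    have eq: "I s (\<gamma> r) (B r) \<longleftrightarrow> I s (\<gamma> t) (B t)" if r: "r \<in> T" for r
    proof -
      have r': "r \<in> N'" "r \<in> {0..1}" "\<gamma> r \<in> N" using r O' unfolding T_def by blast+
      define \<tau> where "\<tau> = A (\<gamma> r) ** matrix_inv (A (\<gamma> t))"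
      have "B r = A (\<gamma> r) ** (matrix_inv (A (\<gamma> r)) ** B r)"
        using matrix_inv_invertible(1)[OF inv] r' N(3) by (simp add: matrix_mul_assoc subset_iff)
      also have "\<dots> = \<tau> ** B t" using N'(3)[OF r'(1)] r'(2,3) subsetD[OF N(3)] by (simp add: \<tau>_def matrix_mul_assoc)
      finally have Br: "B r = \<tau> ** B t" .
      have I\<tau>: "I (\<gamma> t) (\<gamma> r) \<tau>" unfolding \<tau>_def by (rule N(4)[OF r'(3)])
      then have "invertible \<tau>" unfolding I_def isometry_at_def by blast
      then have Bt: "B t = matrix_inv \<tau> ** B r" unfolding Br by (simp add: matrix_mul_assoc matrix_inv_invertible)
      show ?thesis
        using isometry_at_comp[OF _ I\<tau>[unfolded I_def], of "weight V s" "forms V s" "B t"]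
          isometry_at_comp[OF _ isometry_at_inv[OF I\<tau>[unfolded I_def]], of "weight V s" "forms V s" "B r"]
        unfolding I_def Br[symmetric] Bt[symmetric] by blast
    qed
    have "openin (top_of_set {0..1}) T" unfolding T_def by (intro openin_open_Int open_Int O'(1) N'(1))
    moreover have "t \<in> T" using t N'(2) O'(2) N(2) unfolding T_def by blast
    ultimately show "\<exists>T. openin (top_of_set {0..1}) T \<and> t \<in> T \<and>
        (\<forall>x\<in>T. \<forall>y\<in>T. I s (\<gamma> x) (B x) \<longrightarrow> I s (\<gamma> y) (B y))"
      using eq by blast
  qed auto
  then show ?thesis using \<gamma> by (simp add: I_def pathfinish_def)
qed

end

section \<open>Existence of local lifts of the period map\<close>

lemma chart_facts:
  fixes M :: "('s::{t2_space, second_countable_topology}, 'm::finite) chart set"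
  assumes M: "complex_manifold M" and c: "c \<in> M"
  shows "open (fst c)" "x \<in> fst c \<Longrightarrow> chart_inv c (snd c x) = x"
    "z \<in> snd c ` fst c \<Longrightarrow> chart_inv c z \<in> fst c \<and> snd c (chart_inv c z) = z"
    "open U \<Longrightarrow> open (snd c ` (fst c \<inter> U))" "open N \<Longrightarrow> open (fst c \<inter> snd c -` N)"
    "continuous_on (snd c ` fst c) (chart_inv c)"
proof -
  have op: "open (fst c)" "open (snd c ` fst c)" and h: "homeomorphism (fst c) (snd c ` fst c) (snd c) (chart_inv c)"
    using M c unfolding complex_manifold_def by auto
  show "open (fst c)" by fact
  show inv: "chart_inv c (snd c x) = x" if "x \<in> fst c" for x using h that by (simp add: homeomorphism_def)
  show "chart_inv c z \<in> fst c \<and> snd c (chart_inv c z) = z" if z: "z \<in> snd c ` fst c" for z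
  proof -
    obtain x where "x \<in> fst c" "z = snd c x" using z by (rule imageE)
    then show ?thesis by (simp add: inv)
  qed
  show "open (snd c ` (fst c \<inter> U))" if U: "open U" for U
  proof -
    have "openin (top_of_set (snd c ` fst c)) (snd c ` (fst c \<inter> U))"
      by (rule homeomorphism_imp_open_map[OF h]) (use U in \<open>simp add: openin_open_Int\<close>)
    then show ?thesis using op(2) by (simp add: openin_open_eq)
  qed
  show "open (fst c \<inter> snd c -` N)" if "open N" for N
    by (rule continuous_open_preimage[OF homeomorphism_cont1[OF h] op(1) that])
  show "continuous_on (snd c ` fst c) (chart_inv c)" by (rule homeomorphism_cont2[OF h])
qed

lemma path_connected_neighbourhood:
  fixes M :: "('s::{t2_space, second_countable_topology}, 'm::finite) chart set" and x :: 's
  assumes M: "complex_manifold M" and U: "open U" "x \<in> U"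
  shows "\<exists>N. open N \<and> x \<in> N \<and> N \<subseteq> U \<and> path_connected N"
proof -
  obtain c where c: "c \<in> M" "x \<in> fst c" using M unfolding complex_manifold_def by blast
  note cf = chart_facts[OF M c(1)]
  have "open (snd c ` (fst c \<inter> U))" by (rule cf(4)[OF U(1)])
  then obtain r where r: "r > 0" "ball (snd c x) r \<subseteq> snd c ` (fst c \<inter> U)"
    using c(2) U(2) unfolding open_contains_ball by blast
  define N where "N = fst c \<inter> snd c -` ball (snd c x) r"
  have "open N" unfolding N_def by (rule cf(5)[OF open_ball])
  moreover have "x \<in> N" using c r by (simp add: N_def)
  moreover note inv = cf(2)
  have "N \<subseteq> U"
  proof
    fix y assume y: "y \<in> N"
    then obtain y' where "y' \<in> fst c \<inter> U" "snd c y = snd c y'" using r(2) unfolding N_def by blast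
    then show "y \<in> U" using inv y unfolding N_def by (metis IntD1 IntD2)
  qed
  moreover have "N = chart_inv c ` ball (snd c x) r"
  proof
    show "N \<subseteq> chart_inv c ` ball (snd c x) r" unfolding N_def using inv by force
    show "chart_inv c ` ball (snd c x) r \<subseteq> N"
    proof
      fix y assume "y \<in> chart_inv c ` ball (snd c x) r"
      then obtain w where w: "y = chart_inv c w" "w \<in> ball (snd c x) r" by blast
      then obtain y' where "y' \<in> fst c" "w = snd c y'" using r(2) by blast
      then show "y \<in> N" using w inv unfolding N_def by auto
    qed
  qed
  moreover have "path_connected (chart_inv c ` ball (snd c x) r)"
    by (rule path_connected_continuous_image[OF continuous_on_subset[OF cf(6)]])
      (use r(2) in \<open>auto intro: convex_imp_path_connected\<close>)
  ultimately show ?thesis by auto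
qed

lemma frame_transport:
  assumes "flat_frame V U A" "path_connected N" "N \<subseteq> U" "x \<in> N" "y \<in> N" "P \<in> parallel_transports V s x"
  shows "A y ** matrix_inv (A x) ** P \<in> parallel_transports V s y"
proof -
  obtain \<gamma> where \<gamma>: "path \<gamma>" "path_image \<gamma> \<subseteq> N" "pathstart \<gamma> = x" "pathfinish \<gamma> = y"
    using assms unfolding path_connected_def by blast
  show ?thesis
    using parallel_transports_trans[OF assms(6) transport_in_frame[OF assms(1) \<gamma>(1), unfolded \<gamma>(3,4)]] \<gamma>(2) assms(3)
    by (simp add: subset_trans)
qed

text \<open>Transport inside path-connected neighbourhoods shows that the points reachable from
  \<open>s\<close> form an open set with open complement.\<close>

lemma parallel_transports_nonempty:
  fixes M :: "('s::{t2_space, second_countable_topology}, 'm::finite) chart set" and V :: "('s, 'n::finite) variation"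
  assumes M: "complex_manifold M" and conn: "connected (UNIV :: 's set)" and ls: "local_system V"
  shows "parallel_transports V s x \<noteq> {}"
proof (rule connected_induction_simple[OF conn, of s x "\<lambda>x. parallel_transports V s x \<noteq> {}"])
  show "parallel_transports V s s \<noteq> {}" using parallel_transports_refl by blast
  fix z :: 's
  obtain U A where UA: "(U, A) \<in> frames V" "z \<in> U" "flat_frame V U A" using frame_at[OF ls] by blast
  have "open U" by (rule flat_frameD(1)[OF UA(3)])
  from path_connected_neighbourhood[OF M this UA(2)]
  obtain N where N: "open N" "z \<in> N" "N \<subseteq> U" "path_connected N" by blast
  then show "\<exists>T. openin (top_of_set UNIV) T \<and> z \<in> T \<and>
      (\<forall>x\<in>T. \<forall>y\<in>T. parallel_transports V s x \<noteq> {} \<longrightarrow> parallel_transports V s y \<noteq> {})"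
    using frame_transport[OF UA(3) N(4,3)] by (intro exI[of _ N] conjI ballI impI) (simp, simp, blast)
qed auto

text \<open>A flat frame multiplied on the right by a constant matrix remains flat; \<open>C\<close>
  is chosen so that its value at \<open>x\<close> is a parallel transport \<open>P\<close>.
  Path-connectedness of \<open>N\<close> carries this over to the neighbouring points.\<close>

lemma period_lift_exists:
  fixes M :: "('s::{t2_space, second_countable_topology}, 'm::finite) chart set" and V :: "('s, 'n::finite) variation"
  assumes M: "complex_manifold M" and conn: "connected (UNIV :: 's set)"
    and V: "local_system V" "flat_weight V" "flat_forms V"
  shows "\<exists>U \<phi>. period_lift V s U \<phi> \<and> x \<in> U"
proof -
  obtain U A where UA: "(U, A) \<in> frames V" "x \<in> U" "flat_frame V U A" using frame_at[OF V(1)] by blast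
  have "open U" by (rule flat_frameD(1)[OF UA(3)])
  from path_connected_neighbourhood[OF M this UA(2)]
  obtain N where N: "open N" "x \<in> N" "N \<subseteq> U" "path_connected N" by blast
  obtain P where P: "P \<in> parallel_transports V s x" using parallel_transports_nonempty[OF M conn V(1)] by blast
  define C where "C = matrix_inv (A x) ** P"
  have tr: "A y ** C \<in> parallel_transports V s y" if "y \<in> N" for y
    using frame_transport[OF UA(3) N(4,3,2) that P] by (simp add: C_def matrix_mul_assoc)
  have "invertible P" using transport_isometry[OF V P] unfolding isometry_at_def by blast
  then have C: "invertible C"
    unfolding C_def by (intro invertible_mult invertible_matrix_inv flat_frameD(2)[OF UA(3,2)])
  have "flat_frame V N (\<lambda>y. A y ** C)"
    unfolding flat_frame_def
  proof (intro conjI ballI N(1))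
    show "invertible (A y ** C)" if "y \<in> N" for y
      using flat_frameD(2)[OF UA(3)] N(3) that C by (auto intro: invertible_mult)
    fix F assume "F \<in> frames V"
    then obtain U' A' where F: "F = (U', A')" "(U', A') \<in> frames V" by (cases F) auto
    from locally_constant_on_map[OF flat_frameD(3)[OF UA(3) F(2)], of "\<lambda>X. X ** C"]
    have "locally_constant_on (\<lambda>x. matrix_inv (A' x) ** (A x ** C)) (N \<inter> U')"
      by (rule locally_constant_on_subset[OF locally_constant_on_cong]) (use N in \<open>auto simp: matrix_mul_assoc\<close>)
    then show "case F of (U', A') \<Rightarrow> locally_constant_on (\<lambda>x. matrix_inv (A' x) ** (A x ** C)) (N \<inter> U')"
      by (simp add: F)
  qed
  moreover have "act (matrix_inv (A y ** C)) (hodge V y) \<in> period_map V s y" if "y \<in> N" for y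
    unfolding period_map_def monodromy_group_def
    by (rule CollectI, rule exI[of _ "mat 1"], rule exI[of _ "A y ** C"])
      (simp add: act_id tr[OF that] parallel_transports_refl)
  ultimately have "period_lift V s N (\<lambda>y. act (matrix_inv (A y ** C)) (hodge V y))"
    unfolding period_lift_def using tr by blast
  then show ?thesis using N(2) by blast
qed

section \<open>The pulled back metric\<close>

lemma (in hodge_family) restrict: "open N' \<Longrightarrow> N' \<subseteq> N \<Longrightarrow> hodge_family W Q F N' m hi p q0 q1 K"
proof (rule hodge_family.intro)
  assume N': "open N'" "N' \<subseteq> N"
  show "open N'" by (rule N')
  show "polarized_mhs W Q (F z) m hi p q0 q1 K" if "z \<in> N'" for z using ph N' that by blast
  show "holomorphic_subbundle (\<lambda>z. F z r) N'" for r
    unfolding holomorphic_subbundle_def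
  proof
    fix z assume z: "z \<in> N'"
    then have "z \<in> N" using N' by blast
    then obtain N1 k f where f: "open N1" "z \<in> N1" "N1 \<subseteq> N" "\<And>i. i < k \<Longrightarrow> holomorphic_map (f i) N1"
      "\<And>w. w \<in> N1 \<Longrightarrow> F w r = vec.span ((\<lambda>i. f i w) ` {..<k::nat}) \<and> vec.dim (F w r) = k"
      using sub[of r] unfolding holomorphic_subbundle_def by metis
    have "holomorphic_map (f i) (N1 \<inter> N')" if "i < k" for i using f(4)[OF that] unfolding holomorphic_map_def by blast
    then show "\<exists>N1 k f. open N1 \<and> z \<in> N1 \<and> N1 \<subseteq> N' \<and> (\<forall>i<k. holomorphic_map (f i) N1) \<and>
        (\<forall>w\<in>N1. F w r = vec.span ((\<lambda>i. f i w) ` {..<k::nat}) \<and> vec.dim (F w r) = k)"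
      using z N'(1) f(1,2,5) by (intro exI[of _ "N1 \<inter> N'"] exI[of _ k] exI[of _ f] conjI open_Int) blast+
  qed
  show "frechet_derivative f (at z) X \<in> F z (r - 1)"
    if "open M" "M \<subseteq> N'" "holomorphic_map f M" "\<And>w. w \<in> M \<Longrightarrow> f w \<in> F w r" "z \<in> M" for f M z X r
    by (rule transversal[OF that(1) _ that(3-5)]) (use that N' in auto)
qed

text \<open>\<open>P\<close> and \<open>S\<close> are conjugated by the constant matrix of
  \<open>g\<close>, \<open>q0\<close> and \<open>K\<close> transform by congruence, and all these
  factors cancel under the traces.\<close>

lemma metric_End_act:
  assumes A: "hodge_family W Q F N m hi p q0 q1 K" and B: "hodge_family W Q F' N m hi p' q0' q1' K'"
    and z: "z \<in> N" and F': "\<And>w. w \<in> N \<Longrightarrow> F' w = act g (F w)"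
    and g: "invertible g" "(*v) g ` W m = W m"
    and q0': "q0' = transpose (complex_mat (matrix_inv g)) ** q0 ** complex_mat (matrix_inv g)"
    and K': "K' = complex_mat g ** K ** transpose (complex_mat g)"
  shows "mixed_hodge_metric_End W Q (F' z) (tangent_vector W Q F' z X) (tangent_vector W Q F' z Y) =
    mixed_hodge_metric_End W Q (F z) (tangent_vector W Q F z X) (tangent_vector W Q F z Y)"
proof -
  interpret a: hodge_family W Q F N m hi p q0 q1 K by (rule A)
  interpret b: hodge_family W Q F' N m hi p' q0' q1' K' by (rule B)
  define G where "G = complex_mat g"
  define H where "H = complex_mat (matrix_inv g)"
  have ops: "G ** a.P w ** H = b.P w" "G ** a.S w ** H = b.S w" if w: "w \<in> N" for w
  proof -
    have "adjacent_mhs W (act g (F w)) m hi" using b.adj[OF w] by (simp add: F'[OF w])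
    from operators_act[OF a.adj[OF w] this g]
    show "G ** a.P w ** H = b.P w" "G ** a.S w ** H = b.S w" by (simp_all add: F'[OF w] G_def H_def)
  qed
  have GH: "G ** H = mat 1" "H ** G = mat 1" unfolding G_def H_def by (rule complex_mat_inv[OF g(1)])+
  have GHr: "G ** (H ** A) = A" "H ** (G ** A) = A" for A by (simp_all add: GH matrix_mul_assoc)
  have "transpose G ** transpose H = mat 1" by (simp add: GH transpose_mat flip: matrix_transpose_mul)
  then have tGHr: "transpose G ** (transpose H ** A) = A" for A by (simp add: matrix_mul_assoc)
  have L: "bounded_linear (\<lambda>A. G ** A ** H)"
    by (intro bounded_linear_compose[OF bounded_bilinear.bounded_linear_left[OF bounded_bilinear_matrix_mult]
          bounded_bilinear.bounded_linear_right[OF bounded_bilinear_matrix_mult]])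
  have Li: "G ** (mat \<i> ** A) ** H = mat \<i> ** (G ** A ** H)" for A
    by (simp add: mat_left_commute matrix_mul_assoc')
  have dP: "dz b.P z X = G ** dz a.P z X ** H" for X
    using dz_cong(1)[OF a.N z ops(1) differentiable_linear[OF L smooth_on_differentiable[OF a.smooth_P z]]]
    unfolding dz_linear(1)[OF L Li smooth_on_differentiable[OF a.smooth_P z]] .
  have dS: "dz b.S z X = G ** dz a.S z X ** H" for X
    using dz_cong(1)[OF a.N z ops(2) differentiable_linear[OF L smooth_on_differentiable[OF a.smooth_S z]]]
    unfolding dz_linear(1)[OF L Li smooth_on_differentiable[OF a.smooth_S z]] .
  have cr: "cnj_mat G = G" "cnj_mat H = H" by (simp_all add: G_def H_def)
  have tr: "trace (G ** A ** H) = trace A" for A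
    using trace_mult_commute[of "G ** A" H] by (simp add: GHr)
  have "b.fmetric z X Y = trace (G ** (dz a.P z X ** cnj_mat (dz a.P z Y)) ** H)
      + \<i> * trace (G ** (dz a.S z X ** K ** transpose (cnj_mat (dz a.S z Y)) ** q0) ** H)"
    unfolding b.fmetric_eq[OF z] dP dS q0' K' G_def[symmetric] H_def[symmetric] cnj_mat_mult cr matrix_transpose_mul
    by (simp only: matrix_mul_assoc' GHr tGHr)
  also have "\<dots> = a.fmetric z X Y" unfolding a.fmetric_eq[OF z] tr ..
  finally show ?thesis unfolding a.fmetric_def b.fmetric_def .
qed

lemma holomorphic_map_linear:
  fixes G :: "complex^'n::finite^'n"
  assumes "holomorphic_map f N"
  shows "holomorphic_map (\<lambda>w. G *v f w) N"
    "z \<in> N \<Longrightarrow> frechet_derivative (\<lambda>w. G *v f w) (at z) \<xi> = G *v frechet_derivative f (at z) \<xi>"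
proof -
  have L: "bounded_linear ((*v) G)"
    by (rule linear_conv_bounded_linear[THEN iffD1]) (auto intro!: linearI simp: matrix_vector_right_distrib scaleR_eq_smult vector_scalar_commute)
  have d: "((\<lambda>w. G *v f w) has_derivative (\<lambda>v. G *v f' v)) (at z)" if "(f has_derivative f') (at z)" for f' z
    by (rule bounded_linear.has_derivative[OF L that])
  show "holomorphic_map (\<lambda>w. G *v f w) N"
    unfolding holomorphic_map_def
  proof
    fix z assume "z \<in> N"
    then obtain f' where "(f has_derivative f') (at z)" "\<forall>c v. f' (c *s v) = c *s f' v"
      using assms unfolding holomorphic_map_def by blast
    then show "\<exists>f'. ((\<lambda>w. G *v f w) has_derivative f') (at z) \<and> (\<forall>c v. f' (c *s v) = c *s f' v)"
      using d by (intro exI[of _ "\<lambda>v. G *v f' v"]) (simp add: vector_scalar_commute)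
  qed
  show "frechet_derivative (\<lambda>w. G *v f w) (at z) \<xi> = G *v frechet_derivative f (at z) \<xi>" if z: "z \<in> N"
  proof -
    obtain f' where f': "(f has_derivative f') (at z)" using assms z unfolding holomorphic_map_def by blast
    show ?thesis unfolding frechet_derivative_eqI[OF d[OF f']] frechet_derivative_eqI[OF f'] ..
  qed
qed

lemma holomorphic_subbundle_act:
  assumes "holomorphic_subbundle (\<lambda>z. F z r) N" "invertible g" "open N'" "N' \<subseteq> N" "\<And>z. z \<in> N' \<Longrightarrow> F' z = act g (F z)"
  shows "holomorphic_subbundle (\<lambda>z. F' z r) N'"
  unfolding holomorphic_subbundle_def
proof
  fix z assume z: "z \<in> N'"
  then have "z \<in> N" using assms(4) by blast
  then obtain N1 k f where f: "open N1" "z \<in> N1" "N1 \<subseteq> N" "\<And>i. i < k \<Longrightarrow> holomorphic_map (f i) N1"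
    "\<And>w. w \<in> N1 \<Longrightarrow> F w r = vec.span ((\<lambda>i. f i w) ` {..<k::nat}) \<and> vec.dim (F w r) = k"
    using assms(1) unfolding holomorphic_subbundle_def by metis
  let ?G = "complex_mat g"
  have lin: "Vector_Spaces.linear (*s) (*s) ((*v) ?G)" by (rule matrix_vector_mul_linear_gen)
  show "\<exists>N1 k f. open N1 \<and> z \<in> N1 \<and> N1 \<subseteq> N' \<and> (\<forall>i<k. holomorphic_map (f i) N1) \<and>
    (\<forall>w\<in>N1. F' w r = vec.span ((\<lambda>i. f i w) ` {..<k::nat}) \<and> vec.dim (F' w r) = k)"
  proof (intro exI[of _ "N1 \<inter> N'"] exI[of _ k] exI[of _ "\<lambda>i w. ?G *v f i w"] conjI allI impI ballI)
    fix i assume "i < k"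
    then have "holomorphic_map (f i) (N1 \<inter> N')" using f(4)[of i] unfolding holomorphic_map_def by blast
    then show "holomorphic_map (\<lambda>w. ?G *v f i w) (N1 \<inter> N')" by (rule holomorphic_map_linear)
  next
    fix w assume w: "w \<in> N1 \<inter> N'"
    have e: "F' w r = (*v) ?G ` F w r" using assms(5) w by (simp add: act_def)
    show "F' w r = vec.span ((\<lambda>i. ?G *v f i w) ` {..<k})"
      unfolding e using f(5)[of w] w vec.linear_span_image[OF lin, of "(\<lambda>i. f i w) ` {..<k}"] by (simp add: image_image)
    have "vec.dim ((*v) ?G ` F w r) = vec.dim (F w r)"
      by (rule vec.dim_image_eq[OF lin]) (rule inj_on_subset[OF inj_complex_mat[OF assms(2)]], simp)
    then show "vec.dim (F' w r) = k" unfolding e using f(5) w by (metis IntD1)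
  qed (use z f assms(3) in auto)
qed

lemma two_step_weight:
  fixes W :: "'n::finite weight"
  assumes W: "weight_filtration W" and gr: "\<And>k. gr_nontrivial W k \<longleftrightarrow> k = m \<or> k = m + 1"
  shows "k < m \<Longrightarrow> W k = {0}" "k > m \<Longrightarrow> W k = UNIV"
proof -
  obtain l u where lu: "W l = {0}" "W u = UNIV" using W unfolding weight_filtration_def by blast
  have eq: "W (k - 1) = W k" if "k \<noteq> m" "k \<noteq> m + 1" for k using gr[of k] that unfolding gr_nontrivial_def by blast
  have mono: "W i \<subseteq> W j" if "i \<le> j" for i j using W that unfolding weight_filtration_def mono_def by blast
  have 0: "0 \<in> W k" for k using W subspace_0 unfolding weight_filtration_def by blast
  have low: "W (m - 1 - int i) = W (m - 1)" for i
  proof (induction i)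
    case (Suc i)
    then show ?case using eq[of "m - 1 - int i"] by (simp add: algebra_simps)
  qed simp
  have high: "W (m + 1 + int i) = W (m + 1)" for i
  proof (induction i)
    case (Suc i)
    then show ?case using eq[of "m + 1 + int (Suc i)"] by (simp add: algebra_simps)
  qed simp
  show "W k = {0}" if "k < m"
  proof -
    have "W (m - 1) = W (m - 1 - int (nat (m - 1 - l)))" by (rule low[symmetric])
    also have "\<dots> \<subseteq> W l" by (rule mono) simp
    finally have "W (m - 1) \<subseteq> {0}" using lu by simp
    then show ?thesis using mono[of k "m - 1"] that 0[of k] by auto
  qed
  show "W k = UNIV" if "k > m"
  proof -
    have "W u \<subseteq> W (m + 1 + int (nat (u - m - 1)))" by (rule mono) simp
    then have "W (m + 1) = UNIV" unfolding lu high by blast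
    then show ?thesis using mono[of "m + 1" k] that by auto
  qed
qed


text \<open>\<open>flat_frame\<close> compares a frame only with members of \<open>frames V\<close>,
  so two flat frames are related through such a member \<open>C\<close>.\<close>

lemma flat_frame_change:
  assumes ls: "local_system V" and A: "flat_frame V U A" and B: "flat_frame V U' B" and x: "x \<in> U" "x \<in> U'"
  shows "\<exists>N. open N \<and> x \<in> N \<and> N \<subseteq> U \<inter> U' \<and> (\<forall>y\<in>N. B y = A y ** (matrix_inv (A x) ** B x))"
proof -
  obtain U0 C where C: "(U0, C) \<in> frames V" "x \<in> U0" "flat_frame V U0 C" using frame_at[OF ls] by blast
  have xA: "x \<in> U \<inter> U0" and xB: "x \<in> U' \<inter> U0" using x C(2) by auto
  obtain N1 where N1: "open N1" "x \<in> N1" "\<And>y. y \<in> N1 \<Longrightarrow> y \<in> U \<inter> U0 \<Longrightarrow> matrix_inv (C y) ** A y = matrix_inv (C x) ** A x"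
    by (rule locally_constant_onD[OF flat_frameD(3)[OF A C(1)] xA]) (rule that)
  obtain N2 where N2: "open N2" "x \<in> N2" "\<And>y. y \<in> N2 \<Longrightarrow> y \<in> U' \<inter> U0 \<Longrightarrow> matrix_inv (C y) ** B y = matrix_inv (C x) ** B x"
    by (rule locally_constant_onD[OF flat_frameD(3)[OF B C(1)] xB]) (rule that)
  have "B y = A y ** (matrix_inv (A x) ** B x)" if y: "y \<in> N1 \<inter> N2 \<inter> U \<inter> U' \<inter> U0" for y
  proof -
    have Cy: "invertible (C y)" and Ax: "invertible (A x)" using flat_frameD(2)[OF C(3)] flat_frameD(2)[OF A] y x by auto
    have 1: "Z = C y ** (matrix_inv (C y) ** Z)" for Z by (simp add: matrix_mul_assoc matrix_inv_invertible[OF Cy])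
    have "A y ** (matrix_inv (A x) ** B x) = C y ** (matrix_inv (C y) ** A y) ** (matrix_inv (A x) ** B x)" using 1[of "A y"] by simp
    also have "\<dots> = C y ** (matrix_inv (C x) ** A x) ** (matrix_inv (A x) ** B x)" using N1(3)[of y] y by simp
    also have "\<dots> = C y ** (matrix_inv (C x) ** (A x ** matrix_inv (A x)) ** B x)" by (simp only: matrix_mul_assoc)
    also have "\<dots> = C y ** (matrix_inv (C x) ** B x)" by (simp add: matrix_inv_invertible[OF Ax])
    also have "\<dots> = B y" using N2(3)[of y] y 1[of "B y"] by simp
    finally show ?thesis ..
  qed
  moreover have "open (N1 \<inter> N2 \<inter> U \<inter> U' \<inter> U0)"
    by (intro open_Int N1(1) N2(1) flat_frameD(1)[OF A] flat_frameD(1)[OF B] flat_frameD(1)[OF C(3)])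
  moreover have "x \<in> N1 \<inter> N2 \<inter> U \<inter> U' \<inter> U0" "N1 \<inter> N2 \<inter> U \<inter> U' \<inter> U0 \<subseteq> U \<inter> U'"
    using N1(2) N2(2) x C(2) by auto
  ultimately show ?thesis by (intro exI[of _ "N1 \<inter> N2 \<inter> U \<inter> U' \<inter> U0"] conjI ballI)
qed

section \<open>Independence of the lift and of the chart\<close>

context
  fixes M :: "('s::{t2_space, second_countable_topology}, 'm::finite) chart set"
    and V :: "('s, 'n::finite) variation" and s0 :: 's and m :: int
  assumes M: "complex_manifold M" and V: "graded_polarized_VMHS M V"
    and gr: "\<And>x k. gr_nontrivial (weight V x) k \<longleftrightarrow> k = m \<or> k = m + 1"
begin

lemma flatness: "local_system V" "flat_weight V" "flat_forms V"
  using V unfolding graded_polarized_VMHS_def by auto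

lemma hodge_at: "mixed_hodge_structure (weight V x) (hodge V x)" "graded_polarized (weight V x) (forms V x) (hodge V x)"
  using V unfolding graded_polarized_VMHS_def classifying_space_def by blast+

lemma weights_at: "k < m \<Longrightarrow> weight V x k = {0}" "k > m \<Longrightarrow> weight V x k = UNIV"
  using two_step_weight[OF _ gr, of x k] hodge_at(1)[of x] unfolding mixed_hodge_structure_def by blast+

text \<open>The bound is found at \<open>z\<close>, and every larger \<open>hi\<close> works too, so
  that two lifts or two charts can later share the same \<open>hi\<close> and thus the same index
  set.\<close>

lemma lift_family:
  assumes c: "c \<in> M" and z: "z \<in> snd c ` fst c" and zU: "chart_inv c z \<in> U"
    and A: "flat_frame V U A" and AP: "\<And>x. x \<in> U \<Longrightarrow> A x \<in> parallel_transports V s0 x"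
    and \<phi>: "\<And>x. x \<in> U \<Longrightarrow> \<phi> x = act (matrix_inv (A x)) (hodge V x)"
    and fm: "form_matrices (weight V s0) (forms V s0) m p q0 q1 K"
  shows "\<exists>hi0. \<forall>hi\<ge>hi0. \<exists>N. open N \<and> z \<in> N \<and> N \<subseteq> snd c ` (fst c \<inter> U) \<and>
    hodge_family (weight V s0) (forms V s0) (\<lambda>w. \<phi> (chart_inv c w)) N m hi p q0 q1 K"
proof -
  note cf = chart_facts[OF M c]
  define x where "x = chart_inv c z"
  define \<Phi> where "\<Phi> w = \<phi> (chart_inv c w)" for w
  obtain U' B where B: "(U', B) \<in> frames V" "x \<in> U'" "flat_frame V U' B" using frame_at[OF flatness(1)] by blast
  have xU: "x \<in> U" using zU by (simp add: x_def)
  obtain N1 where N1: "open N1" "x \<in> N1" "N1 \<subseteq> U' \<inter> U" "\<And>y. y \<in> N1 \<Longrightarrow> A y = B y ** (matrix_inv (B x) ** A x)"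
    using flat_frame_change[OF flatness(1) B(3) A B(2) xU] by blast
  define C where "C = matrix_inv (B x) ** A x"
  have C: "invertible C" unfolding C_def
    by (intro invertible_mult invertible_matrix_inv flat_frameD(2)[OF B(3,2)] flat_frameD(2)[OF A xU])
  define N0 where "N0 = snd c ` (fst c \<inter> N1)"
  have N0: "open N0" unfolding N0_def by (rule cf(4)[OF N1(1)])
  have zN0: "z \<in> N0" using cf(3)[OF z] N1(2) unfolding N0_def x_def by (metis IntI imageI)
  have N0': "chart_inv c w \<in> N1 \<and> chart_inv c w \<in> fst c" if "w \<in> N0" for w
    using that cf(2) unfolding N0_def by auto
  have N0U: "N0 \<subseteq> snd c ` (fst c \<inter> U)" and N0U': "N0 \<subseteq> snd c ` (fst c \<inter> U')" unfolding N0_def using N1(3) by auto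
  have \<Phi>: "\<Phi> w = act (matrix_inv C) (local_hodge V c B w)" if w: "w \<in> N0" for w
  proof -
    let ?y = "chart_inv c w"
    have y: "?y \<in> N1" "?y \<in> U" "?y \<in> U'" using N0'[OF w] N1(3) by auto
    have "\<Phi> w = act (matrix_inv (B ?y ** C)) (hodge V ?y)" unfolding \<Phi>_def \<phi>[OF y(2)] N1(4)[OF y(1)] C_def ..
    then show ?thesis unfolding matrix_inv_matrix_mul[OF flat_frameD(2)[OF B(3) y(3)] C] local_hodge_def by (simp add: act_mult)
  qed
  have iC: "invertible (matrix_inv C)" by (rule invertible_matrix_inv[OF C])
  have sub: "holomorphic_subbundle (\<lambda>z. \<Phi> z r) N0" for r
  proof (rule holomorphic_subbundle_act[OF _ iC N0 N0U' \<Phi>])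
    show "holomorphic_subbundle (\<lambda>z. local_hodge V c B z r) (snd c ` (fst c \<inter> U'))"
      using V c B(1) unfolding graded_polarized_VMHS_def holomorphic_hodge_def by blast
  qed
  have tr: "frechet_derivative f (at w) X \<in> \<Phi> w (r - 1)"
    if f: "open N'" "N' \<subseteq> N0" "holomorphic_map f N'" "\<And>w. w \<in> N' \<Longrightarrow> f w \<in> \<Phi> w r" "w \<in> N'" for f N' w X r
  proof -
    have *: "v \<in> \<Phi> w r \<longleftrightarrow> complex_mat C *v v \<in> local_hodge V c B w r" if "w \<in> N0" for w v r
      unfolding \<Phi>[OF that] mem_act_iff[OF iC] matrix_inv_matrix_inv[OF C] ..
    have "\<forall>z\<in>N'. complex_mat C *v f z \<in> local_hodge V c B z r" using f(2,4) * by blast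
    moreover have "holomorphic_map (\<lambda>z. complex_mat C *v f z) N'" by (rule holomorphic_map_linear[OF f(3)])
    moreover have "N' \<subseteq> snd c ` (fst c \<inter> U')" using f(2) N0U' by blast
    moreover have "griffiths_transversal M V" using V unfolding graded_polarized_VMHS_def by blast
    ultimately have "frechet_derivative (\<lambda>z. complex_mat C *v f z) (at w) X \<in> local_hodge V c B w (r - 1)"
      using f(1,5) c B(1) unfolding griffiths_transversal_def by blast
    then show ?thesis unfolding holomorphic_map_linear(2)[OF f(3,5)] using * f(2,5) by blast
  qed
  have ph: "mixed_hodge_structure (weight V s0) (\<Phi> w)" "graded_polarized (weight V s0) (forms V s0) (\<Phi> w)" if w: "w \<in> N0" for w
  proof -
    let ?y = "chart_inv c w"
    have y: "?y \<in> U" using N0'[OF w] N1(3) by auto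
    from isometry_transport[OF isometry_at_inv[OF transport_isometry[OF flatness AP[OF y]]] hodge_at]
    show "mixed_hodge_structure (weight V s0) (\<Phi> w)" "graded_polarized (weight V s0) (forms V s0) (\<Phi> w)"
      by (simp_all add: \<Phi>_def \<phi>[OF y])
  qed
  have hf: "hodge_filtration (\<Phi> w)" if "w \<in> N0" for w using ph(1)[OF that] unfolding mixed_hodge_structure_def by blast
  then obtain hi0 where hi0: "\<Phi> z hi0 = {0}" using zN0 unfolding hodge_filtration_def by blast
  show ?thesis
  proof (intro exI[of _ hi0] allI impI)
    fix hi assume "hi \<ge> hi0"
    then have "\<Phi> z hi \<subseteq> {0}" using hf[OF zN0] hi0 unfolding hodge_filtration_def antimono_def by blast
    \<comment> \<open>Rank 0 at \<open>z\<close> persists nearby, since ranks in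
      \<open>holomorphic_subbundle\<close> are locally constant; this makes \<open>hi\<close> a
      bound on a whole neighbourhood.\<close>
    then have "vec.dim (\<Phi> z hi) = 0" by simp
    then obtain N2 where N2: "open N2" "z \<in> N2" "N2 \<subseteq> N0" "\<And>w. w \<in> N2 \<Longrightarrow> vec.dim (\<Phi> w hi) = 0"
      using sub[of hi] zN0 unfolding holomorphic_subbundle_def by metis
    have hi: "\<Phi> w hi = {0}" if w: "w \<in> N2" for w
    proof -
      have "w \<in> N0" using w N2(3) by blast
      then have "0 \<in> \<Phi> w hi" using hf vec.subspace_0 unfolding hodge_filtration_def by blast
      then show ?thesis using N2(4)[OF w] by auto
    qed
    have "hodge_family (weight V s0) (forms V s0) \<Phi> N2 m hi p q0 q1 K"
    proof (rule hodge_family.intro)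
      show "open N2" by (rule N2(1))
      show "polarized_mhs (weight V s0) (forms V s0) (\<Phi> w) m hi p q0 q1 K" if w: "w \<in> N2" for w
      proof -
        have "w \<in> N0" using w N2(3) by blast
        note p = ph[OF this]
        show ?thesis by unfold_locales (use p weights_at hi[OF w] fm in auto)
      qed
      show "holomorphic_subbundle (\<lambda>z. \<Phi> z r) N2" for r
        by (rule holomorphic_subbundle_act[OF sub _ N2(1,3), of "mat 1"])
          (auto simp: act_id invertible_def intro!: exI[of _ "mat 1"])
      show "frechet_derivative f (at w) X \<in> \<Phi> w (r - 1)"
        if "open N'" "N' \<subseteq> N2" "holomorphic_map f N'" "\<And>w. w \<in> N' \<Longrightarrow> f w \<in> \<Phi> w r" "w \<in> N'" for f N' w X r
        by (rule tr[OF that(1) _ that(3-5)]) (use that N2 in auto)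
    qed
    then show "\<exists>N. open N \<and> z \<in> N \<and> N \<subseteq> snd c ` (fst c \<inter> U) \<and>
        hodge_family (weight V s0) (forms V s0) (\<lambda>w. \<phi> (chart_inv c w)) N m hi p q0 q1 K"
      unfolding \<Phi>_def[abs_def] using N2(1-3) N0U by blast
  qed
qed

lemma form_matrices_at: "\<exists>p q0 q1 K. form_matrices (weight V s0) (forms V s0) m p q0 q1 K"
proof (rule form_matrices_exist)
  show "graded_forms (weight V s0) (forms V s0)" using hodge_at(2)[of s0] unfolding graded_polarized_def by blast
  show "subspace (weight V s0 k)" for k
    using hodge_at(1)[of s0] unfolding mixed_hodge_structure_def weight_filtration_def by blast
qed (auto simp: weights_at)

definition lift_metric :: "('s \<Rightarrow> 'n filtration) \<Rightarrow> ('s, 'm) chart \<Rightarrow> complex^'m \<Rightarrow> complex^'m \<Rightarrow> complex^'m \<Rightarrow> complex" where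
  "lift_metric \<phi> c z \<xi> \<eta> = mixed_hodge_metric_End (weight V s0) (forms V s0) (\<phi> (chart_inv c z))
     (tangent_vector (weight V s0) (forms V s0) (\<lambda>w. \<phi> (chart_inv c w)) z \<xi>)
     (tangent_vector (weight V s0) (forms V s0) (\<lambda>w. \<phi> (chart_inv c w)) z \<eta>)"

text \<open>Near the point the two frames differ by a constant matrix \<open>C\<close>. It is an
  isometry of the fibre at \<open>s0\<close> in every weight, being a transport to \<open>x\<close>
  followed by the inverse of another one.\<close>

lemma lift_metric_unique:
  assumes c: "c \<in> M" and z: "z \<in> snd c ` fst c"
    and 1: "period_lift V s0 U1 \<phi>1" "chart_inv c z \<in> U1" and 2: "period_lift V s0 U2 \<phi>2" "chart_inv c z \<in> U2"
  shows "lift_metric \<phi>2 c z \<xi> \<eta> = lift_metric \<phi>1 c z \<xi> \<eta>"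
proof -
  note cf = chart_facts[OF M c]
  define x where "x = chart_inv c z"
  obtain A1 where A1: "flat_frame V U1 A1" "\<And>x. x \<in> U1 \<Longrightarrow> A1 x \<in> parallel_transports V s0 x"
    "\<And>x. x \<in> U1 \<Longrightarrow> \<phi>1 x = act (matrix_inv (A1 x)) (hodge V x)" using 1(1) unfolding period_lift_def by blast
  obtain A2 where A2: "flat_frame V U2 A2" "\<And>x. x \<in> U2 \<Longrightarrow> A2 x \<in> parallel_transports V s0 x"
    "\<And>x. x \<in> U2 \<Longrightarrow> \<phi>2 x = act (matrix_inv (A2 x)) (hodge V x)" using 2(1) unfolding period_lift_def by blast
  have xU: "x \<in> U1" "x \<in> U2" using 1(2) 2(2) by (simp_all add: x_def)
  define C where "C = matrix_inv (A1 x) ** A2 x"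
  obtain N where N: "open N" "x \<in> N" "N \<subseteq> U1 \<inter> U2" "\<And>y. y \<in> N \<Longrightarrow> A2 y = A1 y ** C"
    using flat_frame_change[OF flatness(1) A1(1) A2(1) xU] unfolding C_def by blast
  have C: "isometry_at (weight V s0) (forms V s0) (weight V s0) (forms V s0) k C" for k
    unfolding C_def
    by (rule isometry_at_comp[OF transport_isometry[OF flatness A2(2)[OF xU(2)]]
          isometry_at_inv[OF transport_isometry[OF flatness A1(2)[OF xU(1)]]]])
  then have iC: "invertible C" unfolding isometry_at_def by blast
  define g where "g = matrix_inv C"
  have g: "isometry_at (weight V s0) (forms V s0) (weight V s0) (forms V s0) k g" for k
    unfolding g_def by (rule isometry_at_inv[OF C])
  have ig: "invertible g" "(*v) g ` weight V s0 m = weight V s0 m" using g[of m] unfolding isometry_at_def by blast+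
  obtain p q0 q1 K where fm: "form_matrices (weight V s0) (forms V s0) m p q0 q1 K" using form_matrices_at by blast
  have high: "weight V s0 (m + 1) = UNIV" by (rule weights_at(2)) simp
  note fm' = form_matrices_transport[OF fm high g g refl refl]
  obtain hi1 where hi1: "\<And>hi. hi \<ge> hi1 \<Longrightarrow> \<exists>N. open N \<and> z \<in> N \<and> N \<subseteq> snd c ` (fst c \<inter> U1) \<and>
    hodge_family (weight V s0) (forms V s0) (\<lambda>w. \<phi>1 (chart_inv c w)) N m hi p q0 q1 K"
    using lift_family[OF c z 1(2) A1 fm] by blast
  obtain hi2 where hi2: "\<And>hi. hi \<ge> hi2 \<Longrightarrow> \<exists>N. open N \<and> z \<in> N \<and> N \<subseteq> snd c ` (fst c \<inter> U2) \<and>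
    hodge_family (weight V s0) (forms V s0) (\<lambda>w. \<phi>2 (chart_inv c w)) N m hi
      (complex_mat g ** p ** complex_mat (matrix_inv g))
      (transpose (complex_mat (matrix_inv g)) ** q0 ** complex_mat (matrix_inv g))
      (transpose (complex_mat (matrix_inv g)) ** q1 ** complex_mat (matrix_inv g))
      (complex_mat g ** K ** transpose (complex_mat g))"
    using lift_family[OF c z 2(2) A2 fm'] by blast
  obtain N1 where N1: "open N1" "z \<in> N1"
    "hodge_family (weight V s0) (forms V s0) (\<lambda>w. \<phi>1 (chart_inv c w)) N1 m (max hi1 hi2) p q0 q1 K"
    using hi1[of "max hi1 hi2"] by auto
  obtain N2 where N2: "open N2" "z \<in> N2"
    "hodge_family (weight V s0) (forms V s0) (\<lambda>w. \<phi>2 (chart_inv c w)) N2 m (max hi1 hi2)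
      (complex_mat g ** p ** complex_mat (matrix_inv g))
      (transpose (complex_mat (matrix_inv g)) ** q0 ** complex_mat (matrix_inv g))
      (transpose (complex_mat (matrix_inv g)) ** q1 ** complex_mat (matrix_inv g))
      (complex_mat g ** K ** transpose (complex_mat g))"
    using hi2[of "max hi1 hi2"] by auto
  define N0 where "N0 = snd c ` (fst c \<inter> N)"
  have N0: "open N0" "z \<in> N0"
    unfolding N0_def using cf(4)[OF N(1)] cf(3)[OF z] N(2) unfolding x_def by (auto intro!: image_eqI[of z])
  have act: "\<phi>2 (chart_inv c w) = act g (\<phi>1 (chart_inv c w))" if w: "w \<in> N0" for w
  proof -
    let ?y = "chart_inv c w"
    have y: "?y \<in> N" "?y \<in> U1" "?y \<in> U2" using w cf(2) N(3) unfolding N0_def by auto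
    show ?thesis
      unfolding A1(3)[OF y(2)] A2(3)[OF y(3)] N(4)[OF y(1)] g_def matrix_inv_matrix_mul[OF flat_frameD(2)[OF A1(1) y(2)] iC]
      by (simp add: act_mult)
  qed
  have op: "open (N0 \<inter> N1 \<inter> N2)" and zN: "z \<in> N0 \<inter> N1 \<inter> N2" using N0 N1 N2 by auto
  show ?thesis
    unfolding lift_metric_def
    by (rule metric_End_act[OF hodge_family.restrict[OF N1(3) op] hodge_family.restrict[OF N2(3) op] zN act ig refl refl]) auto
qed

lemma period_pullback_metric_eq:
  assumes "c \<in> M" "z \<in> snd c ` fst c" "period_lift V s0 U \<phi>" "chart_inv c z \<in> U"
  shows "period_pullback_metric V s0 c z \<xi> \<eta> = lift_metric \<phi> c z \<xi> \<eta>"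
  unfolding period_pullback_metric_def Let_def lift_metric_def[symmetric]
proof (rule the_equality)
  show "\<exists>U \<phi>'. period_lift V s0 U \<phi>' \<and> chart_inv c z \<in> U \<and> lift_metric \<phi> c z \<xi> \<eta> = lift_metric \<phi>' c z \<xi> \<eta>"
    using assms by blast
  show "t = lift_metric \<phi> c z \<xi> \<eta>"
    if "\<exists>U \<phi>. period_lift V s0 U \<phi> \<and> chart_inv c z \<in> U \<and> t = lift_metric \<phi> c z \<xi> \<eta>" for t
    using that lift_metric_unique[OF assms] by blast
qed

context
  assumes conn: "connected (UNIV :: 's set)"
begin

lemma period_pullback_metric_local:
  assumes c: "c \<in> M" and z: "z \<in> snd c ` fst c"
  shows "\<exists>N F hi p q0 q1 K. z \<in> N \<and> hodge_family (weight V s0) (forms V s0) F N m hi p q0 q1 K \<and>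
    (\<forall>w\<in>N. \<forall>\<xi> \<eta>. period_pullback_metric V s0 c w \<xi> \<eta> = hodge_family.fmetric (weight V s0) (forms V s0) F w \<xi> \<eta>)"
proof -
  obtain U \<phi> where U: "period_lift V s0 U \<phi>" "chart_inv c z \<in> U"
    using period_lift_exists[OF M conn flatness] by blast
  obtain A where A: "flat_frame V U A" "\<And>x. x \<in> U \<Longrightarrow> A x \<in> parallel_transports V s0 x"
    "\<And>x. x \<in> U \<Longrightarrow> \<phi> x = act (matrix_inv (A x)) (hodge V x)" using U(1) unfolding period_lift_def by blast
  obtain p q0 q1 K where fm: "form_matrices (weight V s0) (forms V s0) m p q0 q1 K" using form_matrices_at by blast
  obtain hi N where N: "z \<in> N" "N \<subseteq> snd c ` (fst c \<inter> U)"
    "hodge_family (weight V s0) (forms V s0) (\<lambda>w. \<phi> (chart_inv c w)) N m hi p q0 q1 K"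
    using lift_family[OF c z U(2) A fm] by blast
  have "period_pullback_metric V s0 c w \<xi> \<eta> = hodge_family.fmetric (weight V s0) (forms V s0) (\<lambda>w. \<phi> (chart_inv c w)) w \<xi> \<eta>"
    if "w \<in> N" for w \<xi> \<eta>
  proof -
    have "w \<in> snd c ` fst c" "chart_inv c w \<in> U" using that N(2) chart_facts(2)[OF M c] by auto
    from period_pullback_metric_eq[OF c this(1) U(1) this(2)]
    show ?thesis unfolding lift_metric_def hodge_family.fmetric_def[OF N(3)] .
  qed
  then show ?thesis using N(1,3) by blast
qed

text \<open>The same lift is used in both charts, so the two operators \<open>P\<close> differ by
  composition with the transition map, and the chain rule for \<open>dz\<close> gives equal tangent
  vectors.\<close>

lemma period_pullback_metric_transition:
  assumes c: "c \<in> M" and d: "d \<in> M" and z: "z \<in> snd c ` (fst c \<inter> fst d)"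
  shows "period_pullback_metric V s0 c z \<xi> \<eta> = period_pullback_metric V s0 d (transition c d z)
    (frechet_derivative (transition c d) (at z) \<xi>) (frechet_derivative (transition c d) (at z) \<eta>)"
proof -
  define t where "t = transition c d"
  define O' where "O' = snd c ` (fst c \<inter> fst d)"
  have O': "open O'" unfolding O'_def by (rule chart_facts(4)[OF M c chart_facts(1)[OF M d]])
  have inv: "chart_inv d (t w) = chart_inv c w \<and> t w \<in> snd d ` fst d \<and> w \<in> snd c ` fst c" if "w \<in> O'" for w
    using that chart_facts(2)[OF M c] chart_facts(2)[OF M d] unfolding O'_def t_def transition_def by auto
  have zO: "z \<in> O'" using z by (simp add: O'_def)
  have "holomorphic_map t O'" using M c d unfolding complex_manifold_def t_def O'_def by blast
  then obtain t' where t': "(t has_derivative t') (at z)" "\<And>c v. t' (c *s v) = c *s t' v"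
    using zO unfolding holomorphic_map_def by blast
  have tD: "t differentiable at z" and tt': "frechet_derivative t (at z) = t'"
    using t'(1) differentiable_def frechet_derivative_eqI by blast+
  obtain U \<phi> where U: "period_lift V s0 U \<phi>" "chart_inv c z \<in> U"
    using period_lift_exists[OF M conn flatness] by blast
  then have Ud: "chart_inv d (t z) \<in> U" using inv[OF zO] by simp
  obtain A where A: "flat_frame V U A" "\<And>x. x \<in> U \<Longrightarrow> A x \<in> parallel_transports V s0 x"
    "\<And>x. x \<in> U \<Longrightarrow> \<phi> x = act (matrix_inv (A x)) (hodge V x)" using U(1) unfolding period_lift_def by blast
  obtain p q0 q1 K where fm: "form_matrices (weight V s0) (forms V s0) m p q0 q1 K" using form_matrices_at by blast
  have zc: "z \<in> snd c ` fst c" and zd: "t z \<in> snd d ` fst d" using inv[OF zO] by blast+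
  obtain hi1 where hi1: "\<And>hi. hi \<ge> hi1 \<Longrightarrow> \<exists>N. open N \<and> z \<in> N \<and> N \<subseteq> snd c ` (fst c \<inter> U) \<and>
    hodge_family (weight V s0) (forms V s0) (\<lambda>w. \<phi> (chart_inv c w)) N m hi p q0 q1 K"
    using lift_family[OF c zc U(2) A fm] by blast
  obtain hi2 where hi2: "\<And>hi. hi \<ge> hi2 \<Longrightarrow> \<exists>N. open N \<and> t z \<in> N \<and> N \<subseteq> snd d ` (fst d \<inter> U) \<and>
    hodge_family (weight V s0) (forms V s0) (\<lambda>w. \<phi> (chart_inv d w)) N m hi p q0 q1 K"
    using lift_family[OF d zd Ud A fm] by blast
  define hi where "hi = max hi1 hi2"
  obtain N1 where N1: "open N1" "z \<in> N1"
    "hodge_family (weight V s0) (forms V s0) (\<lambda>w. \<phi> (chart_inv c w)) N1 m hi p q0 q1 K"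
    using hi1[of hi] unfolding hi_def by auto
  obtain N2 where N2: "open N2" "t z \<in> N2"
    "hodge_family (weight V s0) (forms V s0) (\<lambda>w. \<phi> (chart_inv d w)) N2 m hi p q0 q1 K"
    using hi2[of hi] unfolding hi_def by auto
  interpret c: hodge_family "weight V s0" "forms V s0" "\<lambda>w. \<phi> (chart_inv c w)" N1 m hi p q0 q1 K by (rule N1(3))
  interpret d: hodge_family "weight V s0" "forms V s0" "\<lambda>w. \<phi> (chart_inv d w)" N2 m hi p q0 q1 K by (rule N2(3))
  have "dz c.P z \<xi> = dz d.P (t z) (frechet_derivative t (at z) \<xi>)" for \<xi>
  proof -
    have "dz d.P (t z) (frechet_derivative t (at z) \<xi>) = dz (\<lambda>w. d.P (t w)) z \<xi>"
      by (rule dz_compose[symmetric, OF smooth_on_differentiable[OF d.smooth_P N2(2)] tD]) (simp add: tt' t'(2))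
    also have "\<dots> = dz c.P z \<xi>"
      by (rule dz_cong(1)[OF O' zO _ smooth_on_differentiable[OF c.smooth_P N1(2)]]) (simp add: inv)
    finally show ?thesis ..
  qed
  then show ?thesis
    unfolding t_def[symmetric] period_pullback_metric_eq[OF c zc U] period_pullback_metric_eq[OF d zd U(1) Ud]
      lift_metric_def c.tangent_vector_eq[OF N1(2)] d.tangent_vector_eq[OF N2(2)]
    using inv[OF zO] by simp
qed

lemma kaehler_period_pullback_metric: "kaehler_pseudo_metric M (period_pullback_metric V s0)"
  unfolding kaehler_pseudo_metric_def hermitian_pseudo_metric_def
proof (intro conjI ballI allI)
  let ?g = "period_pullback_metric V s0"
  fix c z \<xi> \<xi>' \<eta> s assume c: "c \<in> M" and z: "z \<in> snd c ` fst c"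
  obtain N F hi p q0 q1 K where N: "z \<in> N" and hf: "hodge_family (weight V s0) (forms V s0) F N m hi p q0 q1 K"
    and eq: "\<And>w \<xi> \<eta>. w \<in> N \<Longrightarrow> ?g c w \<xi> \<eta> = hodge_family.fmetric (weight V s0) (forms V s0) F w \<xi> \<eta>"
    using period_pullback_metric_local[OF c z] by blast
  interpret h: hodge_family "weight V s0" "forms V s0" F N m hi p q0 q1 K by (rule hf)
  show "?g c z (s *s \<xi> + \<xi>') \<eta> = s * ?g c z \<xi> \<eta> + ?g c z \<xi>' \<eta>" unfolding eq[OF N] by (rule h.fmetric_props(1)[OF N])
  show "?g c z \<eta> \<xi> = cnj (?g c z \<xi> \<eta>)" unfolding eq[OF N] by (rule h.fmetric_props(2)[OF N])
  show "0 \<le> Re (?g c z \<xi> \<xi>)" unfolding eq[OF N] by (rule h.fmetric_props(3)[OF N])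
next
  let ?g = "period_pullback_metric V s0"
  fix c \<xi> \<eta> assume c: "c \<in> M"
  show "smooth_on (\<lambda>z. ?g c z \<xi> \<eta>) (snd c ` fst c)"
  proof (rule smooth_on_local)
    fix z assume z: "z \<in> snd c ` fst c"
    obtain N F hi p q0 q1 K where N: "z \<in> N" and hf: "hodge_family (weight V s0) (forms V s0) F N m hi p q0 q1 K"
      and eq: "\<And>w \<xi> \<eta>. w \<in> N \<Longrightarrow> ?g c w \<xi> \<eta> = hodge_family.fmetric (weight V s0) (forms V s0) F w \<xi> \<eta>"
      using period_pullback_metric_local[OF c z] by blast
    interpret h: hodge_family "weight V s0" "forms V s0" F N m hi p q0 q1 K by (rule hf)
    have "smooth_on (\<lambda>z. ?g c z \<xi> \<eta>) N"
      by (rule smooth_on_cong[OF h.N _ h.fmetric_props(4)[of \<xi> \<eta>]]) (simp add: eq)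
    then show "\<exists>N'. open N' \<and> z \<in> N' \<and> smooth_on (\<lambda>z. ?g c z \<xi> \<eta>) N'" using N h.N by blast
  qed
next
  fix c d z \<xi> \<eta> assume "c \<in> M" "d \<in> M" "z \<in> snd c ` (fst c \<inter> fst d)"
  then show "period_pullback_metric V s0 c z \<xi> \<eta> = period_pullback_metric V s0 d (transition c d z)
    (frechet_derivative (transition c d) (at z) \<xi>) (frechet_derivative (transition c d) (at z) \<eta>)"
    by (rule period_pullback_metric_transition)
next
  let ?g = "period_pullback_metric V s0"
  fix c z X Y Z assume c: "c \<in> M" and z: "z \<in> snd c ` fst c"
  obtain N F hi p q0 q1 K where N: "z \<in> N" and hf: "hodge_family (weight V s0) (forms V s0) F N m hi p q0 q1 K"
    and eq: "\<And>w \<xi> \<eta>. w \<in> N \<Longrightarrow> ?g c w \<xi> \<eta> = hodge_family.fmetric (weight V s0) (forms V s0) F w \<xi> \<eta>"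
    using period_pullback_metric_local[OF c z] by blast
  interpret h: hodge_family "weight V s0" "forms V s0" F N m hi p q0 q1 K by (rule hf)
  have "frechet_derivative (\<lambda>w. fundamental_form (?g c) w X Y) (at z)
      = frechet_derivative (\<lambda>w. fundamental_form h.fmetric w X Y) (at z)" for X Y
  proof (rule frechet_derivative_cong_open[OF h.N N])
    show "fundamental_form h.fmetric w X Y = fundamental_form (?g c) w X Y" if "w \<in> N" for w
      by (simp add: fundamental_form_def eq[OF that])
    have "(\<lambda>w. \<i> / 2 * (h.fmetric w X Y - h.fmetric w Y X)) differentiable at z"
      by (rule smooth_on_differentiable[OF _ N]) (intro smooth_on_mult smooth_on_const smooth_on_diff h.N h.fmetric_props(4))
    then show "(\<lambda>w. fundamental_form h.fmetric w X Y) differentiable at z"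
      unfolding fundamental_form_def by (rule differentiable_linear[OF bounded_linear_Re])
  qed
  then show "ext_deriv2 (fundamental_form (?g c)) z X Y Z = 0"
    using h.fmetric_props(5)[OF N, of X Y Z] unfolding ext_deriv2_def by simp
qed

end

end

theorem theorem7p5:
  fixes M :: "('s::{t2_space, second_countable_topology}, 'm::finite) chart set"
    and V :: "('s, 'n::finite) variation"
    and a b :: int and s0 :: 's
  assumes "complex_manifold M" and "connected (UNIV :: 's set)"
    and "graded_polarized_VMHS M V"
    and "\<And>x k. gr_nontrivial (weight V x) k \<longleftrightarrow> k = a \<or> k = b"
    and "\<bar>a - b\<bar> = 1"
  shows "kaehler_pseudo_metric M (period_pullback_metric V s0)"
proof (rule kaehler_period_pullback_metric[where m = "min a b", OF assms(1,3) _ assms(2)])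
  show "gr_nontrivial (weight V x) k \<longleftrightarrow> k = min a b \<or> k = min a b + 1" for x k
    using assms(4)[of x k] assms(5) by auto
qed

end
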